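(* Let $\varrho=-1$, and suppose that for each $\gamma>0$, $(u^\gamma_t,v^\gamma_t)_{t\ge0}$ solves the symbiotic branching model $\mathrm{SBM}_\gamma(-1)$ on $\mathbb{Z}^d$ with initial condition $(u^\gamma_0,v^\gamma_0)=(U_0,V_0)$ not depending on $\gamma$. Suppose furthermore that $(U_0(k),V_0(k))\in\{(1,0),(0,1)\}$ for all $k\in\mathbb{Z}^d$. Then, for any sequence $\gamma_n\to\infty$, we have convergence in law $$(u^{\gamma_n},v^{\gamma_n})\Longrightarrow(U,V),\qquad n\to\infty,$$ in $D([0,\infty),L^2_\beta)$ equipped with the Meyer–Zheng pseudo-path topology, where $U$ is a standard voter process on $\mathbb{Z}^d$ (started at $U_0$) and $V=1-U$ is its reciprocal voter process (opinions $1$ and $0$ interchanged).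
   Context: $\Delta f(k)=\sum_{|i-k|=1}\frac1{2d}(f(i)-f(k))$ is the discrete Laplacian on $\mathbb{Z}^d$. Fix $\beta:\mathbb{Z}^d\to(0,\infty)$ with $\sum_i\beta(i)<\infty$ and, for some $M<\infty$, $\sum_i\beta(i)|a(i,k)|<M\beta(k)$ for all $k$, where $a(i,j)=\frac1{2d}$ if $|i-j|=1$, $a(i,i)=-1$, and $a(i,j)=0$ otherwise. $L^2_\beta$ is the set of pairs $(u,v)$ of functions $u,v:\mathbb{Z}^d\to[0,\infty)$ with $\sum_ku(k)\beta(k)<\infty$ and $\sum_kv(k)\beta(k)<\infty$, with the topology of the norm $\|(u,v)\|_\beta=\sum_k(|u(k)|+|v(k)|)\beta(k)$. $D([0,\infty),L^2_\beta)$ is the space of right-continuous paths with left limits. A solution of $\mathrm{SBM}_\gamma(\varrho)$ is a weak solution: on some filtered probability space there are adapted Brownian motions $B^1(k),B^2(k)$, $k\in\mathbb{Z}^d$ (jointly Gaussian), with $\mathbb{E}[B^1_t(k)B^1_t(j)]=\mathbb{E}[B^2_t(k)B^2_t(j)]=\mathbf 1_{\{k=j\}}t$ and $\mathbb{E}[B^1_t(k)B^2_t(j)]=\varrho\,\mathbf 1_{\{k=j\}}t$, and an adapted process $(u,v)$, almost surely continuous with values in $L^2_\beta$, almost surely satisfying $$u_t(k)=u_0(k)+\int_0^t\Delta u_s(k)\,ds+\int_0^t\sqrt{\gamma u_s(k)v_s(k)}\,dB^1_s(k),\quad v_t(k)=v_0(k)+\int_0^t\Delta v_s(k)\,ds+\int_0^t\sqrt{\gamma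 u_s(k)v_s(k)}\,dB^2_s(k).$$ The standard voter process is the Markov process on $\{0,1\}^{\mathbb{Z}^d}$ with generator $Af(\eta)=\sum_{k\in\mathbb{Z}^d}c(k,\eta)(f(\eta^{(k)})-f(\eta))$ for $f$ depending on finitely many coordinates, where $\eta^{(k)}$ is $\eta$ with the opinion at $k$ flipped and $c(k,\eta)=\frac1{2d}\sum_{|i-k|=1}\mathbf 1_{\{\eta(i)\ne\eta(k)\}}$. The Meyer–Zheng pseudo-path topology identifies a path $w$ with the image of the measure $e^{-t}dt$ under $t\mapsto(t,w(t))$ and uses weak convergence of these measures; equivalently, it is convergence of paths in measure with respect to $e^{-t}dt$. *)

theory Defs
  imports "HOL-Probability.Probability"
begin

section \<open>The lattice\<close>

text \<open>The lattice \<open>\<int>\<^sup>d\<close> is the type \<open>int ^ 'd\<close> with \<open>d = CARD('d)\<close>. For integer points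
  \<open>\<bar>i - k\<bar> = 1\<close> means the same for the Euclidean norm and for the \<open>1\<close>-norm used here.\<close>

type_synonym 'd site = "int ^ 'd"

definition neighbours :: "'d::finite site \<Rightarrow> 'd site set" where
  "neighbours k = {i. (\<Sum>j\<in>UNIV. \<bar>i $ j - k $ j\<bar>) = 1}"

lemma finite_neighbours: "finite (neighbours (k :: 'd::finite site))"
proof -
  have "neighbours k \<subseteq> vec_lambda ` (PiE UNIV (\<lambda>j. {k $ j - 1..k $ j + 1}))"
  proof
    fix i assume i: "i \<in> neighbours k"
    have "\<bar>i $ j - k $ j\<bar> \<le> (\<Sum>j\<in>UNIV. \<bar>i $ j - k $ j\<bar>)" for j
      by (rule member_le_sum) auto
    then have "\<bar>i $ j - k $ j\<bar> \<le> 1" for j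
      using i by (simp add: neighbours_def)
    then have "i $ j \<in> {k $ j - 1..k $ j + 1}" for j
      by (simp add: abs_le_iff) (smt (verit))
    then have "vec_nth i \<in> PiE UNIV (\<lambda>j. {k $ j - 1..k $ j + 1})"
      by auto
    then show "i \<in> vec_lambda ` (PiE UNIV (\<lambda>j. {k $ j - 1..k $ j + 1}))"
      by (metis image_eqI vec_nth_inverse)
  qed
  moreover have "finite (vec_lambda ` (PiE UNIV (\<lambda>j. {k $ j - 1..k $ j + 1})))"
    by (intro finite_imageI finite_PiE) auto
  ultimately show ?thesis by (rule finite_subset)
qed

definition laplacian :: "('d::finite site \<Rightarrow> real) \<Rightarrow> 'd site \<Rightarrow> real" where
  "laplacian f k = (\<Sum>i\<in>neighbours k. 1 / (2 * real CARD('d)) * (f i - f k))"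

definition rw_rate :: "'d::finite site \<Rightarrow> 'd site \<Rightarrow> real" where
  "rw_rate i j = (if i \<in> neighbours j then 1 / (2 * real CARD('d)) else if i = j then - 1 else 0)"

section \<open>The weighted space\<close>

definition admissible_weight :: "('d::finite site \<Rightarrow> real) \<Rightarrow> bool" where
  "admissible_weight \<beta> \<longleftrightarrow>
     (\<forall>k. 0 < \<beta> k) \<and> \<beta> summable_on UNIV \<and>
     (\<exists>M. \<forall>k. (\<Sum>\<^sub>\<infinity>i. \<beta> i * \<bar>rw_rate i k\<bar>) < M * \<beta> k)"

type_synonym 'd state = "('d site \<Rightarrow> real) \<times> ('d site \<Rightarrow> real)"

definition L2_space :: "('d::finite site \<Rightarrow> real) \<Rightarrow> 'd state set" where
  "L2_space \<beta> = {(u, v). (\<forall>k. 0 \<le> u k) \<and> (\<forall>k. 0 \<le> v k) \<and>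
     (\<lambda>k. u k * \<beta> k) summable_on UNIV \<and> (\<lambda>k. v k * \<beta> k) summable_on UNIV}"

definition L2_dist :: "('d::finite site \<Rightarrow> real) \<Rightarrow> 'd state \<Rightarrow> 'd state \<Rightarrow> real" where
  "L2_dist \<beta> x y = (\<Sum>\<^sub>\<infinity>k. (\<bar>fst x k - fst y k\<bar> + \<bar>snd x k - snd y k\<bar>) * \<beta> k)"

definition L2_top :: "('d::finite site \<Rightarrow> real) \<Rightarrow> 'd state topology" where
  "L2_top \<beta> = Metric_space.mtopology (L2_space \<beta>) (L2_dist \<beta>)"

lemma L2_Metric_space:
  fixes \<beta> :: "'d::finite site \<Rightarrow> real"
  assumes pos: "\<And>k. 0 < \<beta> k"
  shows "Metric_space (L2_space \<beta>) (L2_dist \<beta>)"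
proof -
  define g where "g x y k = (\<bar>fst x k - fst y k\<bar> + \<bar>snd x k - snd y k\<bar>) * \<beta> k"
    for x y :: "'d state" and k
  have d: "L2_dist \<beta> x y = (\<Sum>\<^sub>\<infinity>k. g x y k)" for x y
    by (simp add: L2_dist_def g_def)
  have g0: "0 \<le> g x y k" for x y k
    using pos[of k] by (simp add: g_def)
  have sm: "g x y summable_on UNIV" if "x \<in> L2_space \<beta>" "y \<in> L2_space \<beta>" for x y
  proof (rule summable_on_comparison_test[OF _ _ g0])
    show "(\<lambda>k. (fst x k * \<beta> k + snd x k * \<beta> k) + (fst y k * \<beta> k + snd y k * \<beta> k)) summable_on UNIV"
      using that by (intro summable_on_add) (auto simp: L2_space_def)
    fix k
    have "\<bar>fst x k - fst y k\<bar> + \<bar>snd x k - snd y k\<bar> \<le> fst x k + snd x k + (fst y k + snd y k)"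
      using that by (auto simp: L2_space_def abs_le_iff split: prod.splits) (smt (verit))
    then have "g x y k \<le> (fst x k + snd x k + (fst y k + snd y k)) * \<beta> k"
      unfolding g_def using pos[of k] by (intro mult_right_mono) auto
    then show "g x y k \<le> (fst x k * \<beta> k + snd x k * \<beta> k) + (fst y k * \<beta> k + snd y k * \<beta> k)"
      by (simp add: algebra_simps)
  qed
  show ?thesis
  proof
    show "0 \<le> L2_dist \<beta> x y" for x y
      unfolding d by (rule infsum_nonneg) (rule g0)
    show "L2_dist \<beta> x y = L2_dist \<beta> y x" for x y
      by (simp add: L2_dist_def abs_minus_commute)
    show "L2_dist \<beta> x y = 0 \<longleftrightarrow> x = y" if "x \<in> L2_space \<beta>" "y \<in> L2_space \<beta>" for x y
    proof
      assume "L2_dist \<beta> x y = 0"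
      then have "g x y k = 0" for k
        using nonneg_infsum_le_0D[of "g x y" UNIV k] sm[OF that] g0 by (simp add: d)
      then have "\<bar>fst x k - fst y k\<bar> + \<bar>snd x k - snd y k\<bar> = 0" for k
        using pos[of k] unfolding g_def by (metis less_irrefl mult_eq_0_iff)
      then have "fst x k = fst y k \<and> snd x k = snd y k" for k
        by (smt (verit))
      then show "x = y" by (simp add: prod_eq_iff fun_eq_iff)
    qed (simp add: L2_dist_def)
    show "L2_dist \<beta> x z \<le> L2_dist \<beta> x y + L2_dist \<beta> y z"
      if "x \<in> L2_space \<beta>" "y \<in> L2_space \<beta>" "z \<in> L2_space \<beta>" for x y z
    proof -
      have "g x z k \<le> g x y k + g y z k" for k
      proof -
        have "\<bar>fst x k - fst z k\<bar> + \<bar>snd x k - snd z k\<bar>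
            \<le> \<bar>fst x k - fst y k\<bar> + \<bar>snd x k - snd y k\<bar> + (\<bar>fst y k - fst z k\<bar> + \<bar>snd y k - snd z k\<bar>)"
          by linarith
        then show ?thesis
          unfolding g_def distrib_right[symmetric] using pos[of k] by (intro mult_right_mono) auto
      qed
      then have "(\<Sum>\<^sub>\<infinity>k. g x z k) \<le> (\<Sum>\<^sub>\<infinity>k. g x y k + g y z k)"
        using that by (intro infsum_mono sm summable_on_add) auto
      then show ?thesis
        using that by (simp add: d infsum_add sm)
    qed
  qed
qed

section \<open>Weak convergence and the pseudo-path topology\<close>

definition borel_of :: "'a topology \<Rightarrow> 'a measure" where
  "borel_of X = sigma (topspace X) {U. openin X U}"

text \<open>The topology of weak convergence on the Borel probability measures of \<open>X\<close>: the coarsest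
  one making integration of every bounded continuous function continuous.\<close>

definition weak_topology :: "'a topology \<Rightarrow> 'a measure topology" where
  "weak_topology X = topology_generated_by
     {{\<mu>. prob_space \<mu> \<and> sets \<mu> = sets (borel_of X) \<and> (\<integral>x. f x \<partial>\<mu>) \<in> W} | f W.
       continuous_map X euclideanreal f \<and> bounded (f ` topspace X) \<and> open W}"

definition cadlag :: "'a topology \<Rightarrow> (real \<Rightarrow> 'a) \<Rightarrow> bool" where
  "cadlag X w \<longleftrightarrow> (\<forall>t\<ge>0. limitin X w (w t) (at_right t)) \<and> (\<forall>t>0. \<exists>l. limitin X w l (at_left t))"

text \<open>Paths are indexed by \<open>[0,\<infinity>)\<close>, i.e.\ they are extensional on \<open>{0..}\<close>.\<close>

definition cadlag_paths :: "'a topology \<Rightarrow> (real \<Rightarrow> 'a) set" where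
  "cadlag_paths X = {w \<in> extensional {0..}. cadlag X w}"

definition pseudo_path :: "'a topology \<Rightarrow> (real \<Rightarrow> 'a) \<Rightarrow> (real \<times> 'a) measure" where
  "pseudo_path X w =
     distr (density (restrict_space lborel {0..}) (\<lambda>t. ennreal (exp (- t))))
       (borel_of (prod_topology (top_of_set {0..}) X)) (\<lambda>t. (t, w t))"

definition meyer_zheng :: "'a topology \<Rightarrow> (real \<Rightarrow> 'a) topology" where
  "meyer_zheng X = pullback_topology (cadlag_paths X) (pseudo_path X)
     (weak_topology (prod_topology (top_of_set {0..}) X))"

text \<open>The law on \<open>X\<close> of a random element that takes values in \<open>X\<close> only almost surely: on the
  exceptional null set, which need not be measurable before completion, an arbitrary value is
  assigned.\<close>

definition law :: "'a topology \<Rightarrow> 'w measure \<Rightarrow> ('w \<Rightarrow> 'a) \<Rightarrow> 'a measure" where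
  "law X M Z = distr (completion M) (borel_of X)
     (\<lambda>\<omega>. if Z \<omega> \<in> topspace X then Z \<omega> else (SOME x. x \<in> topspace X))"

section \<open>Brownian motion and the It\^o integral\<close>

text \<open>Filtrations are indexed by all of \<open>real\<close> in the library; below only the times \<open>t \<ge> 0\<close>
  matter (a filtration on \<open>[0,\<infinity>)\<close> is extended by \<open>F t = F 0\<close> for \<open>t < 0\<close>).\<close>

definition filtered_prob_space :: "'w measure \<Rightarrow> (real \<Rightarrow> 'w measure) \<Rightarrow> bool" where
  "filtered_prob_space M F \<longleftrightarrow>
     prob_space M \<and> filtration (space M) F \<and> (\<forall>t. subalgebra M (F t))"

definition brownian_motion ::
  "'w measure \<Rightarrow> (real \<Rightarrow> 'w measure) \<Rightarrow> (real \<Rightarrow> 'w \<Rightarrow> real) \<Rightarrow> bool" where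
  "brownian_motion M F B \<longleftrightarrow>
     (\<forall>t\<ge>0. B t \<in> borel_measurable (F t)) \<and>
     (AE \<omega> in M. B 0 \<omega> = 0) \<and>
     (AE \<omega> in M. continuous_on {0..} (\<lambda>t. B t \<omega>)) \<and>
     (\<forall>s t. 0 \<le> s \<and> s < t \<longrightarrow>
        distributed M lborel (\<lambda>\<omega>. B t \<omega> - B s \<omega>) (normal_density 0 (sqrt (t - s))) \<and>
        prob_space.indep_set M (sets (F s))
          (sets (vimage_algebra (space M) (\<lambda>\<omega>. B t \<omega> - B s \<omega>) borel)))"

text \<open>Gaussian variables may be degenerate; this is needed for correlation \<open>\<plusminus>1\<close>.\<close>

definition gaussian :: "'w measure \<Rightarrow> ('w \<Rightarrow> real) \<Rightarrow> bool" where
  "gaussian M X \<longleftrightarrow> X \<in> borel_measurable M \<and>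
     (\<exists>m. (AE \<omega> in M. X \<omega> = m) \<or>
          (\<exists>\<sigma>>0. distributed M lborel X (normal_density m \<sigma>)))"

definition jointly_gaussian :: "'w measure \<Rightarrow> ('i \<Rightarrow> 'w \<Rightarrow> real) \<Rightarrow> 'i set \<Rightarrow> bool" where
  "jointly_gaussian M X I \<longleftrightarrow>
     (\<forall>J c. finite J \<and> J \<subseteq> I \<longrightarrow> gaussian M (\<lambda>\<omega>. \<Sum>i\<in>J. c i * X i \<omega>))"

text \<open>A list of triples \<open>(a, b, \<xi>)\<close> encodes the simple integrand \<open>\<Sum> \<xi> 1\<^bsub>(a,b]\<^esub>\<close>.\<close>

type_synonym 'w simple_integrand = "(real \<times> real \<times> ('w \<Rightarrow> real)) list"

definition simple_integrand :: "(real \<Rightarrow> 'w measure) \<Rightarrow> 'w simple_integrand \<Rightarrow> bool" where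
  "simple_integrand F L \<longleftrightarrow>
     (\<forall>(a, b, \<xi>)\<in>set L. 0 \<le> a \<and> a \<le> b \<and> \<xi> \<in> borel_measurable (F a) \<and> bounded (\<xi> ` space (F a)))"

definition simple_process :: "'w simple_integrand \<Rightarrow> real \<Rightarrow> 'w \<Rightarrow> real" where
  "simple_process L s \<omega> = (\<Sum>(a, b, \<xi>)\<leftarrow>L. \<xi> \<omega> * indicator {a<..b} s)"

definition simple_integral ::
  "(real \<Rightarrow> 'w \<Rightarrow> real) \<Rightarrow> 'w simple_integrand \<Rightarrow> real \<Rightarrow> 'w \<Rightarrow> real" where
  "simple_integral B L t \<omega> = (\<Sum>(a, b, \<xi>)\<leftarrow>L. \<xi> \<omega> * (B (min b t) \<omega> - B (min a t) \<omega>))"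

text \<open>\<open>I\<close> is a version of the It\^o integral process \<open>I\<^sub>t = \<integral>\<^sub>0\<^sup>t H dB\<close>: there are simple
  integrands \<open>H\<^sup>n\<close> such that, for every \<open>T\<close>, \<open>\<integral>\<^sub>0\<^sup>T (H\<^sup>n - H)\<^sup>2 ds \<rightarrow> 0\<close> and
  \<open>sup\<^bsub>t\<le>T\<^esub> \<bar>\<integral>\<^sub>0\<^sup>t H\<^sup>n dB - I\<^sub>t\<bar> \<rightarrow> 0\<close> in probability. Convergence in probability is expressed
  with measurable covers of the exceptional events, since paths are regular only almost surely.\<close>

definition ito_integral ::
  "'w measure \<Rightarrow> (real \<Rightarrow> 'w measure) \<Rightarrow> (real \<Rightarrow> 'w \<Rightarrow> real) \<Rightarrow> (real \<Rightarrow> 'w \<Rightarrow> real) \<Rightarrow>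
   (real \<Rightarrow> 'w \<Rightarrow> real) \<Rightarrow> bool" where
  "ito_integral M F B H I \<longleftrightarrow>
     (AE \<omega> in M. (\<lambda>s. H s \<omega>) \<in> borel_measurable (restrict_space borel {0..})) \<and>
     (\<exists>L. (\<forall>n. simple_integrand F (L n)) \<and>
       (\<forall>T>0. \<forall>\<epsilon>>0. \<forall>\<^sub>F n in sequentially. \<exists>A\<in>sets M. measure M A < \<epsilon> \<and>
          (\<forall>\<omega>\<in>space M - A.
             (\<integral>\<^sup>+s\<in>{0..T}. ennreal ((simple_process (L n) s \<omega> - H s \<omega>)\<^sup>2) \<partial>lborel) \<le> ennreal \<epsilon> \<and>
             (\<forall>t\<in>{0..T}. \<bar>simple_integral B (L n) t \<omega> - I t \<omega>\<bar> \<le> \<epsilon>))))"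

section \<open>The symbiotic branching model\<close>

text \<open>\<open>(u, v)\<close> on the probability space \<open>M\<close> is a (weak) solution of \<open>SBM\<^sub>\<gamma>(\<rho>)\<close>. In the joint
  Gaussianity, \<open>Inl (t, k)\<close> indexes \<open>B\<^sup>1\<^sub>t(k)\<close> and \<open>Inr (t, k)\<close> indexes \<open>B\<^sup>2\<^sub>t(k)\<close>.\<close>

definition sbm_solution ::
  "('d::finite site \<Rightarrow> real) \<Rightarrow> real \<Rightarrow> real \<Rightarrow> 'w measure \<Rightarrow>
   (real \<Rightarrow> 'w \<Rightarrow> 'd site \<Rightarrow> real) \<Rightarrow> (real \<Rightarrow> 'w \<Rightarrow> 'd site \<Rightarrow> real) \<Rightarrow> bool" where
  "sbm_solution \<beta> \<gamma> \<rho> M u v \<longleftrightarrow>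
     (\<exists>F B1 B2 I1 I2.
        filtered_prob_space M F \<and>
        (\<forall>k. brownian_motion M F (B1 k)) \<and> (\<forall>k. brownian_motion M F (B2 k)) \<and>
        jointly_gaussian M (case_sum (\<lambda>(t, k). B1 k t) (\<lambda>(t, k). B2 k t))
          (({0..} \<times> UNIV) <+> ({0..} \<times> UNIV)) \<and>
        (\<forall>t\<ge>0. \<forall>k j.
           (\<integral>\<omega>. B1 k t \<omega> * B1 j t \<omega> \<partial>M) = of_bool (k = j) * t \<and>
           (\<integral>\<omega>. B2 k t \<omega> * B2 j t \<omega> \<partial>M) = of_bool (k = j) * t \<and>
           (\<integral>\<omega>. B1 k t \<omega> * B2 j t \<omega> \<partial>M) = \<rho> * of_bool (k = j) * t) \<and>
        (\<forall>t\<ge>0. \<forall>k. (\<lambda>\<omega>. u t \<omega> k) \<in> borel_measurable (F t) \<and> (\<lambda>\<omega>. v t \<omega> k) \<in> borel_measurable (F t)) \<and>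
        (AE \<omega> in M. continuous_map (top_of_set {0..}) (L2_top \<beta>) (\<lambda>t. (u t \<omega>, v t \<omega>))) \<and>
        (\<forall>k. ito_integral M F (B1 k) (\<lambda>s \<omega>. sqrt (\<gamma> * u s \<omega> k * v s \<omega> k)) (I1 k)) \<and>
        (\<forall>k. ito_integral M F (B2 k) (\<lambda>s \<omega>. sqrt (\<gamma> * u s \<omega> k * v s \<omega> k)) (I2 k)) \<and>
        (AE \<omega> in M. \<forall>t\<ge>0. \<forall>k.
           u t \<omega> k = u 0 \<omega> k + (LINT s:{0..t}|lborel. laplacian (u s \<omega>) k) + I1 k t \<omega> \<and>
           v t \<omega> k = v 0 \<omega> k + (LINT s:{0..t}|lborel. laplacian (v s \<omega>) k) + I2 k t \<omega>))"

section \<open>The voter process\<close>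

text \<open>Configurations in \<open>{0,1}\<^bsup>\<int>\<^sup>d\<^esup>\<close> are \<open>bool\<close>-valued (\<open>True\<close> for opinion 1) and carry the product
  topology, for which this space is compact, so that \<open>'d config \<Rightarrow>\<^sub>C real\<close> is the space of all
  continuous functions with the supremum norm.\<close>

type_synonym 'd config = "'d site \<Rightarrow> bool"

definition voter_rate :: "'d::finite site \<Rightarrow> 'd config \<Rightarrow> real" where
  "voter_rate k \<eta> = 1 / (2 * real CARD('d)) * (\<Sum>i\<in>neighbours k. of_bool (\<eta> i \<noteq> \<eta> k))"

definition voter_generator :: "('d::finite config \<Rightarrow> real) \<Rightarrow> 'd config \<Rightarrow> real" where
  "voter_generator f \<eta> = (\<Sum>\<^sub>\<infinity>k. voter_rate k \<eta> * (f (\<eta>(k := \<not> \<eta> k)) - f \<eta>))"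

definition depends_on_finitely_many :: "('d config \<Rightarrow> real) \<Rightarrow> bool" where
  "depends_on_finitely_many f \<longleftrightarrow>
     (\<exists>K. finite K \<and> (\<forall>\<eta> \<zeta>. (\<forall>k\<in>K. \<eta> k = \<zeta> k) \<longrightarrow> f \<eta> = f \<zeta>))"

definition markov_semigroup ::
  "(real \<Rightarrow> ('a::topological_space \<Rightarrow>\<^sub>C real) \<Rightarrow> ('a \<Rightarrow>\<^sub>C real)) \<Rightarrow> bool" where
  "markov_semigroup S \<longleftrightarrow>
     (\<forall>t\<ge>0. linear (S t)) \<and>
     (\<forall>f. S 0 f = f) \<and>
     (\<forall>f. \<forall>t\<ge>0. ((\<lambda>s. S s f) \<longlongrightarrow> S t f) (at_right t)) \<and>
     (\<forall>s\<ge>0. \<forall>t\<ge>0. \<forall>f. S (s + t) f = S s (S t f)) \<and>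
     (\<forall>t\<ge>0. S t (const_bcontfun 1) = const_bcontfun 1) \<and>
     (\<forall>t\<ge>0. \<forall>f. (\<forall>x. 0 \<le> apply_bcontfun f x) \<longrightarrow> (\<forall>x. 0 \<le> apply_bcontfun (S t f) x))"

text \<open>\<open>f\<close> lies in the domain of the infinitesimal generator of \<open>S\<close>, which maps it to \<open>g\<close>.\<close>

definition in_generator ::
  "(real \<Rightarrow> ('a::topological_space \<Rightarrow>\<^sub>C real) \<Rightarrow> ('a \<Rightarrow>\<^sub>C real)) \<Rightarrow> ('a \<Rightarrow>\<^sub>C real) \<Rightarrow>
   ('a \<Rightarrow>\<^sub>C real) \<Rightarrow> bool" where
  "in_generator S f g \<longleftrightarrow> ((\<lambda>t. (S t f - f) /\<^sub>R t) \<longlongrightarrow> g) (at_right 0)"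

definition voter_semigroup ::
  "(real \<Rightarrow> ('d::finite config \<Rightarrow>\<^sub>C real) \<Rightarrow> ('d config \<Rightarrow>\<^sub>C real)) \<Rightarrow> bool" where
  "voter_semigroup S \<longleftrightarrow> markov_semigroup S \<and>
     (\<forall>f. depends_on_finitely_many (apply_bcontfun f) \<longrightarrow>
        (\<exists>g. apply_bcontfun g = voter_generator (apply_bcontfun f) \<and> in_generator S f g))"

definition natural_filtration ::
  "'w measure \<Rightarrow> (real \<Rightarrow> 'w \<Rightarrow> 'a::topological_space) \<Rightarrow> real \<Rightarrow> 'w measure" where
  "natural_filtration M X t =
     sigma (space M) {X s -` A \<inter> space M | s A. 0 \<le> s \<and> s \<le> t \<and> A \<in> sets borel}"

definition markov_process ::
  "(real \<Rightarrow> ('a::topological_space \<Rightarrow>\<^sub>C real) \<Rightarrow> ('a \<Rightarrow>\<^sub>C real)) \<Rightarrow> 'w measure \<Rightarrow>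
   (real \<Rightarrow> 'w \<Rightarrow> 'a) \<Rightarrow> bool" where
  "markov_process S M X \<longleftrightarrow>
     prob_space M \<and> (\<forall>t\<ge>0. X t \<in> borel_measurable M) \<and>
     (AE \<omega> in M. cadlag euclidean (\<lambda>t. X t \<omega>)) \<and>
     (\<forall>s\<ge>0. \<forall>t\<ge>0. \<forall>f. AE \<omega> in M.
        real_cond_exp M (natural_filtration M X s) (\<lambda>\<omega>. apply_bcontfun f (X (s + t) \<omega>)) \<omega>
          = apply_bcontfun (S t f) (X s \<omega>))"

definition voter_process :: "'w measure \<Rightarrow> (real \<Rightarrow> 'w \<Rightarrow> 'd::finite config) \<Rightarrow> bool" where
  "voter_process M \<eta> \<longleftrightarrow> (\<exists>S. voter_semigroup S \<and> markov_process S M \<eta>)"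

end

theory Submission
  imports Defs
begin

text \<open>For \<open>\<rho> = -1\<close> the two noises cancel, so \<open>u + v\<close> solves the discrete heat equation and is
  identically \<open>1\<close>; hence \<open>u\<close> takes values in \<open>[0,1]\<close>. The noises at different sites are orthogonal, so
  the product \<open>\<Prod>\<^bsub>k\<in>B\<^esub> u\<^sub>t(k)\<close> over a finite set \<open>B\<close> of sites has the drift
  \<open>\<Sum>\<^bsub>k\<in>B\<^esub> (\<Prod>\<^bsub>j\<in>B-{k}\<^esub> u\<^sub>t(j)) \<Delta>u\<^sub>t(k)\<close>, in which \<open>\<gamma>\<close> does not occur. Replacing \<open>u\<^sub>t(i)\<^sup>2\<close> by \<open>u\<^sub>t(i)\<close> turns
  this into the closed linear system of moment equations of the voter process. The replacement costs
  at most \<open>E u\<^sub>t(i)(1 - u\<^sub>t(i))\<close>, and this is \<open>O(1/\<gamma>)\<close>, because the noise pushes \<open>u\<close> to \<open>{0,1}\<close> at rate \<open>\<gamma>\<close>.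
  A Gronwall argument, iterated over the times, gives the convergence of all mixed moments.
  All the paths lie in a compact cube of states. There the pseudo-path topology is generated by the
  integrals of monomials in \<open>e\<^bsup>-t\<^esup>\<close> and \<open>u\<^sub>t(k)\<close> against \<open>e\<^bsup>-t\<^esup>dt\<close>, whose joint moments are integrals of the
  mixed moments; so no separate tightness argument is needed.\<close>

section \<open>Right derivatives and right-continuous paths\<close>

text \<open>The drift of a product is found by differentiating expectations from the right: over a
  window of length h one increment contributes its drift, two increments at different sites
  contribute o(h), and three or more contribute O(h^(3/2)) by a fourth-moment bound. Only forward
  increments are centred given the present, so only right derivatives are at hand, and the
  monotonicity and Gronwall arguments are set up for them. The stochastic integral is given only as
  a limit in probability of simple integrals. Cutting a simple integrand off when its bracket
  exceeds a budget gives a fourth-moment bound uniform in the approximation, which upgrades the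
  convergence to mean square. In the closed system a site of B moves to a neighbour and merges with
  a site that is already there: the number of sites never grows, so the sets of at most n sites form
  a closed family whose Gronwall constant does not depend on \<gamma>. The voter process satisfies
  the same system without error because its values are idempotent; both processes are treated
  through one notion, \<open>moment_flow\<close>.\<close>

lemma right_open_borel:
  fixes S :: "real set"
  assumes "\<And>t. t \<in> S \<Longrightarrow> \<exists>e>0. {t..<t + e} \<subseteq> S"
  shows "S \<in> sets borel"
proof -
  obtain e where e: "\<And>t. t \<in> S \<Longrightarrow> e t > 0 \<and> {t..<t + e t} \<subseteq> S"
    using assms by metis
  define O' where "O' = (\<Union>t\<in>S. {t<..<t + e t})"
  have sub: "O' \<subseteq> S"
    using e by (fastforce simp: O'_def)
  have nin: "s \<notin> {t<..<t + e t}" if "t \<in> S" "s \<in> S - O'" for s t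
    using that by (auto simp: O'_def)
  \<comment> \<open>Points of \<open>S\<close> outside \<open>O'\<close> lie in none of the chosen
    open intervals, so the intervals that start at them are pairwise disjoint and there are only
    countably many.\<close>
  have "countable (S - O')"
  proof -
    have disj: "disjoint ((\<lambda>t. {t<..<t + e t}) ` (S - O'))"
    proof (rule disjointI)
      fix A B assume "A \<in> (\<lambda>t. {t<..<t + e t}) ` (S - O')" "B \<in> (\<lambda>t. {t<..<t + e t}) ` (S - O')" "A \<noteq> B"
      then obtain s t where *: "s \<in> S - O'" "t \<in> S - O'" "A = {s<..<s + e s}" "B = {t<..<t + e t}" "s \<noteq> t"
        by blast
      then show "A \<inter> B = {}"
        using nin[of s t] nin[of t s] by (cases s t rule: linorder_cases) auto
    qed
    have c: "countable ((\<lambda>t. {t<..<t + e t}) ` (S - O'))"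
      by (rule countable_disjoint_open_subsets[OF _ disj]) auto
    have "inj_on (\<lambda>t. {t<..<t + e t}) (S - O')"
    proof (rule inj_onI, rule ccontr)
      fix s t assume *: "s \<in> S - O'" "t \<in> S - O'"
        and eq: "{s<..<s + e s} = {t<..<t + e t}" and ne: "s \<noteq> t"
      have "s + e s / 2 \<in> {s<..<s + e s}" using e[of s] * by auto
      then have "{s<..<s + e s} \<inter> {t<..<t + e t} \<noteq> {}" using eq by auto
      then show False
        using ne nin[of s t] nin[of t s] * by (cases s t rule: linorder_cases) auto
    qed
    with c show ?thesis by (rule countable_image_inj_on)
  qed
  then have "S - O' \<in> sets borel" by (rule sets.countable[rotated]) simp
  moreover have "O' \<in> sets borel" by (auto simp: O'_def intro!: borel_open)
  moreover have "S = O' \<union> (S - O')" using sub by auto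
  ultimately show ?thesis by (metis sets.Un)
qed

text \<open>A continuity argument in place of the mean value theorem, since only one-sided
  derivatives are given. The slack \<open>e\<close> makes the inequality for the difference quotient
  at the last good point \<open>c\<close> strict, so that it persists a little to the right of
  \<open>c\<close>.\<close>

lemma right_deriv_nonpos:
  fixes f :: "real \<Rightarrow> real"
  assumes ab: "a \<le> b" and cont: "continuous_on {a..b} f"
    and der: "\<And>x. a \<le> x \<Longrightarrow> x < b \<Longrightarrow> \<exists>D\<le>0. (f has_real_derivative D) (at_right x)"
  shows "f b \<le> f a"
proof -
  have "f b \<le> f a + e * (b - a)" if e: "e > 0" for e
  proof (rule ccontr)
    assume n: "\<not> f b \<le> f a + e * (b - a)"
    define T where "T = {x\<in>{a..b}. f x - e * (x - a) \<le> f a}"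
    have "closed T"
      unfolding T_def
      by (intro continuous_on_closed_Collect_le continuous_intros cont)
    moreover have "a \<in> T" using ab by (auto simp: T_def)
    moreover have bdd: "bdd_above T" by (auto simp: T_def)
    ultimately have c: "Sup T \<in> T" by (auto intro!: closed_contains_Sup)
    define c where "c = Sup T"
    have cT: "c \<in> T" using c by (simp add: c_def)
    then have cb: "a \<le> c" "c < b"
      using n by (auto simp: T_def intro: order.not_eq_order_implies_strict)
    from der[OF this] obtain D where D: "D \<le> 0" "(f has_real_derivative D) (at_right c)" by blast
    from D(2) have "((\<lambda>y. (f y - f c) / (y - c)) \<longlongrightarrow> D) (at_right c)"
      by (simp add: has_field_derivative_iff)
    then have "\<forall>\<^sub>F y in at_right c. (f y - f c) / (y - c) < e"
      using D e by (intro order_tendstoD(2)[where y = D]) auto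
    moreover have "\<forall>\<^sub>F y in at_right c. y \<in> {c<..<b}"
      using cb by (intro eventually_at_right_real)
    ultimately have "\<forall>\<^sub>F y in at_right c. (f y - f c) / (y - c) < e \<and> y \<in> {c<..<b}"
      by eventually_elim auto
    then obtain y where y: "(f y - f c) / (y - c) < e" "c < y" "y < b"
      using eventually_happens'[OF trivial_limit_at_right_real] by fastforce
    then have "f y - f c \<le> e * (y - c)" by (simp add: divide_less_eq)
    then have "y \<in> T" using y cT cb by (auto simp: T_def algebra_simps)
    then have "y \<le> c" using bdd by (auto simp: c_def intro: cSup_upper)
    then show False using y by simp
  qed
  then have "f b \<le> f a + e" if "e > 0" for e
  proof (cases "a = b")
    case False
    then show ?thesis using \<open>\<And>e. e > 0 \<Longrightarrow> f b \<le> f a + e * (b - a)\<close>[of "e / (b - a)"] that ab by auto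
  qed (use that in auto)
  then show ?thesis by (rule field_le_epsilon)
qed

lemma right_deriv_le:
  fixes f g :: "real \<Rightarrow> real"
  assumes ab: "a \<le> b" and cont: "continuous_on {a..b} f" "continuous_on {a..b} g"
    and der: "\<And>x. a \<le> x \<Longrightarrow> x < b \<Longrightarrow> (f has_real_derivative f' x) (at_right x)"
      "\<And>x. a \<le> x \<Longrightarrow> x < b \<Longrightarrow> (g has_real_derivative g' x) (at_right x)"
      "\<And>x. a \<le> x \<Longrightarrow> x < b \<Longrightarrow> f' x \<le> g' x"
  shows "f b - f a \<le> g b - g a"
proof -
  have "(\<lambda>x. f x - g x) b \<le> (\<lambda>x. f x - g x) a"
  proof (rule right_deriv_nonpos[OF ab])
    show "continuous_on {a..b} (\<lambda>x. f x - g x)" by (intro continuous_intros cont)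
    fix x assume "a \<le> x" "x < b"
    then show "\<exists>D\<le>0. ((\<lambda>x. f x - g x) has_real_derivative D) (at_right x)"
      using der[of x] by (intro exI[of _ "f' x - g' x"]) (auto intro: DERIV_diff)
  qed
  then show ?thesis by simp
qed

text \<open>The sign of the derivative is known only while \<open>f\<close> exceeds
  \<open>K\<close>. After the last time at which \<open>f\<close> is at most \<open>K\<close> the
  function does not increase, and continuity compares it with its value at that time.\<close>

lemma right_deriv_barrier:
  fixes f :: "real \<Rightarrow> real"
  assumes ab: "a \<le> b" and cont: "continuous_on {a..b} f" and fa: "f a \<le> K"
    and der: "\<And>x. a \<le> x \<Longrightarrow> x < b \<Longrightarrow> f x > K \<Longrightarrow> \<exists>D\<le>0. (f has_real_derivative D) (at_right x)"
  shows "f b \<le> K"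
proof (rule ccontr)
  assume n: "\<not> f b \<le> K"
  define T where "T = {x\<in>{a..b}. f x \<le> K}"
  have "closed T"
    unfolding T_def
    by (rule continuous_on_closed_Collect_le[OF cont]) auto
  moreover have "a \<in> T" using ab fa by (auto simp: T_def)
  moreover have bdd: "bdd_above T" by (auto simp: T_def)
  ultimately have c: "Sup T \<in> T" by (auto intro!: closed_contains_Sup)
  define c where "c = Sup T"
  have "c \<in> T" using c by (simp add: c_def)
  then have cb: "a \<le> c" "c < b" "f c \<le> K"
    using n by (auto simp: T_def intro: order.not_eq_order_implies_strict)
  have gt: "f x > K" if "c < x" "x \<le> b" for x
  proof (rule ccontr)
    assume "\<not> f x > K"
    then have "x \<in> T" using that cb by (auto simp: T_def)
    then have "x \<le> c" using bdd by (auto simp: c_def intro: cSup_upper)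
    then show False using that by simp
  qed
  have le: "f b \<le> f x" if "c < x" "x < b" for x
  proof (rule right_deriv_nonpos[where f = f])
    show "continuous_on {x..b} f" using that cb by (intro continuous_on_subset[OF cont]) auto
    show "x \<le> b" using that by simp
    fix y assume "x \<le> y" "y < b"
    then show "\<exists>D\<le>0. (f has_real_derivative D) (at_right y)"
      using that cb gt[of y] by (intro der) auto
  qed
  have "(f \<longlongrightarrow> f c) (at_right c)"
    using cb by (intro continuous_on_Icc_at_rightD[of c b] continuous_on_subset[OF cont]) auto
  moreover have "\<forall>\<^sub>F x in at_right c. f b \<le> f x"
    using eventually_at_right_real[OF cb(2)] by eventually_elim (auto intro: le)
  ultimately have "f b \<le> f c"
    by (intro tendsto_lowerbound) auto
  then show False using n cb by simp
qed

text \<open>The algebra generated by \<pi>. Monomials are indexed by lists because multiplication is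
  then concatenation, repeated factors are allowed, and the empty list supplies the
  constants.\<close>

inductive_set monomial_algebra :: "('i \<Rightarrow> 'a \<Rightarrow> real) \<Rightarrow> ('a \<Rightarrow> real) set" for \<pi> where
  monomial: "(\<lambda>x. \<Prod>i\<leftarrow>l. \<pi> i x) \<in> monomial_algebra \<pi>"
| add: "f \<in> monomial_algebra \<pi> \<Longrightarrow> g \<in> monomial_algebra \<pi> \<Longrightarrow> (\<lambda>x. f x + g x) \<in> monomial_algebra \<pi>"
| scale: "f \<in> monomial_algebra \<pi> \<Longrightarrow> (\<lambda>x. c * f x) \<in> monomial_algebra \<pi>"

lemma monomial_algebra_mult:
  assumes f: "f \<in> monomial_algebra \<pi>" and g: "g \<in> monomial_algebra \<pi>"
  shows "(\<lambda>x. f x * g x) \<in> monomial_algebra \<pi>"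
  using f
proof induction
  case (monomial l)
  from g show ?case
  proof induction
    case (monomial l')
    then show ?case
      using monomial_algebra.monomial[of \<pi> "l @ l'"] by simp
  next
    case (add f g)
    then show ?case by (simp add: distrib_left monomial_algebra.add)
  next
    case (scale f c)
    then show ?case using monomial_algebra.scale[OF scale.IH, of c] by (simp add: mult.left_commute)
  qed
next
  case (add f g)
  then show ?case by (simp add: distrib_right monomial_algebra.add)
next
  case (scale f c)
  then show ?case using monomial_algebra.scale[OF scale.IH, of c] by (simp add: mult.assoc)
qed

text \<open>Stone-Weierstrass. It serves twice: for integrands on the compact space of times and
  states, and for functions of the occupation functionals.\<close>

lemma monomial_algebra_dense:
  fixes \<pi> :: "'i \<Rightarrow> 'a::t2_space \<Rightarrow> real"
  assumes S: "compact S" and cont: "\<And>i. continuous_on S (\<pi> i)"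
    and sep: "\<And>x y. x \<in> S \<Longrightarrow> y \<in> S \<Longrightarrow> x \<noteq> y \<Longrightarrow> \<exists>i. \<pi> i x \<noteq> \<pi> i y"
    and f: "continuous_on S f" and e: "e > 0"
  shows "\<exists>g\<in>monomial_algebra \<pi>. \<forall>x\<in>S. \<bar>f x - g x\<bar> < e"
proof -
  interpret function_ring_on "monomial_algebra \<pi>" S
  proof
    show "continuous_on S g" if "g \<in> monomial_algebra \<pi>" for g
      using that
    proof induction
      case (monomial l)
      show ?case by (induction l) (auto intro!: continuous_intros cont)
    qed (auto intro: continuous_intros)
    show "(\<lambda>_. c) \<in> monomial_algebra \<pi>" for c
      using monomial_algebra.scale[OF monomial_algebra.monomial[of \<pi> "[]"], of c] by simp
    show "\<exists>f\<in>monomial_algebra \<pi>. f x \<noteq> f y" if xy: "x \<in> S" "y \<in> S" "x \<noteq> y" for x y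
    proof -
      obtain i where "\<pi> i x \<noteq> \<pi> i y" using sep[OF xy] by blast
      then show ?thesis
        using monomial_algebra.monomial[of \<pi> "[i]"] by (intro bexI[of _ "\<pi> i"]) (auto simp: fun_eq_iff)
    qed
  qed (auto intro: S monomial_algebra.add monomial_algebra_mult)
  from Stone_Weierstrass_basic[OF f e] show ?thesis .
qed

lemma jointly_measurable_right_continuous:
  fixes X :: "real \<Rightarrow> 'w \<Rightarrow> real"
  assumes meas: "\<And>t. t \<ge> 0 \<Longrightarrow> X t \<in> borel_measurable M"
    and rc: "\<And>w t. w \<in> space M \<Longrightarrow> t \<ge> 0 \<Longrightarrow> ((\<lambda>s. X s w) \<longlongrightarrow> X t w) (at_right t)"
  shows "(\<lambda>(t, w). X (max 0 t) w) \<in> borel_measurable (borel \<Otimes>\<^sub>M M)"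
proof -
  \<comment> \<open>The first point strictly after \<open>max 0 t\<close> in the grid of mesh
    \<open>1 / Suc n\<close>. Right continuity controls only the punctured right neighbourhood,
    hence the strictness; the grid is countable, which gives measurability.\<close>
  define q where "q n t = (of_int \<lfloor>real (Suc n) * max 0 t\<rfloor> + 1) / real (Suc n)" for n :: nat and t :: real
  have q: "q n t > max 0 t \<and> q n t \<le> max 0 t + 1 / real (Suc n)" for n t
  proof
    show "q n t > max 0 t"
      unfolding q_def
      using floor_correct[of "real (Suc n) * max 0 t"] by (simp add: less_divide_eq mult.commute)
    show "q n t \<le> max 0 t + 1 / real (Suc n)"
      unfolding q_def add_divide_distrib
      using of_int_floor_le[of "real (Suc n) * max 0 t"] by (simp add: divide_le_eq mult.commute)
  qed
  have "(\<lambda>p. X (max 0 (fst p)) (snd p)) \<in> borel_measurable (borel \<Otimes>\<^sub>M M)"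
  proof (rule borel_measurable_LIMSEQ_real)
    fix p assume p: "p \<in> space (borel \<Otimes>\<^sub>M M :: (real \<times> 'w) measure)"
    have "(\<lambda>n. q n (fst p)) \<longlonglongrightarrow> max 0 (fst p)"
    proof (rule tendsto_sandwich[OF _ _ tendsto_const])
      show "\<forall>\<^sub>F n in sequentially. max 0 (fst p) \<le> q n (fst p)"
        "\<forall>\<^sub>F n in sequentially. q n (fst p) \<le> max 0 (fst p) + 1 / real (Suc n)"
        using q by (auto intro!: always_eventually less_imp_le)
      show "(\<lambda>n. max 0 (fst p) + 1 / real (Suc n)) \<longlonglongrightarrow> max 0 (fst p)"
        using tendsto_add[OF tendsto_const LIMSEQ_inverse_real_of_nat, of "max 0 (fst p)"]
        by (simp add: inverse_eq_divide)
    qed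
    then have "filterlim (\<lambda>n. q n (fst p)) (at_right (max 0 (fst p))) sequentially"
      unfolding filterlim_at using q[where t = "fst p"] by (auto intro!: always_eventually simp: less_imp_neq[symmetric])
    then show "(\<lambda>n. X (q n (fst p)) (snd p)) \<longlonglongrightarrow> X (max 0 (fst p)) (snd p)"
      using p by (intro filterlim_compose[OF rc]) (auto simp: space_pair_measure)
  next
    fix n
    have "(\<lambda>p. X ((of_int (max 0 i) + 1) / real (Suc n)) (snd p)) \<in> borel_measurable (borel \<Otimes>\<^sub>M M)" for i :: int
      by (rule measurable_compose[OF measurable_snd meas]) auto
    moreover have "(\<lambda>p. \<lfloor>real (Suc n) * max 0 (fst p)\<rfloor>) \<in> borel \<Otimes>\<^sub>M M \<rightarrow>\<^sub>M count_space UNIV"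
      by measurable
    ultimately have "(\<lambda>p. X ((of_int (max 0 \<lfloor>real (Suc n) * max 0 (fst p)\<rfloor>) + 1) / real (Suc n)) (snd p))
        \<in> borel_measurable (borel \<Otimes>\<^sub>M M)"
      by (rule measurable_compose_countable)
    moreover have "max 0 \<lfloor>real (Suc n) * max 0 t\<rfloor> = \<lfloor>real (Suc n) * max 0 t\<rfloor>" for t
      by (simp add: max_def)
    ultimately show "(\<lambda>p. X (q n (fst p)) (snd p)) \<in> borel_measurable (borel \<Otimes>\<^sub>M M)"
      by (simp add: q_def)
  qed
  then show ?thesis by (simp add: case_prod_beta')
qed

section \<open>Paths in a compact cube and their occupation functionals\<close>

lemma compact_unit_cube: "compact (UNIV \<rightarrow> {0..1} :: ('i \<Rightarrow> real) set)"
proof -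
  have "compactin (product_topology (\<lambda>_::'i. euclidean) UNIV) (PiE UNIV (\<lambda>_. {0..1::real}))"
    unfolding compactin_PiE by simp
  then show ?thesis
    by (simp add: euclidean_product_topology PiE_def)
qed

lemma space_borel_of [simp]: "space (borel_of X) = topspace X"
  by (simp add: borel_of_def space_measure_of_conv)

lemma sets_borel_of: "sets (borel_of X) = sigma_sets (topspace X) {U. openin X U}"
  unfolding borel_of_def by (rule sets_measure_of) (auto dest: openin_subset)

lemma borel_of_measurable:
  fixes f :: "'a \<Rightarrow> real"
  assumes f: "continuous_map X euclideanreal f"
  shows "f \<in> borel_measurable (borel_of X)"
proof (rule borel_measurableI)
  fix S :: "real set" assume "open S"
  then have "openin X {x \<in> topspace X. f x \<in> S}"
    using f by (auto simp: continuous_map_def)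
  moreover have "f -` S \<inter> space (borel_of X) = {x \<in> topspace X. f x \<in> S}" by auto
  ultimately show "f -` S \<inter> space (borel_of X) \<in> sets (borel_of X)"
    by (auto simp: sets_borel_of intro: sigma_sets.Basic)
qed

section \<open>Exponential time law, cube paths and occupation functionals\<close>

definition exp_law :: "real measure" where
  "exp_law = density (restrict_space lborel {0..}) (\<lambda>t. ennreal (exp (- t)))"

lemma space_exp_law [simp]: "space exp_law = {0..}"
  by (simp add: exp_law_def space_restrict_space)

lemma sets_exp_law: "sets exp_law = sets (restrict_space borel {0..})"
  by (simp add: exp_law_def sets_restrict_space)

lemma measurable_exp_law: "measurable exp_law N = measurable (restrict_space borel {0..}) N"
  by (rule measurable_cong_sets) (auto simp: sets_exp_law)

lemma prob_space_exp_law: "prob_space exp_law"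
proof
  have "emeasure exp_law (space exp_law) = (\<integral>\<^sup>+t. ennreal (exp (- t)) \<partial>restrict_space lborel {0..})"
    unfolding exp_law_def
    by (subst emeasure_density) (auto simp: space_restrict_space sets_restrict_space intro!: nn_integral_cong measurable_restrict_space1)
  also have "\<dots> = (\<integral>\<^sup>+t. ennreal (exponential_density 1 t) \<partial>lborel)"
    by (subst nn_integral_restrict_space)
      (auto simp: exponential_density_def indicator_def intro!: nn_integral_cong)
  also have "\<dots> = emeasure (density lborel (exponential_density 1)) (space lborel)"
    by (subst emeasure_density) auto
  also have "\<dots> = 1"
    using prob_space.emeasure_space_1[OF prob_space_exponential_density[of 1]] by simp
  finally show "emeasure exp_law (space exp_law) = 1" .
qed

interpretation exp_law: prob_space exp_law
  by (rule prob_space_exp_law)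

lemma measure_exp_law [simp]: "measure exp_law {0..} = 1"
  using exp_law.prob_space by simp

text \<open>With total mass one the second component is determined by the first, so a state is a
  point of the cube.\<close>

definition state_of :: "('d::finite site \<Rightarrow> real) \<Rightarrow> 'd state" where
  "state_of y = (y, \<lambda>k. 1 - y k)"

abbreviation cube :: "('i \<Rightarrow> real) set" where
  "cube \<equiv> UNIV \<rightarrow> {0..1}"

definition cube_paths :: "('d::finite site \<Rightarrow> real) \<Rightarrow> (real \<Rightarrow> 'd state) set" where
  "cube_paths \<beta> = {w \<in> extensional {0..}. cadlag (L2_top \<beta>) w \<and> (\<forall>t\<ge>0. w t \<in> state_of ` cube)}"

text \<open>\<open>None\<close> is the time coordinate. It is fed with e^(-t) instead of t, so that
  time too ranges over the compact interval [0,1].\<close>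

fun coord :: "'d::finite site option \<Rightarrow> real \<times> ('d site \<Rightarrow> real) \<Rightarrow> real" where
  "coord None p = fst p"
| "coord (Some k) p = snd p k"

text \<open>The mixed moments of the pseudo-path measure on the compact space of pairs of e^(-t) and
  state; they serve as coordinates for cube paths.\<close>

definition occ :: "'d::finite site option list \<Rightarrow> (real \<Rightarrow> 'd state) \<Rightarrow> real" where
  "occ l w = (\<integral>t. (\<Prod>i\<leftarrow>l. coord i (exp (- t), fst (w t))) \<partial>exp_law)"

lemma prod_list_unit:
  fixes f :: "'i \<Rightarrow> real"
  shows "(\<And>i. f i \<in> {0..1}) \<Longrightarrow> (\<Prod>i\<leftarrow>l. f i) \<in> {0..1}"
proof (induction l)
  case (Cons a l)
  then have "f a \<in> {0..1}" "(\<Prod>i\<leftarrow>l. f i) \<in> {0..1}" by blast+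
  then show ?case by (auto intro: mult_le_one)
qed simp

locale weighted =
  fixes \<beta> :: "'d::finite site \<Rightarrow> real"
  assumes \<beta>_pos: "\<And>k. 0 < \<beta> k" and \<beta>_summable: "\<beta> summable_on UNIV"
begin

sublocale L2: Metric_space "L2_space \<beta>" "L2_dist \<beta>"
  by (rule L2_Metric_space) (rule \<beta>_pos)

lemma topspace_L2_top [simp]: "topspace (L2_top \<beta>) = L2_space \<beta>"
  by (simp add: L2_top_def)

lemma state_of_in_L2: "y \<in> cube \<Longrightarrow> state_of y \<in> L2_space \<beta>"
proof -
  assume y: "y \<in> cube"
  have "(\<lambda>k. z k * \<beta> k) summable_on UNIV" if "z \<in> cube" for z
    using that \<beta>_pos[THEN less_imp_le]
    by (intro summable_on_comparison_test[OF \<beta>_summable]) (auto simp: Pi_iff mult_left_le_one_le)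
  from this[of y] this[of "\<lambda>k. 1 - y k"] show ?thesis
    using y by (auto simp: L2_space_def state_of_def Pi_iff)
qed

text \<open>On the cube the product topology already controls the weighted norm: finitely many
  coordinates are handled by the topology and the others by the tail of the summable weight.\<close>

lemma state_of_continuous: "continuous_map (top_of_set cube) (L2_top \<beta>) state_of"
  unfolding L2_top_def L2.continuous_map_to_metric
proof (intro ballI allI impI)
  fix y :: "'d site \<Rightarrow> real" and e :: real assume y: "y \<in> topspace (top_of_set cube)" and e: "0 < e"
  then have yc: "y \<in> cube" by simp
  \<comment> \<open>Outside \<open>F\<close> each term is at most \<open>2 * \<beta> k\<close>, so a
    tail of \<open>e / 8\<close> contributes \<open>e / 4\<close> in all; the finite part is kept
    below \<open>e / 2\<close>.\<close>
  obtain F where F: "finite F" "dist (sum \<beta> F) (infsum \<beta> UNIV) \<le> e / 8"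
    using infsum_finite_approximation[OF \<beta>_summable, of "e / 8"] e by auto
  have tail: "infsum \<beta> (- F) \<le> e / 8"
  proof -
    have s: "\<beta> summable_on F" "\<beta> summable_on - F"
      using summable_on_subset_banach[OF \<beta>_summable] by auto
    have "infsum \<beta> (F \<union> - F) = infsum \<beta> F + infsum \<beta> (- F)"
      by (rule infsum_Un_disjoint[OF s]) auto
    then have "infsum \<beta> UNIV = sum \<beta> F + infsum \<beta> (- F)"
      using F(1) by simp
    with F(2) show ?thesis by (simp add: dist_real_def abs_if split: if_splits)
  qed
  define U where "U = {z \<in> cube. (\<Sum>k\<in>F. 2 * \<bar>y k - z k\<bar> * \<beta> k) < e / 2}"
  have cont: "continuous_on A (\<lambda>z::'d site \<Rightarrow> real. \<Sum>k\<in>F. 2 * \<bar>y k - z k\<bar> * \<beta> k)" for A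
    by (intro continuous_intros continuous_on_subset[OF continuous_on_product_coordinates subset_UNIV])
  have "openin (top_of_set cube) U"
  proof -
    have "open ((\<lambda>z. \<Sum>k\<in>F. 2 * \<bar>y k - z k\<bar> * \<beta> k) -` {..<e / 2})"
      by (rule open_vimage[OF open_lessThan cont])
    moreover have "U = cube \<inter> (\<lambda>z. \<Sum>k\<in>F. 2 * \<bar>y k - z k\<bar> * \<beta> k) -` {..<e / 2}"
      by (auto simp: U_def)
    ultimately show ?thesis by (simp add: openin_open_Int)
  qed
  moreover have "y \<in> U" using yc e by (simp add: U_def)
  moreover have "state_of z \<in> L2.mball (state_of y) e" if z: "z \<in> U" for z
  proof -
    have zc: "z \<in> cube" using z by (simp add: U_def)
    have eq: "(\<bar>fst (state_of y) k - fst (state_of z) k\<bar> + \<bar>snd (state_of y) k - snd (state_of z) k\<bar>) * \<beta> k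
        = 2 * \<bar>y k - z k\<bar> * \<beta> k" for k
      by (simp add: state_of_def abs_minus_commute)
    have le: "2 * \<bar>y k - z k\<bar> * \<beta> k \<le> 2 * \<beta> k" for k
    proof -
      have "y k \<in> {0..1}" "z k \<in> {0..1}" using yc zc by auto
      then have "\<bar>y k - z k\<bar> \<le> 1" by (auto simp: abs_le_iff)
      then show ?thesis using \<beta>_pos[of k] by (simp add: mult_le_cancel_right)
    qed
    have s2: "(\<lambda>k. 2 * \<beta> k) summable_on A" for A
      using summable_on_subset_banach[OF \<beta>_summable, of A] by (intro summable_on_cmult_right) auto
    have sm: "(\<lambda>k. 2 * \<bar>y k - z k\<bar> * \<beta> k) summable_on A" for A
      using le \<beta>_pos[THEN less_imp_le] by (intro summable_on_comparison_test[OF s2]) auto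
    have "(\<Sum>\<^sub>\<infinity>k. 2 * \<bar>y k - z k\<bar> * \<beta> k) = (\<Sum>\<^sub>\<infinity>k\<in>F \<union> - F. 2 * \<bar>y k - z k\<bar> * \<beta> k)" by simp
    also have "\<dots> = (\<Sum>k\<in>F. 2 * \<bar>y k - z k\<bar> * \<beta> k) + (\<Sum>\<^sub>\<infinity>k\<in>- F. 2 * \<bar>y k - z k\<bar> * \<beta> k)"
      using F(1) by (subst infsum_Un_disjoint[OF sm sm]) auto
    also have "(\<Sum>\<^sub>\<infinity>k\<in>- F. 2 * \<bar>y k - z k\<bar> * \<beta> k) \<le> (\<Sum>\<^sub>\<infinity>k\<in>- F. 2 * \<beta> k)"
      by (intro infsum_mono sm s2 le)
    also have "\<dots> = 2 * infsum \<beta> (- F)" by (rule infsum_cmult_right')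
    finally have "L2_dist \<beta> (state_of y) (state_of z) < e"
      using tail z e unfolding L2_dist_def eq by (simp add: U_def)
    then show ?thesis
      using state_of_in_L2[OF yc] state_of_in_L2[OF zc] by (simp add: L2.in_mball)
  qed
  ultimately show "\<exists>U. openin (top_of_set cube) U \<and> y \<in> U \<and> (\<forall>z\<in>U. state_of z \<in> L2.mball (state_of y) e)"
    by blast
qed

lemma cube_path_fst: "w \<in> cube_paths \<beta> \<Longrightarrow> t \<ge> 0 \<Longrightarrow> fst (w t) \<in> cube \<and> w t = state_of (fst (w t))"
  by (force simp: cube_paths_def state_of_def)

text \<open>By right continuity every time in the preimage of an open set starts an interval
  contained in that preimage, so \<open>right_open_borel\<close> applies to it.\<close>

lemma path_graph_measurable:
  assumes w: "w \<in> cube_paths \<beta>"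
  shows "(\<lambda>t. (t, w t)) \<in> measurable exp_law (borel_of (prod_topology (top_of_set {0..}) (L2_top \<beta>)))"
  unfolding borel_of_def
proof (rule measurable_measure_of)
  have wt: "w t \<in> L2_space \<beta>" if "t \<ge> 0" for t
    using cube_path_fst[OF w that] state_of_in_L2 by metis
  show "{U. openin (prod_topology (top_of_set {0::real..}) (L2_top \<beta>)) U}
      \<subseteq> Pow (topspace (prod_topology (top_of_set {0..}) (L2_top \<beta>)))"
    by (intro subsetI PowI openin_subset) simp
  show "(\<lambda>t. (t, w t)) \<in> space exp_law \<rightarrow> topspace (prod_topology (top_of_set {0..}) (L2_top \<beta>))"
    using wt by auto
  fix V assume "V \<in> {U. openin (prod_topology (top_of_set {0::real..}) (L2_top \<beta>)) U}"
  then have V: "openin (prod_topology (top_of_set {0..}) (L2_top \<beta>)) V" by simp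
  define S where "S = {t. t \<ge> 0 \<and> (t, w t) \<in> V}"
  have "S \<in> sets borel"
  proof (rule right_open_borel)
    fix t assume t: "t \<in> S"
    then obtain A B where AB: "openin (top_of_set {0::real..}) A" "openin (L2_top \<beta>) B"
        "t \<in> A" "w t \<in> B" "A \<times> B \<subseteq> V"
      using V[unfolded openin_prod_topology_alt, rule_format, of t "w t"] by (auto simp: S_def)
    obtain T where T: "open T" "A = {0..} \<inter> T" using AB(1) by (auto simp: openin_open)
    have "limitin (L2_top \<beta>) w (w t) (at_right t)"
      using w t by (simp add: cube_paths_def cadlag_def S_def)
    then have "\<forall>\<^sub>F s in at_right t. w s \<in> B" using AB by (simp add: limitin_def)
    moreover have "\<forall>\<^sub>F s in at_right t. s \<in> T"
      using T AB(3) by (intro eventually_at_topological[THEN iffD2]) auto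
    ultimately have "\<forall>\<^sub>F s in at_right t. w s \<in> B \<and> s \<in> T" by eventually_elim auto
    then obtain b where b: "b > t" "\<And>s. t < s \<Longrightarrow> s < b \<Longrightarrow> w s \<in> B \<and> s \<in> T"
      by (auto simp: eventually_at_right_field)
    have "{t..<t + (b - t)} \<subseteq> S"
    proof
      fix s assume s: "s \<in> {t..<t + (b - t)}"
      show "s \<in> S"
      proof (cases "s = t")
        case False
        then have "w s \<in> B" "s \<in> A" using b(2)[of s] s t T by (auto simp: S_def)
        then show ?thesis using AB(5) s t by (auto simp: S_def)
      qed (use t in simp)
    qed
    then show "\<exists>e>0. {t..<t + e} \<subseteq> S" using b(1) by (intro exI[of _ "b - t"]) auto
  qed
  moreover have "(\<lambda>t. (t, w t)) -` V \<inter> space exp_law = {0..} \<inter> S" by (auto simp: S_def)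
  ultimately show "(\<lambda>t. (t, w t)) -` V \<inter> space exp_law \<in> sets exp_law"
    by (auto simp: sets_exp_law sets_restrict_space)
qed

lemma prob_space_pseudo_path: "w \<in> cube_paths \<beta> \<Longrightarrow> prob_space (pseudo_path (L2_top \<beta>) w)"
  unfolding pseudo_path_def exp_law_def[symmetric]
  by (rule exp_law.prob_space_distr[OF path_graph_measurable])

lemma integral_pseudo_path:
  fixes f :: "real \<times> 'd state \<Rightarrow> real"
  assumes w: "w \<in> cube_paths \<beta>" and f: "continuous_map (prod_topology (top_of_set {0..}) (L2_top \<beta>)) euclideanreal f"
  shows "(\<integral>x. f x \<partial>pseudo_path (L2_top \<beta>) w) = (\<integral>t. f (t, w t) \<partial>exp_law)"
  unfolding pseudo_path_def exp_law_def[symmetric]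
  by (rule integral_distr[OF path_graph_measurable[OF w] borel_of_measurable[OF f]])

lemma cube_paths_topspace: "cube_paths \<beta> \<subseteq> topspace (meyer_zheng (L2_top \<beta>))"
proof
  fix w assume w: "w \<in> cube_paths \<beta>"
  let ?X = "prod_topology (top_of_set {0..}) (L2_top \<beta>)"
  have "pseudo_path (L2_top \<beta>) w \<in> topspace (weak_topology ?X)"
    unfolding weak_topology_def topology_generated_by_topspace
    \<comment> \<open>The zero function with the full target set gives a generating set that
      contains every Borel probability measure.\<close>
    by (rule UnionI[of "{\<mu>. prob_space \<mu> \<and> sets \<mu> = sets (borel_of ?X) \<and> (\<integral>x. 0 \<partial>\<mu>) \<in> UNIV}"])
      (use prob_space_pseudo_path[OF w] in
        \<open>auto intro!: exI[of _ "\<lambda>_. 0"] exI[of _ UNIV] boundedI[of _ 0] simp: pseudo_path_def\<close>)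
  then show "w \<in> topspace (meyer_zheng (L2_top \<beta>))"
    using w by (simp add: meyer_zheng_def topspace_pullback_topology cube_paths_def cadlag_paths_def)
qed

lemma L2_dist_summable:
  assumes "x \<in> L2_space \<beta>" "y \<in> L2_space \<beta>"
  shows "(\<lambda>k. (\<bar>fst x k - fst y k\<bar> + \<bar>snd x k - snd y k\<bar>) * \<beta> k) summable_on UNIV"
proof (rule summable_on_comparison_test)
  show "(\<lambda>k. (fst x k * \<beta> k + snd x k * \<beta> k) + (fst y k * \<beta> k + snd y k * \<beta> k)) summable_on UNIV"
    using assms by (intro summable_on_add) (auto simp: L2_space_def)
  fix k
  have "0 \<le> fst x k" "0 \<le> snd x k" "0 \<le> fst y k" "0 \<le> snd y k"
    using assms by (auto simp: L2_space_def)
  then have "\<bar>fst x k - fst y k\<bar> + \<bar>snd x k - snd y k\<bar> \<le> fst x k + snd x k + (fst y k + snd y k)"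
    by linarith
  then have "(\<bar>fst x k - fst y k\<bar> + \<bar>snd x k - snd y k\<bar>) * \<beta> k
      \<le> (fst x k + snd x k + (fst y k + snd y k)) * \<beta> k"
    using \<beta>_pos[of k] by (intro mult_right_mono) auto
  then show "(\<bar>fst x k - fst y k\<bar> + \<bar>snd x k - snd y k\<bar>) * \<beta> k
      \<le> (fst x k * \<beta> k + snd x k * \<beta> k) + (fst y k * \<beta> k + snd y k * \<beta> k)"
    by (simp add: algebra_simps)
  show "0 \<le> (\<bar>fst x k - fst y k\<bar> + \<bar>snd x k - snd y k\<bar>) * \<beta> k"
    using \<beta>_pos[of k] by simp
qed

lemma L2_dist_coord:
  assumes "x \<in> L2_space \<beta>" "y \<in> L2_space \<beta>"
  shows "(\<bar>fst x k - fst y k\<bar> + \<bar>snd x k - snd y k\<bar>) * \<beta> k \<le> L2_dist \<beta> x y"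
proof -
  have "(\<Sum>\<^sub>\<infinity>j\<in>{k}. (\<bar>fst x j - fst y j\<bar> + \<bar>snd x j - snd y j\<bar>) * \<beta> j) \<le> L2_dist \<beta> x y"
    unfolding L2_dist_def using L2_dist_summable[OF assms] \<beta>_pos[THEN less_imp_le]
    by (intro infsum_mono_neutral) auto
  then show ?thesis by simp
qed

lemma continuous_map_L2_lipschitz:
  fixes f :: "'d state \<Rightarrow> real"
  assumes C: "0 \<le> C" and f: "\<And>x y. x \<in> L2_space \<beta> \<Longrightarrow> y \<in> L2_space \<beta> \<Longrightarrow> \<bar>f x - f y\<bar> \<le> C * L2_dist \<beta> x y"
  shows "continuous_map (L2_top \<beta>) euclideanreal f"
proof -
  have "continuous_map (L2_top \<beta>) Met_TC.mtopology f"
    unfolding Met_TC.continuous_map_to_metric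
  proof (intro ballI allI impI)
    fix x and e :: real assume x: "x \<in> topspace (L2_top \<beta>)" and e: "0 < e"
    show "\<exists>U. openin (L2_top \<beta>) U \<and> x \<in> U \<and> (\<forall>y\<in>U. f y \<in> Met_TC.mball (f x) e)"
    \<comment> \<open>\<open>C + 1\<close> keeps the radius positive when \<open>C\<close> is
      \<open>0\<close>.\<close>
    proof (intro exI[of _ "L2.mball x (e / (C + 1))"] conjI ballI)
      show "openin (L2_top \<beta>) (L2.mball x (e / (C + 1)))" by (simp add: L2_top_def)
      show "x \<in> L2.mball x (e / (C + 1))" using x e C by (simp add: L2.in_mball)
      fix y assume "y \<in> L2.mball x (e / (C + 1))"
      then have y: "y \<in> L2_space \<beta>" "L2_dist \<beta> x y < e / (C + 1)" by (auto simp: L2.in_mball)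
      have "\<bar>f x - f y\<bar> \<le> C * L2_dist \<beta> x y" using x y by (intro f) auto
      also have "\<dots> \<le> (C + 1) * L2_dist \<beta> x y" by (simp add: mult_right_mono)
      also have "\<dots> < e" using y(2) C by (simp add: less_divide_eq mult.commute)
      finally show "f y \<in> Met_TC.mball (f x) e" by (simp add: Met_TC.in_mball dist_real_def)
    qed
  qed
  then show ?thesis by simp
qed

lemma L2_coord_continuous:
  "continuous_map (L2_top \<beta>) euclideanreal (\<lambda>x. fst x k)"
  "continuous_map (L2_top \<beta>) euclideanreal (\<lambda>x. snd x k)"
proof -
  have "\<bar>fst x k - fst y k\<bar> \<le> 1 / \<beta> k * L2_dist \<beta> x y \<and> \<bar>snd x k - snd y k\<bar> \<le> 1 / \<beta> k * L2_dist \<beta> x y"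
    if xy: "x \<in> L2_space \<beta>" "y \<in> L2_space \<beta>" for x y
  proof -
    have "\<bar>fst x k - fst y k\<bar> * \<beta> k \<le> L2_dist \<beta> x y" "\<bar>snd x k - snd y k\<bar> * \<beta> k \<le> L2_dist \<beta> x y"
      using \<beta>_pos[of k] by (auto intro!: order.trans[OF _ L2_dist_coord[OF xy, of k]] mult_right_mono)
    then show ?thesis using \<beta>_pos[of k] by (simp add: le_divide_eq)
  qed
  then show "continuous_map (L2_top \<beta>) euclideanreal (\<lambda>x. fst x k)"
      "continuous_map (L2_top \<beta>) euclideanreal (\<lambda>x. snd x k)"
    using \<beta>_pos[of k] by (auto intro!: continuous_map_L2_lipschitz[of "1 / \<beta> k"])
qed

lemma coord_measurable:
  assumes w: "w \<in> cube_paths \<beta>"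
  shows "(\<lambda>t. coord i (exp (- t), fst (w t))) \<in> borel_measurable exp_law"
proof (cases i)
  case None
  have "(\<lambda>t::real. exp (- t)) \<in> borel_measurable (restrict_space borel {0..})"
    by (intro measurable_restrict_space1) measurable
  then show ?thesis using None by (simp add: measurable_exp_law)
next
  case (Some k)
  have "continuous_map (prod_topology (top_of_set {0..}) (L2_top \<beta>)) euclideanreal ((\<lambda>x. fst x k) \<circ> snd)"
    by (rule continuous_map_compose[OF continuous_map_snd L2_coord_continuous(1)])
  from measurable_compose[OF path_graph_measurable[OF w] borel_of_measurable[OF this]]
  show ?thesis using Some by simp
qed

lemma coord_bounds:
  assumes "w \<in> cube_paths \<beta>" "t \<ge> 0"
  shows "(exp (- t), fst (w t)) \<in> {0..1} \<times> cube" "coord i (exp (- t), fst (w t)) \<in> {0..1}"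
  using cube_path_fst[OF assms] assms(2) by (cases i; auto simp: Pi_iff)+

lemma monomial_measurable:
  assumes w: "w \<in> cube_paths \<beta>"
  shows "(\<lambda>t. \<Prod>i\<leftarrow>l. coord i (exp (- t), fst (w t))) \<in> borel_measurable exp_law"
proof (induction l)
  case (Cons a l)
  then show ?case using coord_measurable[OF w, of a] by simp
qed simp

lemma monomial_integrable:
  assumes w: "w \<in> cube_paths \<beta>"
  shows "integrable exp_law (\<lambda>t. \<Prod>i\<leftarrow>l. coord i (exp (- t), fst (w t)))"
proof (rule exp_law.integrable_const_bound[where B = 1])
  show "AE t in exp_law. norm (\<Prod>i\<leftarrow>l. coord i (exp (- t), fst (w t))) \<le> 1"
  proof (rule AE_I2)
    fix t assume "t \<in> space exp_law"
    then have "(\<Prod>i\<leftarrow>l. coord i (exp (- t), fst (w t))) \<in> {0..1}"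
      using coord_bounds(2)[OF w] by (intro prod_list_unit) simp
    then show "norm (\<Prod>i\<leftarrow>l. coord i (exp (- t), fst (w t))) \<le> 1" by simp
  qed
qed (rule monomial_measurable[OF w])

lemma occ_bounds: "w \<in> cube_paths \<beta> \<Longrightarrow> occ l w \<in> {0..1}"
proof -
  assume w: "w \<in> cube_paths \<beta>"
  have b: "(\<Prod>i\<leftarrow>l. coord i (exp (- t), fst (w t))) \<in> {0..1}" if "t \<in> space exp_law" for t
    using that coord_bounds(2)[OF w] by (intro prod_list_unit) simp
  have "occ l w \<le> (\<integral>t. 1 \<partial>exp_law)"
    unfolding occ_def using b by (intro integral_mono monomial_integrable[OF w]) auto
  moreover have "0 \<le> occ l w"
    unfolding occ_def using b by (intro Bochner_Integration.integral_nonneg) auto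
  ultimately show ?thesis by (simp add: exp_law.prob_space)
qed

text \<open>Integration in time sends a monomial integrand to a single occupation functional. A
  polynomial integrand thus gives a function of finitely many of them, which is continuous for the
  product topology.\<close>

lemma polynomial_functional:
  assumes g: "g \<in> monomial_algebra coord"
  shows "\<exists>P. continuous_on UNIV P \<and> (\<forall>w\<in>cube_paths \<beta>. integrable exp_law (\<lambda>t. g (exp (- t), fst (w t))) \<and>
    (\<integral>t. g (exp (- t), fst (w t)) \<partial>exp_law) = P (\<lambda>l. occ l w))"
  using g
proof induction
  case (monomial l)
  show ?case
    by (intro exI[of _ "\<lambda>y. y l"]) (auto simp: occ_def intro: monomial_integrable)
next
  case (add f g)
  then obtain P Q where "continuous_on UNIV P" "continuous_on UNIV Q"
    "\<forall>w\<in>cube_paths \<beta>. integrable exp_law (\<lambda>t. f (exp (- t), fst (w t))) \<and>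
      (\<integral>t. f (exp (- t), fst (w t)) \<partial>exp_law) = P (\<lambda>l. occ l w)"
    "\<forall>w\<in>cube_paths \<beta>. integrable exp_law (\<lambda>t. g (exp (- t), fst (w t))) \<and>
      (\<integral>t. g (exp (- t), fst (w t)) \<partial>exp_law) = Q (\<lambda>l. occ l w)"
    by blast
  then show ?case
    by (intro exI[of _ "\<lambda>y. P y + Q y"]) (auto intro: continuous_intros)
next
  case (scale f c)
  then obtain P where "continuous_on UNIV P"
    "\<forall>w\<in>cube_paths \<beta>. integrable exp_law (\<lambda>t. f (exp (- t), fst (w t))) \<and>
      (\<integral>t. f (exp (- t), fst (w t)) \<partial>exp_law) = P (\<lambda>l. occ l w)"
    by blast
  then show ?case
    by (intro exI[of _ "\<lambda>y. c * P y"]) (auto intro: continuous_intros)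
qed

text \<open>The cutoff in time makes the integrand, as a function of \<open>(e\<^bsup>-t\<^esup>, u)\<close>, extend continuously to
  the compact set \<open>[0,1] \<times> [0,1]\<^bsup>\<int>\<^sup>d\<^esup>\<close>, where polynomials are dense.\<close>

lemma functional_approx:
  fixes f :: "real \<times> 'd state \<Rightarrow> real"
  assumes f: "continuous_map (prod_topology (top_of_set {0..}) (L2_top \<beta>)) euclideanreal f"
    and bdd: "bounded (f ` topspace (prod_topology (top_of_set {0..}) (L2_top \<beta>)))" and e: "e > 0"
  shows "\<exists>P. continuous_on UNIV P \<and>
    (\<forall>w\<in>cube_paths \<beta>. \<bar>(\<integral>t. f (t, w t) \<partial>exp_law) - P (\<lambda>l. occ l w)\<bar> \<le> e)"
proof -
  let ?X = "prod_topology (top_of_set {0..}) (L2_top \<beta>)"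
  obtain C where C: "C > 0" "\<And>p. p \<in> topspace ?X \<Longrightarrow> \<bar>f p\<bar> \<le> C"
    using bdd unfolding bounded_pos by auto
  \<comment> \<open>A cutoff equal to 1 up to time \<open>n\<close> and to 0 from time
    \<open>n + 1\<close> on; under the exponential law it costs little once \<open>n\<close> is
    large.\<close>
  define h where "h n t = max 0 (min 1 (real n + 1 - t))" for n t
  have hb: "0 \<le> h n t" "h n t \<le> 1" for n t by (auto simp: h_def)
  have hm: "h n \<in> borel_measurable exp_law" for n
    unfolding measurable_exp_law h_def by (intro measurable_restrict_space1) measurable
  have hi: "integrable exp_law (h n)" for n
    using hb hm by (intro exp_law.integrable_const_bound[where B = 1]) auto
  have "(\<lambda>n. \<integral>t. h n t \<partial>exp_law) \<longlonglongrightarrow> (\<integral>t. 1 \<partial>exp_law)"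
  proof (rule integral_dominated_convergence[where w = "\<lambda>_. 1"])
    show "AE t in exp_law. (\<lambda>n. h n t) \<longlonglongrightarrow> 1"
    proof (rule AE_I2)
      fix t :: real
      have "\<forall>\<^sub>F n in sequentially. h n t = 1"
        using eventually_ge_at_top[of "nat \<lceil>t\<rceil>"]
      proof eventually_elim
        case (elim n)
        then have "t \<le> real n" by linarith
        then show ?case by (simp add: h_def)
      qed
      then show "(\<lambda>n. h n t) \<longlonglongrightarrow> 1" by (rule tendsto_eventually)
    qed
  qed (use hb hm in auto)
  \<comment> \<open>The mass lost to the cutoff is less than \<open>e / (2 * C)\<close>, which leads
    to an error \<open>e / 2\<close>; the polynomial approximation takes the other half.\<close>
  then have "\<forall>\<^sub>F n in sequentially. (\<integral>t. h n t \<partial>exp_law) > 1 - e / (2 * C)"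
    using e C by (intro order_tendstoD(1)) (auto simp: exp_law.prob_space)
  then obtain n where n: "(\<integral>t. h n t \<partial>exp_law) > 1 - e / (2 * C)"
    by (auto simp: eventually_sequentially)
  define \<delta> where "\<delta> = exp (- (real n + 1))"
  have \<delta>: "0 < \<delta>" "\<delta> \<le> 1" by (auto simp: \<delta>_def)
  \<comment> \<open>\<open>\<tau>\<close> inverts the passage from t to e^(-t) up to time
    \<open>n + 1\<close>. Below \<delta> it stays at \<open>n + 1\<close>, where the cutoff
    vanishes, so the logarithm is never taken at 0.\<close>
  define \<tau> where "\<tau> x = - ln (max x \<delta>)" for x
  define G where "G p = h n (\<tau> (fst p)) * f (\<tau> (fst p), state_of (snd p))" for p
  define S :: "(real \<times> ('d site \<Rightarrow> real)) set" where "S = {0..1} \<times> cube"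
  have \<tau>c: "continuous_on A \<tau>" for A
    unfolding \<tau>_def using \<delta> by (intro continuous_intros) auto
  have contG: "continuous_on S G"
  proof -
    have "continuous_map (top_of_set S) (top_of_set {0..}) (\<lambda>p. \<tau> (fst p))"
      unfolding continuous_map_in_subtopology
    proof
      show "continuous_map (top_of_set S) euclidean (\<lambda>p. \<tau> (fst p))"
        by (auto intro!: continuous_on_compose2[OF \<tau>c[of UNIV]] continuous_intros)
      have "\<tau> x \<ge> 0" if "x \<le> 1" for x
        using \<delta> that by (simp add: \<tau>_def)
      then show "(\<lambda>p. \<tau> (fst p)) \<in> topspace (top_of_set S) \<rightarrow> {0..}"
        by (auto simp: S_def)
    qed
    moreover have "continuous_map (top_of_set S) (L2_top \<beta>) (state_of \<circ> snd)"
    proof (rule continuous_map_compose[OF _ state_of_continuous])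
      show "continuous_map (top_of_set S) (top_of_set cube) snd"
        by (auto simp: continuous_map_in_subtopology S_def intro!: continuous_on_snd continuous_on_id)
    qed
    ultimately have "continuous_map (top_of_set S) ?X (\<lambda>p. (\<tau> (fst p), (state_of \<circ> snd) p))"
      by (rule continuous_map_pairedI)
    from continuous_map_compose[OF this f] have "continuous_on S (\<lambda>p. f (\<tau> (fst p), state_of (snd p)))"
      by (simp add: o_def)
    moreover have "continuous_on S (\<lambda>p. h n (\<tau> (fst p)))"
      unfolding h_def by (intro continuous_intros continuous_on_compose2[OF \<tau>c[of UNIV]]) auto
    ultimately show ?thesis unfolding G_def by (intro continuous_intros)
  qed
  have Geq: "G (exp (- t), fst (w t)) = h n t * f (t, w t)" if w: "w \<in> cube_paths \<beta>" and t: "t \<ge> 0" for w t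
  proof (cases "t \<le> real n + 1")
    case True
    then have "\<tau> (exp (- t)) = t" by (simp add: \<tau>_def \<delta>_def max_def)
    then show ?thesis using cube_path_fst[OF w t] by (simp add: G_def)
  next
    case False
    then have "\<tau> (exp (- t)) = real n + 1" by (simp add: \<tau>_def \<delta>_def max_def)
    then show ?thesis using False by (simp add: G_def h_def)
  qed
  have "\<exists>g\<in>monomial_algebra coord. \<forall>p\<in>S. \<bar>G p - g p\<bar> < e / 2"
  proof (rule monomial_algebra_dense[OF _ _ _ contG])
    show "compact S" unfolding S_def by (intro compact_Times compact_unit_cube compact_Icc)
    show "continuous_on S (coord i)" for i
    proof (cases i)
      case (Some k)
      have "continuous_on S (\<lambda>p. snd p k)"
        by (rule continuous_on_compose2[OF continuous_on_product_coordinates[of k]]) (auto intro: continuous_intros)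
      then show ?thesis using Some by (simp add: coord.simps[abs_def])
    qed (auto simp: coord.simps[abs_def] intro: continuous_intros)
    show "\<exists>i. coord i x \<noteq> coord i y" if "x \<noteq> y" for x y :: "real \<times> ('d site \<Rightarrow> real)"
    proof (rule ccontr)
      assume "\<not> (\<exists>i. coord i x \<noteq> coord i y)"
      then have "coord None x = coord None y" "\<And>k. coord (Some k) x = coord (Some k) y" by auto
      then show False using that by (auto simp: prod_eq_iff fun_eq_iff)
    qed
  qed (use e in auto)
  then obtain g where g: "g \<in> monomial_algebra coord" "\<And>p. p \<in> S \<Longrightarrow> \<bar>G p - g p\<bar> < e / 2" by blast
  from polynomial_functional[OF g(1)] obtain P where P: "continuous_on UNIV P"
    "\<And>w. w \<in> cube_paths \<beta> \<Longrightarrow> integrable exp_law (\<lambda>t. g (exp (- t), fst (w t)))"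
    "\<And>w. w \<in> cube_paths \<beta> \<Longrightarrow> (\<integral>t. g (exp (- t), fst (w t)) \<partial>exp_law) = P (\<lambda>l. occ l w)"
    by blast
  show ?thesis
  proof (intro exI[of _ P] conjI P(1) ballI)
    fix w assume w: "w \<in> cube_paths \<beta>"
    have top: "(t, w t) \<in> topspace ?X" if "t \<ge> 0" for t
      using that cube_path_fst[OF w that] state_of_in_L2 by (metis mem_Sigma_iff topspace_prod_topology topspace_L2_top
          topspace_euclidean_subtopology atLeast_iff)
    have fm: "(\<lambda>t. f (t, w t)) \<in> borel_measurable exp_law"
      using measurable_compose[OF path_graph_measurable[OF w] borel_of_measurable[OF f]] .
    have fC: "\<bar>f (t, w t)\<bar> \<le> C" if "t \<in> space exp_law" for t
      using that by (intro C(2) top) simp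
    then have fi: "integrable exp_law (\<lambda>t. f (t, w t))"
      using fm by (intro exp_law.integrable_const_bound[where B = C] AE_I2) simp_all
    have hfi: "integrable exp_law (\<lambda>t. h n t * f (t, w t))"
    proof (rule exp_law.integrable_const_bound[where B = C])
      show "AE t in exp_law. norm (h n t * f (t, w t)) \<le> C"
      proof (rule AE_I2)
        fix t assume "t \<in> space exp_law"
        then have "\<bar>f (t, w t)\<bar> \<le> C" by (rule fC)
        then have "h n t * \<bar>f (t, w t)\<bar> \<le> 1 * C" using hb by (intro mult_mono) auto
        then show "norm (h n t * f (t, w t)) \<le> C" using hb by (simp add: abs_mult)
      qed
    qed (intro borel_measurable_times hm fm)
    have "\<bar>(\<integral>t. f (t, w t) \<partial>exp_law) - (\<integral>t. h n t * f (t, w t) \<partial>exp_law)\<bar>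
        = \<bar>\<integral>t. f (t, w t) - h n t * f (t, w t) \<partial>exp_law\<bar>"
      by (simp add: fi hfi)
    also have "\<dots> \<le> (\<integral>t. C * (1 - h n t) \<partial>exp_law)"
    proof (rule order.trans[OF integral_abs_bound integral_mono])
      fix t assume "t \<in> space exp_law"
      then have "\<bar>f (t, w t)\<bar> \<le> C" by (rule fC)
      then have "(1 - h n t) * \<bar>f (t, w t)\<bar> \<le> (1 - h n t) * C" using hb by (intro mult_left_mono) auto
      moreover have "f (t, w t) - h n t * f (t, w t) = (1 - h n t) * f (t, w t)" by (simp add: algebra_simps)
      ultimately show "\<bar>f (t, w t) - h n t * f (t, w t)\<bar> \<le> C * (1 - h n t)"
        using hb by (simp add: abs_mult mult.commute)
    qed (intro integrable_abs Bochner_Integration.integrable_diff fi hfi integrable_mult_right hi exp_law.integrable_const)+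
    also have "\<dots> = C * (1 - (\<integral>t. h n t \<partial>exp_law))"
      by (simp add: hi exp_law.prob_space)
    also have "\<dots> \<le> C * (e / (2 * C))" using n C by (intro mult_left_mono) auto
    also have "\<dots> = e / 2" using C by simp
    finally have 1: "\<bar>(\<integral>t. f (t, w t) \<partial>exp_law) - (\<integral>t. h n t * f (t, w t) \<partial>exp_law)\<bar> \<le> e / 2" .
    have "\<bar>(\<integral>t. h n t * f (t, w t) \<partial>exp_law) - P (\<lambda>l. occ l w)\<bar>
        = \<bar>\<integral>t. h n t * f (t, w t) - g (exp (- t), fst (w t)) \<partial>exp_law\<bar>"
      by (simp add: hfi P(2)[OF w] P(3)[OF w, symmetric])
    also have "\<dots> \<le> (\<integral>t. e / 2 \<partial>exp_law)"
    proof (rule order.trans[OF integral_abs_bound integral_mono])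
      fix t assume "t \<in> space exp_law"
      then have t: "t \<ge> 0" by simp
      show "\<bar>h n t * f (t, w t) - g (exp (- t), fst (w t))\<bar> \<le> e / 2"
        using g(2)[of "(exp (- t), fst (w t))"] coord_bounds(1)[OF w t] Geq[OF w t] by (simp add: S_def)
    qed (intro integrable_abs Bochner_Integration.integrable_diff hfi P(2)[OF w] exp_law.integrable_const)+
    also have "\<dots> = e / 2" by (simp add: exp_law.prob_space)
    finally show "\<bar>(\<integral>t. f (t, w t) \<partial>exp_law) - P (\<lambda>l. occ l w)\<bar> \<le> e" using 1 by linarith
  qed
qed

text \<open>It is enough to treat the generating sets, where the integral of a bounded continuous
  function is uniformly close, on cube paths, to a continuous function of the occupation
  functionals. Finite intersections and unions preserve the property.\<close>

lemma meyer_zheng_open_trace: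
  assumes G: "openin (meyer_zheng (L2_top \<beta>)) G"
  shows "\<exists>V. open V \<and> (\<forall>w\<in>cube_paths \<beta>. w \<in> G \<longleftrightarrow> (\<lambda>l. occ l w) \<in> V)"
proof -
  let ?X = "prod_topology (top_of_set {0..}) (L2_top \<beta>)"
  let ?B = "{{\<mu>. prob_space \<mu> \<and> sets \<mu> = sets (borel_of ?X) \<and> (\<integral>x. f x \<partial>\<mu>) \<in> W} | f W.
       continuous_map ?X euclideanreal f \<and> bounded (f ` topspace ?X) \<and> open W}"
  from G obtain U where U: "openin (weak_topology ?X) U"
    "G = pseudo_path (L2_top \<beta>) -` U \<inter> cadlag_paths (L2_top \<beta>)"
    unfolding meyer_zheng_def openin_pullback_topology by blast
  have "generate_topology_on ?B U"
    using U(1) unfolding weak_topology_def by (simp add: openin_topology_generated_by_iff)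
  then have "\<exists>V. open V \<and> (\<forall>w\<in>cube_paths \<beta>. pseudo_path (L2_top \<beta>) w \<in> U \<longleftrightarrow> (\<lambda>l. occ l w) \<in> V)"
  proof induction
    case Empty
    show ?case by (intro exI[of _ "{}"]) auto
  next
    case (Int a b)
    from Int.IH(1) obtain V where V: "open V"
      "\<forall>w\<in>cube_paths \<beta>. pseudo_path (L2_top \<beta>) w \<in> a \<longleftrightarrow> (\<lambda>l. occ l w) \<in> V" by (elim exE conjE)
    from Int.IH(2) obtain W where W: "open W"
      "\<forall>w\<in>cube_paths \<beta>. pseudo_path (L2_top \<beta>) w \<in> b \<longleftrightarrow> (\<lambda>l. occ l w) \<in> W" by (elim exE conjE)
    show ?case by (intro exI[of _ "V \<inter> W"] conjI open_Int V(1) W(1)) (use V(2) W(2) in simp)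
  next
    case (UN K)
    have "\<forall>k\<in>K. \<exists>V. open V \<and> (\<forall>w\<in>cube_paths \<beta>. pseudo_path (L2_top \<beta>) w \<in> k \<longleftrightarrow> (\<lambda>l. occ l w) \<in> V)"
      by (intro ballI) (rule UN.IH)
    from bchoice[OF this] obtain V where V: "\<forall>k\<in>K. open (V k) \<and>
      (\<forall>w\<in>cube_paths \<beta>. pseudo_path (L2_top \<beta>) w \<in> k \<longleftrightarrow> (\<lambda>l. occ l w) \<in> V k)" by (elim exE)
    show ?case
      by (intro exI[of _ "\<Union>k\<in>K. V k"] conjI open_UN) (use V in simp_all)
  next
    case (Basis s)
    then obtain f W where s: "s = {\<mu>. prob_space \<mu> \<and> sets \<mu> = sets (borel_of ?X) \<and> (\<integral>x. f x \<partial>\<mu>) \<in> W}"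
      and f: "continuous_map ?X euclideanreal f" "bounded (f ` topspace ?X)" and W: "open W"
      by blast
    let ?I = "\<lambda>w. \<integral>t. f (t, w t) \<partial>exp_law"
    have mem: "pseudo_path (L2_top \<beta>) w \<in> s \<longleftrightarrow> ?I w \<in> W" if w: "w \<in> cube_paths \<beta>" for w
      using prob_space_pseudo_path[OF w] integral_pseudo_path[OF w f(1)]
      by (simp add: s pseudo_path_def)
    have "\<exists>V. open V \<and> (\<lambda>l. occ l w) \<in> V \<and> (\<forall>w'\<in>cube_paths \<beta>. (\<lambda>l. occ l w') \<in> V \<longrightarrow> ?I w' \<in> W)"
      if w: "w \<in> cube_paths \<beta>" "?I w \<in> W" for w
    proof -
      obtain e where e: "e > 0" "\<And>y. \<bar>y - ?I w\<bar> < e \<Longrightarrow> y \<in> W"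
        using W w(2) by (auto simp: open_dist dist_real_def)
      \<comment> \<open>Three errors of at most \<open>e / 4\<close>: two from the approximation, at
        \<open>w\<close> and at \<open>w'\<close>, and one from the size of the
        neighbourhood.\<close>
      obtain P where P: "continuous_on UNIV P" "\<forall>w\<in>cube_paths \<beta>. \<bar>?I w - P (\<lambda>l. occ l w)\<bar> \<le> e / 4"
        using functional_approx[OF f, of "e / 4"] e(1) by auto
      let ?V = "P -` {P (\<lambda>l. occ l w) - e / 4<..<P (\<lambda>l. occ l w) + e / 4}"
      have "open ?V" by (intro open_vimage P(1)) auto
      moreover have "?I w' \<in> W" if "w' \<in> cube_paths \<beta>" "(\<lambda>l. occ l w') \<in> ?V" for w'
      proof (rule e(2))
        have "\<bar>?I w' - P (\<lambda>l. occ l w')\<bar> \<le> e / 4" "\<bar>?I w - P (\<lambda>l. occ l w)\<bar> \<le> e / 4"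
          using P(2) that w by blast+
        moreover have "\<bar>P (\<lambda>l. occ l w') - P (\<lambda>l. occ l w)\<bar> < e / 4"
          unfolding abs_less_iff using that by auto
        ultimately show "\<bar>?I w' - ?I w\<bar> < e" using e(1) by linarith
      qed
      ultimately show ?thesis using e(1) by (intro exI[of _ ?V]) auto
    qed
    then have "\<forall>w\<in>{w\<in>cube_paths \<beta>. ?I w \<in> W}. \<exists>V. open V \<and> (\<lambda>l. occ l w) \<in> V \<and>
        (\<forall>w'\<in>cube_paths \<beta>. (\<lambda>l. occ l w') \<in> V \<longrightarrow> ?I w' \<in> W)" by simp
    from bchoice[OF this] obtain V where V: "\<forall>w\<in>{w\<in>cube_paths \<beta>. ?I w \<in> W}. open (V w) \<and>
        (\<lambda>l. occ l w) \<in> V w \<and> (\<forall>w'\<in>cube_paths \<beta>. (\<lambda>l. occ l w') \<in> V w \<longrightarrow> ?I w' \<in> W)"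
      by (elim exE)
    note V1 = bspec[OF V, THEN conjunct1] and V2 = bspec[OF V, THEN conjunct2, THEN conjunct1]
      and V3 = bspec[OF V, THEN conjunct2, THEN conjunct2, THEN bspec, THEN mp]
    show ?case
    proof (intro exI[of _ "\<Union>w\<in>{w\<in>cube_paths \<beta>. ?I w \<in> W}. V w"] conjI ballI)
      show "open (\<Union>w\<in>{w\<in>cube_paths \<beta>. ?I w \<in> W}. V w)" by (intro open_UN ballI V1)
      fix w assume w: "w \<in> cube_paths \<beta>"
      show "pseudo_path (L2_top \<beta>) w \<in> s \<longleftrightarrow> (\<lambda>l. occ l w) \<in> (\<Union>w\<in>{w\<in>cube_paths \<beta>. ?I w \<in> W}. V w)"
        unfolding mem[OF w]
      proof
        assume "?I w \<in> W"
        then have "w \<in> {w\<in>cube_paths \<beta>. ?I w \<in> W}" using w by simp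
        then show "(\<lambda>l. occ l w) \<in> (\<Union>w\<in>{w\<in>cube_paths \<beta>. ?I w \<in> W}. V w)"
          by (intro UN_I[where a = w] V2)
      next
        assume "(\<lambda>l. occ l w) \<in> (\<Union>w\<in>{w\<in>cube_paths \<beta>. ?I w \<in> W}. V w)"
        then obtain w' where "w' \<in> {w\<in>cube_paths \<beta>. ?I w \<in> W}" "(\<lambda>l. occ l w) \<in> V w'" by (elim UN_E)
        then show "?I w \<in> W" by (intro V3[OF _ w])
      qed
    qed
  qed
  then obtain V where V: "open V" "\<forall>w\<in>cube_paths \<beta>. pseudo_path (L2_top \<beta>) w \<in> U \<longleftrightarrow> (\<lambda>l. occ l w) \<in> V"
    by (elim exE conjE)
  have "w \<in> G \<longleftrightarrow> pseudo_path (L2_top \<beta>) w \<in> U" if "w \<in> cube_paths \<beta>" for w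
    using that U(2) by (simp add: cube_paths_def cadlag_paths_def)
  with V show ?thesis by (intro exI[of _ V]) simp
qed

text \<open>\<open>Z\<close> is the random path, which lies in \<open>cube_paths\<close> only almost
  surely and carries no measurability of its own; \<open>W\<close> is a measurable version of its
  occupation functionals.\<close>

definition almost_surely_cube :: "'w measure \<Rightarrow> ('w \<Rightarrow> real \<Rightarrow> 'd state) \<Rightarrow> ('w \<Rightarrow> 'd site option list \<Rightarrow> real) \<Rightarrow> bool" where
  "almost_surely_cube M Z W \<longleftrightarrow> prob_space M \<and> W \<in> borel_measurable M \<and>
     (AE v in M. Z v \<in> cube_paths \<beta> \<and> W v = (\<lambda>l. occ l (Z v)))"

text \<open>Off a null set the preimage of an open set of paths is the preimage under
  \<open>W\<close> of an open set of sequences, which is measurable. What happens inside the null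
  set is absorbed by the completion.\<close>

lemma law_cube_paths:
  assumes ZW: "almost_surely_cube M Z W"
  defines "X \<equiv> meyer_zheng (L2_top \<beta>)"
  defines "Z' \<equiv> \<lambda>v. if Z v \<in> topspace X then Z v else (SOME x. x \<in> topspace X)"
  shows "Z' \<in> measurable (completion M) (borel_of X)"
    and "AE v in completion M. Z' v \<in> cube_paths \<beta> \<and> W v = (\<lambda>l. occ l (Z' v))"
proof -
  interpret prob_space M using ZW by (simp add: almost_surely_cube_def)
  have top: "cube_paths \<beta> \<subseteq> topspace X" unfolding X_def by (rule cube_paths_topspace)
  have AE: "AE v in M. Z' v \<in> cube_paths \<beta> \<and> W v = (\<lambda>l. occ l (Z' v))"
  proof -
    have "AE v in M. Z v \<in> cube_paths \<beta> \<and> W v = (\<lambda>l. occ l (Z v))"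
      using ZW by (simp add: almost_surely_cube_def)
    then show ?thesis by eventually_elim (use top in \<open>auto simp: Z'_def\<close>)
  qed
  then show "AE v in completion M. Z' v \<in> cube_paths \<beta> \<and> W v = (\<lambda>l. occ l (Z' v))"
    by (rule AE_completion)
  have "\<exists>v. Z' v \<in> cube_paths \<beta>"
  proof (rule ccontr)
    assume "\<not> ?thesis"
    with AE have "AE v in M. False" by simp
    then show False by (simp add: AE_False)
  qed
  then have ne: "\<exists>x. x \<in> topspace X" using top by blast
  from AE obtain N where
    "{v\<in>space M. \<not> (Z' v \<in> cube_paths \<beta> \<and> W v = (\<lambda>l. occ l (Z' v)))} \<subseteq> N"
    "emeasure M N = 0" "N \<in> sets M"
    by (rule AE_E)
  then have N: "N \<in> null_sets M"
    "{v\<in>space M. \<not> (Z' v \<in> cube_paths \<beta> \<and> W v = (\<lambda>l. occ l (Z' v)))} \<subseteq> N"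
    by (simp_all add: null_sets_def)
  show "Z' \<in> measurable (completion M) (borel_of X)"
    unfolding borel_of_def
  proof (rule measurable_measure_of)
    show "{U. openin X U} \<subseteq> Pow (topspace X)" by (intro subsetI PowI openin_subset) simp
    show "Z' \<in> space (completion M) \<rightarrow> topspace X"
      using someI_ex[OF ne] by (auto simp: Z'_def)
    fix G assume "G \<in> {U. openin X U}"
    then have "openin (meyer_zheng (L2_top \<beta>)) G" by (simp add: X_def)
    from meyer_zheng_open_trace[OF this] obtain V where V: "open V"
      "\<And>w. w \<in> cube_paths \<beta> \<Longrightarrow> w \<in> G \<longleftrightarrow> (\<lambda>l. occ l w) \<in> V" by blast
    have 1: "(W -` V \<inter> space M) - N \<in> sets M"
      using ZW V(1) N(1) by (auto simp: almost_surely_cube_def intro!: sets.Diff measurable_sets)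
    have 2: "Z' -` G \<inter> space M \<inter> N \<in> null_sets (completion M)"
      by (rule null_sets_completion_subset[OF _ null_sets_completionI[OF N(1)]]) simp
    have eq: "Z' -` G \<inter> space (completion M) = ((W -` V \<inter> space M) - N) \<union> (Z' -` G \<inter> space M \<inter> N)"
    proof (rule set_eqI)
      fix v
      show "v \<in> Z' -` G \<inter> space (completion M) \<longleftrightarrow> v \<in> ((W -` V \<inter> space M) - N) \<union> (Z' -` G \<inter> space M \<inter> N)"
      proof (cases "v \<in> space M - N")
        case True
        have "v \<notin> {v\<in>space M. \<not> (Z' v \<in> cube_paths \<beta> \<and> W v = (\<lambda>l. occ l (Z' v)))}"
          using True subsetD[OF N(2), of v] by (elim DiffE) (rule notI, erule notE, assumption)
        then have Z1: "Z' v \<in> cube_paths \<beta>" and W1: "W v = (\<lambda>l. occ l (Z' v))" using True by simp_all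
        show ?thesis using True V(2)[OF Z1] by (simp add: W1)
      qed auto
    qed
    show "Z' -` G \<inter> space (completion M) \<in> sets (completion M)"
      unfolding eq using sets_completionI_sets[OF 1] null_setsD2[OF 2] by (rule sets.Un)
  qed
qed

lemma prob_space_law:
  assumes "almost_surely_cube M Z W"
  shows "prob_space (law (meyer_zheng (L2_top \<beta>)) M Z)"
proof -
  interpret prob_space M using assms by (simp add: almost_surely_cube_def)
  interpret c: prob_space "completion M"
    by (rule prob_spaceI) (simp add: emeasure_space_1)
  show ?thesis unfolding law_def by (rule c.prob_space_distr[OF law_cube_paths(1)[OF assms]])
qed

lemma integral_lipschitz_le_law:
  fixes f :: "(real \<Rightarrow> 'd state) \<Rightarrow> real"
  assumes ZW: "almost_surely_cube M Z W"
    and f: "continuous_map (meyer_zheng (L2_top \<beta>)) euclideanreal f"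
    and C: "\<And>w. w \<in> topspace (meyer_zheng (L2_top \<beta>)) \<Longrightarrow> \<bar>f w\<bar> \<le> C"
    and g: "g \<in> borel_measurable borel" "\<And>y. \<bar>g y\<bar> \<le> C'"
    and le: "\<And>w. w \<in> cube_paths \<beta> \<Longrightarrow> g (\<lambda>l. occ l w) \<le> f w"
  shows "(\<integral>v. g (W v) \<partial>M) \<le> (\<integral>w. f w \<partial>law (meyer_zheng (L2_top \<beta>)) M Z)"
proof -
  let ?X = "meyer_zheng (L2_top \<beta>)"
  interpret prob_space M using ZW by (simp add: almost_surely_cube_def)
  interpret c: prob_space "completion M"
    by (rule prob_spaceI) (simp add: emeasure_space_1)
  define Z' where "Z' v = (if Z v \<in> topspace ?X then Z v else (SOME x. x \<in> topspace ?X))" for v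
  note Z' = law_cube_paths[OF ZW, folded Z'_def]
  have fm: "f \<in> borel_measurable (borel_of ?X)" by (rule borel_of_measurable[OF f])
  have gW: "(\<lambda>v. g (W v)) \<in> borel_measurable M"
    using ZW g(1) by (auto simp: almost_surely_cube_def)
  have "(\<integral>v. g (W v) \<partial>M) = (\<integral>v. g (W v) \<partial>completion M)"
    by (rule integral_completion[symmetric, OF gW])
  also have "\<dots> \<le> (\<integral>v. f (Z' v) \<partial>completion M)"
  proof (rule integral_mono_AE)
    show "integrable (completion M) (\<lambda>v. g (W v))"
      using g(2) by (intro c.integrable_const_bound[where B = C'] measurable_completion gW) auto
    have "Z' v \<in> topspace ?X" if "v \<in> space (completion M)" for v
      using measurable_space[OF Z'(1) that] by simp
    then show "integrable (completion M) (\<lambda>v. f (Z' v))"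
      using C by (intro c.integrable_const_bound[where B = C] measurable_compose[OF Z'(1) fm]) auto
    show "AE v in completion M. g (W v) \<le> f (Z' v)"
      using Z'(2) by eventually_elim (auto intro: le)
  qed
  also have "\<dots> = (\<integral>w. f w \<partial>law ?X M Z)"
    unfolding law_def Z'_def[symmetric] by (rule integral_distr[symmetric, OF Z'(1) fm])
  finally show ?thesis .
qed

text \<open>The inf-convolutions \<open>g\<^sub>j\<close> below are Lipschitz functions of the occupation functionals that
  increase to \<open>f\<close> on cube paths.\<close>

lemma lower_approximation:
  fixes f :: "(real \<Rightarrow> 'd state) \<Rightarrow> real"
  assumes ZW: "almost_surely_cube M Z W"
    and f: "continuous_map (meyer_zheng (L2_top \<beta>)) euclideanreal f"
    and C: "\<And>w. w \<in> topspace (meyer_zheng (L2_top \<beta>)) \<Longrightarrow> \<bar>f w\<bar> \<le> C" and e: "e > 0"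
  shows "\<exists>g. continuous_on UNIV g \<and> (\<exists>C'. \<forall>y. \<bar>g y\<bar> \<le> C') \<and>
    (\<forall>w\<in>cube_paths \<beta>. g (\<lambda>l. occ l w) \<le> f w) \<and>
    (\<integral>w. f w \<partial>law (meyer_zheng (L2_top \<beta>)) M Z) - e \<le> (\<integral>v. g (W v) \<partial>M)"
proof -
  let ?X = "meyer_zheng (L2_top \<beta>)"
  let ?\<Phi> = "\<lambda>w l. occ l w"
  interpret prob_space M using ZW by (simp add: almost_surely_cube_def)
  interpret c: prob_space "completion M"
    by (rule prob_spaceI) (simp add: emeasure_space_1)
  define Z' where "Z' v = (if Z v \<in> topspace ?X then Z v else (SOME x. x \<in> topspace ?X))" for v
  note Z' = law_cube_paths[OF ZW, folded Z'_def]
  have fm: "f \<in> borel_measurable (borel_of ?X)" by (rule borel_of_measurable[OF f])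
  have Cc: "\<bar>f w\<bar> \<le> C" if "w \<in> cube_paths \<beta>" for w using that C cube_paths_topspace by blast
  have "\<exists>w. w \<in> cube_paths \<beta>"
  proof (rule ccontr)
    assume "\<not> ?thesis"
    with Z'(2) have "AE v in completion M. False" by simp
    then show False by (simp add: c.AE_False)
  qed
  then obtain w0 where w0: "w0 \<in> cube_paths \<beta>" by blast
  \<comment> \<open>\<open>dist\<close> is the metric of a countable product, since finite lists of
    sites form a countable set. The penalty forces near-minimizers to have occupation functionals
    close to \<open>y\<close>.\<close>
  define h where "h j y w = f w + real j * dist y (?\<Phi> w)" for j y w
  define g where "g j y = (INF w\<in>cube_paths \<beta>. h j y w)" for j y
  have h_lb: "- C \<le> h j y w" if "w \<in> cube_paths \<beta>" for j y w
  proof -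
    have "0 \<le> real j * dist y (?\<Phi> w)" by simp
    with Cc[OF that] show ?thesis unfolding h_def by linarith
  qed
  have bdd: "bdd_below (h j y ` cube_paths \<beta>)" for j y
    using h_lb by (intro bdd_belowI2) 
  have g_le: "g j y \<le> h j y w" if "w \<in> cube_paths \<beta>" for j y w
    unfolding g_def by (rule cINF_lower[OF bdd that])
  have g_ge: "a \<le> g j y" if "\<And>w. w \<in> cube_paths \<beta> \<Longrightarrow> a \<le> h j y w" for a j y
    unfolding g_def using w0 that by (intro cINF_greatest) auto
  have g_lb: "- C \<le> g j y" for j y by (intro g_ge h_lb)
  have g_lip: "g j y \<le> g j z + real j * dist y z" for j y z
  proof -
    have "g j y - real j * dist y z \<le> g j z"
    proof (rule g_ge)
      fix w assume w: "w \<in> cube_paths \<beta>"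
      have "real j * dist y (?\<Phi> w) \<le> real j * (dist y z + dist z (?\<Phi> w))"
        by (intro mult_left_mono dist_triangle) auto
      then show "g j y - real j * dist y z \<le> h j z w"
        using g_le[OF w, of j y] by (simp add: h_def algebra_simps)
    qed
    then show ?thesis by simp
  qed
  have g_cont: "continuous_on UNIV (g j)" for j
  proof (rule continuous_onI)
    fix y :: "'d site option list \<Rightarrow> real" and e :: real assume e: "e > 0"
    show "\<exists>d>0. \<forall>z\<in>UNIV. dist z y < d \<longrightarrow> dist (g j z) (g j y) \<le> e"
    proof (intro exI[of _ "e / (real j + 1)"] conjI ballI impI)
      fix z assume "dist z y < e / (real j + 1)"
      then have "(real j + 1) * dist z y < e" by (simp add: less_divide_eq mult.commute)
      moreover have "real j * dist z y \<le> (real j + 1) * dist z y" by (intro mult_right_mono) auto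
      ultimately show "dist (g j z) (g j y) \<le> e"
        using g_lip[of j z y] g_lip[of j y z] by (simp add: dist_real_def abs_le_iff dist_commute)
    qed (use e in auto)
  qed
  \<comment> \<open>Away from the image of the cube paths the infimum may be large. Truncation at
    the bound of \<open>f\<close> makes it bounded and changes nothing on the image, where the
    infimum is at most \<open>f\<close>.\<close>
  define gb where "gb j y = min C (g j y)" for j y
  have C0: "0 \<le> C" using Cc[OF w0] by linarith
  have gb_b: "\<bar>gb j y\<bar> \<le> C" for j y
    using g_lb[of j y] C0 by (auto simp: gb_def abs_le_iff min_def)
  have gb_c: "continuous_on UNIV (gb j)" for j
    unfolding gb_def by (intro continuous_intros g_cont)
  have gb_m: "gb j \<in> borel_measurable borel" for j
    by (rule borel_measurable_continuous_onI[OF gb_c])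
  have gb_le: "gb j (?\<Phi> w) \<le> f w" if "w \<in> cube_paths \<beta>" for j w
    using g_le[OF that, of j "?\<Phi> w"] by (simp add: gb_def h_def min_def)
  have gb_lim: "(\<lambda>j. gb j (?\<Phi> w)) \<longlonglongrightarrow> f w" if w: "w \<in> cube_paths \<beta>" for w
  proof (rule LIMSEQ_I)
    fix r :: real assume r: "0 < r"
    have "openin ?X {x \<in> topspace ?X. f x \<in> {f w - r / 2<..}}"
      using f open_greaterThan[of "f w - r / 2"] by (auto simp: continuous_map_def simp del: greaterThan_iff)
    from meyer_zheng_open_trace[OF this] obtain V where V: "open V"
      "\<And>w'. w' \<in> cube_paths \<beta> \<Longrightarrow> w' \<in> {x \<in> topspace ?X. f x \<in> {f w - r / 2<..}} \<longleftrightarrow> ?\<Phi> w' \<in> V" by blast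
    have "?\<Phi> w \<in> V" using V(2)[OF w] w r cube_paths_topspace by auto
    then obtain d where d: "d > 0" "\<And>y. dist y (?\<Phi> w) < d \<Longrightarrow> y \<in> V"
      using V(1) by (auto simp: open_dist)
    \<comment> \<open>Beyond distance \<open>d\<close> the penalty exceeds \<open>2 * C\<close>, the
      largest possible oscillation of \<open>f\<close>, so only paths with occupation functionals in
      \<open>V\<close> compete.\<close>
    obtain N where N: "real N > 2 * C / d" using reals_Archimedean2 by blast
    show "\<exists>no. \<forall>j\<ge>no. norm (gb j (?\<Phi> w) - f w) < r"
    proof (intro exI[of _ N] allI impI)
      fix j assume j: "j \<ge> N"
      have "f w - r / 2 \<le> g j (?\<Phi> w)"
      proof (rule g_ge)
        fix w' assume w': "w' \<in> cube_paths \<beta>"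
        show "f w - r / 2 \<le> h j (?\<Phi> w) w'"
        proof (cases "dist (?\<Phi> w') (?\<Phi> w) < d")
          case True
          then have "f w - r / 2 < f w'" using d(2) V(2)[OF w'] by auto
          moreover have "0 \<le> real j * dist (?\<Phi> w) (?\<Phi> w')" by simp
          ultimately show ?thesis unfolding h_def by linarith
        next
          case False
          have "2 * C \<le> real N * d" using N d(1) by (simp add: divide_less_eq)
          also have "\<dots> \<le> real j * dist (?\<Phi> w) (?\<Phi> w')"
            using j d(1) False by (intro mult_mono) (auto simp: dist_commute)
          finally show ?thesis using Cc[OF w] Cc[OF w'] r by (auto simp: h_def abs_le_iff)
        qed
      qed
      then have "f w - r / 2 \<le> gb j (?\<Phi> w)" using Cc[OF w] r by (auto simp: gb_def)
      then show "norm (gb j (?\<Phi> w) - f w) < r" using gb_le[OF w, of j] r by simp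
    qed
  qed
  have gbW: "(\<lambda>v. gb j (W v)) \<in> borel_measurable M" for j
    using ZW gb_m by (auto simp: almost_surely_cube_def)
  have "(\<lambda>j. \<integral>v. gb j (W v) \<partial>completion M) \<longlonglongrightarrow> (\<integral>v. f (Z' v) \<partial>completion M)"
  proof (rule integral_dominated_convergence[where w = "\<lambda>_. C"])
    show "(\<lambda>v. f (Z' v)) \<in> borel_measurable (completion M)" by (rule measurable_compose[OF Z'(1) fm])
    show "AE v in completion M. (\<lambda>j. gb j (W v)) \<longlonglongrightarrow> f (Z' v)"
      using Z'(2) by eventually_elim (auto intro: gb_lim)
  qed (use gb_b gbW in \<open>auto intro: measurable_completion\<close>)
  moreover have "(\<integral>v. f (Z' v) \<partial>completion M) = (\<integral>w. f w \<partial>law ?X M Z)"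
    unfolding law_def Z'_def[symmetric] by (rule integral_distr[symmetric, OF Z'(1) fm])
  moreover have "(\<integral>v. gb j (W v) \<partial>completion M) = (\<integral>v. gb j (W v) \<partial>M)" for j
    by (rule integral_completion[OF gbW])
  ultimately have "(\<lambda>j. \<integral>v. gb j (W v) \<partial>M) \<longlonglongrightarrow> (\<integral>w. f w \<partial>law ?X M Z)" by simp
  then have "\<forall>\<^sub>F j in sequentially. (\<integral>w. f w \<partial>law ?X M Z) - e < (\<integral>v. gb j (W v) \<partial>M)"
    using e by (intro order_tendstoD(1)) auto
  then obtain j where "(\<integral>w. f w \<partial>law ?X M Z) - e < (\<integral>v. gb j (W v) \<partial>M)"
    by (auto simp: eventually_sequentially)
  then show ?thesis
    using gb_c gb_b gb_le by (intro exI[of _ "gb j"]) auto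
qed

text \<open>The method of moments on a compact cube: a continuous function is uniformly approximated
  there by polynomials, whose expectations are combinations of the moments assumed to
  converge.\<close>

lemma moments_imp_continuous:
  fixes M :: "nat \<Rightarrow> 'w measure" and Q :: "'q measure" and g :: "('d site option list \<Rightarrow> real) \<Rightarrow> real"
  assumes ZW: "\<And>n. almost_surely_cube (M n) (Z n) (W n)" and Z\<^sub>0: "almost_surely_cube Q Z\<^sub>0 W\<^sub>0"
    and moments: "\<And>ls. (\<lambda>n. \<integral>v. (\<Prod>l\<leftarrow>ls. W n v l) \<partial>M n) \<longlonglongrightarrow> (\<integral>v. (\<Prod>l\<leftarrow>ls. W\<^sub>0 v l) \<partial>Q)"
    and g: "continuous_on UNIV g" and gb: "\<And>y. \<bar>g y\<bar> \<le> C"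
  shows "(\<lambda>n. \<integral>v. g (W n v) \<partial>M n) \<longlonglongrightarrow> (\<integral>v. g (W\<^sub>0 v) \<partial>Q)"
proof -
  let ?\<pi> = "\<lambda>l (y :: 'd site option list \<Rightarrow> real). y l"
  have cube: "AE v in N. W' v \<in> cube" if "almost_surely_cube N Z' W'" for N :: "'v measure" and Z' W'
  proof -
    have "AE v in N. Z' v \<in> cube_paths \<beta> \<and> W' v = (\<lambda>l. occ l (Z' v))"
      using that by (simp add: almost_surely_cube_def)
    then show ?thesis by eventually_elim (use occ_bounds in \<open>auto simp: Pi_iff\<close>)
  qed
  have meas: "(\<lambda>v. q (W' v)) \<in> borel_measurable N" if "almost_surely_cube N Z' W'" "q \<in> monomial_algebra ?\<pi>"
    for N :: "'v measure" and Z' W' q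
    using that(2)
  proof induction
    case (monomial l)
    have "W' \<in> borel_measurable N" using that(1) by (simp add: almost_surely_cube_def)
    then have "(\<lambda>v. W' v i) \<in> borel_measurable N" for i by (rule measurable_product_then_coordinatewise)
    then show ?case by (induction l) auto
  qed auto
  have int: "integrable N (\<lambda>v. q (W' v))" if "almost_surely_cube N Z' W'" "q \<in> monomial_algebra ?\<pi>"
    for N :: "'v measure" and Z' W' q
    using that(2)
  proof induction
    case (monomial l)
    interpret prob_space N using that by (simp add: almost_surely_cube_def)
    show ?case
    proof (rule integrable_const_bound[where B = 1])
      show "AE v in N. norm (\<Prod>i\<leftarrow>l. W' v i) \<le> 1"
        using cube[OF that(1)]
      proof eventually_elim
        case (elim v)
        then have "(\<Prod>i\<leftarrow>l. W' v i) \<in> {0..1}" by (intro prod_list_unit) auto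
        then show ?case by simp
      qed
      show "(\<lambda>v. \<Prod>i\<leftarrow>l. W' v i) \<in> borel_measurable N"
        using meas[OF that(1) monomial_algebra.monomial] .
    qed
  qed auto
  have poly: "(\<lambda>n. \<integral>v. q (W n v) \<partial>M n) \<longlonglongrightarrow> (\<integral>v. q (W\<^sub>0 v) \<partial>Q)" if "q \<in> monomial_algebra ?\<pi>" for q
    using that
  proof induction
    case (monomial l)
    then show ?case by (rule moments)
  next
    case (add f g)
    then show ?case
      by (simp add: int[OF ZW] int[OF Z\<^sub>0] tendsto_add)
  next
    case (scale f c)
    then show ?case by (simp add: tendsto_mult_left)
  qed
  have close: "\<bar>(\<integral>v. g (W' v) \<partial>N) - (\<integral>v. q (W' v) \<partial>N)\<bar> \<le> e"
    if "almost_surely_cube N Z' W'" "q \<in> monomial_algebra ?\<pi>" "\<And>y. y \<in> cube \<Longrightarrow> \<bar>g y - q y\<bar> < e"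
    for N :: "'v measure" and Z' W' q e
  proof -
    interpret prob_space N using that by (simp add: almost_surely_cube_def)
    have gW: "(\<lambda>v. g (W' v)) \<in> borel_measurable N"
      using that borel_measurable_continuous_onI[OF g] by (auto simp: almost_surely_cube_def)
    have gi: "integrable N (\<lambda>v. g (W' v))"
      using gb gW by (intro integrable_const_bound[where B = C]) auto
    have "\<bar>(\<integral>v. g (W' v) \<partial>N) - (\<integral>v. q (W' v) \<partial>N)\<bar> = \<bar>\<integral>v. g (W' v) - q (W' v) \<partial>N\<bar>"
      using gi int[OF that(1,2)] by simp
    also have "\<dots> \<le> (\<integral>v. e \<partial>N)"
    proof (rule order.trans[OF integral_abs_bound integral_mono_AE])
      show "AE v in N. \<bar>g (W' v) - q (W' v)\<bar> \<le> e"
        using cube[OF that(1)] by eventually_elim (auto intro: less_imp_le[OF that(3)])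
    qed (use gi int[OF that(1,2)] in auto)
    finally show ?thesis by (simp add: prob_space)
  qed
  show ?thesis
  proof (rule LIMSEQ_I)
    fix r :: real assume r: "0 < r"
    have "\<exists>q\<in>monomial_algebra ?\<pi>. \<forall>y\<in>cube. \<bar>g y - q y\<bar> < r / 4"
      using r by (intro monomial_algebra_dense compact_unit_cube continuous_on_subset[OF g]
          continuous_on_subset[OF continuous_on_product_coordinates]) (auto simp: fun_eq_iff)
    then obtain q where q: "q \<in> monomial_algebra ?\<pi>" "\<And>y. y \<in> cube \<Longrightarrow> \<bar>g y - q y\<bar> < r / 4" by blast
    obtain no where no: "\<And>n. n \<ge> no \<Longrightarrow> \<bar>(\<integral>v. q (W n v) \<partial>M n) - (\<integral>v. q (W\<^sub>0 v) \<partial>Q)\<bar> < r / 4"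
      using LIMSEQ_D[OF poly[OF q(1)], of "r / 4"] r by auto
    show "\<exists>no. \<forall>n\<ge>no. norm ((\<integral>v. g (W n v) \<partial>M n) - (\<integral>v. g (W\<^sub>0 v) \<partial>Q)) < r"
    proof (intro exI[of _ no] allI impI)
      fix n assume "n \<ge> no"
      from no[OF this] close[OF ZW[of n] q] close[OF Z\<^sub>0 q]
      show "norm ((\<integral>v. g (W n v) \<partial>M n) - (\<integral>v. g (W\<^sub>0 v) \<partial>Q)) < r"
        unfolding real_norm_def by linarith
    qed
  qed
qed

text \<open>The approximation from below yields only lower bounds for limits of integrals; applied
  to \<open>f\<close> and to \<open>- f\<close> they give convergence for every bounded continuous
  \<open>f\<close>. The weak topology is generated by such integrals.\<close>

theorem law_convergence:
  fixes M :: "nat \<Rightarrow> 'w measure" and Q :: "'q measure"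
  assumes ZW: "\<And>n. almost_surely_cube (M n) (Z n) (W n)" and Z\<^sub>0: "almost_surely_cube Q Z\<^sub>0 W\<^sub>0"
    and moments: "\<And>ls. (\<lambda>n. \<integral>v. (\<Prod>l\<leftarrow>ls. W n v l) \<partial>M n) \<longlonglongrightarrow> (\<integral>v. (\<Prod>l\<leftarrow>ls. W\<^sub>0 v l) \<partial>Q)"
  shows "limitin (weak_topology (meyer_zheng (L2_top \<beta>)))
    (\<lambda>n. law (meyer_zheng (L2_top \<beta>)) (M n) (Z n)) (law (meyer_zheng (L2_top \<beta>)) Q Z\<^sub>0) sequentially"
proof -
  let ?X = "meyer_zheng (L2_top \<beta>)"
  let ?L = "\<lambda>n. law ?X (M n) (Z n)" and ?Lim = "law ?X Q Z\<^sub>0"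
  let ?B = "{{\<mu>. prob_space \<mu> \<and> sets \<mu> = sets (borel_of ?X) \<and> (\<integral>x. f x \<partial>\<mu>) \<in> W} | f W.
       continuous_map ?X euclideanreal f \<and> bounded (f ` topspace ?X) \<and> open W}"
  have lower: "\<forall>\<^sub>F n in sequentially. (\<integral>x. f x \<partial>?Lim) - e < (\<integral>x. f x \<partial>?L n)"
    if f: "continuous_map ?X euclideanreal f" and C: "\<And>w. w \<in> topspace ?X \<Longrightarrow> \<bar>f w\<bar> \<le> C" and e: "e > 0" for f C e
  proof -
    obtain g C' where g: "continuous_on UNIV g" "\<And>y. \<bar>g y\<bar> \<le> C'"
      "\<And>w. w \<in> cube_paths \<beta> \<Longrightarrow> g (\<lambda>l. occ l w) \<le> f w"
      "(\<integral>w. f w \<partial>?Lim) - e / 2 \<le> (\<integral>v. g (W\<^sub>0 v) \<partial>Q)"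
      using lower_approximation[OF Z\<^sub>0 f C, of "e / 2"] e by auto
    have "\<forall>\<^sub>F n in sequentially. (\<integral>v. g (W\<^sub>0 v) \<partial>Q) - e / 2 < (\<integral>v. g (W n v) \<partial>M n)"
      using e by (intro order_tendstoD(1)[OF moments_imp_continuous[OF ZW Z\<^sub>0 moments g(1,2)]]) auto
    then show ?thesis
    proof eventually_elim
      case (elim n)
      with integral_lipschitz_le_law[OF ZW[of n] f C borel_measurable_continuous_onI[OF g(1)] g(2,3)] g(4)
      show ?case by linarith
    qed
  qed
  have basic: "\<forall>\<^sub>F n in sequentially. ?L n \<in> b" if b: "b \<in> ?B" "?Lim \<in> b" for b
  proof -
    obtain f W where bf: "b = {\<mu>. prob_space \<mu> \<and> sets \<mu> = sets (borel_of ?X) \<and> (\<integral>x. f x \<partial>\<mu>) \<in> W}"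
      and f: "continuous_map ?X euclideanreal f" "bounded (f ` topspace ?X)" and W: "open W"
      using b(1) by blast
    obtain C where C: "\<And>w. w \<in> topspace ?X \<Longrightarrow> \<bar>f w\<bar> \<le> C"
      using f(2) unfolding bounded_iff by auto
    have "(\<integral>x. f x \<partial>?Lim) \<in> W" using b(2) bf by simp
    then obtain e where e: "e > 0" "\<And>y. \<bar>y - (\<integral>x. f x \<partial>?Lim)\<bar> < e \<Longrightarrow> y \<in> W"
      using W by (auto simp: open_dist dist_real_def)
    have neg: "continuous_map ?X euclideanreal (\<lambda>x. - f x)" by (intro continuous_intros f)
    have "\<forall>\<^sub>F n in sequentially. (\<integral>x. - f x \<partial>?Lim) - e < (\<integral>x. - f x \<partial>?L n)"
      using C by (intro lower[OF neg _ e(1)]) auto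
    moreover have "\<forall>\<^sub>F n in sequentially. (\<integral>x. f x \<partial>?Lim) - e < (\<integral>x. f x \<partial>?L n)"
      using C by (intro lower[OF f(1) _ e(1)]) auto
    ultimately show ?thesis
    proof eventually_elim
      case (elim n)
      then have "(\<integral>x. f x \<partial>?L n) \<in> W" by (intro e(2)) (simp add: abs_less_iff)
      then show ?case using prob_space_law[OF ZW] by (simp add: bf law_def)
    qed
  qed
  have "\<forall>\<^sub>F n in sequentially. ?L n \<in> U" if "generate_topology_on ?B U" "?Lim \<in> U" for U
    using that
  proof induction
    case (Int a b)
    then show ?case by (auto intro: eventually_conj)
  next
    case (UN K)
    then obtain k where "k \<in> K" "?Lim \<in> k" by blast
    with UN.IH[OF this] show ?case by (auto elim!: eventually_mono)
  next
    case (Basis s)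
    then show ?case by (rule basic)
  qed simp
  moreover have "?Lim \<in> topspace (weak_topology ?X)"
    unfolding weak_topology_def topology_generated_by_topspace
    by (rule UnionI[of "{\<mu>. prob_space \<mu> \<and> sets \<mu> = sets (borel_of ?X) \<and> (\<integral>x. 0 \<partial>\<mu>) \<in> UNIV}"])
      (use prob_space_law[OF Z\<^sub>0] in \<open>auto intro!: exI[of _ "\<lambda>_. 0"] exI[of _ UNIV] boundedI[of _ 0] simp: law_def\<close>)
  ultimately show ?thesis
    by (simp add: limitin_def weak_topology_def openin_topology_generated_by_iff)
qed

end

section \<open>Brownian increments\<close>

context prob_space
begin

lemma AE_bound_nonneg: "AE w in M. \<bar>Z w\<bar> \<le> C \<Longrightarrow> 0 \<le> (C :: real)"
proof -
  assume "AE w in M. \<bar>Z w\<bar> \<le> C"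
  then have "AE w in M. 0 \<le> C" by eventually_elim linarith
  then show ?thesis by simp
qed

lemma integrable_bounded_mult:
  fixes Z Y :: "'a \<Rightarrow> real"
  assumes "integrable M Y" "Z \<in> borel_measurable M" "AE w in M. \<bar>Z w\<bar> \<le> C"
  shows "integrable M (\<lambda>w. Z w * Y w)"
proof (rule Bochner_Integration.integrable_bound)
  show "integrable M (\<lambda>w. C * \<bar>Y w\<bar>)" using assms by auto
  show "(\<lambda>w. Z w * Y w) \<in> borel_measurable M" using assms by auto
  show "AE w in M. norm (Z w * Y w) \<le> norm (C * \<bar>Y w\<bar>)"
    using assms(3)
  proof eventually_elim
    case (elim w)
    then have "\<bar>Z w\<bar> * \<bar>Y w\<bar> \<le> C * \<bar>Y w\<bar>" by (intro mult_right_mono) auto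
    also have "C * \<bar>Y w\<bar> \<le> \<bar>C\<bar> * \<bar>Y w\<bar>" by (intro mult_right_mono) auto
    finally show ?case by (simp add: abs_mult)
  qed
qed

lemma integrable_mult_square:
  fixes X Y :: "'a \<Rightarrow> real"
  assumes "integrable M (\<lambda>w. X w ^ 2)" "integrable M (\<lambda>w. Y w ^ 2)"
    "X \<in> borel_measurable M" "Y \<in> borel_measurable M"
  shows "integrable M (\<lambda>w. X w * Y w)"
proof (rule Bochner_Integration.integrable_bound)
  show "integrable M (\<lambda>w. X w ^ 2 + Y w ^ 2)" using assms by auto
  show "AE w in M. norm (X w * Y w) \<le> norm (X w ^ 2 + Y w ^ 2)"
  proof (rule AE_I2)
    fix w
    have "2 * \<bar>X w * Y w\<bar> \<le> X w ^ 2 + Y w ^ 2"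
      using sum_squares_bound[of "\<bar>X w\<bar>" "\<bar>Y w\<bar>"] by (simp add: abs_mult)
    moreover have "0 \<le> \<bar>X w * Y w\<bar>" by simp
    ultimately show "norm (X w * Y w) \<le> norm (X w ^ 2 + Y w ^ 2)" unfolding real_norm_def by linarith
  qed
qed (use assms in auto)

lemma abs_expectation_le_sqrt:
  fixes X :: "'a \<Rightarrow> real"
  assumes "X \<in> borel_measurable M" "integrable M (\<lambda>w. X w ^ 2)"
  shows "integrable M X" "expectation (\<lambda>w. \<bar>X w\<bar>) \<le> sqrt (expectation (\<lambda>w. X w ^ 2))"
proof -
  show i: "integrable M X"
    using integrable_mult_square[of "\<lambda>_. 1" X] assms by simp
  have "0 \<le> variance (\<lambda>w. \<bar>X w\<bar>)" by simp
  also have "\<dots> = expectation (\<lambda>w. X w ^ 2) - (expectation (\<lambda>w. \<bar>X w\<bar>))\<^sup>2"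
    using i assms by (subst variance_eq) auto
  finally show "expectation (\<lambda>w. \<bar>X w\<bar>) \<le> sqrt (expectation (\<lambda>w. X w ^ 2))"
    by (intro real_le_rsqrt) simp
qed

lemma gaussian_moments:
  assumes g: "gaussian M X" and mean: "expectation X = 0"
  shows "integrable M (\<lambda>w. X w ^ n)" "expectation (\<lambda>w. X w ^ 3) = 0"
    and "expectation (\<lambda>w. X w ^ 4) = 3 * (expectation (\<lambda>w. X w ^ 2))\<^sup>2"
proof -
  have [measurable]: "X \<in> borel_measurable M" using g by (simp add: gaussian_def)
  from g obtain m where "(AE w in M. X w = m) \<or> (\<exists>\<sigma>>0. distributed M lborel X (normal_density m \<sigma>))"
    by (auto simp: gaussian_def)
  then have "integrable M (\<lambda>w. X w ^ n) \<and> expectation (\<lambda>w. X w ^ 3) = 0 \<and>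
      expectation (\<lambda>w. X w ^ 4) = 3 * (expectation (\<lambda>w. X w ^ 2))\<^sup>2"
  proof
    assume ae: "AE w in M. X w = m"
    have "expectation X = expectation (\<lambda>_. m)" by (rule integral_cong_AE) (use ae in auto)
    then have "m = 0" using mean by (simp add: prob_space)
    have "expectation (\<lambda>w. X w ^ k) = expectation (\<lambda>_. m ^ k)" for k
      by (rule integral_cong_AE) (use ae in auto)
    moreover have "integrable M (\<lambda>w. X w ^ n)"
      by (rule integrable_cong_AE[THEN iffD2, of _ _ "\<lambda>_. m ^ n"]) (use ae in auto)
    ultimately show ?thesis using \<open>m = 0\<close> by simp
  next
    assume "\<exists>\<sigma>>0. distributed M lborel X (normal_density m \<sigma>)"
    then obtain \<sigma> where \<sigma>: "\<sigma> > 0" and D: "distributed M lborel X (normal_density m \<sigma>)" by blast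
    have "m = 0" using normal_distributed_expectation[OF \<sigma> D] mean by simp
    then have D: "distributed M lborel X (normal_density 0 \<sigma>)" using D by simp
    have e: "expectation (\<lambda>w. X w ^ k) = (\<integral>x. normal_density 0 \<sigma> x * (x - 0) ^ k \<partial>lborel)" for k
      using distributed_integral[OF D, of "\<lambda>x. x ^ k"] by simp
    have "integrable M (\<lambda>w. X w ^ n)"
      using distributed_integrable[OF D, of "\<lambda>x. x ^ n"] integrable_normal_moment[OF \<sigma>, of 0 n] by simp
    moreover have "expectation (\<lambda>w. X w ^ 3) = 0"
      using e[of 3] integral_normal_moment_odd[OF \<sigma>, of 0 1] by (simp add: numeral_3_eq_3)
    moreover have "expectation (\<lambda>w. X w ^ 2) = \<sigma>\<^sup>2"
    proof -
      have "expectation (\<lambda>w. X w ^ 2) = fact 2 / ((2 / \<sigma>\<^sup>2) ^ 1 * fact 1)"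
        using e[of 2] integral_normal_moment_even[OF \<sigma>, of 0 1] by simp
      then show ?thesis using \<sigma> by (simp add: field_simps)
    qed
    moreover have "expectation (\<lambda>w. X w ^ 4) = 3 * (\<sigma>\<^sup>2)\<^sup>2"
    proof -
      have "expectation (\<lambda>w. X w ^ 4) = fact 4 / ((2 / \<sigma>\<^sup>2) ^ 2 * fact 2)"
        using e[of 4] integral_normal_moment_even[OF \<sigma>, of 0 2] by simp
      then show ?thesis using \<sigma> by (simp add: field_simps fact_numeral)
    qed
    ultimately show ?thesis by simp
  qed
  then show "integrable M (\<lambda>w. X w ^ n)" "expectation (\<lambda>w. X w ^ 3) = 0"
    "expectation (\<lambda>w. X w ^ 4) = 3 * (expectation (\<lambda>w. X w ^ 2))\<^sup>2" by auto
qed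

text \<open>For jointly Gaussian centred variables, being uncorrelated already makes the squares uncorrelated:
  compare the fourth moments of \<open>S + T\<close> and \<open>S - T\<close>.\<close>

lemma gaussian_uncorrelated_squares:
  assumes g: "gaussian M S" "gaussian M T" "gaussian M (\<lambda>w. S w + T w)" "gaussian M (\<lambda>w. S w - T w)"
    and mean: "expectation S = 0" "expectation T = 0" and un: "expectation (\<lambda>w. S w * T w) = 0"
  shows "integrable M (\<lambda>w. (S w)\<^sup>2 * (T w)\<^sup>2)"
    and "expectation (\<lambda>w. (S w)\<^sup>2 * (T w)\<^sup>2) = expectation (\<lambda>w. (S w)\<^sup>2) * expectation (\<lambda>w. (T w)\<^sup>2)"
proof -
  have [measurable]: "S \<in> borel_measurable M" "T \<in> borel_measurable M" using g by (simp_all add: gaussian_def)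
  note S = gaussian_moments[OF g(1) mean(1)] and T = gaussian_moments[OF g(2) mean(2)]
  have i1: "integrable M S" "integrable M T" using S(1)[of 1] T(1)[of 1] by auto
  note i2 = S(1)[of 2] T(1)[of 2] integrable_mult_square[OF S(1)[of 2] T(1)[of 2]]
  have mpm: "expectation (\<lambda>w. S w + T w) = 0" "expectation (\<lambda>w. S w - T w) = 0"
    using i1 mean by simp_all
  note P = gaussian_moments[OF g(3) mpm(1)] and N = gaussian_moments[OF g(4) mpm(2)]
  have p2: "expectation (\<lambda>w. (S w + T w)\<^sup>2) = expectation (\<lambda>w. (S w)\<^sup>2) + expectation (\<lambda>w. (T w)\<^sup>2)"
    using i2 un by (simp add: power2_sum mult.assoc)
  have n2: "expectation (\<lambda>w. (S w - T w)\<^sup>2) = expectation (\<lambda>w. (S w)\<^sup>2) + expectation (\<lambda>w. (T w)\<^sup>2)"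
    using i2 un by (simp add: power2_diff mult.assoc)
  have id: "(S w)\<^sup>2 * (T w)\<^sup>2 = ((S w + T w) ^ 4 + (S w - T w) ^ 4 - 2 * S w ^ 4 - 2 * T w ^ 4) / 12" for w
    by (simp add: field_simps power4_eq_xxxx power2_eq_square)
  show "integrable M (\<lambda>w. (S w)\<^sup>2 * (T w)\<^sup>2)"
    unfolding id using P(1)[of 4] N(1)[of 4] S(1)[of 4] T(1)[of 4] by auto
  have "expectation (\<lambda>w. (S w)\<^sup>2 * (T w)\<^sup>2) = (expectation (\<lambda>w. (S w + T w) ^ 4)
      + expectation (\<lambda>w. (S w - T w) ^ 4) - 2 * expectation (\<lambda>w. S w ^ 4) - 2 * expectation (\<lambda>w. T w ^ 4)) / 12"
    unfolding id using P(1)[of 4] N(1)[of 4] S(1)[of 4] T(1)[of 4] by simp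
  also have "\<dots> = expectation (\<lambda>w. (S w)\<^sup>2) * expectation (\<lambda>w. (T w)\<^sup>2)"
    unfolding P(3) N(3) S(3) T(3) p2 n2 by (simp add: field_simps power2_eq_square)
  finally show "expectation (\<lambda>w. (S w)\<^sup>2 * (T w)\<^sup>2) = expectation (\<lambda>w. (S w)\<^sup>2) * expectation (\<lambda>w. (T w)\<^sup>2)" .
qed

end

text \<open>The linear span of the family. Joint Gaussianity makes each of its members Gaussian, so
  sums and differences of increments of several Brownian motions are covered at once.\<close>

definition lincomb :: "('i \<Rightarrow> 'w \<Rightarrow> real) \<Rightarrow> 'i set \<Rightarrow> ('w \<Rightarrow> real) set" where
  "lincomb X I = {\<lambda>w. \<Sum>i\<in>J. c i * X i w | J c. finite J \<and> J \<subseteq> I}"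

lemma lincomb_base: "i \<in> I \<Longrightarrow> X i \<in> lincomb X I"
  unfolding lincomb_def by (intro CollectI exI[of _ "{i}"] exI[of _ "\<lambda>_. 1"]) auto

lemma lincomb_scaled_add:
  assumes "S \<in> lincomb X I" "T \<in> lincomb X I"
  shows "(\<lambda>w. S w + a * T w) \<in> lincomb X I"
proof -
  from assms obtain J c K d where S: "S = (\<lambda>w. \<Sum>i\<in>J. c i * X i w)" "finite J" "J \<subseteq> I"
    and T: "T = (\<lambda>w. \<Sum>i\<in>K. d i * X i w)" "finite K" "K \<subseteq> I"
    unfolding lincomb_def by blast
  have "S w + a * T w = (\<Sum>i\<in>J \<union> K. ((if i \<in> J then c i else 0) + a * (if i \<in> K then d i else 0)) * X i w)" for w
  proof -
    have "S w = (\<Sum>i\<in>J \<union> K. (if i \<in> J then c i else 0) * X i w)"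
      unfolding S(1) using S(2) T(2) by (intro sum.mono_neutral_cong_left) auto
    moreover have "T w = (\<Sum>i\<in>J \<union> K. (if i \<in> K then d i else 0) * X i w)"
      unfolding T(1) using S(2) T(2) by (intro sum.mono_neutral_cong_left) auto
    ultimately show ?thesis
      by (simp add: sum.distrib[symmetric] sum_distrib_left algebra_simps)
  qed
  then show ?thesis
    unfolding lincomb_def using S T
    by (intro CollectI exI[of _ "J \<union> K"] exI[of _ "\<lambda>i. (if i \<in> J then c i else 0) + a * (if i \<in> K then d i else 0)"])
      (auto simp: fun_eq_iff)
qed

lemma lincomb_add: "S \<in> lincomb X I \<Longrightarrow> T \<in> lincomb X I \<Longrightarrow> (\<lambda>w. S w + T w) \<in> lincomb X I"
  using lincomb_scaled_add[of S X I T 1] by simp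

lemma lincomb_diff: "S \<in> lincomb X I \<Longrightarrow> T \<in> lincomb X I \<Longrightarrow> (\<lambda>w. S w - T w) \<in> lincomb X I"
  using lincomb_scaled_add[of S X I T "-1"] by simp

lemma jointly_gaussian_lincomb: "jointly_gaussian M X I \<Longrightarrow> S \<in> lincomb X I \<Longrightarrow> gaussian M S"
  by (auto simp: jointly_gaussian_def lincomb_def)

section \<open>Brownian increments relative to a filtration\<close>

locale filtered_space =
  fixes M :: "'w measure" and F :: "real \<Rightarrow> 'w measure"
  assumes filtered: "filtered_prob_space M F"

sublocale filtered_space \<subseteq> prob_space M
  using filtered by (simp add: filtered_prob_space_def)

context filtered_space
begin

lemma adapted_measurable: "f \<in> borel_measurable (F t) \<Longrightarrow> f \<in> borel_measurable M"
  using filtered by (auto simp: filtered_prob_space_def intro: measurable_from_subalg)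

lemma space_F: "space (F t) = space M"
  using filtered by (auto simp: filtered_prob_space_def subalgebra_def)

lemma adapted_mono: "f \<in> borel_measurable (F s) \<Longrightarrow> s \<le> t \<Longrightarrow> f \<in> borel_measurable (F t)"
proof -
  assume f: "f \<in> borel_measurable (F s)" and st: "s \<le> t"
  have "sets (F s) \<subseteq> sets (F t)"
    using filtered st by (auto simp: filtered_prob_space_def filtration_def)
  then have "subalgebra (F t) (F s)" by (simp add: subalgebra_def space_F)
  then show ?thesis using f by (rule measurable_from_subalg)
qed

lemma brownian_adapted: "brownian_motion M F B \<Longrightarrow> 0 \<le> t \<Longrightarrow> B t \<in> borel_measurable (F t)"
  by (simp add: brownian_motion_def)

lemma brownian_measurable: "brownian_motion M F B \<Longrightarrow> 0 \<le> t \<Longrightarrow> B t \<in> borel_measurable M"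
  using brownian_adapted adapted_measurable by blast

lemma increment_gaussian:
  assumes B: "brownian_motion M F B" and ab: "0 \<le> a" "a \<le> b"
  defines "D \<equiv> \<lambda>w. B b w - B a w"
  shows "gaussian M D" "expectation D = 0" "expectation (\<lambda>w. (D w)\<^sup>2) = b - a"
proof -
  have [measurable]: "B a \<in> borel_measurable M" "B b \<in> borel_measurable M"
    using brownian_measurable[OF B] ab by auto
  have "gaussian M D \<and> expectation D = 0 \<and> expectation (\<lambda>w. (D w)\<^sup>2) = b - a"
  proof (cases "a = b")
    case True
    then have "D = (\<lambda>_. 0)" by (simp add: D_def)
    then show ?thesis using True by (auto simp: gaussian_def)
  next
    case False
    then have s: "0 < sqrt (b - a)" and D: "distributed M lborel D (normal_density 0 (sqrt (b - a)))"
      using B ab by (auto simp: brownian_motion_def D_def)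
    have "gaussian M D"
      unfolding gaussian_def
    proof
      show "D \<in> borel_measurable M" by (simp add: D_def)
      have "\<exists>\<sigma>>0. distributed M lborel D (normal_density 0 \<sigma>)" using s D by blast
      then show "\<exists>m. (AE w in M. D w = m) \<or> (\<exists>\<sigma>>0. distributed M lborel D (normal_density m \<sigma>))"
        by blast
    qed
    moreover have "expectation D = 0" by (rule normal_distributed_expectation[OF s D])
    moreover have "variance D = (sqrt (b - a))\<^sup>2" by (rule normal_distributed_variance[OF s D])
    ultimately show ?thesis using ab by simp
  qed
  then show "gaussian M D" "expectation D = 0" "expectation (\<lambda>w. (D w)\<^sup>2) = b - a" by auto
qed

lemma increment_moments:
  assumes B: "brownian_motion M F B" and ab: "0 \<le> a" "a \<le> b"
  defines "D \<equiv> \<lambda>w. B b w - B a w"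
  shows "integrable M (\<lambda>w. D w ^ n)" "expectation (\<lambda>w. D w ^ 3) = 0"
    and "expectation (\<lambda>w. D w ^ 4) = 3 * (b - a)\<^sup>2"
  using gaussian_moments[OF increment_gaussian(1,2)[OF B ab]] increment_gaussian(3)[OF B ab]
  by (simp_all add: D_def)

lemma increment_independent:
  assumes B: "brownian_motion M F B" and ab: "0 \<le> a" "a \<le> b"
    and W: "W \<in> borel_measurable (F a)" "integrable M W"
  defines "D \<equiv> \<lambda>w. B b w - B a w"
  shows "integrable M (\<lambda>w. W w * D w ^ n)"
    and "expectation (\<lambda>w. W w * D w ^ n) = expectation W * expectation (\<lambda>w. D w ^ n)"
proof -
  have Dm [measurable]: "D \<in> borel_measurable M"
    unfolding D_def using brownian_measurable[OF B] ab by (intro borel_measurable_diff) auto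
  have Wm: "W \<in> borel_measurable M" using W(1) by (rule adapted_measurable)
  have "integrable M (\<lambda>w. W w * D w ^ n) \<and>
    expectation (\<lambda>w. W w * D w ^ n) = expectation W * expectation (\<lambda>w. D w ^ n)"
  \<comment> \<open>Independence is postulated only for increments over nondegenerate intervals;
    over a point the increment is 0.\<close>
  proof (cases "a = b")
    case True
    then have "D = (\<lambda>_. 0)" by (simp add: D_def)
    then show ?thesis using W(2) by (cases n) (auto simp: prob_space)
  next
    case False
    then have ind: "indep_set (sets (F a)) (sets (vimage_algebra (space M) D borel))"
      using B ab by (auto simp: brownian_motion_def D_def)
    have "indep_var borel W borel D"
      unfolding indep_var_eq
    proof (intro conjI Wm Dm)
      show "indep_set (sigma_sets (space M) {W -` A \<inter> space M |A. A \<in> sets borel})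
          (sigma_sets (space M) {D -` A \<inter> space M |A. A \<in> sets borel})"
      proof (rule indep_setI)
        have s1: "sigma_sets (space M) {W -` A \<inter> space M |A. A \<in> sets borel} \<subseteq> sets (F a)"
          unfolding space_F[of a, symmetric] using W(1)
          by (intro sets.sigma_sets_subset) (auto intro: measurable_sets)
        have s2: "sigma_sets (space M) {D -` A \<inter> space M |A. A \<in> sets borel}
            \<subseteq> sets (vimage_algebra (space M) D borel)"
          by (simp add: sets_vimage_algebra)
        show "sigma_sets (space M) {W -` A \<inter> space M |A. A \<in> sets borel} \<subseteq> events"
          using s1 indep_setD_ev1[OF ind] by blast
        show "sigma_sets (space M) {D -` A \<inter> space M |A. A \<in> sets borel} \<subseteq> events"
          using s2 indep_setD_ev2[OF ind] by blast
        show "prob (x \<inter> y) = prob x * prob y"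
          if "x \<in> sigma_sets (space M) {W -` A \<inter> space M |A. A \<in> sets borel}"
            "y \<in> sigma_sets (space M) {D -` A \<inter> space M |A. A \<in> sets borel}" for x y
          using indep_setD[OF ind, of x y] s1 s2 that by blast
      qed
    qed
    then have iv: "indep_var borel (\<lambda>w. W w) borel (\<lambda>w. D w ^ n)"
      using indep_var_compose[of borel W borel D "\<lambda>x. x" borel "\<lambda>x. x ^ n" borel] by (simp add: o_def)
    have Di: "integrable M (\<lambda>w. D w ^ n)"
      using increment_moments(1)[OF B ab] by (simp add: D_def)
    show ?thesis
      using indep_var_integrable[OF iv W(2) Di] indep_var_lebesgue_integral[OF iv W(2) Di] by simp
  qed
  then show "integrable M (\<lambda>w. W w * D w ^ n)"
    and "expectation (\<lambda>w. W w * D w ^ n) = expectation W * expectation (\<lambda>w. D w ^ n)" by auto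
qed

lemma increment_centred:
  assumes B: "brownian_motion M F B" and ab: "0 \<le> a" "a \<le> b"
    and W: "W \<in> borel_measurable (F a)" "integrable M W"
  shows "integrable M (\<lambda>w. W w * (B b w - B a w))" "expectation (\<lambda>w. W w * (B b w - B a w)) = 0"
  using increment_independent[OF assms, of 1] increment_gaussian(2)[OF B ab] by simp_all

lemma brownian_square_integrable:
  assumes B: "brownian_motion M F B" and t: "0 \<le> t"
  shows "integrable M (\<lambda>w. (B t w)\<^sup>2)" "integrable M (B t)"
proof -
  have m: "B t \<in> borel_measurable M" "B 0 \<in> borel_measurable M"
    using brownian_measurable[OF B] t by auto
  have ae: "AE w in M. B 0 w = 0" using B by (simp add: brownian_motion_def)
  have "AE w in M. (B t w)\<^sup>2 = (B t w - B 0 w) ^ 2" using ae by eventually_elim simp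
  then show *: "integrable M (\<lambda>w. (B t w)\<^sup>2)"
    using increment_moments(1)[OF B order_refl t, of 2] m by (subst integrable_cong_AE) auto
  show "integrable M (B t)" by (rule abs_expectation_le_sqrt(1)[OF m(1) *])
qed

text \<open>Neither increment is assumed independent of \<open>F\<^sub>a\<close> jointly with the other one, so the conditional
  covariance is computed through the bracket: refining the interval, \<open>\<Sum> \<Delta>\<^sub>iB \<Delta>\<^sub>iB'\<close> tends to \<open>0\<close> in
  \<open>L\<^sup>2\<close> by joint Gaussianity alone.\<close>

definition orthogonal_increments :: "(real \<Rightarrow> 'w \<Rightarrow> real) \<Rightarrow> (real \<Rightarrow> 'w \<Rightarrow> real) \<Rightarrow> bool" where
  "orthogonal_increments B B' \<longleftrightarrow> (\<forall>a b W C. 0 \<le> a \<and> a \<le> b \<and> W \<in> borel_measurable (F a) \<and> (AE w in M. \<bar>W w\<bar> \<le> C) \<longrightarrow>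
     expectation (\<lambda>w. W w * ((B b w - B a w) * (B' b w - B' a w))) = 0)"

lemma increments_product_integrable:
  assumes B: "brownian_motion M F B" and B': "brownian_motion M F B'" and ab: "0 \<le> a" "a \<le> b" "0 \<le> c" "c \<le> d"
  shows "integrable M (\<lambda>w. (B b w - B a w) * (B' d w - B' c w))"
  using increment_moments(1)[OF B ab(1,2), of 2] increment_moments(1)[OF B' ab(3,4), of 2]
    brownian_measurable[OF B] brownian_measurable[OF B'] ab
  by (intro integrable_mult_square) auto

text \<open>The terms that pair a value at \<open>a\<close> with a later increment vanish by
  centring, and what remains is a difference of covariances at \<open>b\<close> and at
  \<open>a\<close>.\<close>

lemma increments_uncorrelated:
  assumes B: "brownian_motion M F B" and B': "brownian_motion M F B'"
    and cov: "\<And>t. 0 \<le> t \<Longrightarrow> expectation (\<lambda>w. B t w * B' t w) = 0" and ab: "0 \<le> a" "a \<le> b"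
  shows "expectation (\<lambda>w. (B b w - B a w) * (B' b w - B' a w)) = 0"
proof -
  have b0: "0 \<le> b" using ab by simp
  note c1 = increment_centred[OF B ab brownian_adapted[OF B' ab(1)] brownian_square_integrable(2)[OF B' ab(1)]]
  note c2 = increment_centred[OF B' ab brownian_adapted[OF B ab(1)] brownian_square_integrable(2)[OF B ab(1)]]
  have i: "integrable M (\<lambda>w. B t w * B' t w)" if "0 \<le> t" for t
    using brownian_square_integrable(1)[OF B that] brownian_square_integrable(1)[OF B' that]
      brownian_measurable[OF B that] brownian_measurable[OF B' that] by (intro integrable_mult_square)
  have "(\<lambda>w. (B b w - B a w) * (B' b w - B' a w)) = (\<lambda>w. B b w * B' b w - B a w * B' a w
      - B' a w * (B b w - B a w) - B a w * (B' b w - B' a w))"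
    by (simp add: fun_eq_iff algebra_simps)
  then show ?thesis
    using i[OF ab(1)] i[OF b0] c1 c2 cov[OF ab(1)] cov[OF b0] by simp
qed

text \<open>The weight and the earlier increment are known at time \<open>c\<close>, where the later
  increment is still centred.\<close>

lemma disjoint_increments_centred:
  assumes B: "brownian_motion M F B" and B': "brownian_motion M F B'"
    and ab: "0 \<le> a" "a \<le> b" "b \<le> c" "c \<le> d" and W: "W \<in> borel_measurable (F b)" "AE w in M. \<bar>W w\<bar> \<le> C"
  shows "integrable M (\<lambda>w. W w * ((B b w - B a w) * (B' d w - B' c w)))"
    and "expectation (\<lambda>w. W w * ((B b w - B a w) * (B' d w - B' c w))) = 0"
proof -
  have V: "(\<lambda>w. W w * (B b w - B a w)) \<in> borel_measurable (F c)"
    using adapted_mono[OF W(1) ab(3)] adapted_mono[OF brownian_adapted[OF B, of b], of c]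
      adapted_mono[OF brownian_adapted[OF B, of a], of c] ab by (intro borel_measurable_times borel_measurable_diff) auto
  have Vi: "integrable M (\<lambda>w. W w * (B b w - B a w))"
    using increment_moments(1)[OF B ab(1,2), of 1] adapted_measurable[OF W(1)] W(2)
    by (intro integrable_bounded_mult) auto
  have c: "0 \<le> c" using ab by simp
  show "integrable M (\<lambda>w. W w * ((B b w - B a w) * (B' d w - B' c w)))"
    "expectation (\<lambda>w. W w * ((B b w - B a w) * (B' d w - B' c w))) = 0"
    using increment_centred[OF B' c ab(4) V Vi] by (simp_all add: mult.assoc)
qed

text \<open>The products are differences of squares of the combinations \<open>D + x * D'\<close>
  and \<open>E + y * E'\<close> with signs \<open>x\<close> and \<open>y\<close>. These combinations
  are Gaussian and uncorrelated, so their squares are uncorrelated; and since \<open>D\<close> and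
  \<open>D'\<close> are uncorrelated, the variance of the first combination does not depend on the
  sign.\<close>

lemma product_increments_orthogonal:
  assumes B: "brownian_motion M F B" and B': "brownian_motion M F B'"
    and jg: "jointly_gaussian M X I" and lc: "\<And>t. 0 \<le> t \<Longrightarrow> B t \<in> lincomb X I" "\<And>t. 0 \<le> t \<Longrightarrow> B' t \<in> lincomb X I"
    and cov: "\<And>t. 0 \<le> t \<Longrightarrow> expectation (\<lambda>w. B t w * B' t w) = 0" and ab: "0 \<le> a" "a \<le> b" "b \<le> c" "c \<le> d"
  defines "D \<equiv> \<lambda>w. B b w - B a w" and "D' \<equiv> \<lambda>w. B' b w - B' a w"
    and "E \<equiv> \<lambda>w. B d w - B c w" and "E' \<equiv> \<lambda>w. B' d w - B' c w"
  shows "integrable M (\<lambda>w. (D w * D' w) * (E w * E' w))"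
    and "expectation (\<lambda>w. (D w * D' w) * (E w * E' w)) = 0"
proof -
  have c0: "0 \<le> c" "0 \<le> b" "0 \<le> d" using ab by auto
  have lin: "D \<in> lincomb X I" "D' \<in> lincomb X I" "E \<in> lincomb X I" "E' \<in> lincomb X I"
    unfolding D_def D'_def E_def E'_def using ab c0 by (auto intro!: lincomb_diff lc)
  have mean: "expectation D = 0" "expectation D' = 0" "expectation E = 0" "expectation E' = 0"
    unfolding D_def D'_def E_def E'_def
    using increment_gaussian(2)[OF B ab(1,2)] increment_gaussian(2)[OF B' ab(1,2)]
      increment_gaussian(2)[OF B c0(1) ab(4)] increment_gaussian(2)[OF B' c0(1) ab(4)] by simp_all
  have int1: "integrable M D" "integrable M D'" "integrable M E" "integrable M E'"
    unfolding D_def D'_def E_def E'_def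
    using increment_moments(1)[OF B ab(1,2), of 1] increment_moments(1)[OF B' ab(1,2), of 1]
      increment_moments(1)[OF B c0(1) ab(4), of 1] increment_moments(1)[OF B' c0(1) ab(4), of 1] by simp_all
  have int2: "integrable M (\<lambda>w. (D w)\<^sup>2)" "integrable M (\<lambda>w. (D' w)\<^sup>2)" "integrable M (\<lambda>w. (E w)\<^sup>2)" "integrable M (\<lambda>w. (E' w)\<^sup>2)"
    unfolding D_def D'_def E_def E'_def
    using increment_moments(1)[OF B ab(1,2), of 2] increment_moments(1)[OF B' ab(1,2), of 2]
      increment_moments(1)[OF B c0(1) ab(4), of 2] increment_moments(1)[OF B' c0(1) ab(4), of 2] by simp_all
  have DD: "integrable M (\<lambda>w. D w * D' w)" "expectation (\<lambda>w. D w * D' w) = 0"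
    unfolding D_def D'_def using increments_product_integrable[OF B B' ab(1,2) ab(1,2)] increments_uncorrelated[OF B B' cov ab(1,2)] by simp_all
  have one: "(\<lambda>_. 1) \<in> borel_measurable (F b)" "AE w in M. \<bar>1::real\<bar> \<le> 1" by auto
  have cross: "integrable M (\<lambda>w. D w * E w)" "expectation (\<lambda>w. D w * E w) = 0"
    "integrable M (\<lambda>w. D w * E' w)" "expectation (\<lambda>w. D w * E' w) = 0"
    "integrable M (\<lambda>w. D' w * E w)" "expectation (\<lambda>w. D' w * E w) = 0"
    "integrable M (\<lambda>w. D' w * E' w)" "expectation (\<lambda>w. D' w * E' w) = 0"
    unfolding D_def D'_def E_def E'_def
    using disjoint_increments_centred[OF B B ab one] disjoint_increments_centred[OF B B' ab one]
      disjoint_increments_centred[OF B' B ab one] disjoint_increments_centred[OF B' B' ab one] by simp_all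
  let ?S = "\<lambda>x w. D w + x * D' w" and ?T = "\<lambda>y w. E w + y * E' w"
  have unc: "integrable M (\<lambda>w. (?S x w)\<^sup>2 * (?T y w)\<^sup>2) \<and>
      expectation (\<lambda>w. (?S x w)\<^sup>2 * (?T y w)\<^sup>2) = expectation (\<lambda>w. (?S x w)\<^sup>2) * expectation (\<lambda>w. (?T y w)\<^sup>2)" for x y
  proof -
    have l: "?S x \<in> lincomb X I" "?T y \<in> lincomb X I"
      using lin by (auto intro!: lincomb_scaled_add)
    have g: "gaussian M (?S x)" "gaussian M (?T y)" "gaussian M (\<lambda>w. ?S x w + ?T y w)" "gaussian M (\<lambda>w. ?S x w - ?T y w)"
      using l by (auto intro!: jointly_gaussian_lincomb[OF jg] intro: lincomb_add lincomb_diff)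
    have m: "expectation (?S x) = 0" "expectation (?T y) = 0" using mean int1 by simp_all
    have "(\<lambda>w. ?S x w * ?T y w) = (\<lambda>w. D w * E w + y * (D w * E' w) + x * (D' w * E w) + x * y * (D' w * E' w))"
      by (simp add: fun_eq_iff algebra_simps)
    then have "expectation (\<lambda>w. ?S x w * ?T y w) = 0" using cross by simp
    from gaussian_uncorrelated_squares[OF g m this] show ?thesis by simp
  qed
  have vS: "expectation (\<lambda>w. (?S x w)\<^sup>2) = expectation (\<lambda>w. (D w)\<^sup>2) + x\<^sup>2 * expectation (\<lambda>w. (D' w)\<^sup>2)" for x
  proof -
    have "(\<lambda>w. (?S x w)\<^sup>2) = (\<lambda>w. (D w)\<^sup>2 + x\<^sup>2 * (D' w)\<^sup>2 + 2 * x * (D w * D' w))"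
      by (simp add: fun_eq_iff power2_eq_square algebra_simps)
    then show ?thesis using int2 DD by simp
  qed
  \<comment> \<open>Polarization in both pairs: four times \<open>D * D'\<close> is a difference of
    two squares, and likewise for \<open>E * E'\<close>, whence the factor 16.\<close>
  have id: "(D w * D' w) * (E w * E' w) = ((?S 1 w)\<^sup>2 * (?T 1 w)\<^sup>2 - (?S 1 w)\<^sup>2 * (?T (-1) w)\<^sup>2
      - (?S (-1) w)\<^sup>2 * (?T 1 w)\<^sup>2 + (?S (-1) w)\<^sup>2 * (?T (-1) w)\<^sup>2) / 16" for w
    by (simp add: power2_eq_square algebra_simps)
  show "integrable M (\<lambda>w. (D w * D' w) * (E w * E' w))"
    unfolding id using unc[of 1 1] unc[of 1 "-1"] unc[of "-1" 1] unc[of "-1" "-1"] 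
    by (intro integrable_divide_zero Bochner_Integration.integrable_add Bochner_Integration.integrable_diff) auto
  have "expectation (\<lambda>w. (D w * D' w) * (E w * E' w)) =
      (expectation (\<lambda>w. (?S 1 w)\<^sup>2 * (?T 1 w)\<^sup>2) - expectation (\<lambda>w. (?S 1 w)\<^sup>2 * (?T (-1) w)\<^sup>2)
      - expectation (\<lambda>w. (?S (-1) w)\<^sup>2 * (?T 1 w)\<^sup>2) + expectation (\<lambda>w. (?S (-1) w)\<^sup>2 * (?T (-1) w)\<^sup>2)) / 16"
    unfolding id integral_divide_zero
    using unc[of 1 1] unc[of 1 "-1"] unc[of "-1" 1] unc[of "-1" "-1"]
    by (subst Bochner_Integration.integral_add Bochner_Integration.integral_diff; (intro Bochner_Integration.integrable_diff)?; simp)+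
  also have "\<dots> = 0"
    using unc[of 1 1] unc[of 1 "-1"] unc[of "-1" 1] unc[of "-1" "-1"]
      vS[of 1] vS[of "-1"] by simp
  finally show "expectation (\<lambda>w. (D w * D' w) * (E w * E' w)) = 0" .
qed

text \<open>After subdivision the weighted products over different pieces vanish, because the weight
  and the earlier increment are known when the later one starts. For the diagonal sum the weight is
  bounded by \<open>C\<close> and the terms are orthogonal, so the second moment is at most a
  constant times the number of pieces times the square of the mesh.\<close>

lemma orthogonal_incrementsI:
  assumes B: "brownian_motion M F B" and B': "brownian_motion M F B'"
    and jg: "jointly_gaussian M X I" and lc: "\<And>t. 0 \<le> t \<Longrightarrow> B t \<in> lincomb X I" "\<And>t. 0 \<le> t \<Longrightarrow> B' t \<in> lincomb X I"
    and cov: "\<And>t. 0 \<le> t \<Longrightarrow> expectation (\<lambda>w. B t w * B' t w) = 0"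
  shows "orthogonal_increments B B'"
  unfolding orthogonal_increments_def
proof (intro allI impI, elim conjE)
  fix a b C :: real and W :: "'w \<Rightarrow> real" assume ab: "0 \<le> a" "a \<le> b" and W: "W \<in> borel_measurable (F a)" "AE w in M. \<bar>W w\<bar> \<le> C"
  let ?e = "expectation (\<lambda>w. W w * ((B b w - B a w) * (B' b w - B' a w)))"
  have Wm: "W \<in> borel_measurable M" by (rule adapted_measurable[OF W(1)])
  have bound: "\<bar>?e\<bar> \<le> \<bar>C\<bar> * sqrt (3 * (b - a)\<^sup>2 / real (Suc N))" for N
  proof -
    define p where "p i = a + (b - a) * (real i / real (Suc N))" for i
    define \<delta> where "\<delta> = (b - a) / real (Suc N)"
    have pmono: "p i \<le> p j" if "i \<le> j" for i j
      unfolding p_def using ab that by (intro add_left_mono mult_left_mono divide_right_mono) auto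
    have p0: "p 0 = a" "p (Suc N) = b" by (simp_all add: p_def)
    have pge: "0 \<le> p i" for i using pmono[of 0 i] p0 ab by simp
    have pd: "p (Suc i) - p i = \<delta>" for i
      by (simp add: p_def \<delta>_def diff_divide_distrib[symmetric] algebra_simps)
    define D where "D i w = B (p (Suc i)) w - B (p i) w" for i w
    define D' where "D' i w = B' (p (Suc i)) w - B' (p i) w" for i w
    have Wp: "W \<in> borel_measurable (F (p i))" for i
      using pmono[of 0 i] p0 by (intro adapted_mono[OF W(1)]) simp
    have tel: "B b w - B a w = (\<Sum>i<Suc N. D i w)" "B' b w - B' a w = (\<Sum>i<Suc N. D' i w)" for w
      unfolding D_def D'_def using sum_lessThan_telescope[of "\<lambda>i. B (p i) w" "Suc N"]
        sum_lessThan_telescope[of "\<lambda>i. B' (p i) w" "Suc N"] p0 by simp_all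
    have Dp: "integrable M (\<lambda>w. D i w * D' j w)" for i j
      unfolding D_def D'_def by (intro increments_product_integrable[OF B B'] pge pmono) auto
    have WDp: "integrable M (\<lambda>w. W w * (D i w * D' j w))" for i j
      by (rule integrable_bounded_mult[OF Dp Wm W(2)])
    have off: "expectation (\<lambda>w. W w * (D i w * D' j w)) = 0" if "i \<noteq> j" for i j
    proof (cases "i < j")
      case True
      then show ?thesis
        unfolding D_def D'_def using pge pmono
        by (intro disjoint_increments_centred(2)[OF B B' _ _ _ _ Wp W(2)]) auto
    next
      case False
      then have "expectation (\<lambda>w. W w * (D' j w * D i w)) = 0"
        unfolding D_def D'_def using pge pmono that
        by (intro disjoint_increments_centred(2)[OF B' B _ _ _ _ Wp W(2)]) auto
      then show ?thesis by (simp add: mult.commute)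
    qed
    have "?e = expectation (\<lambda>w. \<Sum>i<Suc N. \<Sum>j<Suc N. W w * (D i w * D' j w))"
      unfolding tel sum_product by (simp only: sum_distrib_left)
    also have "\<dots> = (\<Sum>i<Suc N. \<Sum>j<Suc N. expectation (\<lambda>w. W w * (D i w * D' j w)))"
      using WDp by (simp add: Bochner_Integration.integral_sum del: sum.lessThan_Suc)
    also have "\<dots> = (\<Sum>i<Suc N. expectation (\<lambda>w. W w * (D i w * D' i w)))"
    proof (intro sum.cong refl)
      fix i assume "i \<in> {..<Suc N}"
      then have "(\<Sum>j<Suc N. expectation (\<lambda>w. W w * (D i w * D' j w)))
          = (\<Sum>j\<in>{i}. expectation (\<lambda>w. W w * (D i w * D' j w)))"
        by (intro sum.mono_neutral_right) (auto intro: off)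
      then show "(\<Sum>j<Suc N. expectation (\<lambda>w. W w * (D i w * D' j w))) = expectation (\<lambda>w. W w * (D i w * D' i w))"
        by simp
    qed
    also have "\<dots> = expectation (\<lambda>w. W w * (\<Sum>i<Suc N. D i w * D' i w))"
      unfolding sum_distrib_left by (rule Bochner_Integration.integral_sum[symmetric]) (rule WDp)
    finally have e1: "?e = expectation (\<lambda>w. W w * (\<Sum>i<Suc N. D i w * D' i w))" .
    define S where "S w = (\<Sum>i<Suc N. D i w * D' i w)" for w
    have Si: "integrable M S" unfolding S_def using Dp by auto
    have Q: "integrable M (\<lambda>w. (D i w * D' i w) * (D j w * D' j w)) \<and>
        expectation (\<lambda>w. (D i w * D' i w) * (D j w * D' j w)) = 0" if "i < j" for i j
      unfolding D_def D'_def using pge pmono that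
      using product_increments_orthogonal[OF B B' jg lc cov, of "p i" "p (Suc i)" "p j" "p (Suc j)"] by auto
    \<comment> \<open>The constant 3 is the fourth moment of a standard normal variable; the product
      of the two squares is bounded by the mean of the fourth powers.\<close>
    have Qd: "integrable M (\<lambda>w. (D i w * D' i w) * (D i w * D' i w)) \<and>
        expectation (\<lambda>w. (D i w * D' i w) * (D i w * D' i w)) \<le> 3 * \<delta>\<^sup>2" for i
    proof -
      have le: "p i \<le> p (Suc i)" by (rule pmono) simp
      note m = increment_moments[OF B pge[of i] le, folded D_def, unfolded pd]
        and m' = increment_moments[OF B' pge[of i] le, folded D'_def, unfolded pd]
      have mm: "D i \<in> borel_measurable M" "D' i \<in> borel_measurable M"
        using m(1)[of 1] m'(1)[of 1] by auto
      have m2: "integrable M (\<lambda>w. ((D i w)\<^sup>2)\<^sup>2)" "integrable M (\<lambda>w. ((D' i w)\<^sup>2)\<^sup>2)"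
        using m(1)[of 4] m'(1)[of 4] by (simp_all flip: power_mult)
      have i: "integrable M (\<lambda>w. (D i w)\<^sup>2 * (D' i w)\<^sup>2)"
        using mm by (intro integrable_mult_square m2) auto
      have "expectation (\<lambda>w. (D i w)\<^sup>2 * (D' i w)\<^sup>2) \<le> expectation (\<lambda>w. (D i w ^ 4 + D' i w ^ 4) / 2)"
      proof (rule integral_mono[OF i])
        show "(D i w)\<^sup>2 * (D' i w)\<^sup>2 \<le> (D i w ^ 4 + D' i w ^ 4) / 2" for w
          using sum_squares_bound[of "(D i w)\<^sup>2" "(D' i w)\<^sup>2"] by (simp flip: power_mult)
      qed (use m(1)[of 4] m'(1)[of 4] in auto)
      also have "\<dots> = 3 * \<delta>\<^sup>2" using m(1)[of 4] m'(1)[of 4] m(3) m'(3) by simp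
      finally show ?thesis using i by (simp add: power2_eq_square ac_simps)
    qed
    have Qi: "integrable M (\<lambda>w. (D i w * D' i w) * (D j w * D' j w))" for i j
    proof (cases i j rule: linorder_cases)
      case greater
      then show ?thesis using Q[of j i] by (simp add: mult.commute)
    qed (use Q Qd in auto)
    have Q0: "expectation (\<lambda>w. (D i w * D' i w) * (D j w * D' j w)) = 0" if "i \<noteq> j" for i j
    proof (cases "i < j")
      case False
      then show ?thesis using Q[of j i] that by (simp add: mult.commute)
    qed (use Q in auto)
    have S2: "S w ^ 2 = (\<Sum>i<Suc N. \<Sum>j<Suc N. (D i w * D' i w) * (D j w * D' j w))" for w
      by (simp add: S_def power2_eq_square sum_product del: sum.lessThan_Suc)
    have S2i: "integrable M (\<lambda>w. S w ^ 2)" unfolding S2 using Qi by auto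
    have "expectation (\<lambda>w. S w ^ 2) = (\<Sum>i<Suc N. \<Sum>j<Suc N. expectation (\<lambda>w. (D i w * D' i w) * (D j w * D' j w)))"
      unfolding S2 using Qi by (simp add: Bochner_Integration.integral_sum del: sum.lessThan_Suc)
    also have "\<dots> = (\<Sum>i<Suc N. expectation (\<lambda>w. (D i w * D' i w) * (D i w * D' i w)))"
    proof (intro sum.cong refl)
      fix i assume "i \<in> {..<Suc N}"
      then have "(\<Sum>j<Suc N. expectation (\<lambda>w. (D i w * D' i w) * (D j w * D' j w)))
          = (\<Sum>j\<in>{i}. expectation (\<lambda>w. (D i w * D' i w) * (D j w * D' j w)))"
        by (intro sum.mono_neutral_right) (auto intro: Q0)
      then show "(\<Sum>j<Suc N. expectation (\<lambda>w. (D i w * D' i w) * (D j w * D' j w)))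
          = expectation (\<lambda>w. (D i w * D' i w) * (D i w * D' i w))" by simp
    qed
    also have "\<dots> \<le> (\<Sum>i<Suc N. 3 * \<delta>\<^sup>2)" using Qd by (intro sum_mono) auto
    also have "\<dots> = 3 * (b - a)\<^sup>2 / real (Suc N)"
      unfolding sum_constant card_lessThan \<delta>_def power_divide power2_eq_square[of "real (Suc N)"]
      by (simp del: of_nat_Suc)
    finally have ES2: "expectation (\<lambda>w. S w ^ 2) \<le> 3 * (b - a)\<^sup>2 / real (Suc N)" .
    have "\<bar>?e\<bar> = \<bar>expectation (\<lambda>w. W w * S w)\<bar>" using e1 by (simp add: S_def)
    also have "\<dots> \<le> expectation (\<lambda>w. \<bar>C\<bar> * \<bar>S w\<bar>)"
    proof (rule order.trans[OF integral_abs_bound integral_mono_AE])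
      show "AE w in M. \<bar>W w * S w\<bar> \<le> \<bar>C\<bar> * \<bar>S w\<bar>"
        using W(2) by eventually_elim (auto simp: abs_mult intro!: mult_right_mono)
      show "integrable M (\<lambda>w. \<bar>W w * S w\<bar>)"
        by (intro integrable_abs integrable_bounded_mult[OF Si Wm W(2)])
    qed (use Si in auto)
    also have "\<dots> = \<bar>C\<bar> * expectation (\<lambda>w. \<bar>S w\<bar>)" by simp
    also have "\<dots> \<le> \<bar>C\<bar> * sqrt (expectation (\<lambda>w. S w ^ 2))"
      using abs_expectation_le_sqrt(2)[OF _ S2i] Si by (intro mult_left_mono) auto
    also have "\<dots> \<le> \<bar>C\<bar> * sqrt (3 * (b - a)\<^sup>2 / real (Suc N))"
      using ES2 by (intro mult_left_mono real_sqrt_le_mono) auto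
    finally show ?thesis .
  qed
  have "(\<lambda>N. \<bar>C\<bar> * sqrt (3 * (b - a)\<^sup>2 / real (Suc N))) \<longlonglongrightarrow> \<bar>C\<bar> * sqrt 0"
    by (intro tendsto_mult tendsto_const tendsto_real_sqrt LIMSEQ_Suc lim_const_over_n)
  then have "\<bar>?e\<bar> \<le> \<bar>C\<bar> * sqrt 0"
    by (rule LIMSEQ_le_const) (use bound in auto)
  then show "?e = 0" by simp
qed

end

section \<open>Ito integrals of bounded integrands\<close>

context prob_space
begin

definition bounded_rv :: "('a \<Rightarrow> real) \<Rightarrow> bool" where
  "bounded_rv f \<longleftrightarrow> f \<in> borel_measurable M \<and> (\<exists>C. \<forall>w\<in>space M. \<bar>f w\<bar> \<le> C)"

lemma bounded_rv_const [intro, simp]: "bounded_rv (\<lambda>_. c)"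
  by (auto simp: bounded_rv_def)

lemma bounded_rv_mult [intro]: "bounded_rv f \<Longrightarrow> bounded_rv g \<Longrightarrow> bounded_rv (\<lambda>w. f w * g w)"
proof -
  assume "bounded_rv f" "bounded_rv g"
  then obtain C D where m: "f \<in> borel_measurable M" "g \<in> borel_measurable M"
    and b: "\<And>w. w \<in> space M \<Longrightarrow> \<bar>f w\<bar> \<le> C" "\<And>w. w \<in> space M \<Longrightarrow> \<bar>g w\<bar> \<le> D"
    by (auto simp: bounded_rv_def)
  have "\<bar>f w * g w\<bar> \<le> C * D" if "w \<in> space M" for w
    unfolding abs_mult using b(1)[OF that] b(2)[OF that] by (intro mult_mono) auto
  then show ?thesis using m by (auto simp: bounded_rv_def)
qed

lemma bounded_rv_add [intro]: "bounded_rv f \<Longrightarrow> bounded_rv g \<Longrightarrow> bounded_rv (\<lambda>w. f w + g w)"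
proof -
  assume "bounded_rv f" "bounded_rv g"
  then obtain C D where m: "f \<in> borel_measurable M" "g \<in> borel_measurable M"
    and b: "\<And>w. w \<in> space M \<Longrightarrow> \<bar>f w\<bar> \<le> C" "\<And>w. w \<in> space M \<Longrightarrow> \<bar>g w\<bar> \<le> D"
    by (auto simp: bounded_rv_def)
  have "\<bar>f w + g w\<bar> \<le> C + D" if "w \<in> space M" for w
    using b(1)[OF that] b(2)[OF that] by linarith
  then show ?thesis using m by (auto simp: bounded_rv_def)
qed

lemma bounded_rv_diff [intro]: "bounded_rv f \<Longrightarrow> bounded_rv g \<Longrightarrow> bounded_rv (\<lambda>w. f w - g w)"
  using bounded_rv_add[of f "\<lambda>w. - 1 * g w"] bounded_rv_mult[of "\<lambda>_. - 1" g] by simp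

lemma bounded_rv_power [intro]: "bounded_rv f \<Longrightarrow> bounded_rv (\<lambda>w. f w ^ n)"
  by (induction n) auto

lemma bounded_rv_sum [intro]: "(\<And>i. i \<in> A \<Longrightarrow> bounded_rv (f i)) \<Longrightarrow> bounded_rv (\<lambda>w. \<Sum>i\<in>A. f i w)"
  by (induction A rule: infinite_finite_induct) auto

lemma integrable_bounded_rv_mult: "bounded_rv f \<Longrightarrow> integrable M g \<Longrightarrow> integrable M (\<lambda>w. f w * g w)"
  by (auto simp: bounded_rv_def intro!: integrable_bounded_mult)

lemma integrable_bounded_rv: "bounded_rv f \<Longrightarrow> integrable M f"
  using integrable_bounded_rv_mult[of f "\<lambda>_. 1"] by simp

end

section \<open>Martingale transforms of step integrands and their brackets\<close>

definition mtrans :: "(real \<Rightarrow> 'w \<Rightarrow> real) \<Rightarrow> (nat \<Rightarrow> real) \<Rightarrow> (nat \<Rightarrow> 'w \<Rightarrow> real) \<Rightarrow> nat \<Rightarrow> 'w \<Rightarrow> real" where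
  "mtrans B p \<zeta> n w = (\<Sum>i<n. \<zeta> i w * (B (p (Suc i)) w - B (p i) w))"

definition qvar :: "(nat \<Rightarrow> real) \<Rightarrow> (nat \<Rightarrow> 'w \<Rightarrow> real) \<Rightarrow> nat \<Rightarrow> 'w \<Rightarrow> real" where
  "qvar p \<zeta> n w = (\<Sum>i<n. (\<zeta> i w)\<^sup>2 * (p (Suc i) - p i))"

text \<open>Switches the integrand off as soon as its bracket would exceed the budget
  \<open>R\<close>. The tested bracket includes step \<open>i\<close> itself, yet it involves only
  the values of \<zeta> up to index \<open>i\<close> and is known when that step begins; so the
  stopped integrand remains adapted.\<close>

definition budget_stop :: "real \<Rightarrow> (nat \<Rightarrow> real) \<Rightarrow> (nat \<Rightarrow> 'w \<Rightarrow> real) \<Rightarrow> nat \<Rightarrow> 'w \<Rightarrow> real" where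
  "budget_stop R p \<zeta> i w = (if qvar p \<zeta> (Suc i) w \<le> R then \<zeta> i w else 0)"

lemma mtrans_Suc: "mtrans B p \<zeta> (Suc n) w = mtrans B p \<zeta> n w + \<zeta> n w * (B (p (Suc n)) w - B (p n) w)"
  by (simp add: mtrans_def)

lemma qvar_Suc: "qvar p \<zeta> (Suc n) w = qvar p \<zeta> n w + (\<zeta> n w)\<^sup>2 * (p (Suc n) - p n)"
  by (simp add: qvar_def)

lemma mtrans_0 [simp]: "mtrans B p \<zeta> 0 w = 0" and qvar_0 [simp]: "qvar p \<zeta> 0 w = 0"
  by (simp_all add: mtrans_def qvar_def)

lemma qvar_mono: "mono p \<Longrightarrow> m \<le> n \<Longrightarrow> qvar p \<zeta> m w \<le> qvar p \<zeta> n w"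
  unfolding qvar_def by (intro sum_mono2) (auto simp: mono_def)

lemma qvar_budget_stop_le:
  assumes p: "mono p" and R: "0 \<le> R"
  shows "qvar p (budget_stop R p \<zeta>) n w \<le> R"
proof (induction n)
  case (Suc n)
  show ?case
  proof (cases "qvar p \<zeta> (Suc n) w \<le> R")
    case True
    have "qvar p (budget_stop R p \<zeta>) (Suc n) w \<le> qvar p \<zeta> (Suc n) w"
      unfolding qvar_def using p
      by (intro sum_mono mult_right_mono) (auto simp: budget_stop_def mono_def)
    then show ?thesis using True by simp
  next
    case False
    then have "budget_stop R p \<zeta> n w = 0" by (simp add: budget_stop_def)
    then show ?thesis using Suc.IH by (simp add: qvar_Suc)
  qed
qed (simp add: R)

lemma budget_stop_eq:
  assumes p: "mono p" and q: "qvar p \<zeta> N w \<le> R"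
  shows "mtrans B p (budget_stop R p \<zeta>) N w = mtrans B p \<zeta> N w"
    and "qvar p (budget_stop R p \<zeta>) N w = qvar p \<zeta> N w"
proof -
  have "budget_stop R p \<zeta> i w = \<zeta> i w" if "i < N" for i
    using qvar_mono[OF p, of "Suc i" N \<zeta> w] q that by (simp add: budget_stop_def)
  then show "mtrans B p (budget_stop R p \<zeta>) N w = mtrans B p \<zeta> N w"
    and "qvar p (budget_stop R p \<zeta>) N w = qvar p \<zeta> N w"
    by (simp_all add: mtrans_def qvar_def)
qed

context filtered_space
begin

definition step_integrand :: "(nat \<Rightarrow> real) \<Rightarrow> (nat \<Rightarrow> 'w \<Rightarrow> real) \<Rightarrow> bool" where
  "step_integrand p \<zeta> \<longleftrightarrow> mono p \<and> 0 \<le> p 0 \<and> (\<forall>i. \<zeta> i \<in> borel_measurable (F (p i)) \<and> bounded_rv (\<zeta> i))"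

lemma step_integrandD:
  assumes "step_integrand p \<zeta>"
  shows "p i \<le> p (Suc i)" "0 \<le> p i" "\<zeta> i \<in> borel_measurable (F (p i))" "bounded_rv (\<zeta> i)" "i \<le> j \<Longrightarrow> p i \<le> p j"
proof -
  have m: "mono p" "0 \<le> p 0" using assms by (auto simp: step_integrand_def)
  show "p i \<le> p (Suc i)" "i \<le> j \<Longrightarrow> p i \<le> p j" using m by (auto intro: monoD)
  show "0 \<le> p i" using m(2) monoD[OF m(1), of 0 i] by simp
qed (use assms in \<open>auto simp: step_integrand_def\<close>)

lemma mtrans_adapted:
  assumes B: "brownian_motion M F B" and s: "step_integrand p \<zeta>"
  shows "mtrans B p \<zeta> n \<in> borel_measurable (F (p n))"
proof -
  have "(\<lambda>w. \<zeta> i w * (B (p (Suc i)) w - B (p i) w)) \<in> borel_measurable (F (p n))" if "i < n" for i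
    using that step_integrandD[OF s]
    by (intro borel_measurable_times borel_measurable_diff)
      (auto intro: adapted_mono[OF brownian_adapted[OF B]] adapted_mono[of "\<zeta> i" "p i"])
  then show ?thesis unfolding mtrans_def by auto
qed

lemma qvar_adapted:
  assumes s: "step_integrand p \<zeta>"
  shows "qvar p \<zeta> (Suc n) \<in> borel_measurable (F (p n))"
proof -
  have "(\<lambda>w. (\<zeta> i w)\<^sup>2 * (p (Suc i) - p i)) \<in> borel_measurable (F (p n))" if "i < Suc n" for i
    using that step_integrandD[OF s] adapted_mono[of "\<zeta> i" "p i" "p n"] by auto
  then show ?thesis unfolding qvar_def by auto
qed

lemma bounded_rv_qvar: "step_integrand p \<zeta> \<Longrightarrow> bounded_rv (qvar p \<zeta> n)"
  unfolding qvar_def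
  by (intro bounded_rv_sum bounded_rv_mult bounded_rv_power bounded_rv_const step_integrandD(4))

lemma step_integrand_budget_stop:
  assumes s: "step_integrand p \<zeta>"
  shows "step_integrand p (budget_stop R p \<zeta>)"
proof -
  have m: "budget_stop R p \<zeta> i \<in> borel_measurable (F (p i))" for i
    unfolding budget_stop_def using qvar_adapted[OF s, of i] step_integrandD(3)[OF s, of i]
    by (intro measurable_If) auto
  moreover have "bounded_rv (budget_stop R p \<zeta> i)" for i
  proof -
    obtain C where C: "\<And>w. w \<in> space M \<Longrightarrow> \<bar>\<zeta> i w\<bar> \<le> C"
      using step_integrandD(4)[OF s, of i] by (auto simp: bounded_rv_def)
    have "\<bar>budget_stop R p \<zeta> i w\<bar> \<le> C" if "w \<in> space M" for w
      using C[OF that] by (auto simp: budget_stop_def)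
    then show ?thesis using adapted_measurable[OF m] by (auto simp: bounded_rv_def)
  qed
  ultimately show ?thesis using s by (simp add: step_integrand_def)
qed

text \<open>In the binomial expansion of the last step every term is a variable known at the left
  end point times a power of an increment independent of it, so integrability is inherited from step
  to step.\<close>

lemma mtrans_moment_integrable:
  assumes B: "brownian_motion M F B" and s: "step_integrand p \<zeta>"
  shows "integrable M (\<lambda>w. mtrans B p \<zeta> n w ^ k)"
proof (induction n arbitrary: k)
  case (Suc n)
  let ?D = "\<lambda>w. B (p (Suc n)) w - B (p n) w"
  have "integrable M (\<lambda>w. (\<zeta> n w ^ (k - j) * mtrans B p \<zeta> n w ^ j) * ?D w ^ (k - j))" for j
  proof (rule increment_independent(1)[OF B])
    show "(\<lambda>w. \<zeta> n w ^ (k - j) * mtrans B p \<zeta> n w ^ j) \<in> borel_measurable (F (p n))"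
      using mtrans_adapted[OF B s, of n] step_integrandD(3)[OF s, of n] by auto
    show "integrable M (\<lambda>w. \<zeta> n w ^ (k - j) * mtrans B p \<zeta> n w ^ j)"
      using step_integrandD(4)[OF s, of n] by (intro integrable_bounded_rv_mult Suc.IH) auto
  qed (use step_integrandD[OF s] in auto)
  moreover have "mtrans B p \<zeta> (Suc n) w ^ k
      = (\<Sum>j\<le>k. real (k choose j) * ((\<zeta> n w ^ (k - j) * mtrans B p \<zeta> n w ^ j) * ?D w ^ (k - j)))" for w
    unfolding mtrans_Suc binomial_ring by (intro sum.cong refl) (simp add: power_mult_distrib)
  ultimately show ?case by simp
qed (cases k, auto)

lemma mtrans_measurable:
  "brownian_motion M F B \<Longrightarrow> step_integrand p \<zeta> \<Longrightarrow> mtrans B p \<zeta> n \<in> borel_measurable M"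
  using mtrans_adapted adapted_measurable by blast

lemma mtrans_centred:
  assumes B: "brownian_motion M F B" and s: "step_integrand p \<zeta>"
    and Z: "Z \<in> borel_measurable (F (p 0))" "AE w in M. \<bar>Z w\<bar> \<le> C"
  shows "expectation (\<lambda>w. Z w * mtrans B p \<zeta> n w) = 0"
proof (induction n)
  case (Suc n)
  have Zm: "Z \<in> borel_measurable M" by (rule adapted_measurable[OF Z(1)])
  have W: "(\<lambda>w. Z w * \<zeta> n w) \<in> borel_measurable (F (p n))"
    using adapted_mono[OF Z(1), of "p n"] step_integrandD[OF s] by auto
  have Wi: "integrable M (\<lambda>w. Z w * \<zeta> n w)"
    by (intro integrable_bounded_mult[OF _ Zm Z(2)] integrable_bounded_rv step_integrandD(4)[OF s])
  have i: "integrable M (\<lambda>w. Z w * mtrans B p \<zeta> n w)"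
    using mtrans_moment_integrable[OF B s, of n 1] by (intro integrable_bounded_mult[OF _ Zm Z(2)]) simp
  show ?case
    using increment_centred[OF B step_integrandD(2,1)[OF s] W Wi] i Suc.IH
    by (simp add: mtrans_Suc distrib_left mult.assoc)
qed simp

text \<open>The Ito isometry along a partition: the cross term is centred and the squared increment
  contributes the length of the step.\<close>

lemma mtrans_square:
  assumes B: "brownian_motion M F B" and s: "step_integrand p \<zeta>"
  shows "expectation (\<lambda>w. (mtrans B p \<zeta> n w)\<^sup>2) = expectation (qvar p \<zeta> n)"
proof (induction n)
  case (Suc n)
  let ?D = "\<lambda>w. B (p (Suc n)) w - B (p n) w" and ?M = "mtrans B p \<zeta> n"
  note pn = step_integrandD(2,1)[OF s, of n]
  have W1: "(\<lambda>w. \<zeta> n w * ?M w) \<in> borel_measurable (F (p n))" "integrable M (\<lambda>w. \<zeta> n w * ?M w)"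
    using mtrans_adapted[OF B s, of n] step_integrandD[OF s] mtrans_moment_integrable[OF B s, of n 1]
    by (auto intro!: integrable_bounded_rv_mult)
  have W2: "(\<lambda>w. (\<zeta> n w)\<^sup>2) \<in> borel_measurable (F (p n))" "integrable M (\<lambda>w. (\<zeta> n w)\<^sup>2)"
    using step_integrandD[OF s] by (auto intro!: integrable_bounded_rv)
  note i1 = increment_centred[OF B pn W1] and i2 = increment_independent[OF B pn W2, of 2]
  have "(mtrans B p \<zeta> (Suc n) w)\<^sup>2 = (?M w)\<^sup>2 + 2 * ((\<zeta> n w * ?M w) * ?D w) + (\<zeta> n w)\<^sup>2 * (?D w)\<^sup>2" for w
    by (simp add: mtrans_Suc power2_eq_square algebra_simps)
  then have "expectation (\<lambda>w. (mtrans B p \<zeta> (Suc n) w)\<^sup>2)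
      = expectation (\<lambda>w. (?M w)\<^sup>2) + expectation (\<lambda>w. (\<zeta> n w)\<^sup>2) * (p (Suc n) - p n)"
    using i1 i2 mtrans_moment_integrable[OF B s, of n 2] increment_gaussian(3)[OF B pn] by simp
  also have "\<dots> = expectation (qvar p \<zeta> (Suc n))"
    unfolding qvar_Suc[abs_def] using Suc.IH W2 integrable_bounded_rv[OF bounded_rv_qvar[OF s, of n]] by simp
  finally show ?case .
qed (simp add: mtrans_def qvar_def)

text \<open>Of the new terms in each step, those with one increment are centred. The one with both
  increments falls under \<open>orthogonal_increments\<close>, with \<open>Z\<close> and the two
  integrands combined into a single bounded weight.\<close>

lemma mtrans_orthogonal:
  assumes B: "brownian_motion M F B" and B': "brownian_motion M F B'" and o: "orthogonal_increments B B'"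
    and s: "step_integrand p \<zeta>" and s': "step_integrand p \<zeta>'"
    and Z: "Z \<in> borel_measurable (F (p 0))" "AE w in M. \<bar>Z w\<bar> \<le> C"
  shows "expectation (\<lambda>w. Z w * (mtrans B p \<zeta> n w * mtrans B' p \<zeta>' n w)) = 0"
proof (induction n)
  case (Suc n)
  let ?D = "\<lambda>w. B (p (Suc n)) w - B (p n) w" and ?M = "mtrans B p \<zeta> n"
  let ?D' = "\<lambda>w. B' (p (Suc n)) w - B' (p n) w" and ?M' = "mtrans B' p \<zeta>' n"
  note pn = step_integrandD(2,1)[OF s, of n]
  have Zm: "Z \<in> borel_measurable M" by (rule adapted_measurable[OF Z(1)])
  have Zn: "Z \<in> borel_measurable (F (p n))"
    using step_integrandD(5)[OF s, of 0 n] by (intro adapted_mono[OF Z(1)]) simp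
  note m = mtrans_adapted[OF B s, of n] and m' = mtrans_adapted[OF B' s', of n]
  have V1: "(\<lambda>w. Z w * (\<zeta> n w * ?M' w)) \<in> borel_measurable (F (p n))" "integrable M (\<lambda>w. Z w * (\<zeta> n w * ?M' w))"
    using Zn m' step_integrandD[OF s] mtrans_moment_integrable[OF B' s', of n 1]
    by (auto intro!: integrable_bounded_rv_mult integrable_bounded_mult[OF _ Zm Z(2)])
  have V2: "(\<lambda>w. Z w * (\<zeta>' n w * ?M w)) \<in> borel_measurable (F (p n))" "integrable M (\<lambda>w. Z w * (\<zeta>' n w * ?M w))"
    using Zn m step_integrandD[OF s'] mtrans_moment_integrable[OF B s, of n 1]
    by (auto intro!: integrable_bounded_rv_mult integrable_bounded_mult[OF _ Zm Z(2)])
  note i1 = increment_centred[OF B pn V1] and i2 = increment_centred[OF B' pn V2]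
  have i0: "integrable M (\<lambda>w. Z w * (?M w * ?M' w))"
    using mtrans_moment_integrable[OF B s, of n 2] mtrans_moment_integrable[OF B' s', of n 2]
      mtrans_measurable[OF B s] mtrans_measurable[OF B' s']
    by (intro integrable_bounded_mult[OF _ Zm Z(2)] integrable_mult_square) auto
  have "bounded_rv (\<lambda>w. \<zeta> n w * \<zeta>' n w)"
    using step_integrandD(4)[OF s] step_integrandD(4)[OF s'] by auto
  then obtain C' where C': "\<And>w. w \<in> space M \<Longrightarrow> \<bar>\<zeta> n w * \<zeta>' n w\<bar> \<le> C'" by (auto simp: bounded_rv_def)
  have Wm: "(\<lambda>w. Z w * (\<zeta> n w * \<zeta>' n w)) \<in> borel_measurable (F (p n))"
    using Zn step_integrandD(3)[OF s, of n] step_integrandD(3)[OF s', of n] by auto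
  have Wb: "AE w in M. \<bar>Z w * (\<zeta> n w * \<zeta>' n w)\<bar> \<le> \<bar>C\<bar> * \<bar>C'\<bar>"
    using Z(2) AE_space
  proof eventually_elim
    case (elim w)
    show ?case unfolding abs_mult[of "Z w"] using elim C'[of w] by (intro mult_mono) auto
  qed
  have i3: "expectation (\<lambda>w. (Z w * (\<zeta> n w * \<zeta>' n w)) * (?D w * ?D' w)) = 0"
    using o pn Wm Wb unfolding orthogonal_increments_def by blast
  have i3': "integrable M (\<lambda>w. (Z w * (\<zeta> n w * \<zeta>' n w)) * (?D w * ?D' w))"
    by (rule integrable_bounded_mult[OF increments_product_integrable[OF B B' pn pn] adapted_measurable[OF Wm] Wb])
  have "(\<lambda>w. Z w * (mtrans B p \<zeta> (Suc n) w * mtrans B' p \<zeta>' (Suc n) w)) = (\<lambda>w. Z w * (?M w * ?M' w)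
      + (Z w * (\<zeta> n w * ?M' w)) * ?D w + (Z w * (\<zeta>' n w * ?M w)) * ?D' w
      + (Z w * (\<zeta> n w * \<zeta>' n w)) * (?D w * ?D' w))"
    by (simp add: mtrans_Suc fun_eq_iff algebra_simps)
  then show ?case using i0 i1 i2 i3 i3' Suc.IH by simp
qed simp

text \<open>With the remaining budget \<open>A = R - V\<close>, the heat polynomial \<open>M\<^sup>4 + 6M\<^sup>2A + 3A\<^sup>2\<close> has constant
  expectation.\<close>

lemma mtrans_fourth:
  assumes B: "brownian_motion M F B" and s: "step_integrand p \<zeta>"
    and R: "\<And>w. w \<in> space M \<Longrightarrow> qvar p \<zeta> n w \<le> R"
  shows "expectation (\<lambda>w. mtrans B p \<zeta> n w ^ 4) \<le> 3 * R\<^sup>2"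
proof -
  define A where "A k w = R - qvar p \<zeta> k w" for k w
  define h where "h k w = mtrans B p \<zeta> k w ^ 4 + 6 * (A k w * mtrans B p \<zeta> k w ^ 2) + 3 * (A k w)\<^sup>2" for k w
  have Ab: "bounded_rv (A k)" for k
    unfolding A_def using bounded_rv_qvar[OF s, of k] by auto
  have hi: "integrable M (h k)" for k
    unfolding h_def
    by (intro Bochner_Integration.integrable_add integrable_mult_right mtrans_moment_integrable[OF B s]
        integrable_bounded_rv_mult[OF Ab] integrable_bounded_rv[OF bounded_rv_power[OF Ab]])
  have Am: "A k \<in> borel_measurable (F (p k))" for k
  proof (cases k)
    case (Suc j)
    then show ?thesis
      unfolding A_def using adapted_mono[OF qvar_adapted[OF s, of j], of "p k"] step_integrandD(1)[OF s, of j] by auto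
  qed (simp add: A_def[abs_def])
  have "expectation (h k) = 3 * R\<^sup>2" for k
  proof (induction k)
    case (Suc k)
    let ?D = "\<lambda>w. B (p (Suc k)) w - B (p k) w" and ?M = "mtrans B p \<zeta> k" and ?\<delta> = "p (Suc k) - p k"
    let ?v = "\<lambda>w. (\<zeta> k w)\<^sup>2 * ?\<delta>"
    note pk = step_integrandD(2,1)[OF s, of k]
    have \<zeta>b: "bounded_rv (\<zeta> k)" and \<zeta>m: "\<zeta> k \<in> borel_measurable (F (p k))" using step_integrandD[OF s] by auto
    note Mm = mtrans_adapted[OF B s, of k] and Mi = mtrans_moment_integrable[OF B s, of k]
    have Mi1: "integrable M ?M" using Mi[of 1] by simp
    \<comment> \<open>\<open>W1\<close> to \<open>W4\<close> are the coefficients of the powers of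
      the increment in the change of the polynomial, and \<open>W0\<close> is the part free of it.
      Odd moments of the increment vanish, and the contributions of the even ones cancel against
      \<open>W0\<close>.\<close>
    define W1 where "W1 w = 4 * \<zeta> k w * ?M w ^ 3 + (12 * \<zeta> k w * (A k w - ?v w)) * ?M w" for w
    define W2 where "W2 w = (6 * (\<zeta> k w)\<^sup>2) * ?M w ^ 2 + 6 * (\<zeta> k w)\<^sup>2 * (A k w - ?v w)" for w
    define W3 where "W3 w = (4 * \<zeta> k w ^ 3) * ?M w" for w
    define W4 where "W4 w = \<zeta> k w ^ 4" for w
    define W0 where "W0 w = (- 6 * ?\<delta> * (\<zeta> k w)\<^sup>2) * ?M w ^ 2 + (- 6 * A k w * ?v w + 3 * (?v w)\<^sup>2)" for w
    have b: "bounded_rv (\<lambda>w. 4 * \<zeta> k w)" "bounded_rv (\<lambda>w. 12 * \<zeta> k w * (A k w - ?v w))"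
      "bounded_rv (\<lambda>w. 6 * (\<zeta> k w)\<^sup>2)" "bounded_rv (\<lambda>w. 6 * (\<zeta> k w)\<^sup>2 * (A k w - ?v w))"
      "bounded_rv (\<lambda>w. 4 * \<zeta> k w ^ 3)" "bounded_rv (\<lambda>w. \<zeta> k w ^ 4)"
      "bounded_rv (\<lambda>w. - 6 * ?\<delta> * (\<zeta> k w)\<^sup>2)" "bounded_rv (\<lambda>w. - 6 * A k w * ?v w + 3 * (?v w)\<^sup>2)"
      by (intro bounded_rv_add bounded_rv_mult bounded_rv_diff bounded_rv_power bounded_rv_const \<zeta>b Ab)+
    have wi: "integrable M W0" "integrable M W1" "integrable M W2" "integrable M W3" "integrable M W4"
      unfolding W0_def W1_def W2_def W3_def W4_def
      using integrable_bounded_rv_mult[OF b(1) Mi[of 3]] integrable_bounded_rv_mult[OF b(2) Mi1]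
        integrable_bounded_rv_mult[OF b(3) Mi[of 2]] integrable_bounded_rv[OF b(4)]
        integrable_bounded_rv_mult[OF b(5) Mi1] integrable_bounded_rv[OF b(6)]
        integrable_bounded_rv_mult[OF b(7) Mi[of 2]] integrable_bounded_rv[OF b(8)]
      by (simp_all only: Bochner_Integration.integrable_add)
    have wm: "W1 \<in> borel_measurable (F (p k))" "W2 \<in> borel_measurable (F (p k))"
      "W3 \<in> borel_measurable (F (p k))" "W4 \<in> borel_measurable (F (p k))"
      unfolding W1_def W2_def W3_def W4_def using \<zeta>m Am[of k] Mm by measurable
    have "h (Suc k) = (\<lambda>w. h k w + W1 w * ?D w ^ 1 + W2 w * ?D w ^ 2 + W3 w * ?D w ^ 3 + W4 w * ?D w ^ 4 + W0 w)"
      unfolding h_def W0_def W1_def W2_def W3_def W4_def A_def mtrans_Suc qvar_Suc fun_eq_iff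
      by (simp add: algebra_simps power2_eq_square power3_eq_cube power4_eq_xxxx)
    moreover note i1 = increment_independent[OF B pk wm(1) wi(2), of 1] increment_independent[OF B pk wm(2) wi(3), of 2]
       increment_independent[OF B pk wm(3) wi(4), of 3] increment_independent[OF B pk wm(4) wi(5), of 4]
    moreover note m = increment_gaussian[OF B pk] increment_moments(2,3)[OF B pk]
    ultimately have E: "expectation (h (Suc k)) = expectation (h k) + expectation W2 * ?\<delta> + expectation W4 * (3 * ?\<delta>\<^sup>2) + expectation W0"
      using hi[of k] wi by simp
    have "expectation W2 * ?\<delta> + expectation W4 * (3 * ?\<delta>\<^sup>2) + expectation W0
        = expectation (\<lambda>w. W2 w * ?\<delta> + W4 w * (3 * ?\<delta>\<^sup>2) + W0 w)"
      using wi by simp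
    also have "(\<lambda>w. W2 w * ?\<delta> + W4 w * (3 * ?\<delta>\<^sup>2) + W0 w) = (\<lambda>_. 0)"
      unfolding W0_def W2_def W4_def fun_eq_iff
      by (simp add: algebra_simps power2_eq_square power4_eq_xxxx)
    finally show ?case using E Suc.IH by simp
  qed (simp add: h_def A_def prob_space)
  moreover have "expectation (\<lambda>w. mtrans B p \<zeta> n w ^ 4) \<le> expectation (h n)"
  proof (rule integral_mono[OF mtrans_moment_integrable[OF B s] hi])
    fix w assume "w \<in> space M"
    then have "0 \<le> A n w" using R by (simp add: A_def)
    then show "mtrans B p \<zeta> n w ^ 4 \<le> h n w" by (simp add: h_def)
  qed
  ultimately show ?thesis by simp
qed

lemma finite_set_enumeration:
  fixes X :: "real set"
  assumes X: "finite X" "X \<subseteq> {s..t}" "s \<in> X" "t \<in> X"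
  shows "\<exists>(p :: nat \<Rightarrow> real) N. mono p \<and> p 0 = s \<and> p N = t \<and> (\<forall>i j. i < j \<longrightarrow> j \<le> N \<longrightarrow> p i < p j) \<and>
    (\<forall>x\<in>X. \<exists>i\<le>N. p i = x) \<and> (\<forall>i\<ge>N. p i = t)"
proof -
  define xs where "xs = sorted_list_of_set X"
  define N where "N = length xs - 1"
  \<comment> \<open>Beyond the last point the enumeration stays at \<open>t\<close>, so that it is
    monotone on all of the naturals.\<close>
  define p where "p i = (if i < length xs then xs ! i else t)" for i
  have xs: "set xs = X" "sorted_wrt (<) xs" using X(1) by (simp_all add: xs_def)
  have "xs \<noteq> []" using xs X by auto
  then have len: "length xs = Suc N" by (simp add: N_def)
  have strict: "p i < p j" if "i < j" "j \<le> N" for i j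
    using that len sorted_wrt_nth_less[OF xs(2), of i j] by (simp add: p_def)
  have onto: "\<exists>i\<le>N. p i = x" if "x \<in> X" for x
  proof -
    from that xs obtain i where "i < length xs" "xs ! i = x" by (auto simp: in_set_conv_nth)
    then show ?thesis using len by (intro exI[of _ i]) (simp add: p_def)
  qed
  have inX: "p i \<in> X" for i using xs len X(4) by (auto simp: p_def)
  have pN: "p N = t"
  proof -
    obtain i where i: "i \<le> N" "p i = t" using onto[OF X(4)] by blast
    have "p N \<le> t" using inX[of N] X(2) by auto
    then show ?thesis using strict[of i N] i by (cases "i = N") auto
  qed
  have p0: "p 0 = s"
  proof -
    obtain i where i: "i \<le> N" "p i = s" using onto[OF X(3)] by blast
    have "s \<le> p 0" using inX[of 0] X(2) by auto
    then show ?thesis using strict[of 0 i] i by (cases "i = 0") auto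
  qed
  have after: "p i = t" if "N \<le> i" for i
    using that pN len by (cases "i = N") (auto simp: p_def)
  have "p i \<le> p (Suc i)" for i
  proof (cases "Suc i \<le> N")
    case False
    then show ?thesis using after[of i] after[of "Suc i"] by simp
  qed (use strict[of i "Suc i"] in simp)
  then have "mono p" by (simp add: mono_iff_le_Suc)
  then show ?thesis
    by (intro exI[of _ p] exI[of _ N] conjI p0 pN allI impI ballI strict onto after)
qed

text \<open>The steps are open on the left and closed on the right, like the intervals of the simple
  integrands, which is what lets each value be known at the left end point.\<close>

definition represents :: "(nat \<Rightarrow> real) \<Rightarrow> nat \<Rightarrow> (nat \<Rightarrow> 'w \<Rightarrow> real) \<Rightarrow> real \<Rightarrow> real \<Rightarrow> 'w simple_integrand \<Rightarrow> bool" where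
  "represents p N \<zeta> s t L \<longleftrightarrow> step_integrand p \<zeta> \<and>
    (\<forall>B w. simple_integral B L t w - simple_integral B L s w = mtrans B p \<zeta> N w) \<and>
    (\<forall>i<N. \<forall>r\<in>{p i<..p (Suc i)}. \<forall>w. simple_process L r w = \<zeta> i w)"

lemma representsD:
  assumes "represents p N \<zeta> s t L"
  shows "step_integrand p \<zeta>" "simple_integral B L t w - simple_integral B L s w = mtrans B p \<zeta> N w"
    "i < N \<Longrightarrow> r \<in> {p i<..p (Suc i)} \<Longrightarrow> simple_process L r w = \<zeta> i w"
  using assms by (auto simp: represents_def)

text \<open>One partition serves all integrands of the family, because products of two transforms
  are compared step by step.\<close>

lemma simple_partition:
  assumes K: "finite K" and L: "\<And>k. k \<in> K \<Longrightarrow> simple_integrand F (L k)" and st: "0 \<le> s" "s < t"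
  shows "\<exists>p N \<zeta>. mono p \<and> p 0 = s \<and> p N = t \<and> (\<forall>k\<in>K. represents p N (\<zeta> k) s t (L k))"
proof -
  define c where "c x = max s (min x t)" for x
  define X where "X = insert s (insert t (\<Union>k\<in>K. \<Union>(a, b, \<xi>)\<in>set (L k). {c a, c b}))"
  have "finite X" "X \<subseteq> {s..t}" "s \<in> X" "t \<in> X"
    using K st by (auto simp: X_def c_def)
  then have "\<exists>(p :: nat \<Rightarrow> real) N. mono p \<and> p 0 = s \<and> p N = t \<and> (\<forall>i j. i < j \<longrightarrow> j \<le> N \<longrightarrow> p i < p j) \<and>
    (\<forall>x\<in>X. \<exists>i\<le>N. p i = x) \<and> (\<forall>i\<ge>N. p i = t)" by (rule finite_set_enumeration)
  then obtain p :: "nat \<Rightarrow> real" and N :: nat where p: "mono p" "p 0 = s" "p N = t" and "\<forall>i j. i < j \<longrightarrow> j \<le> N \<longrightarrow> p i < p j"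
    "\<forall>x\<in>X. \<exists>i\<le>N. p i = x" "\<forall>i\<ge>N. p i = t" by (elim exE conjE)
  then have strict: "\<And>i j. i < j \<Longrightarrow> j \<le> N \<Longrightarrow> p i < p j" and onto: "\<And>x. x \<in> X \<Longrightarrow> \<exists>i\<le>N. p i = x"
    and after: "\<And>i. N \<le> i \<Longrightarrow> p i = t" by simp_all
  have ple: "p i \<le> t" "s \<le> p i" for i
    using monoD[OF p(1), of i "max i N"] after[of "max i N"] monoD[OF p(1), of 0 i] p(2) by auto
  have lt_iff: "p i < p j \<longleftrightarrow> i < j" if "i \<le> N" "j \<le> N" for i j
    using that strict[of i j] monoD[OF p(1), of j i] by (cases "i < j") auto
  have le_iff: "p i \<le> p j \<longleftrightarrow> i \<le> j" if "i \<le> N" "j \<le> N" for i j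
    using lt_iff[OF that(2,1)] by (simp add: not_less[symmetric])
  \<comment> \<open>The strict inequality excludes the constant tail of the partition. There an
    interval that begins after \<open>t\<close>, with its left end clamped to \<open>t\<close>,
    would count as active although its weight is not yet known.\<close>
  define act where "act a b i \<longleftrightarrow> c a \<le> p i \<and> p (Suc i) \<le> c b \<and> p i < p (Suc i)" for a b i
  define \<zeta> where "\<zeta> k i w = (\<Sum>(a, b, \<xi>)\<leftarrow>L k. if act a b i then \<xi> w else 0)" for k i w
  have idx: "\<exists>x\<le>N. \<exists>y\<le>N. x \<le> y \<and> p x = c a \<and> p y = c b" if "k \<in> K" "(a, b, \<xi>) \<in> set (L k)" for k a b \<xi>
  proof -
    have "c a \<in> X" "c b \<in> X" unfolding X_def using that by force+
    from onto[OF this(1)] onto[OF this(2)] obtain x y where xy: "x \<le> N" "p x = c a" "y \<le> N" "p y = c b"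
      by (elim exE conjE)
    have "a \<le> b" using L[OF that(1)] that(2) by (auto simp: simple_integrand_def)
    then have "c a \<le> c b" by (auto simp: c_def)
    then have "x \<le> y" using le_iff[OF xy(1,3)] xy by simp
    with xy show ?thesis by blast
  qed
  have step: "step_integrand p (\<zeta> k)" if k: "k \<in> K" for k
    unfolding step_integrand_def
  proof (intro conjI allI p(1))
    show "0 \<le> p 0" using st p by simp
    fix i
    have one: "(\<lambda>w. if act a b i then \<xi> w else 0) \<in> borel_measurable (F (p i)) \<and>
        bounded_rv (\<lambda>w. if act a b i then \<xi> w else 0)"
      if "(a, b, \<xi>) \<in> set (L k)" for a b \<xi>
    proof (cases "act a b i")
      case True
      have x: "\<xi> \<in> borel_measurable (F a)" "bounded (\<xi> ` space M)"
        using L[OF k] that by (auto simp: simple_integrand_def space_F)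
      have "a \<le> p i" using True ple(1)[of "Suc i"] by (auto simp: act_def c_def)
      then have "\<xi> \<in> borel_measurable (F (p i))" by (rule adapted_mono[OF x(1)])
      moreover have "bounded_rv \<xi>"
        using x(2) adapted_measurable[OF x(1)] by (auto simp: bounded_rv_def bounded_iff)
      ultimately show ?thesis using True by simp
    qed auto
    have "(\<forall>(a, b, \<xi>)\<in>set xs. P a b \<xi> \<in> borel_measurable (F (p i)) \<and> bounded_rv (P a b \<xi>)) \<Longrightarrow>
       (\<lambda>w. \<Sum>(a, b, \<xi>)\<leftarrow>xs. P a b \<xi> w) \<in> borel_measurable (F (p i)) \<and> bounded_rv (\<lambda>w. \<Sum>(a, b, \<xi>)\<leftarrow>xs. P a b \<xi> w)"
      for xs :: "'w simple_integrand" and P :: "real \<Rightarrow> real \<Rightarrow> ('w \<Rightarrow> real) \<Rightarrow> 'w \<Rightarrow> real"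
      by (induction xs) auto
    from this[of "L k" "\<lambda>a b \<xi> w. if act a b i then \<xi> w else 0"] one
    show "\<zeta> k i \<in> borel_measurable (F (p i))" "bounded_rv (\<zeta> k i)"
      unfolding \<zeta>_def by auto
  qed
  have int: "simple_integral B (L k) t w - simple_integral B (L k) s w = mtrans B p (\<zeta> k) N w" if k: "k \<in> K" for k B w
  proof -
    have one: "\<xi> w * (B (min b t) w - B (min a t) w) - \<xi> w * (B (min b s) w - B (min a s) w)
        = (\<Sum>i<N. (if act a b i then \<xi> w else 0) * (B (p (Suc i)) w - B (p i) w))"
      if ab: "(a, b, \<xi>) \<in> set (L k)" for a b \<xi>
    proof -
      obtain x y where xy: "x \<le> N" "y \<le> N" "x \<le> y" "p x = c a" "p y = c b" using idx[OF k ab] by blast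
      have eq: "B (min z t) w - B (min z s) w = B (c z) w - B s w" for z
        using st by (cases "z \<le> s") (auto simp: c_def min_def max_def)
      have "\<xi> w * (B (min b t) w - B (min a t) w) - \<xi> w * (B (min b s) w - B (min a s) w)
          = \<xi> w * ((B (min b t) w - B (min b s) w) - (B (min a t) w - B (min a s) w))"
        by (simp add: algebra_simps)
      also have "\<dots> = \<xi> w * (B (p y) w - B (p x) w)" by (simp add: eq xy)
      also have "\<dots> = (\<Sum>i\<in>{x..<y}. \<xi> w * (B (p (Suc i)) w - B (p i) w))"
        using sum_Suc_diff'[OF xy(3), of "\<lambda>i. B (p i) w"] by (simp add: sum_distrib_left[symmetric])
      also have "\<dots> = (\<Sum>i<N. (if act a b i then \<xi> w else 0) * (B (p (Suc i)) w - B (p i) w))"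
      proof (rule sum.mono_neutral_cong_left)
        show "\<forall>i\<in>{..<N} - {x..<y}. (if act a b i then \<xi> w else 0) * (B (p (Suc i)) w - B (p i) w) = 0"
        proof
          fix i assume i: "i \<in> {..<N} - {x..<y}"
          have "\<not> (p x \<le> p i \<and> p (Suc i) \<le> p y)" using i xy le_iff[of x i] le_iff[of "Suc i" y] by auto
          then show "(if act a b i then \<xi> w else 0) * (B (p (Suc i)) w - B (p i) w) = 0"
            by (auto simp: act_def xy)
        qed
        fix i assume i: "i \<in> {x..<y}"
        then have "p x \<le> p i \<and> p (Suc i) \<le> p y \<and> p i < p (Suc i)"
          using xy le_iff[of x i] le_iff[of "Suc i" y] strict[of i "Suc i"] by auto
        then show "\<xi> w * (B (p (Suc i)) w - B (p i) w)
            = (if act a b i then \<xi> w else 0) * (B (p (Suc i)) w - B (p i) w)"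
          by (simp add: act_def xy)
      qed (use xy in auto)
      finally show ?thesis .
    qed
    have "(\<forall>(a, b, \<xi>)\<in>set xs. G a b \<xi> - H a b \<xi> = (\<Sum>i<N. P i a b \<xi> * D i)) \<Longrightarrow>
       (\<Sum>(a, b, \<xi>)\<leftarrow>xs. G a b \<xi>) - (\<Sum>(a, b, \<xi>)\<leftarrow>xs. H a b \<xi>) = (\<Sum>i<N. (\<Sum>(a, b, \<xi>)\<leftarrow>xs. P i a b \<xi>) * D i)"
      for xs :: "'w simple_integrand" and G H :: "real \<Rightarrow> real \<Rightarrow> ('w \<Rightarrow> real) \<Rightarrow> real" and P and D :: "nat \<Rightarrow> real"
      by (induction xs) (auto simp: distrib_right sum.distrib)
    from this[of "L k" "\<lambda>a b \<xi>. \<xi> w * (B (min b t) w - B (min a t) w)" "\<lambda>a b \<xi>. \<xi> w * (B (min b s) w - B (min a s) w)"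
        "\<lambda>i a b \<xi>. if act a b i then \<xi> w else 0" "\<lambda>i. B (p (Suc i)) w - B (p i) w"] one
    show ?thesis
      unfolding simple_integral_def mtrans_def \<zeta>_def by auto
  qed
  have proc: "simple_process (L k) r w = \<zeta> k i w" if k: "k \<in> K" and i: "i < N" and r: "r \<in> {p i<..p (Suc i)}" for k i r w
    unfolding simple_process_def \<zeta>_def
  proof (intro arg_cong[where f = sum_list] map_cong refl, clarify)
    fix a b \<xi> assume ab: "(a, b, \<xi>) \<in> set (L k)"
    obtain x y where xy: "x \<le> N" "y \<le> N" "x \<le> y" "p x = c a" "p y = c b" using idx[OF k ab] by blast
    have rb: "s < r" "r \<le> t" using r ple[of i] ple[of "Suc i"] by auto
    have "a < r \<longleftrightarrow> p x < r" using rb by (auto simp: xy c_def)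
    also have "\<dots> \<longleftrightarrow> p x \<le> p i"
      using r le_iff[of x i] le_iff[of "Suc i" x] xy i by (cases "x \<le> i") auto
    finally have 1: "a < r \<longleftrightarrow> c a \<le> p i" by (simp add: xy)
    have "r \<le> b \<longleftrightarrow> r \<le> p y" using rb by (auto simp: xy c_def)
    also have "\<dots> \<longleftrightarrow> p (Suc i) \<le> p y"
      using r le_iff[of y i] le_iff[of "Suc i" y] xy i by (cases "y \<le> i") auto
    finally have 2: "r \<le> b \<longleftrightarrow> p (Suc i) \<le> c b" by (simp add: xy)
    show "\<xi> w * indicator {a<..b} r = (if act a b i then \<xi> w else 0)"
      using 1 2 strict[of i "Suc i"] i by (simp add: act_def indicator_def)
  qed
  show ?thesis
    by (intro exI[of _ p] exI[of _ N] exI[of _ \<zeta>] conjI p ballI) (auto simp: represents_def step int proc)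
qed

end

section \<open>Square integrals of simple and of bounded integrands\<close>

lemma set_integrable_const_Icc: "set_integrable lborel {s..t::real} (\<lambda>_. c :: real)"
  unfolding set_integrable_def
  by (simp, intro disjI2 integrable_real_indicator) (simp_all add: emeasure_lborel_Icc_eq)

lemma bounded_set_integrable:
  fixes h :: "real \<Rightarrow> real"
  assumes h: "h \<in> borel_measurable (restrict_space borel {0..})" and s: "0 \<le> s"
    and b: "\<And>r. r \<in> {s..t} \<Longrightarrow> \<bar>h r\<bar> \<le> c"
  shows "set_integrable lborel {s..t} h"
proof -
  have "h \<in> borel_measurable (restrict_space borel {s..t})"
    using s by (intro measurable_restrict_mono[OF h]) auto
  then have "set_borel_measurable lborel {s..t} h"
    by (simp add: set_borel_measurable_def borel_measurable_restrict_space_iff)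
  then show ?thesis
    using b set_integrable_const_Icc[of s t c]
    by (intro set_integrable_bound[of lborel "{s..t}" "\<lambda>_. c" h]) (auto intro!: AE_I2 order.trans[OF b])
qed

text \<open>The error is expressed through the bound of \<open>g\<close> alone: in the application
  \<open>f\<close> is a simple integrand, whose bound varies from path to path. The mixed term is
  split by Young's inequality with parameter \<open>sqrt e\<close>.\<close>

lemma square_integral_close:
  fixes f g :: "real \<Rightarrow> real"
  assumes f: "f \<in> borel_measurable (restrict_space borel {0..})" and g: "g \<in> borel_measurable (restrict_space borel {0..})"
    and st: "0 \<le> s" "s \<le> t" and fb: "\<And>r. r \<in> {s..t} \<Longrightarrow> \<bar>f r\<bar> \<le> b" and gc: "\<And>r. r \<in> {s..t} \<Longrightarrow> \<bar>g r\<bar> \<le> c"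
    and e: "0 < e" "0 \<le> c" and ni: "(\<integral>\<^sup>+r\<in>{0..t}. ennreal ((f r - g r)\<^sup>2) \<partial>lborel) \<le> ennreal e"
  shows "\<bar>(LINT r:{s..t}|lborel. (f r)\<^sup>2) - (LINT r:{s..t}|lborel. (g r)\<^sup>2)\<bar> \<le> sqrt e * c * (t - s + 1) + e"
proof -
  define \<theta> where "\<theta> = sqrt e"
  have \<theta>: "\<theta> > 0" "\<theta> * \<theta> = e" using e by (auto simp: \<theta>_def)
  have fi: "set_integrable lborel {s..t} (\<lambda>r. (f r)\<^sup>2)" and gi: "set_integrable lborel {s..t} (\<lambda>r. (g r)\<^sup>2)"
  proof -
    have "\<bar>(f r)\<^sup>2\<bar> \<le> b\<^sup>2" "\<bar>(g r)\<^sup>2\<bar> \<le> c\<^sup>2" if "r \<in> {s..t}" for r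
      using power_mono[OF fb[OF that], of 2] power_mono[OF gc[OF that], of 2] by simp_all
    then show "set_integrable lborel {s..t} (\<lambda>r. (f r)\<^sup>2)" "set_integrable lborel {s..t} (\<lambda>r. (g r)\<^sup>2)"
      using f g st bounded_set_integrable[of "\<lambda>r. (f r)\<^sup>2" s t "b\<^sup>2"]
        bounded_set_integrable[of "\<lambda>r. (g r)\<^sup>2" s t "c\<^sup>2"] by simp_all
  qed
  have di: "set_integrable lborel {s..t} (\<lambda>r. (f r - g r)\<^sup>2)"
  proof (rule bounded_set_integrable[where c = "(b + c)\<^sup>2"])
    fix r assume r: "r \<in> {s..t}"
    have "\<bar>f r - g r\<bar> \<le> b + c" using fb[OF r] gc[OF r] by linarith
    then show "\<bar>(f r - g r)\<^sup>2\<bar> \<le> (b + c)\<^sup>2" using power_mono[of "\<bar>f r - g r\<bar>" "b + c" 2] by simp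
  qed (use f g st in auto)
  have "ennreal (LINT r:{s..t}|lborel. (f r - g r)\<^sup>2) = (\<integral>\<^sup>+r. ennreal (indicator {s..t} r * (f r - g r)\<^sup>2) \<partial>lborel)"
    using di unfolding set_integrable_def set_lebesgue_integral_def by (subst nn_integral_eq_integral) auto
  also have "\<dots> \<le> (\<integral>\<^sup>+r\<in>{0..t}. ennreal ((f r - g r)\<^sup>2) \<partial>lborel)"
    using st by (intro nn_integral_mono) (auto simp: indicator_def)
  also have "\<dots> \<le> ennreal e" by (rule ni)
  finally have de: "(LINT r:{s..t}|lborel. (f r - g r)\<^sup>2) \<le> e" using e by (simp add: ennreal_le_iff)
  have ptw: "\<bar>(f r)\<^sup>2 - (g r)\<^sup>2\<bar> \<le> c * \<theta> + (c / \<theta> + 1) * (f r - g r)\<^sup>2" if r: "r \<in> {s..t}" for r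
  proof -
    define d where "d = f r - g r"
    have "(f r)\<^sup>2 - (g r)\<^sup>2 = 2 * g r * d + d\<^sup>2" by (simp add: d_def power2_eq_square algebra_simps)
    then have "\<bar>(f r)\<^sup>2 - (g r)\<^sup>2\<bar> \<le> 2 * \<bar>g r\<bar> * \<bar>d\<bar> + d\<^sup>2"
      using abs_triangle_ineq[of "2 * g r * d" "d\<^sup>2"] by (simp add: abs_mult)
    also have "2 * \<bar>g r\<bar> * \<bar>d\<bar> \<le> 2 * c * \<bar>d\<bar>" using gc[OF r] by (intro mult_right_mono) auto
    also have "2 * c * \<bar>d\<bar> \<le> c * (\<theta> + d\<^sup>2 / \<theta>)"
    proof -
      have "2 * \<theta> * \<bar>d\<bar> \<le> \<theta>\<^sup>2 + \<bar>d\<bar>\<^sup>2" by (rule sum_squares_bound)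
      then have "2 * \<bar>d\<bar> \<le> \<theta> + d\<^sup>2 / \<theta>" using \<theta>(1) by (simp add: field_simps power2_eq_square)
      then have "c * (2 * \<bar>d\<bar>) \<le> c * (\<theta> + d\<^sup>2 / \<theta>)" using e by (intro mult_left_mono) auto
      then show ?thesis by simp
    qed
    finally show ?thesis by (simp add: d_def algebra_simps)
  qed
  have "\<bar>(LINT r:{s..t}|lborel. (f r)\<^sup>2) - (LINT r:{s..t}|lborel. (g r)\<^sup>2)\<bar> = \<bar>LINT r:{s..t}|lborel. (f r)\<^sup>2 - (g r)\<^sup>2\<bar>"
    by (simp add: set_integral_diff fi gi)
  also have "\<dots> \<le> (LINT r:{s..t}|lborel. \<bar>(f r)\<^sup>2 - (g r)\<^sup>2\<bar>)"
    using set_integral_norm_bound[OF set_integral_diff(1)[OF fi gi]] by simp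
  also have "\<dots> \<le> (LINT r:{s..t}|lborel. c * \<theta> + (c / \<theta> + 1) * (f r - g r)\<^sup>2)"
  proof (rule set_integral_mono)
    show "set_integrable lborel {s..t} (\<lambda>r. \<bar>(f r)\<^sup>2 - (g r)\<^sup>2\<bar>)"
      by (rule set_integrable_abs[OF set_integral_diff(1)[OF fi gi]])
    show "set_integrable lborel {s..t} (\<lambda>r. c * \<theta> + (c / \<theta> + 1) * (f r - g r)\<^sup>2)"
      using di by (intro set_integral_add set_integrable_const_Icc set_integrable_mult_right)
  qed (rule ptw)
  also have "\<dots> = c * \<theta> * (t - s) + (c / \<theta> + 1) * (LINT r:{s..t}|lborel. (f r - g r)\<^sup>2)"
  proof -
    have "(LINT r:{s..t}|lborel. c * \<theta> + (c / \<theta> + 1) * (f r - g r)\<^sup>2)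
        = (LINT r:{s..t}|lborel. c * \<theta>) + (LINT r:{s..t}|lborel. (c / \<theta> + 1) * (f r - g r)\<^sup>2)"
      using di by (intro set_integral_add(2) set_integrable_const_Icc set_integrable_mult_right)
    moreover have "(LINT r:{s..t}|lborel. c * \<theta>) = c * \<theta> * (t - s)"
      using st by (simp add: set_lebesgue_integral_def)
    ultimately show ?thesis by simp
  qed
  also have "\<dots> \<le> c * \<theta> * (t - s) + (c / \<theta> + 1) * e"
    using de \<theta> e by (intro add_left_mono mult_left_mono) auto
  also have "\<dots> = \<theta> * c * (t - s + 1) + e"
    using \<theta> by (simp add: field_simps flip: \<theta>(2))
  finally show ?thesis by (simp add: \<theta>_def)
qed

lemma simple_process_measurable: "(\<lambda>r. simple_process L r w) \<in> borel_measurable borel"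
  unfolding simple_process_def by (induction L) auto

lemma simple_process_bounded: "\<exists>b. \<forall>r. \<bar>simple_process L r w\<bar> \<le> b"
proof (induction L)
  case (Cons x L)
  then obtain b where b: "\<And>r. \<bar>simple_process L r w\<bar> \<le> b" by blast
  obtain a d \<xi> where x: "x = (a, d, \<xi>)" by (cases x)
  have "\<bar>simple_process (x # L) r w\<bar> \<le> \<bar>\<xi> w\<bar> + b" for r
    using b[of r] by (auto simp: x simple_process_def indicator_def)
  then show ?case by blast
qed (auto simp: simple_process_def)

lemma step_square_integral:
  fixes f :: "real \<Rightarrow> real"
  assumes p: "mono p" "p 0 = s" "p N = t" and f: "\<And>i r. i < N \<Longrightarrow> r \<in> {p i<..p (Suc i)} \<Longrightarrow> f r = z i"
    and fm: "f \<in> borel_measurable borel"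
  shows "(LINT r:{s..t}|lborel. (f r)\<^sup>2) = (\<Sum>i<N. (z i)\<^sup>2 * (p (Suc i) - p i))"
proof -
  have "has_bochner_integral lborel (\<lambda>r. indicator {s<..p n} r * (f r)\<^sup>2) (\<Sum>i<n. (z i)\<^sup>2 * (p (Suc i) - p i))"
    if "n \<le> N" for n
    using that
  proof (induction n)
    case (Suc n)
    have le: "p n \<le> p (Suc n)" "s \<le> p n" using monoD[OF p(1), of n "Suc n"] monoD[OF p(1), of 0 n] p(2) by auto
    have "has_bochner_integral lborel (\<lambda>r. (z n)\<^sup>2 * indicator {p n<..p (Suc n)} r) ((z n)\<^sup>2 * (p (Suc n) - p n))"
      using le has_bochner_integral_real_indicator[of "{p n<..p (Suc n)}" lborel]
      by (intro has_bochner_integral_mult_right) (simp add: emeasure_lborel_Ioc)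
    from has_bochner_integral_add[OF Suc.IH this] Suc.prems
    have "has_bochner_integral lborel (\<lambda>r. indicator {s<..p n} r * (f r)\<^sup>2 + (z n)\<^sup>2 * indicator {p n<..p (Suc n)} r)
       (\<Sum>i<Suc n. (z i)\<^sup>2 * (p (Suc i) - p i))" by simp
    moreover have "indicator {s<..p n} r * (f r)\<^sup>2 + (z n)\<^sup>2 * indicator {p n<..p (Suc n)} r = indicator {s<..p (Suc n)} r * (f r)\<^sup>2" for r
      using f[of n r] Suc.prems le by (auto simp: indicator_def)
    ultimately show ?case by simp
  qed (simp add: p(2) has_bochner_integral_zero)
  from this[of N] have "has_bochner_integral lborel (\<lambda>r. indicator {s<..t} r * (f r)\<^sup>2) (\<Sum>i<N. (z i)\<^sup>2 * (p (Suc i) - p i))"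
    by (simp add: p(3))
  then have "(\<integral>r. indicator {s<..t} r * (f r)\<^sup>2 \<partial>lborel) = (\<Sum>i<N. (z i)\<^sup>2 * (p (Suc i) - p i))"
    by (rule has_bochner_integral_integral_eq)
  moreover have "(LINT r:{s..t}|lborel. (f r)\<^sup>2) = (\<integral>r. indicator {s<..t} r * (f r)\<^sup>2 \<partial>lborel)"
    unfolding set_lebesgue_integral_def
  proof (rule integral_cong_AE)
    show "AE r in lborel. indicator {s..t} r *\<^sub>R (f r)\<^sup>2 = indicator {s<..t} r * (f r)\<^sup>2"
      using AE_lborel_singleton[of s] by eventually_elim (auto simp: indicator_def)
  qed (use fm in auto)
  ultimately show ?thesis by simp
qed

section \<open>Moments of Ito integrals over a time window\<close>

definition (in filtered_space) ito_approximant :: "(real \<Rightarrow> 'w \<Rightarrow> real) \<Rightarrow> (real \<Rightarrow> 'w \<Rightarrow> real) \<Rightarrow>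
    (real \<Rightarrow> 'w \<Rightarrow> real) \<Rightarrow> real \<Rightarrow> real \<Rightarrow> 'w simple_integrand \<Rightarrow> 'w set \<Rightarrow> bool" where
  "ito_approximant B H I t e L A \<longleftrightarrow> simple_integrand F L \<and> A \<in> sets M \<and> prob A < e \<and>
    (\<forall>w\<in>space M - A. (\<integral>\<^sup>+r\<in>{0..t}. ennreal ((simple_process L r w - H r w)\<^sup>2) \<partial>lborel) \<le> ennreal e \<and>
      (\<forall>r\<in>{0..t}. \<bar>simple_integral B L r w - I r w\<bar> \<le> e))"

lemma (in filtered_space) ito_approximation:
  assumes I: "ito_integral M F B H I" and t: "0 < t" and e: "0 < e"
  shows "\<exists>L A. ito_approximant B H I t e L A"
proof -
  from I obtain L where L: "\<And>n. simple_integrand F (L n)"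
    and ev: "\<forall>T>0. \<forall>\<epsilon>>0. \<forall>\<^sub>F n in sequentially. \<exists>A\<in>sets M. prob A < \<epsilon> \<and>
      (\<forall>w\<in>space M - A. (\<integral>\<^sup>+r\<in>{0..T}. ennreal ((simple_process (L n) r w - H r w)\<^sup>2) \<partial>lborel) \<le> ennreal \<epsilon> \<and>
        (\<forall>r\<in>{0..T}. \<bar>simple_integral B (L n) r w - I r w\<bar> \<le> \<epsilon>))"
    unfolding ito_integral_def by (elim conjE exE) blast
  from eventually_happens'[OF sequentially_bot ev[rule_format, OF t e]] L show ?thesis
    unfolding ito_approximant_def by (elim exE bexE) blast
qed

text \<open>\<open>J\<close> and \<open>Q\<close> are measurable versions of the increment of the
  integral and of its bracket over the window. The budget \<open>R\<close> exceeds the bracket bound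
  \<open>c\<^sup>2 * (t - s)\<close> by the length of the window; this room absorbs the
  approximation error, so that the cutoff is inactive outside a small event.\<close>

locale ito_window = filtered_space M F for M :: "'w measure" and F +
  fixes K :: "'k set" and B H I :: "'k \<Rightarrow> real \<Rightarrow> 'w \<Rightarrow> real" and J Q :: "'k \<Rightarrow> 'w \<Rightarrow> real"
    and s t c b R :: real
  assumes K: "finite K" and B: "\<And>k. k \<in> K \<Longrightarrow> brownian_motion M F (B k)"
    and ito: "\<And>k. k \<in> K \<Longrightarrow> ito_integral M F (B k) (H k) (I k)"
    and st: "0 \<le> s" "s < t" and c: "0 \<le> c"
    and H_bound: "\<And>k. k \<in> K \<Longrightarrow> AE w in M. \<forall>r\<in>{s..t}. \<bar>H k r w\<bar> \<le> c"
    and J_meas: "\<And>k. k \<in> K \<Longrightarrow> J k \<in> borel_measurable M"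
    and J_eq: "\<And>k. k \<in> K \<Longrightarrow> AE w in M. J k w = I k t w - I k s w"
    and J_bound: "\<And>k. k \<in> K \<Longrightarrow> AE w in M. \<bar>J k w\<bar> \<le> b"
    and Q_meas: "\<And>k. k \<in> K \<Longrightarrow> Q k \<in> borel_measurable M"
    and Q_eq: "\<And>k. k \<in> K \<Longrightarrow> AE w in M. Q k w = (LINT r:{s..t}|lborel. (H k r w)\<^sup>2)"
    and R: "R = (c\<^sup>2 + 1) * (t - s)"
begin

definition approximates :: "real \<Rightarrow> nat \<Rightarrow> (nat \<Rightarrow> real) \<Rightarrow> ('k \<Rightarrow> nat \<Rightarrow> 'w \<Rightarrow> real) \<Rightarrow> bool" where
  "approximates \<epsilon> N p \<zeta> \<longleftrightarrow> p 0 = s \<and> (\<forall>k\<in>K. step_integrand p (\<zeta> k) \<and> (\<forall>w. qvar p (\<zeta> k) N w \<le> R) \<and>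
    expectation (\<lambda>w. (mtrans (B k) p (\<zeta> k) N w - J k w)\<^sup>2) \<le> \<epsilon> \<and>
    \<bar>expectation (qvar p (\<zeta> k) N) - expectation (Q k)\<bar> \<le> \<epsilon>)"

lemma approximatesD:
  assumes "approximates \<epsilon> N p \<zeta>"
  shows "p 0 = s" "k \<in> K \<Longrightarrow> step_integrand p (\<zeta> k)" "k \<in> K \<Longrightarrow> qvar p (\<zeta> k) N w \<le> R"
    "k \<in> K \<Longrightarrow> expectation (\<lambda>w. (mtrans (B k) p (\<zeta> k) N w - J k w)\<^sup>2) \<le> \<epsilon>"
    "k \<in> K \<Longrightarrow> \<bar>expectation (qvar p (\<zeta> k) N) - expectation (Q k)\<bar> \<le> \<epsilon>"
  using assms by (auto simp: approximates_def)

text \<open>Convergence in probability of the simple integrals becomes convergence in mean square: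
  the budget gives a fourth-moment bound uniform in the approximation, hence uniform integrability
  of the squared errors.\<close>

lemma approximation:
  assumes \<epsilon>: "0 < \<epsilon>"
  shows "\<exists>N p \<zeta>. approximates \<epsilon> N p \<zeta>"
proof -
  have R0: "0 < R" using st by (simp add: R add_nonneg_pos)
  \<comment> \<open>Bounds the fourth moment of the error: \<open>mtrans_fourth\<close> gives
    \<open>3 * R\<^sup>2\<close> for the transform, \<open>J\<close> is bounded by \<open>b\<close>,
    and (x - y)^4 is at most 8 (x^4 + y^4).\<close>
  define C4 where "C4 = 8 * (3 * R\<^sup>2 + b ^ 4)"
  have C4: "0 \<le> C4" by (simp add: C4_def)
  \<comment> \<open>The squared error is at most \<kappa> or at most its own square divided by
    \<kappa>; this level makes the second alternative cost at most half of \<epsilon>.\<close>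
  define \<kappa> where "\<kappa> = 2 * C4 / \<epsilon> + 1"
  have \<kappa>: "0 < \<kappa>" "C4 / \<kappa> \<le> \<epsilon> / 2"
  proof -
    show 1: "0 < \<kappa>" using C4 \<epsilon> by (simp add: \<kappa>_def add_nonneg_pos)
    have "C4 \<le> \<epsilon> / 2 * \<kappa>" using \<epsilon> by (simp add: \<kappa>_def field_simps)
    then show "C4 / \<kappa> \<le> \<epsilon> / 2" using 1 by (simp add: divide_le_eq)
  qed
  have t1: "((\<lambda>e. 4 * e\<^sup>2 + \<kappa> * e) \<longlongrightarrow> 4 * 0\<^sup>2 + \<kappa> * 0) (at_right 0)"
    and t2: "((\<lambda>e. sqrt e * c * (t - s + 1) + e) \<longlongrightarrow> sqrt 0 * c * (t - s + 1) + 0) (at_right 0)"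
    and t3: "((\<lambda>e. 2 * R * e) \<longlongrightarrow> 2 * R * 0) (at_right 0)"
    by (intro tendsto_intros)+
  have "\<forall>\<^sub>F e in at_right 0. 4 * e\<^sup>2 + \<kappa> * e < \<epsilon> / 2"
    "\<forall>\<^sub>F e in at_right 0. sqrt e * c * (t - s + 1) + e < min (t - s) (\<epsilon> / 2)"
    "\<forall>\<^sub>F e in at_right 0. 2 * R * e < \<epsilon> / 2" "\<forall>\<^sub>F e::real in at_right 0. 0 < e"
    using order_tendstoD(2)[OF t1, of "\<epsilon> / 2"] order_tendstoD(2)[OF t2, of "min (t - s) (\<epsilon> / 2)"]
      order_tendstoD(2)[OF t3, of "\<epsilon> / 2"] \<epsilon> st by (auto simp: eventually_at_right_less)
  then have "\<forall>\<^sub>F e in at_right 0. 4 * e\<^sup>2 + \<kappa> * e < \<epsilon> / 2 \<and> sqrt e * c * (t - s + 1) + e < min (t - s) (\<epsilon> / 2)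
      \<and> 2 * R * e < \<epsilon> / 2 \<and> 0 < e"
    by eventually_elim auto
  then obtain e where e: "4 * e\<^sup>2 + \<kappa> * e < \<epsilon> / 2" "sqrt e * c * (t - s + 1) + e < min (t - s) (\<epsilon> / 2)"
      "2 * R * e < \<epsilon> / 2" "0 < e"
    using eventually_happens'[OF trivial_limit_at_right_real] by blast
  define good where "good k L A \<longleftrightarrow> ito_approximant (B k) (H k) (I k) t e L A" for k L A
  have "\<forall>k\<in>K. \<exists>LA. good k (fst LA) (snd LA)"
    using ito_approximation[OF ito _ e(4), of _ t] st by (auto simp: good_def)
  from bchoice[OF this] obtain LA where LA: "\<forall>k\<in>K. good k (fst (LA k)) (snd (LA k))" by (elim exE)
  define L where "L k = fst (LA k)" for k
  define A where "A k = snd (LA k)" for k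
  have LA: "good k (L k) (A k)" if "k \<in> K" for k using LA that by (simp add: L_def A_def)
  have Ls: "simple_integrand F (L k)" if "k \<in> K" for k using LA[OF that] by (simp add: good_def ito_approximant_def)
  have "\<exists>p N \<zeta>. mono p \<and> p 0 = s \<and> p N = t \<and> (\<forall>k\<in>K. represents p N (\<zeta> k) s t (L k))"
    by (rule simple_partition[OF K Ls st])
  then obtain p N \<zeta> where p: "mono p" "p 0 = s" "p N = t"
    and "\<forall>k\<in>K. represents p N (\<zeta> k) s t (L k)"
    by (elim exE conjE)
  then have rep: "k \<in> K \<Longrightarrow> represents p N (\<zeta> k) s t (L k)" for k by blast
  note step = representsD(1)[OF rep] and int = representsD(2)[OF rep] and proc = representsD(3)[OF rep]
  define \<zeta>' where "\<zeta>' k = budget_stop R p (\<zeta> k)" for k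
  have step': "step_integrand p (\<zeta>' k)" if "k \<in> K" for k
    unfolding \<zeta>'_def by (rule step_integrand_budget_stop[OF step[OF that]])
  have budget: "qvar p (\<zeta>' k) n w \<le> R" for k n w
    unfolding \<zeta>'_def by (rule qvar_budget_stop_le[OF p(1) less_imp_le[OF R0]])
  have q0: "0 \<le> qvar p (\<zeta>' k) n w" for k n w
    unfolding qvar_def using p(1) by (intro sum_nonneg mult_nonneg_nonneg) (auto simp: mono_def)
  have main: "expectation (\<lambda>w. (mtrans (B k) p (\<zeta>' k) N w - J k w)\<^sup>2) \<le> \<epsilon> \<and>
      \<bar>expectation (qvar p (\<zeta>' k) N) - expectation (Q k)\<bar> \<le> \<epsilon>" if k: "k \<in> K" for k
  proof -
    let ?M = "mtrans (B k) p (\<zeta>' k) N" and ?V = "qvar p (\<zeta>' k) N"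
    have Am: "A k \<in> sets M" and PA: "prob (A k) < e" using LA[OF k] by (auto simp: good_def ito_approximant_def)
    have Hm: "AE w in M. (\<lambda>r. H k r w) \<in> borel_measurable (restrict_space borel {0..})"
      using ito[OF k] by (simp add: ito_integral_def)
    have Qb: "AE w in M. 0 \<le> Q k w \<and> Q k w \<le> c\<^sup>2 * (t - s)"
      using Hm H_bound[OF k] Q_eq[OF k]
    proof eventually_elim
      case (elim w)
      have sq: "(H k r w)\<^sup>2 \<le> c\<^sup>2" if "r \<in> {s..t}" for r
        using power_mono[of "\<bar>H k r w\<bar>" c 2] elim(2) that by auto
      have "set_integrable lborel {s..t} (\<lambda>r. (H k r w)\<^sup>2)"
        using elim(1) st sq by (intro bounded_set_integrable[where c = "c\<^sup>2"]) auto
      then have "(LINT r:{s..t}|lborel. (H k r w)\<^sup>2) \<le> (LINT r:{s..t}|lborel. c\<^sup>2)"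
        using sq by (intro set_integral_mono set_integrable_const_Icc)
      moreover have "(LINT r:{s..t}|lborel. c\<^sup>2) = c\<^sup>2 * (t - s)"
        using st by (simp add: set_lebesgue_integral_def)
      moreover have "0 \<le> (LINT r:{s..t}|lborel. (H k r w)\<^sup>2)"
        unfolding set_lebesgue_integral_def by (intro Bochner_Integration.integral_nonneg) auto
      ultimately show ?case using elim(3) by simp
    qed
    have close: "AE w in M. w \<notin> A k \<longrightarrow> \<bar>?M w - J k w\<bar> \<le> 2 * e \<and> \<bar>?V w - Q k w\<bar> \<le> \<epsilon> / 2"
      using Hm H_bound[OF k] Q_eq[OF k] J_eq[OF k] Qb AE_space
    proof eventually_elim
      case (elim w)
      show ?case
      proof
        assume nA: "w \<notin> A k"
        then have ni: "(\<integral>\<^sup>+r\<in>{0..t}. ennreal ((simple_process (L k) r w - H k r w)\<^sup>2) \<partial>lborel) \<le> ennreal e"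
          and si: "\<And>r. r \<in> {0..t} \<Longrightarrow> \<bar>simple_integral (B k) (L k) r w - I k r w\<bar> \<le> e"
          using LA[OF k] elim(6) by (auto simp: good_def ito_approximant_def)
        obtain bb where bb: "\<And>r. \<bar>simple_process (L k) r w\<bar> \<le> bb"
          using simple_process_bounded by metis
        have "(LINT r:{s..t}|lborel. (simple_process (L k) r w)\<^sup>2) = qvar p (\<zeta> k) N w"
          unfolding qvar_def by (rule step_square_integral[OF p]) (auto intro: proc[OF k] simple_process_measurable)
        moreover have "\<bar>(LINT r:{s..t}|lborel. (simple_process (L k) r w)\<^sup>2) - (LINT r:{s..t}|lborel. (H k r w)\<^sup>2)\<bar>
            \<le> sqrt e * c * (t - s + 1) + e"
          using elim(2) bb
          by (intro square_integral_close[OF measurable_restrict_space1[OF simple_process_measurable] elim(1)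
              st(1) less_imp_le[OF st(2)] _ _ e(4) c ni, of bb]) auto
        \<comment> \<open>Off the exceptional event the bracket misses its limit by at most
          \<open>t - s\<close>, so it stays within the budget and the cutoff changes
          nothing.\<close>
        ultimately have qc: "\<bar>qvar p (\<zeta> k) N w - Q k w\<bar> \<le> min (t - s) (\<epsilon> / 2)"
          using e(2) elim(3) by simp
        then have qR: "qvar p (\<zeta> k) N w \<le> R" using elim(5) by (auto simp: R algebra_simps)
        note eq = budget_stop_eq[OF p(1) qR, folded \<zeta>'_def]
        have "\<bar>mtrans (B k) p (\<zeta> k) N w - J k w\<bar> \<le> 2 * e"
          using si[of s] si[of t] st elim(4) by (simp add: int[OF k, symmetric])
        then show "\<bar>?M w - J k w\<bar> \<le> 2 * e \<and> \<bar>?V w - Q k w\<bar> \<le> \<epsilon> / 2"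
          using qc by (simp add: eq)
      qed
    qed
    have Mm: "?M \<in> borel_measurable M" by (rule mtrans_measurable[OF B[OF k] step'[OF k]])
    note Mi = mtrans_moment_integrable[OF B[OF k] step'[OF k], of N]
    define D where "D w = ?M w - J k w" for w
    have [measurable]: "D \<in> borel_measurable M" unfolding D_def using Mm J_meas[OF k] by auto
    have D4b: "AE w in M. D w ^ 4 \<le> 8 * (?M w ^ 4 + b ^ 4)"
      using J_bound[OF k]
    proof eventually_elim
      case (elim w)
      have "(D w)\<^sup>2 \<le> 2 * (?M w)\<^sup>2 + 2 * (J k w)\<^sup>2"
        using zero_le_power2[of "?M w + J k w"] by (simp add: D_def power2_sum power2_diff)
      then have "((D w)\<^sup>2)\<^sup>2 \<le> (2 * (?M w)\<^sup>2 + 2 * (J k w)\<^sup>2)\<^sup>2" by (intro power_mono) auto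
      also have "\<dots> \<le> 8 * (((?M w)\<^sup>2)\<^sup>2 + ((J k w)\<^sup>2)\<^sup>2)"
        using zero_le_power2[of "(?M w)\<^sup>2 - (J k w)\<^sup>2"] by (simp add: power2_sum power2_diff)
      finally have "D w ^ 4 \<le> 8 * (?M w ^ 4 + J k w ^ 4)" by (simp flip: power_mult)
      moreover have "J k w ^ 4 \<le> b ^ 4" using power_mono[OF elim, of 4] by (simp add: power_even_abs)
      ultimately show ?case by simp
    qed
    have i8: "integrable M (\<lambda>w. 8 * (?M w ^ 4 + b ^ 4))" using Mi[of 4] by auto
    have D4i: "integrable M (\<lambda>w. D w ^ 4)"
      by (rule Bochner_Integration.integrable_bound[OF i8]) (use D4b in auto)
    have "expectation (\<lambda>w. D w ^ 4) \<le> expectation (\<lambda>w. 8 * (?M w ^ 4 + b ^ 4))"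
      by (rule integral_mono_AE[OF D4i i8 D4b])
    also have "\<dots> = 8 * (expectation (\<lambda>w. ?M w ^ 4) + b ^ 4)" using Mi[of 4] by (simp add: prob_space)
    also have "\<dots> \<le> C4"
      using mtrans_fourth[OF B[OF k] step'[OF k] budget] by (simp add: C4_def)
    finally have ED4: "expectation (\<lambda>w. D w ^ 4) \<le> C4" .
    have ptw: "AE w in M. (D w)\<^sup>2 \<le> 4 * e\<^sup>2 + (\<kappa> * indicator (A k) w + D w ^ 4 / \<kappa>)"
      using close
    proof eventually_elim
      case (elim w)
      have nn: "0 \<le> D w ^ 4 / \<kappa>" using \<kappa>(1) by simp
      show ?case
      proof (cases "w \<in> A k")
        case True
        show ?thesis
        proof (cases "(D w)\<^sup>2 \<le> \<kappa>")
          case False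
          then have "\<kappa> * (D w)\<^sup>2 \<le> (D w)\<^sup>2 * (D w)\<^sup>2" by (intro mult_right_mono) auto
          then have "(D w)\<^sup>2 \<le> D w ^ 4 / \<kappa>" using \<kappa>(1)
            by (simp add: le_divide_eq mult.commute flip: power_add)
          then show ?thesis using True \<kappa>(1) by (simp add: add_nonneg_nonneg add_increasing)
        qed (use True nn in \<open>simp add: add_increasing add_increasing2\<close>)
      next
        case False
        then have "\<bar>D w\<bar> \<le> 2 * e" using elim by (simp add: D_def)
        then have "(D w)\<^sup>2 \<le> 4 * e\<^sup>2" using power_mono[of "\<bar>D w\<bar>" "2 * e" 2] by (simp add: power_mult_distrib)
        then show ?thesis using False nn by simp
      qed
    qed
    have ri: "integrable M (\<lambda>w. 4 * e\<^sup>2 + (\<kappa> * indicator (A k) w + D w ^ 4 / \<kappa>))"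
      using D4i Am by (intro Bochner_Integration.integrable_add integrable_const integrable_mult_right
          integrable_divide_zero integrable_real_indicator) (auto simp: emeasure_eq_measure)
    have D2i: "integrable M (\<lambda>w. (D w)\<^sup>2)"
      by (rule Bochner_Integration.integrable_bound[OF ri]) (use ptw in auto)
    have "expectation (\<lambda>w. (D w)\<^sup>2) \<le> expectation (\<lambda>w. 4 * e\<^sup>2 + (\<kappa> * indicator (A k) w + D w ^ 4 / \<kappa>))"
      by (rule integral_mono_AE[OF D2i ri ptw])
    also have "\<dots> = 4 * e\<^sup>2 + (\<kappa> * prob (A k) + expectation (\<lambda>w. D w ^ 4) / \<kappa>)"
      using D4i Am by (subst Bochner_Integration.integral_add;
        (intro Bochner_Integration.integrable_add integrable_mult_right integrable_divide_zero integrable_real_indicator)?;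
        (simp add: prob_space emeasure_eq_measure)?)+
    also have "\<dots> \<le> 4 * e\<^sup>2 + (\<kappa> * e + C4 / \<kappa>)"
      using PA ED4 \<kappa>(1) by (intro add_left_mono add_mono mult_left_mono divide_right_mono) auto
    also have "\<dots> \<le> \<epsilon>" using e(1) \<kappa>(2) by linarith
    finally have first: "expectation (\<lambda>w. (?M w - J k w)\<^sup>2) \<le> \<epsilon>" by (simp add: D_def)
    have Vi: "integrable M ?V" by (rule integrable_bounded_rv[OF bounded_rv_qvar[OF step'[OF k]]])
    have Qi: "integrable M (Q k)"
      using Qb Q_meas[OF k] by (intro integrable_const_bound[where B = "c\<^sup>2 * (t - s)"]) (auto elim: eventually_mono)
    have ptv: "AE w in M. \<bar>?V w - Q k w\<bar> \<le> \<epsilon> / 2 + 2 * R * indicator (A k) w"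
      using close Qb
    proof eventually_elim
      case (elim w)
      have "Q k w \<le> R" using elim(2) st by (simp add: R algebra_simps)
      then have "\<bar>?V w - Q k w\<bar> \<le> 2 * R" using q0[of k N w] budget[of k N w] elim(2) by (simp add: abs_le_iff)
      then show ?case using elim(1) \<epsilon> by (cases "w \<in> A k") auto
    qed
    have "\<bar>expectation ?V - expectation (Q k)\<bar> = \<bar>expectation (\<lambda>w. ?V w - Q k w)\<bar>" using Vi Qi by simp
    also have "\<dots> \<le> expectation (\<lambda>w. \<bar>?V w - Q k w\<bar>)" by (rule integral_abs_bound)
    also have "\<dots> \<le> expectation (\<lambda>w. \<epsilon> / 2 + 2 * R * indicator (A k) w)"
      using Vi Qi Am ptv
      by (intro integral_mono_AE integrable_abs Bochner_Integration.integrable_add Bochner_Integration.integrable_diff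
          integrable_const integrable_mult_right integrable_real_indicator) (auto simp: emeasure_eq_measure)
    also have "\<dots> = \<epsilon> / 2 + 2 * R * prob (A k)"
    proof -
      have "integrable M (\<lambda>w. 2 * R * indicat_real (A k) w)"
        using Am by (intro integrable_mult_right integrable_real_indicator) (auto simp: emeasure_eq_measure)
      then show ?thesis using Am by (subst Bochner_Integration.integral_add) (auto simp: prob_space)
    qed
    also have "\<dots> \<le> \<epsilon> / 2 + 2 * R * e" using PA R0 by (intro add_left_mono mult_left_mono) auto
    also have "\<dots> \<le> \<epsilon>" using e(3) by simp
    finally show ?thesis using first by simp
  qed
  show ?thesis
    by (intro exI[of _ N] exI[of _ p] exI[of _ \<zeta>']) (simp add: approximates_def p(2) step' budget main)
qed

lemma J_integrable:
  assumes k: "k \<in> K"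
  shows "integrable M (\<lambda>w. J k w ^ n)" "integrable M (J k)"
proof -
  show *: "integrable M (\<lambda>w. J k w ^ n)" for n
  proof (rule integrable_const_bound[where B = "b ^ n"])
    show "AE w in M. norm (J k w ^ n) \<le> b ^ n"
      using J_bound[OF k] by eventually_elim (simp add: power_abs power_mono)
  qed (use J_meas[OF k] in auto)
  show "integrable M (J k)" using *[of 1] by simp
qed

lemma b_nonneg:
  assumes k: "k \<in> K"
  shows "0 \<le> b"
proof -
  have "AE w in M. 0 \<le> b" using J_bound[OF k] by eventually_elim linarith
  then show ?thesis by simp
qed

lemma error_le_zero:
  fixes x a c' :: real
  assumes "\<And>\<epsilon>. 0 < \<epsilon> \<Longrightarrow> x \<le> a * sqrt \<epsilon> + c' * \<epsilon>"
  shows "x \<le> 0"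
proof -
  have "((\<lambda>\<epsilon>. a * sqrt \<epsilon> + c' * \<epsilon>) \<longlongrightarrow> a * sqrt 0 + c' * 0) (at_right 0)"
    by (intro tendsto_intros)
  moreover have "\<forall>\<^sub>F \<epsilon> in at_right 0. x \<le> a * sqrt \<epsilon> + c' * \<epsilon>"
    using eventually_at_right_less[of "0::real"] by eventually_elim (rule assms)
  ultimately have "x \<le> a * sqrt 0 + c' * 0"
    by (rule tendsto_lowerbound) simp
  then show ?thesis by simp
qed

lemma difference_moments:
  assumes k: "k \<in> K" and s: "step_integrand p \<zeta>" and e: "expectation (\<lambda>w. (mtrans (B k) p \<zeta> N w - J k w)\<^sup>2) \<le> \<epsilon>"
  defines "D \<equiv> \<lambda>w. mtrans (B k) p \<zeta> N w - J k w"
  shows "D \<in> borel_measurable M" "integrable M (\<lambda>w. (D w)\<^sup>2)" "integrable M D" "expectation (\<lambda>w. \<bar>D w\<bar>) \<le> sqrt \<epsilon>"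
proof -
  note m = mtrans_measurable[OF B[OF k] s, of N] and mi = mtrans_moment_integrable[OF B[OF k] s, of N]
  show Dm: "D \<in> borel_measurable M" unfolding D_def using m J_meas[OF k] by auto
  have "integrable M (\<lambda>w. mtrans (B k) p \<zeta> N w * J k w)"
    by (intro integrable_mult_square mi J_integrable k m J_meas)
  then show D2: "integrable M (\<lambda>w. (D w)\<^sup>2)"
    unfolding D_def power2_diff using mi[of 2] J_integrable(1)[OF k, of 2] by (simp add: mult.assoc)
  show "integrable M D" by (rule abs_expectation_le_sqrt(1)[OF Dm D2])
  have "expectation (\<lambda>w. \<bar>D w\<bar>) \<le> sqrt (expectation (\<lambda>w. (D w)\<^sup>2))" by (rule abs_expectation_le_sqrt(2)[OF Dm D2])
  also have "\<dots> \<le> sqrt \<epsilon>" using e by (simp add: D_def)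
  finally show "expectation (\<lambda>w. \<bar>D w\<bar>) \<le> sqrt \<epsilon>" .
qed

lemma expectation_bounded_mult_le:
  fixes Z Y :: "'w \<Rightarrow> real"
  assumes Z: "Z \<in> borel_measurable M" "AE w in M. \<bar>Z w\<bar> \<le> C" and Y: "integrable M Y"
  shows "\<bar>expectation (\<lambda>w. Z w * Y w)\<bar> \<le> C * expectation (\<lambda>w. \<bar>Y w\<bar>)"
proof -
  have "\<bar>expectation (\<lambda>w. Z w * Y w)\<bar> \<le> expectation (\<lambda>w. C * \<bar>Y w\<bar>)"
  proof (rule order.trans[OF integral_abs_bound integral_mono_AE])
    show "integrable M (\<lambda>w. \<bar>Z w * Y w\<bar>)" by (intro integrable_abs integrable_bounded_mult[OF Y Z])
    show "AE w in M. \<bar>Z w * Y w\<bar> \<le> C * \<bar>Y w\<bar>"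
      using Z(2) by eventually_elim (auto simp: abs_mult intro: mult_right_mono)
  qed (use Y in auto)
  then show ?thesis by simp
qed

lemma J_centred:
  assumes k: "k \<in> K" and Z: "Z \<in> borel_measurable (F s)" "AE w in M. \<bar>Z w\<bar> \<le> C"
  shows "expectation (\<lambda>w. Z w * J k w) = 0"
proof -
  have Zm: "Z \<in> borel_measurable M" by (rule adapted_measurable[OF Z(1)])
  have C0: "0 \<le> C" by (rule AE_bound_nonneg[OF Z(2)])
  have "\<bar>expectation (\<lambda>w. Z w * J k w)\<bar> \<le> C * sqrt \<epsilon> + 0 * \<epsilon>" if \<epsilon>: "0 < \<epsilon>" for \<epsilon>
  proof -
    from approximation[OF \<epsilon>] obtain N p \<zeta> where ap: "approximates \<epsilon> N p \<zeta>" by (elim exE)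
    note p = approximatesD(1,2)[OF ap] and e = approximatesD(4)[OF ap]
    note d = difference_moments[OF k p(2)[OF k] e[OF k]]
    let ?M = "mtrans (B k) p (\<zeta> k) N"
    have "integrable M (\<lambda>w. Z w * (?M w - J k w))" "integrable M (\<lambda>w. Z w * J k w)"
      by (intro integrable_bounded_mult[OF _ Zm Z(2)] d J_integrable(2)[OF k])+
    then have "expectation (\<lambda>w. Z w * (?M w - J k w) + Z w * J k w)
        = expectation (\<lambda>w. Z w * (?M w - J k w)) + expectation (\<lambda>w. Z w * J k w)"
      by (rule Bochner_Integration.integral_add)
    moreover have "expectation (\<lambda>w. Z w * (?M w - J k w) + Z w * J k w) = 0"
      using mtrans_centred[OF B[OF k] p(2)[OF k], of Z C N] Z p(1) by (simp add: right_diff_distrib)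
    ultimately have "\<bar>expectation (\<lambda>w. Z w * J k w)\<bar> = \<bar>expectation (\<lambda>w. Z w * (?M w - J k w))\<bar>" by linarith
    also have "\<dots> \<le> C * expectation (\<lambda>w. \<bar>?M w - J k w\<bar>)" by (rule expectation_bounded_mult_le[OF Zm Z(2) d(3)])
    also have "\<dots> \<le> C * sqrt \<epsilon>" using d(4) C0 by (rule mult_left_mono)
    finally show ?thesis by simp
  qed
  then have "\<bar>expectation (\<lambda>w. Z w * J k w)\<bar> \<le> 0" by (rule error_le_zero)
  then show ?thesis by simp
qed

lemma J_square:
  assumes k: "k \<in> K"
  shows "expectation (\<lambda>w. (J k w)\<^sup>2) = expectation (Q k)"
proof -
  have "\<bar>expectation (\<lambda>w. (J k w)\<^sup>2) - expectation (Q k)\<bar> \<le> (2 * b) * sqrt \<epsilon> + 2 * \<epsilon>" if \<epsilon>: "0 < \<epsilon>" for \<epsilon>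
  proof -
    from approximation[OF \<epsilon>] obtain N p \<zeta> where ap: "approximates \<epsilon> N p \<zeta>" by (elim exE)
    note p = approximatesD(1,2)[OF ap] and e = approximatesD(4)[OF ap] and q = approximatesD(5)[OF ap]
    note d = difference_moments[OF k p(2)[OF k] e[OF k]]
    let ?M = "mtrans (B k) p (\<zeta> k) N"
    let ?D = "\<lambda>w. ?M w - J k w"
    have i: "integrable M (\<lambda>w. J k w * ?D w)"
      by (intro integrable_bounded_mult[OF d(3) J_meas[OF k] J_bound[OF k]])
    have "(\<lambda>w. (?M w)\<^sup>2) = (\<lambda>w. (J k w)\<^sup>2 + 2 * (J k w * ?D w) + (?D w)\<^sup>2)"
      by (simp add: fun_eq_iff power2_eq_square algebra_simps)
    then have "expectation (\<lambda>w. (?M w)\<^sup>2) = expectation (\<lambda>w. (J k w)\<^sup>2) + 2 * expectation (\<lambda>w. J k w * ?D w) + expectation (\<lambda>w. (?D w)\<^sup>2)"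
      using i d(2) J_integrable(1)[OF k, of 2] by simp
    moreover have "\<bar>expectation (\<lambda>w. J k w * ?D w)\<bar> \<le> b * sqrt \<epsilon>"
      using expectation_bounded_mult_le[OF J_meas[OF k] J_bound[OF k] d(3)] mult_left_mono[OF d(4) b_nonneg[OF k]] by linarith
    moreover have "0 \<le> expectation (\<lambda>w. (?D w)\<^sup>2)" by simp
    ultimately show ?thesis
      using mtrans_square[OF B[OF k] p(2)[OF k], of N] q[OF k] e[OF k] by linarith
  qed
  then have "\<bar>expectation (\<lambda>w. (J k w)\<^sup>2) - expectation (Q k)\<bar> \<le> 0" by (rule error_le_zero)
  then show ?thesis by simp
qed

text \<open>Convexity replaces convergence of fourth moments: the tangent line of x^4 at
  \<open>J\<close> bounds the fourth power of the transform from below, and the linear term vanishes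
  in the limit because it pairs the bounded cube of \<open>J\<close> with the error.\<close>

lemma J_fourth:
  assumes k: "k \<in> K"
  shows "expectation (\<lambda>w. J k w ^ 4) \<le> 3 * R\<^sup>2"
proof -
  have "expectation (\<lambda>w. J k w ^ 4) - 3 * R\<^sup>2 \<le> (4 * b ^ 3) * sqrt \<epsilon> + 0 * \<epsilon>" if \<epsilon>: "0 < \<epsilon>" for \<epsilon>
  proof -
    from approximation[OF \<epsilon>] obtain N p \<zeta> where ap: "approximates \<epsilon> N p \<zeta>" by (elim exE)
    note p = approximatesD(1,2)[OF ap] and r = approximatesD(3)[OF ap] and e = approximatesD(4)[OF ap]
    note d = difference_moments[OF k p(2)[OF k] e[OF k]]
    let ?M = "mtrans (B k) p (\<zeta> k) N"
    let ?D = "\<lambda>w. ?M w - J k w"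
    have J3: "(\<lambda>w. J k w ^ 3) \<in> borel_measurable M" "AE w in M. \<bar>J k w ^ 3\<bar> \<le> b ^ 3"
      using J_meas[OF k] J_bound[OF k] by (auto simp: power_abs intro!: power_mono elim!: eventually_mono)
    have i: "integrable M (\<lambda>w. J k w ^ 3 * ?D w)"
      by (intro integrable_bounded_mult[OF d(3) J3])
    have M4: "integrable M (\<lambda>w. ?M w ^ 4)" by (rule mtrans_moment_integrable[OF B[OF k] p(2)[OF k]])
    have young: "x ^ 4 \<le> 3 / 4 * x ^ 4 + 1 / 4 * y ^ 4 - x ^ 3 * (y - x)" for x y :: real
    proof -
      have "x ^ 3 * y = x\<^sup>2 * (x * y)" by (simp add: power2_eq_square power3_eq_cube)
      moreover have "2 * (x\<^sup>2 * (x * y)) \<le> (x\<^sup>2)\<^sup>2 + (x * y)\<^sup>2" using sum_squares_bound[of "x\<^sup>2" "x * y"] by simp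
      moreover have "2 * (x * y)\<^sup>2 \<le> (x\<^sup>2)\<^sup>2 + (y\<^sup>2)\<^sup>2" using sum_squares_bound[of "x\<^sup>2" "y\<^sup>2"] by (simp add: power_mult_distrib)
      ultimately have "4 * (x ^ 3 * y) \<le> 3 * (x\<^sup>2)\<^sup>2 + (y\<^sup>2)\<^sup>2" by linarith
      then have "4 * (x ^ 3 * y) \<le> 3 * x ^ 4 + y ^ 4"
        by (simp flip: power_mult)
      then show ?thesis by (simp add: right_diff_distrib power3_eq_cube power4_eq_xxxx)
    qed
    have "expectation (\<lambda>w. J k w ^ 4) \<le> expectation (\<lambda>w. 3 / 4 * J k w ^ 4 + 1 / 4 * ?M w ^ 4 - J k w ^ 3 * ?D w)"
      using i M4 J_integrable(1)[OF k, of 4] by (intro integral_mono young) auto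
    also have "\<dots> = 3 / 4 * expectation (\<lambda>w. J k w ^ 4) + 1 / 4 * expectation (\<lambda>w. ?M w ^ 4) - expectation (\<lambda>w. J k w ^ 3 * ?D w)"
      using i M4 J_integrable(1)[OF k, of 4] by simp
    finally have "expectation (\<lambda>w. J k w ^ 4) \<le> expectation (\<lambda>w. ?M w ^ 4) + 4 * \<bar>expectation (\<lambda>w. J k w ^ 3 * ?D w)\<bar>"
      by linarith
    moreover have "expectation (\<lambda>w. ?M w ^ 4) \<le> 3 * R\<^sup>2"
      by (rule mtrans_fourth[OF B[OF k] p(2)[OF k] r[OF k]])
    moreover have "\<bar>expectation (\<lambda>w. J k w ^ 3 * ?D w)\<bar> \<le> b ^ 3 * sqrt \<epsilon>"
      using expectation_bounded_mult_le[OF J3 d(3)] mult_left_mono[OF d(4), of "b ^ 3"] b_nonneg[OF k] by force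
    ultimately show ?thesis by linarith
  qed
  then have "expectation (\<lambda>w. J k w ^ 4) - 3 * R\<^sup>2 \<le> 0" by (rule error_le_zero)
  then show ?thesis by simp
qed

text \<open>The product of the transforms differs from the product of the integrals by terms that
  contain an error. Paired with a bounded \<open>J\<close> an error is of order
  \<open>sqrt \<epsilon>\<close>, and the product of two errors is of order \<epsilon>.\<close>

lemma J_orthogonal:
  assumes k: "k \<in> K" "l \<in> K" and o: "orthogonal_increments (B k) (B l)"
    and Z: "Z \<in> borel_measurable (F s)" "AE w in M. \<bar>Z w\<bar> \<le> C"
  shows "expectation (\<lambda>w. Z w * (J k w * J l w)) = 0"
proof -
  have Zm: "Z \<in> borel_measurable M" by (rule adapted_measurable[OF Z(1)])
  have C0: "0 \<le> C" by (rule AE_bound_nonneg[OF Z(2)])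
  have "\<bar>expectation (\<lambda>w. Z w * (J k w * J l w))\<bar> \<le> (C * (2 * b)) * sqrt \<epsilon> + C * \<epsilon>" if \<epsilon>: "0 < \<epsilon>" for \<epsilon>
  proof -
    from approximation[OF \<epsilon>] obtain N p \<zeta> where ap: "approximates \<epsilon> N p \<zeta>" by (elim exE)
    note p = approximatesD(1,2)[OF ap] and e = approximatesD(4)[OF ap]
    define D where "D k w = mtrans (B k) p (\<zeta> k) N w - J k w" for k w
    note d = difference_moments[OF k(1) p(2)[OF k(1)] e[OF k(1)], folded D_def]
    note d' = difference_moments[OF k(2) p(2)[OF k(2)] e[OF k(2)], folded D_def]
    have i1: "integrable M (\<lambda>w. J l w * D k w)" by (intro integrable_bounded_mult[OF d(3) J_meas[OF k(2)] J_bound[OF k(2)]])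
    have i2: "integrable M (\<lambda>w. J k w * D l w)" by (intro integrable_bounded_mult[OF d'(3) J_meas[OF k(1)] J_bound[OF k(1)]])
    have i3: "integrable M (\<lambda>w. D k w * D l w)" by (intro integrable_mult_square d d')
    define E where "E w = J l w * D k w + J k w * D l w + D k w * D l w" for w
    have Ei: "integrable M E" unfolding E_def using i1 i2 i3 by simp
    have Jkl: "integrable M (\<lambda>w. J k w * J l w)" by (intro integrable_mult_square J_integrable J_meas k)
    have "(\<lambda>w. Z w * (mtrans (B k) p (\<zeta> k) N w * mtrans (B l) p (\<zeta> l) N w)) = (\<lambda>w. Z w * (J k w * J l w) + Z w * E w)"
      by (simp add: fun_eq_iff E_def D_def algebra_simps)
    then have "expectation (\<lambda>w. Z w * (J k w * J l w)) = - expectation (\<lambda>w. Z w * E w)"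
      using mtrans_orthogonal[OF B[OF k(1)] B[OF k(2)] o p(2)[OF k(1)] p(2)[OF k(2)], of Z C N] Z p(1)
        integrable_bounded_mult[OF Ei Zm Z(2)] integrable_bounded_mult[OF Jkl Zm Z(2)] by simp
    then have "\<bar>expectation (\<lambda>w. Z w * (J k w * J l w))\<bar> \<le> C * expectation (\<lambda>w. \<bar>E w\<bar>)"
      using expectation_bounded_mult_le[OF Zm Z(2) Ei] by simp
    also have "expectation (\<lambda>w. \<bar>E w\<bar>) \<le> expectation (\<lambda>w. b * \<bar>D k w\<bar> + b * \<bar>D l w\<bar> + ((D k w)\<^sup>2 + (D l w)\<^sup>2) / 2)"
    proof (rule integral_mono_AE)
      show "AE w in M. \<bar>E w\<bar> \<le> b * \<bar>D k w\<bar> + b * \<bar>D l w\<bar> + ((D k w)\<^sup>2 + (D l w)\<^sup>2) / 2"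
        using J_bound[OF k(1)] J_bound[OF k(2)]
      proof eventually_elim
        case (elim w)
        have "\<bar>J l w * D k w\<bar> \<le> b * \<bar>D k w\<bar>" "\<bar>J k w * D l w\<bar> \<le> b * \<bar>D l w\<bar>"
          using elim by (auto simp: abs_mult intro: mult_right_mono)
        moreover have "\<bar>D k w * D l w\<bar> \<le> ((D k w)\<^sup>2 + (D l w)\<^sup>2) / 2"
          using sum_squares_bound[of "\<bar>D k w\<bar>" "\<bar>D l w\<bar>"] by (simp add: abs_mult)
        ultimately show ?case unfolding E_def by linarith
      qed
    qed (use Ei d d' in auto)
    also have "\<dots> = b * expectation (\<lambda>w. \<bar>D k w\<bar>) + b * expectation (\<lambda>w. \<bar>D l w\<bar>)
        + (expectation (\<lambda>w. (D k w)\<^sup>2) + expectation (\<lambda>w. (D l w)\<^sup>2)) / 2"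
      using d d' by simp
    also have "\<dots> \<le> b * sqrt \<epsilon> + b * sqrt \<epsilon> + (\<epsilon> + \<epsilon>) / 2"
      using d(4) d'(4) e[OF k(1)] e[OF k(2)] b_nonneg[OF k(1)]
      by (intro add_mono mult_left_mono divide_right_mono) (auto simp: D_def)
    finally have "\<bar>expectation (\<lambda>w. Z w * (J k w * J l w))\<bar> \<le> C * (b * sqrt \<epsilon> + b * sqrt \<epsilon> + (\<epsilon> + \<epsilon>) / 2)"
      using C0 by (simp add: mult_left_mono)
    then show ?thesis by (simp add: algebra_simps)
  qed
  then have "\<bar>expectation (\<lambda>w. Z w * (J k w * J l w))\<bar> \<le> 0" by (rule error_le_zero)
  then show ?thesis by simp
qed

end

section \<open>The annihilating branching model\<close>

lemma neighbours_sym: "i \<in> neighbours k \<longleftrightarrow> k \<in> neighbours i"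
  by (simp add: neighbours_def abs_minus_commute)

lemma card_neighbours: "card (neighbours (k :: 'd::finite site)) = card (neighbours (0 :: 'd site))"
proof -
  have "bij_betw (\<lambda>i. i + k) (neighbours 0) (neighbours k)"
    by (rule bij_betw_byWitness[where f' = "\<lambda>i. i - k"]) (auto simp: neighbours_def)
  then show ?thesis by (simp add: bij_betw_same_card)
qed

text \<open>The total rate of the walk. Its value is 1, a site having 2d neighbours; kept symbolic,
  it requires only that all sites have equally many.\<close>

definition jump_rate :: "'d::finite itself \<Rightarrow> real" where
  "jump_rate _ = real (card (neighbours (0 :: 'd site))) / (2 * real CARD('d))"

lemma jump_rate_nonneg: "0 \<le> jump_rate TYPE('d::finite)"
  by (simp add: jump_rate_def)

lemma laplacian_eq:
  "laplacian f (k :: 'd::finite site) = (\<Sum>i\<in>neighbours k. f i) / (2 * real CARD('d)) - jump_rate TYPE('d) * f k"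
proof -
  have "laplacian f k = 1 / (2 * real CARD('d)) * ((\<Sum>i\<in>neighbours k. f i) - real (card (neighbours k)) * f k)"
    unfolding laplacian_def sum_distrib_left[symmetric] by (simp add: sum_subtractf)
  then show ?thesis by (simp add: jump_rate_def card_neighbours[of k] right_diff_distrib)
qed

lemma laplacian_bound:
  fixes f :: "'d::finite site \<Rightarrow> real"
  assumes "\<And>i. f i \<in> {0..1}"
  shows "\<bar>laplacian f k\<bar> \<le> jump_rate TYPE('d)"
proof -
  have "\<bar>laplacian f k\<bar> \<le> (\<Sum>i\<in>neighbours k. 1 / (2 * real CARD('d)))"
    unfolding laplacian_def
  proof (rule order.trans[OF sum_abs sum_mono])
    fix i
    have "f i \<in> {0..1}" "f k \<in> {0..1}" using assms by auto
    then have "\<bar>f i - f k\<bar> \<le> 1" by (auto simp: abs_le_iff)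
    then show "\<bar>1 / (2 * real CARD('d)) * (f i - f k)\<bar> \<le> 1 / (2 * real CARD('d))"
      unfolding abs_mult by (simp add: divide_le_cancel)
  qed
  also have "\<dots> = jump_rate TYPE('d)" by (simp add: jump_rate_def card_neighbours[of k])
  finally show ?thesis .
qed

lemma laplacian_add: "laplacian (\<lambda>i. f i + g i) k = laplacian f k + laplacian g k"
  unfolding laplacian_def sum.distrib[symmetric] by (intro sum.cong refl) (simp add: diff_divide_distrib add_divide_distrib)

lemma laplacian_shift: "laplacian (\<lambda>i. f i - c) k = laplacian f k"
  unfolding laplacian_def by simp

section \<open>Uniqueness for the heat equation in the weighted space\<close>

lemma continuous_on_laplacian:
  assumes "\<And>i. continuous_on S (\<lambda>t. f t i)"
  shows "continuous_on S (\<lambda>t. laplacian (f t) k)"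
  unfolding laplacian_def by (intro continuous_intros assms)

text \<open>Admissibility bounds the columns of the walk kernel against the weight, so interchanging
  the two sums bounds the Laplacian in the weighted norm. The norm appears as a bound on all finite
  partial sums.\<close>

lemma weighted_laplacian_bound:
  fixes \<beta> z :: "'d::finite site \<Rightarrow> real"
  assumes pos: "\<And>k. 0 < \<beta> k" and rate: "\<And>k. (\<Sum>\<^sub>\<infinity>i. \<beta> i * \<bar>rw_rate i k\<bar>) < m * \<beta> k"
    and S: "finite S" and G: "\<And>E. finite E \<Longrightarrow> (\<Sum>k\<in>E. \<bar>z k\<bar> * \<beta> k) \<le> g"
  shows "(\<Sum>k\<in>S. \<bar>laplacian z k\<bar> * \<beta> k) \<le> (\<bar>m\<bar> + jump_rate TYPE('d)) * g"
proof -
  let ?a = "1 / (2 * real CARD('d))"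
  have col: "(\<Sum>k\<in>neighbours i. ?a * \<beta> k) \<le> m * \<beta> i" for i
  proof -
    have "(\<Sum>\<^sub>\<infinity>k. \<beta> k * \<bar>rw_rate k i\<bar>) = (\<Sum>\<^sub>\<infinity>k\<in>insert i (neighbours i). \<beta> k * \<bar>rw_rate k i\<bar>)"
      by (rule infsum_cong_neutral) (auto simp: rw_rate_def)
    also have "\<dots> = (\<Sum>k\<in>insert i (neighbours i). \<beta> k * \<bar>rw_rate k i\<bar>)"
      by (rule infsum_finite) (simp add: finite_neighbours)
    also have "\<dots> \<ge> (\<Sum>k\<in>neighbours i. \<beta> k * \<bar>rw_rate k i\<bar>)"
      using pos[THEN less_imp_le] by (intro sum_mono2) (auto simp: finite_neighbours)
    also have "(\<Sum>k\<in>neighbours i. \<beta> k * \<bar>rw_rate k i\<bar>) = (\<Sum>k\<in>neighbours i. ?a * \<beta> k)"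
      by (intro sum.cong refl) (simp add: rw_rate_def)
    finally show ?thesis using rate[of i] by simp
  qed
  \<comment> \<open>All sites whose values enter the neighbour sums over \<open>S\<close>; with it
    the interchange of sums is finite.\<close>
  define E where "E = (\<Union>k\<in>S. neighbours k)"
  have E: "finite E" using S by (simp add: E_def finite_neighbours)
  have "(\<Sum>k\<in>S. \<bar>laplacian z k\<bar> * \<beta> k)
      \<le> (\<Sum>k\<in>S. (\<Sum>i\<in>neighbours k. ?a * \<bar>z i\<bar>) * \<beta> k + jump_rate TYPE('d) * (\<bar>z k\<bar> * \<beta> k))"
  proof (rule sum_mono)
    fix k
    have "\<bar>laplacian z k\<bar> \<le> \<bar>\<Sum>i\<in>neighbours k. ?a * z i\<bar> + jump_rate TYPE('d) * \<bar>z k\<bar>"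
      unfolding laplacian_eq using jump_rate_nonneg[where 'd = 'd]
        abs_triangle_ineq4[of "(\<Sum>i\<in>neighbours k. ?a * z i)" "jump_rate TYPE('d) * z k"]
      by (simp add: abs_mult sum_divide_distrib)
    also have "\<bar>\<Sum>i\<in>neighbours k. ?a * z i\<bar> \<le> (\<Sum>i\<in>neighbours k. ?a * \<bar>z i\<bar>)"
      by (rule order.trans[OF sum_abs]) (simp add: abs_mult)
    finally have "\<bar>laplacian z k\<bar> * \<beta> k \<le> ((\<Sum>i\<in>neighbours k. ?a * \<bar>z i\<bar>) + jump_rate TYPE('d) * \<bar>z k\<bar>) * \<beta> k"
      using pos[of k] by (intro mult_right_mono) auto
    then show "\<bar>laplacian z k\<bar> * \<beta> k \<le> (\<Sum>i\<in>neighbours k. ?a * \<bar>z i\<bar>) * \<beta> k + jump_rate TYPE('d) * (\<bar>z k\<bar> * \<beta> k)"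
      by (simp add: algebra_simps)
  qed
  also have "\<dots> = (\<Sum>k\<in>S. \<Sum>i\<in>neighbours k. ?a * \<bar>z i\<bar> * \<beta> k) + jump_rate TYPE('d) * (\<Sum>k\<in>S. \<bar>z k\<bar> * \<beta> k)"
    by (simp add: sum.distrib sum_distrib_left sum_distrib_right)
  also have "(\<Sum>k\<in>S. \<Sum>i\<in>neighbours k. ?a * \<bar>z i\<bar> * \<beta> k) = (\<Sum>k\<in>S. \<Sum>i\<in>{i\<in>E. i \<in> neighbours k}. ?a * \<bar>z i\<bar> * \<beta> k)"
    by (intro sum.cong refl) (auto simp: E_def)
  also have "\<dots> = (\<Sum>i\<in>E. \<Sum>k\<in>{k\<in>S. i \<in> neighbours k}. ?a * \<bar>z i\<bar> * \<beta> k)"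
    by (rule sum.swap_restrict[OF S E])
  also have "\<dots> \<le> (\<Sum>i\<in>E. \<Sum>k\<in>neighbours i. ?a * \<bar>z i\<bar> * \<beta> k)"
    using pos[THEN less_imp_le] neighbours_sym
    by (intro sum_mono sum_mono2) (auto simp: finite_neighbours)
  also have "\<dots> = (\<Sum>i\<in>E. \<bar>z i\<bar> * (\<Sum>k\<in>neighbours i. ?a * \<beta> k))"
    by (simp add: sum_distrib_left mult.left_commute)
  also have "\<dots> \<le> (\<Sum>i\<in>E. \<bar>z i\<bar> * (\<bar>m\<bar> * \<beta> i))"
  proof (intro sum_mono mult_left_mono)
    fix i
    have "m * \<beta> i \<le> \<bar>m\<bar> * \<beta> i" using pos[of i] by (intro mult_right_mono) auto
    then show "(\<Sum>k\<in>neighbours i. ?a * \<beta> k) \<le> \<bar>m\<bar> * \<beta> i" using col[of i] by linarith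
  qed auto
  also have "\<dots> = \<bar>m\<bar> * (\<Sum>i\<in>E. \<bar>z i\<bar> * \<beta> i)" by (simp add: sum_distrib_left mult.left_commute)
  also have "\<dots> \<le> \<bar>m\<bar> * g" using G[OF E] by (intro mult_left_mono) auto
  also have "jump_rate TYPE('d) * (\<Sum>k\<in>S. \<bar>z k\<bar> * \<beta> k) \<le> jump_rate TYPE('d) * g"
    using G[OF S] jump_rate_nonneg[where 'd = 'd] by (intro mult_left_mono) auto
  finally show ?thesis by (simp add: distrib_right)
qed

lemma continuous_path_set_integrable:
  fixes f :: "real \<Rightarrow> real"
  assumes "continuous_on {0..} f" "0 \<le> s"
  shows "set_integrable lborel {s..t} f"
  unfolding set_integrable_def
  using borel_integrable_compact[OF compact_Icc, of s t f] continuous_on_subset[OF assms(1), of "{s..t}"] assms(2)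
  by auto

text \<open>Compares the supremum of \<open>e\<^bsup>-\<lambda>t\<^esup>\<parallel>z\<^sub>t\<parallel>\<close> with half of itself.\<close>

lemma heat_uniqueness:
  fixes \<beta> :: "'d::finite site \<Rightarrow> real" and z :: "real \<Rightarrow> 'd site \<Rightarrow> real"
  assumes pos: "\<And>k. 0 < \<beta> k" and rate: "\<And>k. (\<Sum>\<^sub>\<infinity>i. \<beta> i * \<bar>rw_rate i k\<bar>) < m * \<beta> k"
    and cont: "\<And>k. continuous_on {0..} (\<lambda>t. z t k)"
    and heat: "\<And>t k. 0 \<le> t \<Longrightarrow> z t k = (LINT r:{0..t}|lborel. laplacian (z r) k)"
    and bdd: "\<And>t E. t \<in> {0..T} \<Longrightarrow> finite E \<Longrightarrow> (\<Sum>k\<in>E. \<bar>z t k\<bar> * \<beta> k) \<le> D"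
    and t: "t \<in> {0..T}"
  shows "z t k = 0"
proof -
  \<comment> \<open>A Laplacian bound with constant \<open>c\<close>, integrated against an
    exponential of rate \<open>2 * c\<close>, gains the factor 1/2. The added 1 makes
    \<open>c\<close> positive.\<close>
  define c where "c = \<bar>m\<bar> + jump_rate TYPE('d) + 1"
  have c: "0 < c" "\<bar>m\<bar> + jump_rate TYPE('d) \<le> c" using jump_rate_nonneg[where 'd = 'd] by (auto simp: c_def)
  define Y where "Y = {exp (- 2 * c * t) * (\<Sum>k\<in>E. \<bar>z t k\<bar> * \<beta> k) | t E. t \<in> {0..T} \<and> finite E}"
  have D0: "0 \<le> D" using bdd[OF t, of "{}"] by simp
  have Yb: "bdd_above Y"
  proof (rule bdd_aboveI)
    fix y assume "y \<in> Y"
    then obtain r E where r: "y = exp (- 2 * c * r) * (\<Sum>k\<in>E. \<bar>z r k\<bar> * \<beta> k)" "r \<in> {0..T}" "finite E"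
      by (auto simp: Y_def)
    have "0 \<le> c * r" using r(2) c by (intro mult_nonneg_nonneg) auto
    then have "exp (- 2 * c * r) \<le> 1" by simp
    then have "y \<le> 1 * D" unfolding r(1) using bdd[OF r(2,3)] D0 pos[THEN less_imp_le]
      by (intro mult_mono) (auto intro!: sum_nonneg)
    then show "y \<le> D" by simp
  qed
  define S where "S = Sup Y"
  have in_Y: "exp (- 2 * c * r) * (\<Sum>k\<in>E. \<bar>z r k\<bar> * \<beta> k) \<le> S" if "r \<in> {0..T}" "finite E" for r E
    unfolding S_def using that by (intro cSup_upper Yb) (auto simp: Y_def)
  have S0: "0 \<le> S" using in_Y[OF t, of "{}"] by simp
  have G: "(\<Sum>k\<in>E. \<bar>z r k\<bar> * \<beta> k) \<le> S * exp (2 * c * r)" if "r \<in> {0..T}" "finite E" for r E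
    using in_Y[OF that] by (simp add: exp_minus field_simps)
  have half: "(\<Sum>k\<in>E. \<bar>z r k\<bar> * \<beta> k) \<le> S / 2 * exp (2 * c * r)" if r: "r \<in> {0..T}" and E: "finite E" for r E
  proof -
    have lc: "continuous_on {0..} (\<lambda>q. laplacian (z q) k)" for k by (rule continuous_on_laplacian[OF cont])
    have li: "set_integrable lborel {0..r} (\<lambda>q. \<bar>laplacian (z q) k\<bar> * \<beta> k)" for k
      by (intro continuous_path_set_integrable continuous_intros lc) auto
    have "(\<Sum>k\<in>E. \<bar>z r k\<bar> * \<beta> k) \<le> (\<Sum>k\<in>E. LINT q:{0..r}|lborel. \<bar>laplacian (z q) k\<bar> * \<beta> k)"
    proof (rule sum_mono)
      fix k
      have "\<bar>z r k\<bar> \<le> (LINT q:{0..r}|lborel. \<bar>laplacian (z q) k\<bar>)"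
        using heat[of r k] r set_integral_norm_bound[OF continuous_path_set_integrable[OF lc[of k], of 0 r]] by simp
      then have "\<bar>z r k\<bar> * \<beta> k \<le> (LINT q:{0..r}|lborel. \<bar>laplacian (z q) k\<bar>) * \<beta> k"
        using pos[of k] by (intro mult_right_mono) auto
      then show "\<bar>z r k\<bar> * \<beta> k \<le> (LINT q:{0..r}|lborel. \<bar>laplacian (z q) k\<bar> * \<beta> k)" by simp
    qed
    also have "\<dots> = (LINT q:{0..r}|lborel. \<Sum>k\<in>E. \<bar>laplacian (z q) k\<bar> * \<beta> k)"
      unfolding set_lebesgue_integral_def scaleR_sum_right
      by (rule Bochner_Integration.integral_sum[symmetric]) (use li in \<open>simp add: set_integrable_def\<close>)
    also have "\<dots> \<le> (LINT q:{0..r}|lborel. c * S * exp (2 * c * q))"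
    proof (rule set_integral_mono)
      show "set_integrable lborel {0..r} (\<lambda>q. \<Sum>k\<in>E. \<bar>laplacian (z q) k\<bar> * \<beta> k)"
        by (intro continuous_path_set_integrable continuous_intros lc) auto
      show "set_integrable lborel {0..r} (\<lambda>q. c * S * exp (2 * c * q))"
        by (intro continuous_path_set_integrable continuous_intros) auto
      fix q assume q: "q \<in> {0..r}"
      then have qT: "q \<in> {0..T}" using r by auto
      have "(\<Sum>k\<in>E. \<bar>laplacian (z q) k\<bar> * \<beta> k) \<le> (\<bar>m\<bar> + jump_rate TYPE('d)) * (S * exp (2 * c * q))"
        by (rule weighted_laplacian_bound[OF pos rate E G[OF qT]])
      also have "\<dots> \<le> c * (S * exp (2 * c * q))" using c(2) S0 by (intro mult_right_mono) auto
      finally show "(\<Sum>k\<in>E. \<bar>laplacian (z q) k\<bar> * \<beta> k) \<le> c * S * exp (2 * c * q)" by (simp add: mult.assoc)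
    qed
    also have "\<dots> = S / 2 * exp (2 * c * r) - S / 2 * exp (2 * c * 0)"
      unfolding set_lebesgue_integral_def
    proof (rule integral_FTC_Icc)
      show "0 \<le> r" using r by simp
      show "((\<lambda>q. S / 2 * exp (2 * c * q)) has_vector_derivative c * S * exp (2 * c * q)) (at q within {0..r})" for q
        unfolding has_real_derivative_iff_has_vector_derivative[symmetric]
        by (auto intro!: derivative_eq_intros)
      show "continuous_on {0..r} (\<lambda>q. c * S * exp (2 * c * q))" by (intro continuous_intros)
    qed
    also have "\<dots> \<le> S / 2 * exp (2 * c * r)" using S0 by simp
    finally show ?thesis .
  qed
  have "S \<le> S / 2"
    unfolding S_def
  proof (rule cSup_least)
    show "Y \<noteq> {}" using t by (auto simp: Y_def)
    fix y assume "y \<in> Y"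
    then obtain r E where r: "y = exp (- 2 * c * r) * (\<Sum>k\<in>E. \<bar>z r k\<bar> * \<beta> k)" "r \<in> {0..T}" "finite E"
      by (auto simp: Y_def)
    have "y \<le> exp (- 2 * c * r) * (S / 2 * exp (2 * c * r))"
      unfolding r(1) by (intro mult_left_mono half r) auto
    also have "\<dots> = S / 2" by (simp add: exp_minus field_simps)
    finally show "y \<le> Sup Y / 2" by (simp add: S_def)
  qed
  then have "S \<le> 0" by simp
  then have "(\<Sum>k\<in>{k}. \<bar>z t k\<bar> * \<beta> k) \<le> 0"
    using G[OF t, of "{k}"] mult_nonpos_nonneg[of S "exp (2 * c * t)"] by simp
  then have "\<bar>z t k\<bar> * \<beta> k \<le> 0" by simp
  then show ?thesis using pos[of k] by (simp add: mult_le_0_iff)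
qed

text \<open>The variable need not be measurable, so the exceptional sets are given as covers. A
  point that lies outside infinitely many of them has value 0, and the tail intersections are
  null.\<close>

lemma (in prob_space) AE_zero_if_small:
  fixes X :: "'a \<Rightarrow> real"
  assumes "\<And>\<delta>. 0 < \<delta> \<Longrightarrow> \<exists>A\<in>sets M. prob A < \<delta> \<and> (AE w in M. w \<notin> A \<longrightarrow> \<bar>X w\<bar> \<le> \<delta>)"
  shows "AE w in M. X w = 0"
proof -
  have "\<forall>n. \<exists>A. A \<in> sets M \<and> prob A < 1 / real (Suc n) \<and> (AE w in M. w \<notin> A \<longrightarrow> \<bar>X w\<bar> \<le> 1 / real (Suc n))"
  proof
    fix n
    show "\<exists>A. A \<in> sets M \<and> prob A < 1 / real (Suc n) \<and> (AE w in M. w \<notin> A \<longrightarrow> \<bar>X w\<bar> \<le> 1 / real (Suc n))"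
      using assms[of "1 / real (Suc n)"] by auto
  qed
  from choice[OF this] obtain A where "\<forall>n. A n \<in> sets M \<and> prob (A n) < 1 / real (Suc n) \<and>
    (AE w in M. w \<notin> A n \<longrightarrow> \<bar>X w\<bar> \<le> 1 / real (Suc n))" by (elim exE)
  then have A: "\<And>n. A n \<in> sets M" "\<And>n. prob (A n) < 1 / real (Suc n)"
    "\<And>n. AE w in M. w \<notin> A n \<longrightarrow> \<bar>X w\<bar> \<le> 1 / real (Suc n)" by auto
  have null: "AE w in M. w \<notin> (\<Inter>n\<in>{m..}. A n)" for m
  proof -
    have s: "(\<Inter>n\<in>{m..}. A n) \<in> sets M" using A(1) by (intro sets.countable_INT') auto
    have "prob (\<Inter>n\<in>{m..}. A n) \<le> 1 / real (Suc n)" if "n \<ge> m" for n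
    proof -
      have "prob (\<Inter>n\<in>{m..}. A n) \<le> prob (A n)" using that A(1) by (intro finite_measure_mono) auto
      then show ?thesis using A(2)[of n] by simp
    qed
    then have "prob (\<Inter>n\<in>{m..}. A n) \<le> 0"
      by (intro LIMSEQ_le_const[OF LIMSEQ_Suc[OF lim_const_over_n[of 1]]] exI[of _ m]) simp
    then have "prob (\<Inter>n\<in>{m..}. A n) = 0" by (simp add: measure_le_0_iff)
    then show ?thesis using s by (simp add: prob_eq_0)
  qed
  have "AE w in M. (\<forall>m. w \<notin> (\<Inter>n\<in>{m..}. A n)) \<and> (\<forall>n. w \<notin> A n \<longrightarrow> \<bar>X w\<bar> \<le> 1 / real (Suc n))"
    using null A(3) by (simp add: AE_conj_iff AE_all_countable)
  then show ?thesis
  proof eventually_elim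
    case (elim w)
    have "\<bar>X w\<bar> \<le> 1 / real (Suc m)" for m
    proof -
      from elim obtain n where n: "n \<ge> m" "w \<notin> A n" by auto
      then have "\<bar>X w\<bar> \<le> 1 / real (Suc n)" using elim by blast
      also have "\<dots> \<le> 1 / real (Suc m)" using n by (intro divide_left_mono) auto
      finally show ?thesis .
    qed
    then have "\<bar>X w\<bar> \<le> 0"
      by (intro LIMSEQ_le_const[OF LIMSEQ_Suc[OF lim_const_over_n[of 1]]]) auto
    then show ?case by simp
  qed
qed

lemma simple_integral_0: "simple_integrand F L \<Longrightarrow> simple_integral B L 0 w = 0"
proof (induction L)
  case (Cons x L)
  obtain a b \<xi> where x: "x = (a, b, \<xi>)" by (cases x)
  have "simple_integral B (x # L) 0 w = \<xi> w * (B (min b 0) w - B (min a 0) w) + simple_integral B L 0 w"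
    by (simp add: simple_integral_def x)
  also have "min b 0 = min a 0" using Cons.prems by (auto simp: simple_integrand_def x)
  finally show ?case using Cons by (simp add: simple_integrand_def)
qed (simp add: simple_integral_def)

lemma continuous_path_integral_at_right:
  fixes f :: "real \<Rightarrow> real"
  assumes f: "continuous_on {0..} f" and t: "0 \<le> t"
  shows "((\<lambda>r. LINT q:{0..r}|lborel. f q) \<longlongrightarrow> (LINT q:{0..t}|lborel. f q)) (at_right t)"
proof -
  have eq: "(LINT q:{0..r}|lborel. f q) = integral {0..r} f" for r
    by (intro set_borel_integral_eq_integral(2) continuous_path_set_integrable f) simp
  have "continuous_on {0..t + 1} (\<lambda>r. integral {0..r} f)"
    by (intro indefinite_integral_continuous_1 integrable_continuous_real continuous_on_subset[OF f]) auto
  then have "continuous_on {t..t + 1} (\<lambda>r. integral {0..r} f)"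
    using t by (elim continuous_on_subset) auto
  from continuous_on_Icc_at_rightD[OF this] show ?thesis by (simp add: eq)
qed

text \<open>Identities that hold almost surely at each time hold simultaneously only at countably
  many; right limits along positive rationals carry them to every time, including 0.\<close>

lemma zero_on_rationals:
  fixes h :: "real \<Rightarrow> real"
  assumes lim: "(h \<longlongrightarrow> h t) (at_right t)" and t: "0 \<le> t" and z: "\<And>q::rat. 0 < real_of_rat q \<Longrightarrow> h (real_of_rat q) = 0"
  shows "h t = 0"
proof (rule ccontr)
  assume "h t \<noteq> 0"
  then have "\<forall>\<^sub>F r in at_right t. h r \<noteq> 0"
    using lim by (rule tendsto_imp_eventually_ne[rotated])
  then obtain b where b: "b > t" "\<And>r. t < r \<Longrightarrow> r < b \<Longrightarrow> h r \<noteq> 0" by (auto simp: eventually_at_right_field)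
  obtain q where "t < real_of_rat q" "real_of_rat q < b" using of_rat_dense[OF b(1)] by blast
  then have "h (real_of_rat q) \<noteq> 0" "0 < real_of_rat q" using b(2)[of "real_of_rat q"] t by linarith+
  then show False using z[of q] by simp
qed

lemma integral_path_measurable:
  fixes f :: "real \<Rightarrow> 'w \<Rightarrow> real"
  assumes f: "\<And>r. 0 \<le> r \<Longrightarrow> f r \<in> borel_measurable M" "\<And>w. w \<in> space M \<Longrightarrow> continuous_on {0..} (\<lambda>r. f r w)" and s: "0 \<le> s"
  shows "(\<lambda>w. LINT r:{s..t}|lborel. f r w) \<in> borel_measurable M"
proof -
  have "(\<lambda>(r, w). f (max 0 r) w) \<in> borel_measurable (borel \<Otimes>\<^sub>M M)"
  proof (rule jointly_measurable_right_continuous[OF f(1)])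
    fix w r assume "w \<in> space M" "0 \<le> (r::real)"
    then have "continuous_on {r..r + 1} (\<lambda>r. f r w)" by (intro continuous_on_subset[OF f(2)]) auto
    then show "((\<lambda>s. f s w) \<longlongrightarrow> f r w) (at_right r)" by (rule continuous_on_Icc_at_rightD) simp
  qed
  then have "(\<lambda>p. f (max 0 (fst p)) (snd p)) \<in> borel_measurable (lborel \<Otimes>\<^sub>M M)"
    by (simp add: case_prod_beta' cong: measurable_cong_sets)
  from measurable_compose[OF measurable_pair_swap' this]
  have "(\<lambda>(w, r). f (max 0 r) w) \<in> borel_measurable (M \<Otimes>\<^sub>M lborel)"
    by (simp add: case_prod_beta')
  then have "(\<lambda>(w, r). indicator {s..t} r * f (max 0 r) w) \<in> borel_measurable (M \<Otimes>\<^sub>M lborel)"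
    unfolding case_prod_beta' by measurable
  then have "(\<lambda>w. \<integral>r. indicator {s..t} r * f (max 0 r) w \<partial>lborel) \<in> borel_measurable M"
    by (rule lborel.borel_measurable_lebesgue_integral)
  moreover have "indicator {s..t} r * f (max 0 r) w = indicator {s..t} r *\<^sub>R f r w" for r w
    using s by (auto simp: indicator_def max_def)
  ultimately show ?thesis by (simp add: set_lebesgue_integral_def)
qed

lemma path_average_tendsto:
  fixes f :: "real \<Rightarrow> real"
  assumes f: "continuous_on {0..} f" and t: "0 \<le> t" and h: "\<And>n. 0 < h n" "h \<longlonglongrightarrow> 0"
  shows "(\<lambda>n. (LINT r:{t..t + h n}|lborel. f r) / h n) \<longlonglongrightarrow> f t"
proof (rule LIMSEQ_I)
  fix e :: real assume e: "0 < e"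
  have "continuous_on {t..t + 1} f" using t by (intro continuous_on_subset[OF f]) auto
  then have "(f \<longlongrightarrow> f t) (at_right t)" by (rule continuous_on_Icc_at_rightD) simp
  then have "\<forall>\<^sub>F r in at_right t. \<bar>f r - f t\<bar> < e / 2"
    using tendstoD[of f "f t" "at_right t" "e / 2"] e by (simp add: dist_real_def)
  then obtain b where b: "b > t" "\<And>r. t < r \<Longrightarrow> r < b \<Longrightarrow> \<bar>f r - f t\<bar> < e / 2" by (auto simp: eventually_at_right_field)
  have "\<forall>\<^sub>F n in sequentially. h n < b - t" using h(2) b(1) by (intro order_tendstoD) auto
  then obtain N where N: "\<And>n. n \<ge> N \<Longrightarrow> h n < b - t" by (auto simp: eventually_sequentially)
  show "\<exists>no. \<forall>n\<ge>no. norm ((LINT r:{t..t + h n}|lborel. f r) / h n - f t) < e"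
  proof (intro exI[of _ N] allI impI)
    fix n assume n: "n \<ge> N"
    have fi: "set_integrable lborel {t..t + h n} f" by (rule continuous_path_set_integrable[OF f t])
    have ci: "(LINT r:{t..t + h n}|lborel. c) = c * h n" for c :: real
      using h(1)[of n] by (simp add: set_lebesgue_integral_def)
    have bnd: "\<bar>f r - f t\<bar> \<le> e / 2" if "r \<in> {t..t + h n}" for r
      using b(2)[of r] N[OF n] that e by (cases "r = t") auto
    have bnd': "f r \<le> f t + e / 2" "f t - e / 2 \<le> f r" if "r \<in> {t..t + h n}" for r
      using bnd[OF that] by linarith+
    have "(LINT r:{t..t + h n}|lborel. f r) \<le> (LINT r:{t..t + h n}|lborel. f t + e / 2)"
      by (intro set_integral_mono fi set_integrable_const_Icc bnd')
    moreover have "(LINT r:{t..t + h n}|lborel. f t - e / 2) \<le> (LINT r:{t..t + h n}|lborel. f r)"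
      by (intro set_integral_mono fi set_integrable_const_Icc bnd')
    ultimately have "(f t - e / 2) * h n \<le> (LINT r:{t..t + h n}|lborel. f r)" "(LINT r:{t..t + h n}|lborel. f r) \<le> (f t + e / 2) * h n"
      by (simp_all only: ci)
    then have "f t - e / 2 \<le> (LINT r:{t..t + h n}|lborel. f r) / h n" "(LINT r:{t..t + h n}|lborel. f r) / h n \<le> f t + e / 2"
      using h(1)[of n] by (simp_all add: le_divide_eq divide_le_eq)
    then show "norm ((LINT r:{t..t + h n}|lborel. f r) / h n - f t) < e" using e by (simp add: abs_less_iff)
  qed
qed

section \<open>The solution at correlation -1: total mass and a regular version\<close>

locale annihilating_sbm = filtered_space M F + weighted \<beta>
  for M :: "'w measure" and F and \<beta> :: "'d::finite site \<Rightarrow> real" +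
  fixes \<gamma> m :: real and B1 B2 I1 I2 :: "'d site \<Rightarrow> real \<Rightarrow> 'w \<Rightarrow> real"
    and u v :: "real \<Rightarrow> 'w \<Rightarrow> 'd site \<Rightarrow> real" and U\<^sub>0 V\<^sub>0 :: "'d site \<Rightarrow> real"
  assumes rate: "\<And>k. (\<Sum>\<^sub>\<infinity>i. \<beta> i * \<bar>rw_rate i k\<bar>) < m * \<beta> k"
    and \<gamma>: "0 < \<gamma>"
    and B1: "\<And>k. brownian_motion M F (B1 k)" and B2: "\<And>k. brownian_motion M F (B2 k)"
    and jointly: "jointly_gaussian M (case_sum (\<lambda>(t, k). B1 k t) (\<lambda>(t, k). B2 k t)) (({0..} \<times> UNIV) <+> ({0..} \<times> UNIV))"
    and cov: "\<And>t k j. 0 \<le> t \<Longrightarrow> expectation (\<lambda>w. B1 k t w * B1 j t w) = of_bool (k = j) * t"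
      "\<And>t k j. 0 \<le> t \<Longrightarrow> expectation (\<lambda>w. B2 k t w * B2 j t w) = of_bool (k = j) * t"
      "\<And>t k j. 0 \<le> t \<Longrightarrow> expectation (\<lambda>w. B1 k t w * B2 j t w) = - 1 * of_bool (k = j) * t"
    and adapted: "\<And>t k. 0 \<le> t \<Longrightarrow> (\<lambda>w. u t w k) \<in> borel_measurable (F t)"
      "\<And>t k. 0 \<le> t \<Longrightarrow> (\<lambda>w. v t w k) \<in> borel_measurable (F t)"
    and continuous_paths: "AE w in M. continuous_map (top_of_set {0..}) (L2_top \<beta>) (\<lambda>t. (u t w, v t w))"
    and ito1: "\<And>k. ito_integral M F (B1 k) (\<lambda>s w. sqrt (\<gamma> * u s w k * v s w k)) (I1 k)"
    and ito2: "\<And>k. ito_integral M F (B2 k) (\<lambda>s w. sqrt (\<gamma> * u s w k * v s w k)) (I2 k)"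
    and equation: "AE w in M. \<forall>t\<ge>0. \<forall>k.
           u t w k = u 0 w k + (LINT s:{0..t}|lborel. laplacian (u s w) k) + I1 k t w \<and>
           v t w k = v 0 w k + (LINT s:{0..t}|lborel. laplacian (v s w) k) + I2 k t w"
    and start: "AE w in M. u 0 w = U\<^sub>0 \<and> v 0 w = V\<^sub>0"
    and initial: "\<And>k. (U\<^sub>0 k, V\<^sub>0 k) \<in> {(1, 0), (0, 1)}"
begin

text \<open>The second moment of the sum of the two motions is t + t - 2t.\<close>

lemma opposite_brownian: "0 \<le> t \<Longrightarrow> AE w in M. B2 k t w = - B1 k t w"
proof -
  assume t: "0 \<le> t"
  note s = brownian_square_integrable[OF B1[of k] t] brownian_square_integrable[OF B2[of k] t]
  note meas = brownian_measurable[OF B1[of k] t] brownian_measurable[OF B2[of k] t]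
  have i: "integrable M (\<lambda>w. B1 k t w * B2 k t w)" by (intro integrable_mult_square s meas)
  have si: "integrable M (\<lambda>w. (B1 k t w + B2 k t w)\<^sup>2)"
    unfolding power2_sum using s i by (simp add: mult.assoc)
  have "expectation (\<lambda>w. (B1 k t w + B2 k t w)\<^sup>2) = 0"
    unfolding power2_sum using s i cov[OF t, of k k] by (simp add: mult.assoc power2_eq_square)
  then have "AE w in M. (B1 k t w + B2 k t w)\<^sup>2 = 0"
    using si by (subst (asm) integral_nonneg_eq_0_iff_AE) auto
  then show ?thesis by eventually_elim (simp add: add_eq_0_iff)
qed

text \<open>With one common simple integrand the two integrals would cancel exactly. They come with
  different approximations of the same integrand, so the integral of the difference against
  \<open>B1\<close> remains; its bracket is small, and the isometry together with Chebyshev's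
  inequality makes it small in probability.\<close>

lemma integrals_cancel:
  assumes t: "0 < t"
  shows "AE w in M. I1 k t w + I2 k t w = 0"
proof (rule AE_zero_if_small)
  fix \<delta> :: real assume \<delta>: "0 < \<delta>"
  \<comment> \<open>The first quantity bounds the exceptional probability: \<open>2 * e\<close> from
    the two approximations and \<open>4 * sqrt e\<close> from Chebyshev at level
    \<open>sqrt (sqrt e)\<close>. The second bounds the error outside that event.\<close>
  have "((\<lambda>e::real. 2 * e + 4 * sqrt e) \<longlongrightarrow> 2 * 0 + 4 * sqrt 0) (at_right 0)"
    "((\<lambda>e. 2 * e + sqrt (sqrt e)) \<longlongrightarrow> 2 * 0 + sqrt (sqrt 0)) (at_right 0)"
    by (intro tendsto_intros)+
  then have "\<forall>\<^sub>F e in at_right 0. 2 * e + 4 * sqrt e < \<delta>" "\<forall>\<^sub>F e in at_right 0. 2 * e + sqrt (sqrt e) < \<delta>"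
      "\<forall>\<^sub>F e::real in at_right 0. 0 < e"
    using \<delta> by (auto intro: order_tendstoD eventually_at_right_less)
  then have "\<forall>\<^sub>F e in at_right 0. 2 * e + 4 * sqrt e < \<delta> \<and> 2 * e + sqrt (sqrt e) < \<delta> \<and> 0 < e"
    by eventually_elim auto
  then obtain e where e: "2 * e + 4 * sqrt e < \<delta>" "2 * e + sqrt (sqrt e) < \<delta>" "0 < e"
    using eventually_happens'[OF trivial_limit_at_right_real] by blast
  let ?H = "\<lambda>s w. sqrt (\<gamma> * u s w k * v s w k)"
  from ito_approximation[OF ito1[of k] t e(3)] obtain L1 A1 where L1: "ito_approximant (B1 k) ?H (I1 k) t e L1 A1" by (elim exE)
  from ito_approximation[OF ito2[of k] t e(3)] obtain L2 A2 where L2: "ito_approximant (B2 k) ?H (I2 k) t e L2 A2" by (elim exE)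
  note L12 = L1[unfolded ito_approximant_def] L2[unfolded ito_approximant_def]
  \<comment> \<open>Indexing by booleans puts both simple integrands on one partition.\<close>
  define L where "L b = (if b then L1 else L2)" for b
  have L: "simple_integrand F (L b)" for b using L12 by (simp add: L_def)
  have "\<exists>p N \<zeta>. mono p \<and> p 0 = 0 \<and> p N = t \<and> (\<forall>b\<in>UNIV. represents p N (\<zeta> b) 0 t (L b))"
    using t L by (intro simple_partition) auto
  then obtain p N \<zeta> where p: "mono p" "p 0 = 0" "p N = t" and "\<forall>b\<in>UNIV. represents p N (\<zeta> b) 0 t (L b)" by (elim exE conjE)
  then have rep: "represents p N (\<zeta> b) 0 t (L b)" for b by simp
  note step = representsD(1)[OF rep] and int = representsD(2)[OF rep] and proc = representsD(3)[OF rep]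
  have int0: "simple_integral B (L b) 0 w = 0" for B :: "real \<Rightarrow> 'w \<Rightarrow> real" and b w
    by (rule simple_integral_0[OF L])
  define \<xi> where "\<xi> i w = \<zeta> True i w - \<zeta> False i w" for i w
  have \<xi>: "step_integrand p \<xi>"
    using step[of True] step[of False] unfolding step_integrand_def \<xi>_def[abs_def]
    by (auto intro!: borel_measurable_diff bounded_rv_diff)
  \<comment> \<open>The budget \<open>4 * e\<close> comes from (x - y)^2 being at most 2 (x - z)^2 +
    2 (y - z)^2, with z the common integrand and each integral at most \<open>e\<close>.\<close>
  let ?M = "mtrans (B1 k) p (budget_stop (4 * e) p \<xi>) N"
  note \<xi>' = step_integrand_budget_stop[OF \<xi>, of "4 * e"]
  have Mm: "?M \<in> borel_measurable M" by (rule mtrans_measurable[OF B1 \<xi>'])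
  have M2: "expectation (\<lambda>w. (?M w)\<^sup>2) \<le> 4 * e"
  proof -
    have "expectation (qvar p (budget_stop (4 * e) p \<xi>) N) \<le> expectation (\<lambda>_. 4 * e)"
      using qvar_budget_stop_le[OF p(1), of "4 * e"] e(3)
      by (intro integral_mono integrable_bounded_rv bounded_rv_qvar \<xi>') auto
    then show ?thesis by (simp add: mtrans_square[OF B1 \<xi>'] prob_space)
  qed
  define A3 where "A3 = {w\<in>space M. sqrt (sqrt e) \<le> \<bar>?M w\<bar>}"
  have A3: "A3 \<in> sets M" unfolding A3_def using Mm by measurable
  have "prob A3 \<le> 4 * sqrt e"
  proof -
    have "sqrt e * prob A3 = expectation (\<lambda>w. sqrt e * indicator A3 w)" using A3 by simp
    also have "\<dots> \<le> expectation (\<lambda>w. (?M w)\<^sup>2)"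
    proof (rule integral_mono)
      show "integrable M (\<lambda>w. sqrt e * indicator A3 w)"
        using A3 by (intro integrable_mult_right integrable_real_indicator) (auto simp: emeasure_eq_measure)
      show "integrable M (\<lambda>w. (?M w)\<^sup>2)" by (rule mtrans_moment_integrable[OF B1 \<xi>'])
      show "sqrt e * indicator A3 w \<le> (?M w)\<^sup>2" for w
      proof (cases "w \<in> A3")
        case True
        then have "(sqrt (sqrt e))\<^sup>2 \<le> \<bar>?M w\<bar>\<^sup>2" using e(3) by (intro power_mono) (auto simp: A3_def)
        then show ?thesis using True e(3) by simp
      qed simp
    qed
    also have "\<dots> \<le> 4 * (sqrt e * sqrt e)" using M2 e(3) by simp
    also have "\<dots> = sqrt e * (4 * sqrt e)" by simp
    finally show ?thesis using e(3) by (simp add: mult_le_cancel_left)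
  qed
  have AEB: "AE w in M. \<forall>i. B2 k (p i) w = - B1 k (p i) w"
    unfolding AE_all_countable using step_integrandD(2)[OF \<xi>] by (intro allI opposite_brownian)
  have Hm: "AE w in M. (\<lambda>s. ?H s w) \<in> borel_measurable (restrict_space borel {0..})"
    using ito1[of k] by (simp add: ito_integral_def)
  have "AE w in M. w \<notin> A1 \<union> A2 \<union> A3 \<longrightarrow> \<bar>I1 k t w + I2 k t w\<bar> \<le> \<delta>"
    using AEB Hm AE_space
  proof eventually_elim
    case (elim w)
    show ?case
    proof
      assume w: "w \<notin> A1 \<union> A2 \<union> A3"
      let ?f = "\<lambda>b r. simple_process (L b) r w"
      have n1: "(\<integral>\<^sup>+s\<in>{0..t}. ennreal ((?f True s - ?H s w)\<^sup>2) \<partial>lborel) \<le> ennreal e"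
        and i1: "\<bar>simple_integral (B1 k) (L True) t w - I1 k t w\<bar> \<le> e" using L12(1) w elim(3) t by (auto simp: L_def)
      have n2: "(\<integral>\<^sup>+s\<in>{0..t}. ennreal ((?f False s - ?H s w)\<^sup>2) \<partial>lborel) \<le> ennreal e"
        and i2: "\<bar>simple_integral (B2 k) (L False) t w - I2 k t w\<bar> \<le> e" using L12(2) w elim(3) t by (auto simp: L_def)
      have fm: "?f b \<in> borel_measurable borel" for b by (rule simple_process_measurable)
      have Hm0: "(\<lambda>s. ?H s w * indicator {0..} s) \<in> borel_measurable borel"
        using elim(2) by (simp add: borel_measurable_restrict_space_iff mult.commute)
      have q: "qvar p \<xi> N w = (LINT r:{0..t}|lborel. (?f True r - ?f False r)\<^sup>2)"
        unfolding qvar_def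
        by (rule step_square_integral[OF p, symmetric]) (use proc fm in \<open>auto simp: \<xi>_def\<close>)
      obtain b1 b2 where b: "\<And>r. \<bar>?f True r\<bar> \<le> b1" "\<And>r. \<bar>?f False r\<bar> \<le> b2"
        using simple_process_bounded by metis
      have "set_integrable lborel {0..t} (\<lambda>r. (?f True r - ?f False r)\<^sup>2)"
      proof (rule bounded_set_integrable[where c = "(b1 + b2)\<^sup>2"])
        show "(\<lambda>r. (?f True r - ?f False r)\<^sup>2) \<in> borel_measurable (restrict_space borel {0..})"
          using fm by (intro measurable_restrict_space1) auto
        fix r
        have "\<bar>?f True r - ?f False r\<bar> \<le> b1 + b2" using b(1)[of r] b(2)[of r] by linarith
        from power_mono[OF this, of 2] show "\<bar>(?f True r - ?f False r)\<^sup>2\<bar> \<le> (b1 + b2)\<^sup>2" by simp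
      qed simp
      then have "ennreal (qvar p \<xi> N w) = (\<integral>\<^sup>+r. ennreal (indicator {0..t} r * (?f True r - ?f False r)\<^sup>2) \<partial>lborel)"
        unfolding q set_integrable_def set_lebesgue_integral_def by (subst nn_integral_eq_integral) auto
      also have "\<dots> \<le> (\<integral>\<^sup>+r. 2 * (ennreal ((?f True r - ?H r w)\<^sup>2) * indicator {0..t} r)
          + 2 * (ennreal ((?f False r - ?H r w)\<^sup>2) * indicator {0..t} r) \<partial>lborel)"
      proof (rule nn_integral_mono)
        fix r
        have "(?f True r - ?f False r)\<^sup>2 \<le> 2 * (?f True r - ?H r w)\<^sup>2 + 2 * (?f False r - ?H r w)\<^sup>2"
          using zero_le_power2[of "(?f True r - ?H r w) + (?f False r - ?H r w)"]
          by (simp add: power2_eq_square algebra_simps)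
        then have "ennreal ((?f True r - ?f False r)\<^sup>2) \<le> 2 * ennreal ((?f True r - ?H r w)\<^sup>2) + 2 * ennreal ((?f False r - ?H r w)\<^sup>2)"
          by (simp add: ennreal_mult''[symmetric] ennreal_plus[symmetric] ennreal_leI flip: ennreal_numeral del: ennreal_plus)
        then show "ennreal (indicator {0..t} r * (?f True r - ?f False r)\<^sup>2) \<le>
          2 * (ennreal ((?f True r - ?H r w)\<^sup>2) * indicator {0..t} r) + 2 * (ennreal ((?f False r - ?H r w)\<^sup>2) * indicator {0..t} r)"
          by (auto simp: indicator_def)
      qed
      also have "\<dots> = 2 * (\<integral>\<^sup>+s\<in>{0..t}. ennreal ((?f True s - ?H s w)\<^sup>2) \<partial>lborel)
          + 2 * (\<integral>\<^sup>+s\<in>{0..t}. ennreal ((?f False s - ?H s w)\<^sup>2) \<partial>lborel)"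
      proof -
        have mm: "(\<lambda>r. ennreal ((?f b r - ?H r w)\<^sup>2) * indicator {0..t} r) \<in> borel_measurable lborel" for b
        proof -
          have "(\<lambda>r. ennreal ((?f b r - ?H r w * indicator {0..} r)\<^sup>2) * indicator {0..t} r) \<in> borel_measurable borel"
            using fm[of b] Hm0 by measurable
          moreover have "ennreal ((?f b r - ?H r w * indicator {0..} r)\<^sup>2) * indicator {0..t} r
            = ennreal ((?f b r - ?H r w)\<^sup>2) * indicator {0..t} r" for r by (auto simp: indicator_def)
          ultimately show ?thesis by simp
        qed
        show ?thesis using mm[of True] mm[of False] by (simp add: nn_integral_add nn_integral_cmult)
      qed
      also have "\<dots> \<le> 2 * ennreal e + 2 * ennreal e" by (intro add_mono mult_left_mono n1 n2) auto
      also have "\<dots> = ennreal (4 * e)"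
        using e(3) by (simp add: ennreal_mult''[symmetric] ennreal_plus[symmetric] flip: ennreal_numeral del: ennreal_plus)
      finally have "qvar p \<xi> N w \<le> 4 * e" using e(3) by (simp add: ennreal_le_iff)
      from budget_stop_eq(1)[OF p(1) this, of "B1 k"] have Meq: "?M w = mtrans (B1 k) p \<xi> N w" .
      have "simple_integral (B1 k) (L True) t w + simple_integral (B2 k) (L False) t w
          = mtrans (B1 k) p (\<zeta> True) N w + mtrans (B2 k) p (\<zeta> False) N w"
        using int[of "B1 k" True w] int[of "B2 k" False w] by (simp add: int0)
      also have "\<dots> = mtrans (B1 k) p \<xi> N w"
        unfolding mtrans_def sum.distrib[symmetric] \<xi>_def
        by (intro sum.cong refl) (simp add: elim(1) algebra_simps)
      finally have "\<bar>simple_integral (B1 k) (L True) t w + simple_integral (B2 k) (L False) t w\<bar> \<le> sqrt (sqrt e)"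
        using w elim(3) by (simp add: Meq[symmetric] A3_def)
      then show "\<bar>I1 k t w + I2 k t w\<bar> \<le> \<delta>" using i1 i2 e(2) by linarith
    qed
  qed
  moreover have "prob (A1 \<union> A2 \<union> A3) < \<delta>"
  proof -
    have "prob (A1 \<union> A2 \<union> A3) \<le> prob (A1 \<union> A2) + prob A3" using L12 A3 by (intro measure_Un_le) auto
    also have "prob (A1 \<union> A2) \<le> prob A1 + prob A2" using L12 by (intro measure_Un_le) auto
    finally show ?thesis using \<open>prob A3 \<le> 4 * sqrt e\<close> L12 e(1) by linarith
  qed
  ultimately show "\<exists>A\<in>sets M. prob A < \<delta> \<and> (AE w in M. w \<notin> A \<longrightarrow> \<bar>I1 k t w + I2 k t w\<bar> \<le> \<delta>)"
    using L12 A3 by (intro bexI[of _ "A1 \<union> A2 \<union> A3"]) auto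
qed

lemma path_coord_continuous:
  assumes "continuous_map (top_of_set {0..}) (L2_top \<beta>) (\<lambda>t. (u t w, v t w))"
  shows "continuous_on {0..} (\<lambda>t. u t w k)" "continuous_on {0..} (\<lambda>t. v t w k)"
  using continuous_map_compose[OF assms L2_coord_continuous(1)[of k]] continuous_map_compose[OF assms L2_coord_continuous(2)[of k]]
  by (simp_all add: o_def)

text \<open>The deviation of u + v from 1 starts at 0 and solves the heat equation, since the noises
  cancel. Continuity of the path in the weighted space bounds its norm on compact time intervals, as
  uniqueness requires.\<close>

lemma total_mass: "AE w in M. \<forall>t\<ge>0. \<forall>k. u t w k + v t w k = 1"
proof -
  have "AE w in M. \<forall>q::rat. \<forall>k. 0 < real_of_rat q \<longrightarrow> I1 k (real_of_rat q) w + I2 k (real_of_rat q) w = 0"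
    unfolding AE_all_countable using integrals_cancel by (auto intro: AE_mp)
  then show ?thesis
    using continuous_paths equation start
  proof eventually_elim
    case (elim w)
    note cont = path_coord_continuous[OF elim(2)]
    define z where "z t k = u t w k + v t w k - 1" for t k
    have zc: "continuous_on {0..} (\<lambda>t. z t k)" for k unfolding z_def by (intro continuous_intros cont)
    have z0: "u 0 w k + v 0 w k = 1" for k using elim(4) initial[of k] by auto
    have lap: "laplacian (z r) k = laplacian (u r w) k + laplacian (v r w) k" for r k
      unfolding z_def laplacian_shift[of "\<lambda>i. u r w i + v r w i"] by (rule laplacian_add)
    have li: "set_integrable lborel {0..t} (\<lambda>r. laplacian (u r w) k)" "set_integrable lborel {0..t} (\<lambda>r. laplacian (v r w) k)" for t k
      by (intro continuous_path_set_integrable continuous_on_laplacian cont, simp)+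
    have sum: "z t k - (LINT r:{0..t}|lborel. laplacian (z r) k) = I1 k t w + I2 k t w" if t: "0 \<le> t" for t k
    proof -
      have "u t w k = u 0 w k + (LINT s:{0..t}|lborel. laplacian (u s w) k) + I1 k t w"
        "v t w k = v 0 w k + (LINT s:{0..t}|lborel. laplacian (v s w) k) + I2 k t w"
        using elim(3) t by blast+
      moreover have "(LINT r:{0..t}|lborel. laplacian (z r) k)
          = (LINT s:{0..t}|lborel. laplacian (u s w) k) + (LINT s:{0..t}|lborel. laplacian (v s w) k)"
        unfolding lap by (rule set_integral_add(2)[OF li])
      ultimately show ?thesis using z0[of k] by (simp add: z_def)
    qed
    have heat: "z t k = (LINT r:{0..t}|lborel. laplacian (z r) k)" if t: "0 \<le> t" for t k
    proof -
      have "continuous_on {t..t + 1} (\<lambda>t. z t k)" using t by (intro continuous_on_subset[OF zc]) auto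
      then have "((\<lambda>t. z t k) \<longlongrightarrow> z t k) (at_right t)" by (rule continuous_on_Icc_at_rightD) simp
      then have "((\<lambda>t. z t k - (LINT r:{0..t}|lborel. laplacian (z r) k)) \<longlongrightarrow> z t k - (LINT r:{0..t}|lborel. laplacian (z r) k)) (at_right t)"
        by (intro tendsto_diff continuous_path_integral_at_right continuous_on_laplacian zc t)
      then have "z t k - (LINT r:{0..t}|lborel. laplacian (z r) k) = 0"
        by (rule zero_on_rationals[OF _ t]) (use sum elim(1) in auto)
      then show ?thesis by simp
    qed
    have "z T k = 0" if T: "0 \<le> T" for T k
    proof -
      let ?x = "\<lambda>t. (u t w, v t w)"
      have L2: "?x t \<in> L2_space \<beta>" if "0 \<le> t" for t
        using elim(2) that by (auto simp: continuous_map_def)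
      have "continuous_map (L2_top \<beta>) euclideanreal (\<lambda>x. L2_dist \<beta> x (?x 0))"
      proof (rule continuous_map_L2_lipschitz[of 1])
        fix x y assume "x \<in> L2_space \<beta>" "y \<in> L2_space \<beta>"
        then show "\<bar>L2_dist \<beta> x (?x 0) - L2_dist \<beta> y (?x 0)\<bar> \<le> 1 * L2_dist \<beta> x y"
          using L2.triangle[of x y "?x 0"] L2.triangle[of y x "?x 0"] L2[of 0] L2.commute[of x y] by auto
      qed simp
      from continuous_map_compose[OF elim(2) this] have "continuous_on {0..} (\<lambda>t. L2_dist \<beta> (?x t) (?x 0))" by (simp add: o_def)
      then have "continuous_on {0..T} (\<lambda>t. L2_dist \<beta> (?x t) (?x 0))" by (rule continuous_on_subset) auto
      then have "bounded ((\<lambda>t. L2_dist \<beta> (?x t) (?x 0)) ` {0..T})"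
        by (intro compact_imp_bounded compact_continuous_image compact_Icc)
      then obtain D where D': "\<forall>y\<in>(\<lambda>t. L2_dist \<beta> (?x t) (?x 0)) ` {0..T}. norm y \<le> D"
        unfolding bounded_iff by (elim exE)
      have D: "L2_dist \<beta> (?x t) (?x 0) \<le> D" if "t \<in> {0..T}" for t
        using bspec[OF D' imageI[OF that]] by simp
      show ?thesis
      proof (rule heat_uniqueness[OF \<beta>_pos rate zc heat])
        show "T \<in> {0..T}" using T by simp
        fix t and E :: "'d site set" assume t: "t \<in> {0..T}" and E: "finite E"
        let ?g = "\<lambda>k. (\<bar>fst (?x t) k - fst (?x 0) k\<bar> + \<bar>snd (?x t) k - snd (?x 0) k\<bar>) * \<beta> k"
        have "(\<Sum>k\<in>E. \<bar>z t k\<bar> * \<beta> k) \<le> (\<Sum>k\<in>E. ?g k)"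
        proof (rule sum_mono)
          fix k
          have "\<bar>z t k\<bar> \<le> \<bar>u t w k - u 0 w k\<bar> + \<bar>v t w k - v 0 w k\<bar>" unfolding z_def using z0[of k] by linarith
          then show "\<bar>z t k\<bar> * \<beta> k \<le> ?g k" using \<beta>_pos[of k] by (simp add: mult_right_mono)
        qed
        also have "\<dots> \<le> infsum ?g UNIV"
          using t \<beta>_pos[THEN less_imp_le] by (intro finite_sum_le_infsum L2_dist_summable L2 E) auto
        also have "\<dots> = L2_dist \<beta> (?x t) (?x 0)" by (simp add: L2_dist_def)
        also have "\<dots> \<le> D" using D[OF t] by simp
        finally show "(\<Sum>k\<in>E. \<bar>z t k\<bar> * \<beta> k) \<le> D" .
      qed
    qed
    then show ?case by (auto simp: z_def)
  qed
qed

definition regular :: "'w \<Rightarrow> bool" where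
  "regular w \<longleftrightarrow> continuous_map (top_of_set {0..}) (L2_top \<beta>) (\<lambda>t. (u t w, v t w)) \<and>
    (\<forall>t\<ge>0. \<forall>k. v t w k = 1 - u t w k \<and> u t w k \<in> {0..1}) \<and> u 0 w = U\<^sub>0 \<and>
    (\<forall>t\<ge>0. \<forall>k. u t w k = U\<^sub>0 k + (LINT s:{0..t}|lborel. laplacian (u s w) k) + I1 k t w)"

lemma AE_regular: "AE w in M. regular w"
  using total_mass continuous_paths equation start
proof eventually_elim
  case (elim w)
  have nn: "0 \<le> u t w k \<and> 0 \<le> v t w k" if "0 \<le> t" for t k
  proof -
    have "(u t w, v t w) \<in> L2_space \<beta>" using elim(2) that by (auto simp: continuous_map_def)
    then show ?thesis by (simp add: L2_space_def)
  qed
  have "v t w k = 1 - u t w k \<and> u t w k \<in> {0..1}" if "0 \<le> t" for t k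
    using elim(1)[rule_format, OF that, of k] nn[OF that, of k] by simp
  then show ?case using elim(2,3,4) by (simp add: regular_def)
qed

lemma regular_set: "\<exists>G\<in>sets M. (AE w in M. w \<in> G) \<and> (\<forall>w\<in>G. regular w)"
proof -
  from AE_regular obtain N where N: "{w\<in>space M. \<not> regular w} \<subseteq> N" "emeasure M N = 0" "N \<in> sets M" by (rule AE_E)
  have "AE w in M. w \<notin> N" using N by (intro AE_not_in) (auto simp: null_sets_def)
  then have "AE w in M. w \<in> space M - N" using AE_space by eventually_elim auto
  then show ?thesis using N by (intro bexI[of _ "space M - N"]) auto
qed

text \<open>Fixed by choice as a measurable event, since \<open>regular\<close> itself need not
  define one.\<close>

definition good_set :: "'w set" where
  "good_set = (SOME G. G \<in> sets M \<and> (AE w in M. w \<in> G) \<and> (\<forall>w\<in>G. regular w))"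

lemma good_set: "good_set \<in> sets M" "AE w in M. w \<in> good_set" "w \<in> good_set \<Longrightarrow> regular w"
proof -
  have "\<exists>G. G \<in> sets M \<and> (AE w in M. w \<in> G) \<and> (\<forall>w\<in>G. regular w)" using regular_set by blast
  from someI_ex[OF this] show "good_set \<in> sets M" "AE w in M. w \<in> good_set" "w \<in> good_set \<Longrightarrow> regular w"
    unfolding good_set_def by auto
qed

text \<open>A version of \<open>u\<close> all of whose paths are continuous and stay in [0,1]; off
  the good event it is frozen at the initial state. The good event is only known to lie in
  \<open>M\<close>, so \<open>X\<close> is measurable but need not be adapted, and weights that must
  be known at the present time are built from \<open>u\<close> instead.\<close>

definition X :: "real \<Rightarrow> 'w \<Rightarrow> 'd site \<Rightarrow> real" where
  "X t w k = (if w \<in> good_set \<and> 0 \<le> t then u t w k else U\<^sub>0 k)"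

lemma X_measurable: "(\<lambda>w. X t w k) \<in> borel_measurable M"
  unfolding X_def using good_set(1) adapted_measurable[OF adapted(1), of t k]
  by (cases "0 \<le> t") (auto intro!: measurable_If)

lemma X_range: "X t w k \<in> {0..1}"
proof (cases "w \<in> good_set \<and> 0 \<le> t")
  case True
  then have "u t w k \<in> {0..1}" using good_set(3)[of w] unfolding regular_def by blast
  then show ?thesis using True unfolding X_def by simp
next
  case False
  then have "X t w k = U\<^sub>0 k" unfolding X_def by (rule if_not_P)
  then show ?thesis using initial[of k] by auto
qed

lemma X_0: "X 0 w k = U\<^sub>0 k"
  using good_set(3)[of w] by (auto simp: X_def regular_def)

lemma X_continuous: "continuous_on {0..} (\<lambda>t. X t w k)"
proof (cases "w \<in> good_set")
  case True
  then have "continuous_on {0..} (\<lambda>t. u t w k)"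
    using good_set(3)[of w] path_coord_continuous(1) by (auto simp: regular_def)
  then show ?thesis by (rule continuous_on_eq) (simp add: X_def True)
qed (simp add: X_def)

lemma X_eq: "AE w in M. \<forall>t\<ge>0. \<forall>k. u t w k = X t w k \<and> v t w k = 1 - X t w k"
  using good_set(2) by eventually_elim (use good_set(3) in \<open>auto simp: X_def regular_def\<close>)

lemma X_equation: "AE w in M. \<forall>t\<ge>0. \<forall>k. X t w k = U\<^sub>0 k + (LINT s:{0..t}|lborel. laplacian (X s w) k) + I1 k t w"
  using good_set(2)
proof eventually_elim
  case (elim w)
  have eq: "X s w = u s w" if "0 \<le> s" for s using that elim by (simp add: X_def fun_eq_iff)
  have "(LINT s:{0..t}|lborel. laplacian (X s w) k) = (LINT s:{0..t}|lborel. laplacian (u s w) k)" for t k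
    by (rule set_lebesgue_integral_cong) (auto simp: eq)
  then show ?case using good_set(3)[OF elim] by (simp add: regular_def eq)
qed

end

section \<open>Moments of the branching model\<close>

text \<open>Passing to sequences makes dominated convergence available for difference quotients of
  expectations.\<close>

lemma right_derivativeI:
  fixes f :: "real \<Rightarrow> real"
  assumes "\<And>h. (\<And>n. 0 < h n) \<Longrightarrow> h \<longlonglongrightarrow> 0 \<Longrightarrow> (\<lambda>n. (f (x + h n) - f x) / h n) \<longlonglongrightarrow> D"
  shows "(f has_real_derivative D) (at_right x)"
  unfolding has_field_derivative_iff tendsto_at_iff_sequentially
proof (intro allI impI)
  fix y assume y: "\<forall>i. y i \<in> {x<..} - {x}" "y \<longlonglongrightarrow> x"
  have "(\<lambda>n. y n - x) \<longlonglongrightarrow> 0" using tendsto_diff[OF y(2) tendsto_const[of x]] by simp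
  then have "(\<lambda>n. (f (x + (y n - x)) - f x) / (y n - x)) \<longlonglongrightarrow> D"
    using y(1) by (intro assms) auto
  then show "((\<lambda>y. (f y - f x) / (y - x)) \<circ> y) \<longlonglongrightarrow> D" by (simp add: o_def)
qed

definition path_monomial :: "(real \<Rightarrow> 'w \<Rightarrow> 'd site \<Rightarrow> real) \<Rightarrow> nat set \<Rightarrow> (nat \<Rightarrow> real) \<Rightarrow> (nat \<Rightarrow> 'd site set) \<Rightarrow> 'w \<Rightarrow> real" where
  "path_monomial X S \<tau> A w = (\<Prod>i\<in>S. \<Prod>k\<in>A i. X (\<tau> i) w k)"

definition mixed_moment :: "'w measure \<Rightarrow> (real \<Rightarrow> 'w \<Rightarrow> 'd site \<Rightarrow> real) \<Rightarrow> nat set \<Rightarrow> (nat \<Rightarrow> real) \<Rightarrow>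
    (nat \<Rightarrow> 'd site set) \<Rightarrow> 'd site set \<Rightarrow> real \<Rightarrow> real" where
  "mixed_moment M X S \<tau> A B r = (\<integral>w. path_monomial X S \<tau> A w * (\<Prod>k\<in>B. X r w k) \<partial>M)"

text \<open>The product rule without second-order terms: increments at different sites are
  orthogonal, and no site occurs twice in the set \<open>B\<close>.\<close>

definition moment_drift :: "'w measure \<Rightarrow> (real \<Rightarrow> 'w \<Rightarrow> 'd::finite site \<Rightarrow> real) \<Rightarrow> nat set \<Rightarrow> (nat \<Rightarrow> real) \<Rightarrow>
    (nat \<Rightarrow> 'd site set) \<Rightarrow> 'd site set \<Rightarrow> real \<Rightarrow> real" where
  "moment_drift M X S \<tau> A B r =
    (\<Sum>k\<in>B. \<integral>w. path_monomial X S \<tau> A w * ((\<Prod>j\<in>B - {k}. X r w j) * laplacian (X r w) k) \<partial>M)"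

text \<open>What the two processes have in common. The number \<epsilon> bounds in mean how far the
  values are from 0 and 1; it is of order 1/\<gamma> for the branching model and 0 for the voter
  process.\<close>

definition moment_flow :: "'w measure \<Rightarrow> (real \<Rightarrow> 'w \<Rightarrow> 'd::finite site \<Rightarrow> real) \<Rightarrow> ('d site \<Rightarrow> real) \<Rightarrow> real \<Rightarrow> bool" where
  "moment_flow M X U\<^sub>0 \<epsilon> \<longleftrightarrow> prob_space M \<and>
     (\<forall>t\<ge>0. \<forall>k. (\<lambda>w. X t w k) \<in> borel_measurable M) \<and> (\<forall>t w k. X t w k \<in> {0..1}) \<and>
     (AE w in M. \<forall>k. X 0 w k = U\<^sub>0 k) \<and>
     (\<forall>t\<ge>0. \<forall>k. (\<integral>w. X t w k * (1 - X t w k) \<partial>M) \<le> \<epsilon>) \<and>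
     (\<forall>S \<tau> A B s. finite S \<and> (\<forall>i\<in>S. 0 \<le> \<tau> i \<and> \<tau> i \<le> s \<and> finite (A i)) \<and> 0 \<le> s \<and> finite B \<longrightarrow>
        continuous_on {s..} (mixed_moment M X S \<tau> A B) \<and>
        (\<forall>r\<ge>s. (mixed_moment M X S \<tau> A B has_real_derivative moment_drift M X S \<tau> A B r) (at_right r)))"

lemma prod_unit:
  fixes f :: "'i \<Rightarrow> real"
  assumes "\<And>i. i \<in> A \<Longrightarrow> f i \<in> {0..1}"
  shows "(\<Prod>i\<in>A. f i) \<in> {0..1}"
  using assms by (auto intro!: prod_nonneg prod_le_1)

text \<open>The product is at most the cube of its largest factor, and that cube is one of the
  summands.\<close>

lemma cube_powers_bound:
  fixes x :: "'i \<Rightarrow> real"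
  assumes D: "finite D" "3 \<le> card D" and x: "\<And>i. i \<in> D \<Longrightarrow> \<bar>x i\<bar> \<le> 1"
  shows "\<bar>\<Prod>i\<in>D. x i\<bar> \<le> (\<Sum>i\<in>D. \<bar>x i\<bar> ^ 3)"
proof -
  have ne: "D \<noteq> {}" using D by auto
  define m where "m = Max ((\<lambda>i. \<bar>x i\<bar>) ` D)"
  have "m \<in> (\<lambda>i. \<bar>x i\<bar>) ` D" unfolding m_def using D(1) ne by (intro Max_in) auto
  then obtain j where j: "j \<in> D" "m = \<bar>x j\<bar>" by auto
  have le: "\<bar>x i\<bar> \<le> m" if "i \<in> D" for i unfolding m_def using D(1) that by (intro Max_ge) auto
  have "\<bar>\<Prod>i\<in>D. x i\<bar> = (\<Prod>i\<in>D. \<bar>x i\<bar>)" by (rule abs_prod)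
  also have "\<dots> \<le> (\<Prod>i\<in>D. m)" using le by (intro prod_mono) auto
  also have "\<dots> = m ^ card D" by simp
  also have "\<dots> \<le> m ^ 3" using j x[OF j(1)] D(2) by (intro power_decreasing) auto
  also have "\<dots> \<le> (\<Sum>i\<in>D. \<bar>x i\<bar> ^ 3)" unfolding j(2) using D(1) j(1) by (intro member_le_sum[of j D "\<lambda>i. \<bar>x i\<bar> ^ 3"]) auto
  finally show ?thesis .
qed

section \<open>Increments of the solution over a short window\<close>

context annihilating_sbm
begin

definition drift :: "real \<Rightarrow> real \<Rightarrow> 'd site \<Rightarrow> 'w \<Rightarrow> real" where
  "drift s t k w = (LINT r:{s..t}|lborel. laplacian (X r w) k)"

definition noise :: "real \<Rightarrow> real \<Rightarrow> 'd site \<Rightarrow> 'w \<Rightarrow> real" where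
  "noise s t k w = X t w k - X s w k - drift s t k w"

definition bracket :: "real \<Rightarrow> real \<Rightarrow> 'd site \<Rightarrow> 'w \<Rightarrow> real" where
  "bracket s t k w = (LINT r:{s..t}|lborel. \<gamma> * (X r w k * (1 - X r w k)))"

lemma laplacian_X_continuous: "continuous_on {0..} (\<lambda>t. laplacian (X t w) k)"
  by (intro continuous_on_laplacian X_continuous)

lemma laplacian_X_measurable: "(\<lambda>w. laplacian (X t w) k) \<in> borel_measurable M"
  unfolding laplacian_def using X_measurable by measurable

lemma laplacian_X_bound: "\<bar>laplacian (X t w) k\<bar> \<le> jump_rate TYPE('d)"
  by (rule laplacian_bound) (rule X_range)

lemma drift_measurable: "0 \<le> s \<Longrightarrow> drift s t k \<in> borel_measurable M"
  unfolding drift_def by (rule integral_path_measurable[OF laplacian_X_measurable laplacian_X_continuous])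

lemma drift_bound:
  assumes "0 \<le> s" "s \<le> t"
  shows "\<bar>drift s t k w\<bar> \<le> jump_rate TYPE('d) * (t - s)"
proof -
  have i: "set_integrable lborel {s..t} (\<lambda>r. laplacian (X r w) k)"
    by (rule continuous_path_set_integrable[OF laplacian_X_continuous assms(1)])
  have "\<bar>drift s t k w\<bar> \<le> (LINT r:{s..t}|lborel. \<bar>laplacian (X r w) k\<bar>)"
    unfolding drift_def using set_integral_norm_bound[OF i] by simp
  also have "\<dots> \<le> (LINT r:{s..t}|lborel. jump_rate TYPE('d))"
    by (intro set_integral_mono set_integrable_abs i set_integrable_const_Icc laplacian_X_bound)
  also have "\<dots> = jump_rate TYPE('d) * (t - s)" using assms by (simp add: set_lebesgue_integral_def)
  finally show ?thesis .
qed

lemma bracket_integrand: "0 \<le> \<gamma> * (X r w k * (1 - X r w k))" "\<gamma> * (X r w k * (1 - X r w k)) \<le> \<gamma>"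
proof -
  have x: "0 \<le> X r w k" "X r w k \<le> 1" using X_range[of r w k] by auto
  then have "X r w k * (1 - X r w k) \<le> 1 * 1" by (intro mult_mono) auto
  then show "\<gamma> * (X r w k * (1 - X r w k)) \<le> \<gamma>" using \<gamma> by (simp add: mult_left_le)
  show "0 \<le> \<gamma> * (X r w k * (1 - X r w k))" using x \<gamma> by simp
qed

lemma bracket_continuous: "continuous_on {0..} (\<lambda>r. \<gamma> * (X r w k * (1 - X r w k)))"
  by (intro continuous_intros X_continuous)

lemma bracket_measurable: "0 \<le> s \<Longrightarrow> bracket s t k \<in> borel_measurable M"
  unfolding bracket_def
  by (rule integral_path_measurable[OF _ bracket_continuous]) (use X_measurable in measurable)

lemma bracket_bounds:
  assumes "0 \<le> s" "s \<le> t"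
  shows "0 \<le> bracket s t k w" "bracket s t k w \<le> \<gamma> * (t - s)"
proof -
  have i: "set_integrable lborel {s..t} (\<lambda>r. \<gamma> * (X r w k * (1 - X r w k)))"
    by (rule continuous_path_set_integrable[OF bracket_continuous assms(1)])
  have "bracket s t k w \<le> (LINT r:{s..t}|lborel. \<gamma>)"
    unfolding bracket_def by (intro set_integral_mono i set_integrable_const_Icc bracket_integrand)
  also have "\<dots> = \<gamma> * (t - s)" using assms by (simp add: set_lebesgue_integral_def)
  finally show "bracket s t k w \<le> \<gamma> * (t - s)" .
  have "(LINT r:{s..t}|lborel. 0) \<le> bracket s t k w"
    unfolding bracket_def by (intro set_integral_mono i set_integrable_const_Icc bracket_integrand)
  then show "0 \<le> bracket s t k w" by (simp add: set_lebesgue_integral_def)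
qed

lemma X_increment_bound: "\<bar>X t w k - X s w k\<bar> \<le> 1"
  using X_range[of t w k] X_range[of s w k] by (auto simp: abs_le_iff)

lemma noise_bound:
  assumes "0 \<le> s" "s \<le> t"
  shows "\<bar>noise s t k w\<bar> \<le> 1 + jump_rate TYPE('d) * (t - s)"
  unfolding noise_def using X_increment_bound[of t w k s] drift_bound[OF assms, of k w] by linarith

lemma noise_measurable: "0 \<le> s \<Longrightarrow> noise s t k \<in> borel_measurable M"
  unfolding noise_def using X_measurable drift_measurable by measurable

text \<open>The integrand is at most \<open>sqrt \<gamma>\<close> because x (1 - x) is at most 1,
  which fixes the budget as \<open>(\<gamma> + 1) * (t - s)\<close>; the noise is bounded because
  \<open>X\<close> and the drift are.\<close>

lemma window:
  assumes K: "finite K" and st: "0 \<le> s" "s < t"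
  shows "ito_window M F K B1 (\<lambda>k s w. sqrt (\<gamma> * u s w k * v s w k)) I1 (noise s t) (bracket s t)
    s t (sqrt \<gamma>) (1 + jump_rate TYPE('d) * (t - s)) ((\<gamma> + 1) * (t - s))"
proof (unfold_locales)
  fix k
  have sq: "\<gamma> * u r w k * v r w k = \<gamma> * (X r w k * (1 - X r w k))" if "u r w k = X r w k \<and> v r w k = 1 - X r w k" for r w
    using that by (simp add: mult.assoc)
  show "AE w in M. \<forall>r\<in>{s..t}. \<bar>sqrt (\<gamma> * u r w k * v r w k)\<bar> \<le> sqrt \<gamma>"
    using X_eq
  proof eventually_elim
    case (elim w)
    show ?case
    proof
      fix r assume "r \<in> {s..t}"
      then have r: "0 \<le> r" using st by simp
      show "\<bar>sqrt (\<gamma> * u r w k * v r w k)\<bar> \<le> sqrt \<gamma>"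
        unfolding sq[OF elim[rule_format, OF r, of k]] using bracket_integrand[of r w k] by simp
    qed
  qed
  show "AE w in M. noise s t k w = I1 k t w - I1 k s w"
    using X_equation
  proof eventually_elim
    case (elim w)
    have "0 \<le> t" using st by simp
    have i: "set_integrable lborel {a..b} (\<lambda>r. laplacian (X r w) k)" if "0 \<le> a" for a b
      by (rule continuous_path_set_integrable[OF laplacian_X_continuous that])
    have "(LINT r:{0..s}|lborel. laplacian (X r w) k) + (LINT r:{s..t}|lborel. laplacian (X r w) k)
        = (LINT r:{0..t}|lborel. laplacian (X r w) k)"
    proof -
      have "{0..t} = {0..s} \<union> {s..t}" using st by auto
      moreover have "(LINT r:{0..s} \<union> {s..t}|lborel. laplacian (X r w) k)
          = (LINT r:{0..s}|lborel. laplacian (X r w) k) + (LINT r:{s..t}|lborel. laplacian (X r w) k)"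
        using i st AE_lborel_singleton[of s]
        by (intro set_integral_Un_AE) (auto simp: set_integrable_def set_borel_measurable_def elim!: eventually_mono)
      ultimately show ?thesis by simp
    qed
    then show ?case
      using elim[rule_format, OF \<open>0 \<le> t\<close>, of k] elim[rule_format, OF st(1), of k] by (simp add: noise_def drift_def)
  qed
  show "AE w in M. bracket s t k w = (LINT r:{s..t}|lborel. (sqrt (\<gamma> * u r w k * v r w k))\<^sup>2)"
    using X_eq
  proof eventually_elim
    case (elim w)
    show ?case
      unfolding bracket_def
    proof (rule set_lebesgue_integral_cong)
      show "\<forall>r. r \<in> {s..t} \<longrightarrow> \<gamma> * (X r w k * (1 - X r w k)) = (sqrt (\<gamma> * u r w k * v r w k))\<^sup>2"
      proof (intro allI impI)
        fix r assume "r \<in> {s..t}"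
        then have r: "0 \<le> r" using st by simp
        show "\<gamma> * (X r w k * (1 - X r w k)) = (sqrt (\<gamma> * u r w k * v r w k))\<^sup>2"
          unfolding sq[OF elim[rule_format, OF r, of k]] using bracket_integrand[of r w k] by simp
      qed
    qed simp
  qed
qed (use K st B1 ito1 \<gamma> noise_measurable noise_bound bracket_measurable in \<open>auto intro!: AE_I2\<close>)

lemma noise_orthogonal: "k \<noteq> l \<Longrightarrow> orthogonal_increments (B1 k) (B1 l)"
proof (rule orthogonal_incrementsI[OF B1 B1 jointly])
  fix t :: real assume t: "0 \<le> t" and kl: "k \<noteq> l"
  show "B1 k t \<in> lincomb (case_sum (\<lambda>(t, k). B1 k t) (\<lambda>(t, k). B2 k t)) (({0..} \<times> UNIV) <+> ({0..} \<times> UNIV))"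
    "B1 l t \<in> lincomb (case_sum (\<lambda>(t, k). B1 k t) (\<lambda>(t, k). B2 k t)) (({0..} \<times> UNIV) <+> ({0..} \<times> UNIV))"
  proof -
    have m: "Inl (t, j) \<in> ({0..} \<times> UNIV) <+> ({0..} \<times> UNIV)" for j :: "'d site" using t by auto
    show "B1 k t \<in> lincomb (case_sum (\<lambda>(t, k). B1 k t) (\<lambda>(t, k). B2 k t)) (({0..} \<times> UNIV) <+> ({0..} \<times> UNIV))"
      "B1 l t \<in> lincomb (case_sum (\<lambda>(t, k). B1 k t) (\<lambda>(t, k). B2 k t)) (({0..} \<times> UNIV) <+> ({0..} \<times> UNIV))"
      using lincomb_base[OF m[of k], of "case_sum (\<lambda>(t, k). B1 k t) (\<lambda>(t, k). B2 k t)"]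
        lincomb_base[OF m[of l], of "case_sum (\<lambda>(t, k). B1 k t) (\<lambda>(t, k). B2 k t)"] by simp_all
  qed
  show "expectation (\<lambda>w. B1 k t w * B1 l t w) = 0" using cov(1)[OF t, of k l] kl by simp
qed

definition increment :: "real \<Rightarrow> real \<Rightarrow> 'd site \<Rightarrow> 'w \<Rightarrow> real" where
  "increment s t k w = X t w k - X s w k"

lemma increment_decomposition: "increment s t k w = noise s t k w + drift s t k w"
  by (simp add: increment_def noise_def)

lemma increment_measurable: "increment s t k \<in> borel_measurable M"
  unfolding increment_def using X_measurable by measurable

lemma bounded_rvI: "f \<in> borel_measurable M \<Longrightarrow> (\<And>w. \<bar>f w\<bar> \<le> c) \<Longrightarrow> bounded_rv f"
  by (auto simp: bounded_rv_def)

lemma bounded_rv_dynamics: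
  assumes "0 \<le> s" "s \<le> t"
  shows "bounded_rv (noise s t k)" "bounded_rv (drift s t k)" "bounded_rv (bracket s t k)" "bounded_rv (increment s t k)"
  using noise_measurable[OF assms(1), of t k] drift_measurable[OF assms(1), of t k] bracket_measurable[OF assms(1), of t k]
    increment_measurable[of s t k] noise_bound[OF assms, of k] drift_bound[OF assms, of k]
    bracket_bounds[OF assms, of k] X_increment_bound[of t _ k s]
  by (auto intro!: bounded_rvI simp: increment_def[abs_def])

lemma noise_moments:
  assumes st: "0 \<le> s" "s < t"
  shows "expectation (\<lambda>w. (noise s t k w)\<^sup>2) = expectation (bracket s t k)"
    and "expectation (\<lambda>w. noise s t k w ^ 4) \<le> 3 * ((\<gamma> + 1) * (t - s))\<^sup>2"
    and "expectation (\<lambda>w. \<bar>noise s t k w\<bar>) \<le> sqrt (\<gamma> * (t - s))"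
proof -
  interpret w: ito_window M F "{k}" B1 "\<lambda>k s w. sqrt (\<gamma> * u s w k * v s w k)" I1 "noise s t" "bracket s t"
    s t "sqrt \<gamma>" "1 + jump_rate TYPE('d) * (t - s)" "(\<gamma> + 1) * (t - s)"
    by (rule window[OF _ st]) simp
  show sq: "expectation (\<lambda>w. (noise s t k w)\<^sup>2) = expectation (bracket s t k)" by (rule w.J_square) simp
  show "expectation (\<lambda>w. noise s t k w ^ 4) \<le> 3 * ((\<gamma> + 1) * (t - s))\<^sup>2" by (rule w.J_fourth) simp
  have le: "s \<le> t" using st by simp
  note b = bounded_rv_dynamics[OF st(1) le, of k]
  have "expectation (bracket s t k) \<le> expectation (\<lambda>_. \<gamma> * (t - s))"
    using bracket_bounds(2)[OF st(1) le] by (intro integral_mono integrable_bounded_rv b) auto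
  then have "expectation (\<lambda>w. (noise s t k w)\<^sup>2) \<le> \<gamma> * (t - s)" unfolding sq by (simp add: prob_space)
  moreover have "expectation (\<lambda>w. \<bar>noise s t k w\<bar>) \<le> sqrt (expectation (\<lambda>w. (noise s t k w)\<^sup>2))"
    using b(1) by (intro abs_expectation_le_sqrt(2) integrable_bounded_rv bounded_rv_power noise_measurable st)
  ultimately show "expectation (\<lambda>w. \<bar>noise s t k w\<bar>) \<le> sqrt (\<gamma> * (t - s))"
    by (meson order.trans real_sqrt_le_mono)
qed

lemma noise_centred:
  assumes st: "0 \<le> s" "s < t" and Z: "Z \<in> borel_measurable (F s)" "AE w in M. \<bar>Z w\<bar> \<le> C"
  shows "expectation (\<lambda>w. Z w * noise s t k w) = 0"
    and "k \<noteq> l \<Longrightarrow> expectation (\<lambda>w. Z w * (noise s t k w * noise s t l w)) = 0"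
proof -
  interpret w: ito_window M F "{k, l}" B1 "\<lambda>k s w. sqrt (\<gamma> * u s w k * v s w k)" I1 "noise s t" "bracket s t"
    s t "sqrt \<gamma>" "1 + jump_rate TYPE('d) * (t - s)" "(\<gamma> + 1) * (t - s)"
    by (rule window[OF _ st]) simp
  show "expectation (\<lambda>w. Z w * noise s t k w) = 0" by (rule w.J_centred[OF _ Z]) simp
  show "k \<noteq> l \<Longrightarrow> expectation (\<lambda>w. Z w * (noise s t k w * noise s t l w)) = 0"
    by (rule w.J_orthogonal[OF _ _ noise_orthogonal Z]) auto
qed

text \<open>Interpolates between the second moment, of order h, and the fourth, of order h^2:
  Young's inequality with parameter \<open>sqrt h\<close> gives the order h^(3/2).\<close>

lemma increment_third_moment:
  assumes st: "0 \<le> s" "s < t"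
  defines "h \<equiv> t - s" and "\<kappa> \<equiv> jump_rate TYPE('d)"
  shows "expectation (\<lambda>w. \<bar>increment s t k w\<bar> ^ 3)
    \<le> (sqrt h * (2 * (\<gamma> * h) + 2 * (\<kappa> * h)\<^sup>2) + 8 * (3 * ((\<gamma> + 1) * h)\<^sup>2 + (\<kappa> * h) ^ 4) / sqrt h) / 2"
proof -
  have le: "s \<le> t" and h: "0 < h" using st by (simp_all add: h_def)
  note b = bounded_rv_dynamics[OF st(1) le, of k]
  let ?J = "noise s t k" and ?d = "drift s t k" and ?\<delta> = "increment s t k"
  have d: "\<bar>?d w\<bar> \<le> \<kappa> * h" for w using drift_bound[OF st(1) le] by (simp add: \<kappa>_def h_def)
  have d2: "(?d w)\<^sup>2 \<le> (\<kappa> * h)\<^sup>2" "?d w ^ 4 \<le> (\<kappa> * h) ^ 4" for w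
    using power_mono[OF d[of w], of 2] power_mono[OF d[of w], of 4] by (simp_all add: power_even_abs)
  have e2: "(?\<delta> w)\<^sup>2 \<le> 2 * (?J w)\<^sup>2 + 2 * (?d w)\<^sup>2" for w
    using zero_le_power2[of "?J w - ?d w"] by (simp add: increment_decomposition power2_sum power2_diff)
  have e4: "?\<delta> w ^ 4 \<le> 8 * (?J w ^ 4 + ?d w ^ 4)" for w
  proof -
    have "((?\<delta> w)\<^sup>2)\<^sup>2 \<le> (2 * (?J w)\<^sup>2 + 2 * (?d w)\<^sup>2)\<^sup>2" by (intro power_mono e2) auto
    also have "\<dots> \<le> 8 * (((?J w)\<^sup>2)\<^sup>2 + ((?d w)\<^sup>2)\<^sup>2)"
      using zero_le_power2[of "(?J w)\<^sup>2 - (?d w)\<^sup>2"] by (simp add: power2_sum power2_diff)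
    finally show ?thesis by (simp flip: power_mult)
  qed
  have young: "\<bar>x\<bar> ^ 3 \<le> (sqrt h * x\<^sup>2 + x ^ 4 / sqrt h) / 2" for x :: real
  proof -
    have "2 * (sqrt h * \<bar>x\<bar>) * x\<^sup>2 \<le> h * x\<^sup>2 + x ^ 4"
      using sum_squares_bound[of "sqrt h * \<bar>x\<bar>" "x\<^sup>2"] h by (simp add: power_mult_distrib flip: power_mult)
    then have "2 * \<bar>x\<bar> ^ 3 * sqrt h \<le> (sqrt h * x\<^sup>2) * sqrt h + x ^ 4"
      using h by (simp add: power3_eq_cube power2_eq_square mult_ac flip: abs_mult)
    then have "2 * \<bar>x\<bar> ^ 3 \<le> sqrt h * x\<^sup>2 + x ^ 4 / sqrt h"
      using h by (simp add: field_simps)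
    then show ?thesis by simp
  qed
  have "expectation (\<lambda>w. \<bar>?\<delta> w\<bar> ^ 3)
      \<le> expectation (\<lambda>w. (sqrt h * (2 * (?J w)\<^sup>2 + 2 * (\<kappa> * h)\<^sup>2) + 8 * (?J w ^ 4 + (\<kappa> * h) ^ 4) / sqrt h) / 2)"
  proof (rule integral_mono)
    have "bounded_rv (\<lambda>w. \<bar>?\<delta> w\<bar> ^ 3)"
      using b(4) by (intro bounded_rv_power) (auto simp: bounded_rv_def)
    then show "integrable M (\<lambda>w. \<bar>?\<delta> w\<bar> ^ 3)" by (rule integrable_bounded_rv)
    have "integrable M (\<lambda>w. (?J w)\<^sup>2)" "integrable M (\<lambda>w. ?J w ^ 4)"
      by (intro integrable_bounded_rv bounded_rv_power b)+
    then show "integrable M (\<lambda>w. (sqrt h * (2 * (?J w)\<^sup>2 + 2 * (\<kappa> * h)\<^sup>2) + 8 * (?J w ^ 4 + (\<kappa> * h) ^ 4) / sqrt h) / 2)"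
      by simp
    fix w
    have "\<bar>?\<delta> w\<bar> ^ 3 \<le> (sqrt h * (?\<delta> w)\<^sup>2 + ?\<delta> w ^ 4 / sqrt h) / 2" by (rule young)
    also have "\<dots> \<le> (sqrt h * (2 * (?J w)\<^sup>2 + 2 * (\<kappa> * h)\<^sup>2) + 8 * (?J w ^ 4 + (\<kappa> * h) ^ 4) / sqrt h) / 2"
      using e2[of w] e4[of w] d2[of w] h
      by (intro divide_right_mono add_mono mult_left_mono) auto
    finally show "\<bar>?\<delta> w\<bar> ^ 3 \<le> (sqrt h * (2 * (?J w)\<^sup>2 + 2 * (\<kappa> * h)\<^sup>2) + 8 * (?J w ^ 4 + (\<kappa> * h) ^ 4) / sqrt h) / 2" .
  qed
  also have "\<dots> = (sqrt h * (2 * expectation (\<lambda>w. (?J w)\<^sup>2) + 2 * (\<kappa> * h)\<^sup>2) + 8 * (expectation (\<lambda>w. ?J w ^ 4) + (\<kappa> * h) ^ 4) / sqrt h) / 2"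
  proof -
    have "integrable M (\<lambda>w. (?J w)\<^sup>2)" "integrable M (\<lambda>w. ?J w ^ 4)"
      by (intro integrable_bounded_rv bounded_rv_power b)+
    then show ?thesis by (simp add: prob_space)
  qed
  also have "\<dots> \<le> (sqrt h * (2 * (\<gamma> * h) + 2 * (\<kappa> * h)\<^sup>2) + 8 * (3 * ((\<gamma> + 1) * h)\<^sup>2 + (\<kappa> * h) ^ 4) / sqrt h) / 2"
  proof -
    have "expectation (bracket s t k) \<le> expectation (\<lambda>_. \<gamma> * h)"
      using bracket_bounds(2)[OF st(1) le] by (intro integral_mono integrable_bounded_rv b) (auto simp: h_def)
    then have "expectation (\<lambda>w. (?J w)\<^sup>2) \<le> \<gamma> * h" by (simp add: noise_moments(1)[OF st] prob_space)
    then show ?thesis using noise_moments(2)[OF st, of k] h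
      by (intro divide_right_mono add_mono mult_left_mono) (auto simp: h_def)
  qed
  finally show ?thesis .
qed

section \<open>Infinitesimal moments of the increments, given the past\<close>

context
  fixes t :: real and h :: "nat \<Rightarrow> real" and Z :: "'w \<Rightarrow> real" and C :: real
  assumes t: "0 \<le> t" and h: "\<And>n. 0 < h n" "h \<longlonglongrightarrow> 0"
    and Z: "Z \<in> borel_measurable (F t)" "AE w in M. \<bar>Z w\<bar> \<le> C"
begin

lemma sqrt_h: "(\<lambda>n. sqrt (h n)) \<longlonglongrightarrow> 0"
  using tendsto_real_sqrt[OF h(2)] by simp

lemma linear_rate:
  "(\<lambda>n. expectation (\<lambda>w. Z w * increment t (t + h n) k w) / h n) \<longlonglongrightarrow> expectation (\<lambda>w. Z w * laplacian (X t w) k)"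
proof -
  have Zm: "Z \<in> borel_measurable M" by (rule adapted_measurable[OF Z(1)])
  have d: "\<bar>drift t (t + h n) k w / h n\<bar> \<le> jump_rate TYPE('d)" for n w
    using drift_bound[OF t, of "t + h n" k w] h(1)[of n] by (simp add: abs_divide divide_le_eq)
  have dm: "drift t (t + h n) k \<in> borel_measurable M" for n by (rule drift_measurable[OF t])
  have "(\<lambda>n. expectation (\<lambda>w. Z w * (drift t (t + h n) k w / h n))) \<longlonglongrightarrow> expectation (\<lambda>w. Z w * laplacian (X t w) k)"
  proof (rule integral_dominated_convergence[where w = "\<lambda>_. \<bar>C\<bar> * jump_rate TYPE('d)"])
    show "AE w in M. (\<lambda>n. Z w * (drift t (t + h n) k w / h n)) \<longlonglongrightarrow> Z w * laplacian (X t w) k"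
      unfolding drift_def
      by (intro AE_I2 tendsto_mult tendsto_const path_average_tendsto laplacian_X_continuous t h)
    show "AE w in M. norm (Z w * (drift t (t + h n) k w / h n)) \<le> \<bar>C\<bar> * jump_rate TYPE('d)" for n
      using Z(2)
    proof eventually_elim
      case (elim w)
      show ?case unfolding real_norm_def abs_mult[of "Z w"] using elim by (intro mult_mono d) auto
    qed
  qed (use Zm dm laplacian_X_measurable[of t k] in auto)
  moreover have "expectation (\<lambda>w. Z w * (drift t (t + h n) k w / h n)) = expectation (\<lambda>w. Z w * increment t (t + h n) k w) / h n" for n
  proof -
    have tn: "t < t + h n" "t \<le> t + h n" using h(1)[of n] by auto
    note b = bounded_rv_dynamics[OF t tn(2), of k]
    have "integrable M (\<lambda>w. Z w * noise t (t + h n) k w)" "integrable M (\<lambda>w. Z w * drift t (t + h n) k w)"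
      by (intro integrable_bounded_mult[OF _ Zm Z(2)] integrable_bounded_rv b)+
    then have "expectation (\<lambda>w. Z w * increment t (t + h n) k w) = expectation (\<lambda>w. Z w * drift t (t + h n) k w)"
      using noise_centred(1)[OF t tn(1) Z, of k] by (simp add: increment_decomposition distrib_left)
    then show ?thesis by simp
  qed
  ultimately show ?thesis by (simp only:)
qed

text \<open>The product of the two noises is centred. Every other term contains a drift, of order h,
  paired with a noise of mean size at most of order \<open>sqrt h\<close> or with another
  drift.\<close>

lemma cross_rate:
  assumes kl: "k \<noteq> l"
  shows "(\<lambda>n. expectation (\<lambda>w. Z w * (increment t (t + h n) k w * increment t (t + h n) l w)) / h n) \<longlonglongrightarrow> 0"
proof (rule Lim_null_comparison)
  let ?\<kappa> = "jump_rate TYPE('d)"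
  let ?b = "\<lambda>n. C * (?\<kappa> * (sqrt \<gamma> * sqrt (h n) + sqrt \<gamma> * sqrt (h n)) + ?\<kappa> * ?\<kappa> * h n)"
  have Zm: "Z \<in> borel_measurable M" by (rule adapted_measurable[OF Z(1)])
  show "\<forall>\<^sub>F n in sequentially. norm (expectation (\<lambda>w. Z w * (increment t (t + h n) k w * increment t (t + h n) l w)) / h n) \<le> ?b n"
  proof (rule always_eventually, rule allI)
    fix n
    have tn: "t < t + h n" "t \<le> t + h n" using h(1)[of n] by auto
    note bk = bounded_rv_dynamics[OF t tn(2), of k] and bl = bounded_rv_dynamics[OF t tn(2), of l]
    let ?J = "noise t (t + h n)" and ?d = "drift t (t + h n)"
    define E where "E w = ?J k w * ?d l w + ?d k w * ?J l w + ?d k w * ?d l w" for w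
    have C0: "0 \<le> C" by (rule AE_bound_nonneg[OF Z(2)])
    have Eb: "bounded_rv E" unfolding E_def by (intro bounded_rv_add bounded_rv_mult bk bl)
    have "(\<lambda>w. Z w * (increment t (t + h n) k w * increment t (t + h n) l w)) = (\<lambda>w. Z w * (?J k w * ?J l w) + Z w * E w)"
      by (simp add: fun_eq_iff increment_decomposition E_def algebra_simps)
    moreover have "integrable M (\<lambda>w. Z w * (?J k w * ?J l w))" "integrable M (\<lambda>w. Z w * E w)"
      by (intro integrable_bounded_mult[OF _ Zm Z(2)] integrable_bounded_rv bounded_rv_mult bk bl Eb)+
    ultimately have eq: "expectation (\<lambda>w. Z w * (increment t (t + h n) k w * increment t (t + h n) l w)) = expectation (\<lambda>w. Z w * E w)"
      using noise_centred(2)[OF t tn(1) Z kl] by simp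
    have d: "\<bar>?d j w\<bar> \<le> ?\<kappa> * h n" for j w using drift_bound[OF t tn(2)] by simp
    have "\<bar>expectation (\<lambda>w. Z w * E w)\<bar> \<le> expectation (\<lambda>w. C * (?\<kappa> * h n * (\<bar>?J k w\<bar> + \<bar>?J l w\<bar>) + (?\<kappa> * h n) * (?\<kappa> * h n)))"
    proof (rule order.trans[OF integral_abs_bound integral_mono_AE])
      show "integrable M (\<lambda>w. \<bar>Z w * E w\<bar>)"
        by (intro integrable_abs integrable_bounded_mult[OF _ Zm Z(2)] integrable_bounded_rv Eb)
      show "integrable M (\<lambda>w. C * (?\<kappa> * h n * (\<bar>?J k w\<bar> + \<bar>?J l w\<bar>) + (?\<kappa> * h n) * (?\<kappa> * h n)))"
        using integrable_bounded_rv[OF bk(1)] integrable_bounded_rv[OF bl(1)]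
        by (intro integrable_mult_right Bochner_Integration.integrable_add integrable_abs integrable_const)
      show "AE w in M. \<bar>Z w * E w\<bar> \<le> C * (?\<kappa> * h n * (\<bar>?J k w\<bar> + \<bar>?J l w\<bar>) + (?\<kappa> * h n) * (?\<kappa> * h n))"
        using Z(2)
      proof eventually_elim
        case (elim w)
        have "\<bar>?J k w * ?d l w\<bar> \<le> \<bar>?J k w\<bar> * (?\<kappa> * h n)" "\<bar>?d k w * ?J l w\<bar> \<le> (?\<kappa> * h n) * \<bar>?J l w\<bar>"
          "\<bar>?d k w * ?d l w\<bar> \<le> (?\<kappa> * h n) * (?\<kappa> * h n)"
          unfolding abs_mult using d[of k w] d[of l w] by (auto intro!: mult_mono mult_left_mono mult_right_mono order.trans[OF abs_ge_zero])
        then have "\<bar>E w\<bar> \<le> \<bar>?J k w\<bar> * (?\<kappa> * h n) + (?\<kappa> * h n) * \<bar>?J l w\<bar> + (?\<kappa> * h n) * (?\<kappa> * h n)"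
          unfolding E_def by linarith
        then have "\<bar>E w\<bar> \<le> ?\<kappa> * h n * (\<bar>?J k w\<bar> + \<bar>?J l w\<bar>) + (?\<kappa> * h n) * (?\<kappa> * h n)" by (simp add: algebra_simps)
        then show ?case unfolding abs_mult[of "Z w"] using elim C0 by (intro mult_mono) auto
      qed
    qed
    also have "\<dots> = C * (?\<kappa> * h n * (expectation (\<lambda>w. \<bar>?J k w\<bar>) + expectation (\<lambda>w. \<bar>?J l w\<bar>)) + (?\<kappa> * h n) * (?\<kappa> * h n))"
    proof -
      have i: "integrable M (\<lambda>w. \<bar>?J k w\<bar>)" "integrable M (\<lambda>w. \<bar>?J l w\<bar>)"
        using integrable_bounded_rv[OF bk(1)] integrable_bounded_rv[OF bl(1)] by auto
      then have "integrable M (\<lambda>w. ?\<kappa> * h n * (\<bar>?J k w\<bar> + \<bar>?J l w\<bar>))" by (intro integrable_mult_right Bochner_Integration.integrable_add)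
      then show ?thesis using i
        by (subst integral_mult_right_zero, subst Bochner_Integration.integral_add) (simp_all add: prob_space)
    qed
    also have "\<dots> \<le> C * (?\<kappa> * h n * (sqrt \<gamma> * sqrt (h n) + sqrt \<gamma> * sqrt (h n)) + (?\<kappa> * h n) * (?\<kappa> * h n))"
      using noise_moments(3)[OF t tn(1), of k] noise_moments(3)[OF t tn(1), of l] C0 jump_rate_nonneg[where 'd = 'd] h(1)[of n]
      by (intro mult_left_mono add_mono) (auto simp: real_sqrt_mult)
    also have "\<dots> = ?b n * h n" by (simp add: algebra_simps)
    finally show "norm (expectation (\<lambda>w. Z w * (increment t (t + h n) k w * increment t (t + h n) l w)) / h n) \<le> ?b n"
      using h(1)[of n] by (simp add: eq abs_divide divide_le_eq)
  qed
  have "?b \<longlonglongrightarrow> C * (?\<kappa> * (sqrt \<gamma> * 0 + sqrt \<gamma> * 0) + ?\<kappa> * ?\<kappa> * 0)"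
    by (intro tendsto_intros sqrt_h h(2))
  then show "?b \<longlonglongrightarrow> 0" by simp
qed

lemma cubic_rate: "(\<lambda>n. expectation (\<lambda>w. \<bar>increment t (t + h n) k w\<bar> ^ 3) / h n) \<longlonglongrightarrow> 0"
proof (rule Lim_null_comparison)
  let ?\<kappa> = "jump_rate TYPE('d)"
  let ?b = "\<lambda>n. (sqrt (h n) * (2 * \<gamma> + 2 * ?\<kappa>\<^sup>2 * h n) + sqrt (h n) * (24 * (\<gamma> + 1)\<^sup>2 + 8 * ?\<kappa> ^ 4 * (h n)\<^sup>2)) / 2"
  show "\<forall>\<^sub>F n in sequentially. norm (expectation (\<lambda>w. \<bar>increment t (t + h n) k w\<bar> ^ 3) / h n) \<le> ?b n"
  proof (rule always_eventually, rule allI)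
    fix n
    define q where "q = sqrt (h n)"
    have q: "0 < q" "h n = q * q" using h(1)[of n] by (simp_all add: q_def)
    have "expectation (\<lambda>w. \<bar>increment t (t + h n) k w\<bar> ^ 3)
      \<le> (q * (2 * (\<gamma> * (q * q)) + 2 * (?\<kappa> * (q * q))\<^sup>2) + 8 * (3 * ((\<gamma> + 1) * (q * q))\<^sup>2 + (?\<kappa> * (q * q)) ^ 4) / q) / 2"
      using increment_third_moment[OF t, of "t + h n" k] h(1)[of n] by (simp add: q_def)
    also have "\<dots> = (q * (2 * \<gamma> + 2 * ?\<kappa>\<^sup>2 * (q * q)) + q * (24 * (\<gamma> + 1)\<^sup>2 + 8 * ?\<kappa> ^ 4 * (q * q)\<^sup>2)) / 2 * (q * q)"
      using q(1) by (simp add: field_simps power2_eq_square power4_eq_xxxx)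
    finally have "expectation (\<lambda>w. \<bar>increment t (t + h n) k w\<bar> ^ 3) \<le> ?b n * h n"
      unfolding q_def[symmetric] by (simp only: q(2))
    then show "norm (expectation (\<lambda>w. \<bar>increment t (t + h n) k w\<bar> ^ 3) / h n) \<le> ?b n"
      using h(1)[of n] by (simp add: divide_le_eq)
  qed
  have "?b \<longlonglongrightarrow> (0 * (2 * \<gamma> + 2 * ?\<kappa>\<^sup>2 * 0) + 0 * (24 * (\<gamma> + 1)\<^sup>2 + 8 * ?\<kappa> ^ 4 * 0\<^sup>2)) / 2"
    by (intro tendsto_intros sqrt_h h(2)) simp
  then show "?b \<longlonglongrightarrow> 0" by simp
qed

text \<open>The squared noise has the expectation of the bracket, whose average over the window
  tends to its integrand; the terms that contain a drift are of smaller order.\<close>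

lemma square_rate:
  "(\<lambda>n. expectation (\<lambda>w. (increment t (t + h n) k w)\<^sup>2) / h n) \<longlonglongrightarrow> \<gamma> * expectation (\<lambda>w. X t w k * (1 - X t w k))"
proof -
  let ?\<kappa> = "jump_rate TYPE('d)"
  define E where "E n w = 2 * (noise t (t + h n) k w * drift t (t + h n) k w) + (drift t (t + h n) k w)\<^sup>2" for n w
  have tn: "t < t + h n" "t \<le> t + h n" for n using h(1)[of n] by auto
  note b = bounded_rv_dynamics[OF t tn(2), of _ k]
  have "(\<lambda>n. expectation (\<lambda>w. bracket t (t + h n) k w / h n)) \<longlonglongrightarrow> expectation (\<lambda>w. \<gamma> * (X t w k * (1 - X t w k)))"
  proof (rule integral_dominated_convergence[where w = "\<lambda>_. \<gamma>"])
    show "AE w in M. (\<lambda>n. bracket t (t + h n) k w / h n) \<longlonglongrightarrow> \<gamma> * (X t w k * (1 - X t w k))"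
      unfolding bracket_def by (intro AE_I2 path_average_tendsto bracket_continuous t h)
    show "AE w in M. norm (bracket t (t + h n) k w / h n) \<le> \<gamma>" for n
      using bracket_bounds[OF t tn(2), of n k] h(1)[of n] by (auto simp: divide_le_eq)
  qed (use bracket_measurable[OF t] X_measurable[of t k] in auto)
  then have lim: "(\<lambda>n. expectation (bracket t (t + h n) k) / h n) \<longlonglongrightarrow> \<gamma> * expectation (\<lambda>w. X t w k * (1 - X t w k))" by simp
  have "(\<lambda>n. expectation (E n) / h n) \<longlonglongrightarrow> 0"
  proof (rule Lim_null_comparison)
    let ?b = "\<lambda>n. 2 * ?\<kappa> * (sqrt \<gamma> * sqrt (h n)) + ?\<kappa>\<^sup>2 * h n"
    show "\<forall>\<^sub>F n in sequentially. norm (expectation (E n) / h n) \<le> ?b n"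
    proof (rule always_eventually, rule allI)
      fix n
      have d: "\<bar>drift t (t + h n) k w\<bar> \<le> ?\<kappa> * h n" for w using drift_bound[OF t tn(2), of n k w] by simp
      have Ji: "integrable M (\<lambda>w. \<bar>noise t (t + h n) k w\<bar>)" using integrable_bounded_rv[OF b(1)] by auto
      have "bounded_rv (E n)"
        unfolding E_def by (intro bounded_rv_add bounded_rv_mult bounded_rv_power bounded_rv_const b)
      then have Ei: "integrable M (E n)" by (rule integrable_bounded_rv)
      have "\<bar>expectation (E n)\<bar> \<le> expectation (\<lambda>w. (2 * (?\<kappa> * h n)) * \<bar>noise t (t + h n) k w\<bar> + (?\<kappa> * h n)\<^sup>2)"
      proof (rule order.trans[OF integral_abs_bound integral_mono])
        fix w
        have "\<bar>noise t (t + h n) k w * drift t (t + h n) k w\<bar> \<le> \<bar>noise t (t + h n) k w\<bar> * (?\<kappa> * h n)"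
          unfolding abs_mult using d by (intro mult_left_mono) auto
        moreover have "(drift t (t + h n) k w)\<^sup>2 \<le> (?\<kappa> * h n)\<^sup>2" using power_mono[OF d[of w], of 2] by simp
        moreover have "0 \<le> (drift t (t + h n) k w)\<^sup>2" by simp
        ultimately have "\<bar>E n w\<bar> \<le> 2 * (\<bar>noise t (t + h n) k w\<bar> * (?\<kappa> * h n)) + (?\<kappa> * h n)\<^sup>2" unfolding E_def by linarith
        then show "\<bar>E n w\<bar> \<le> (2 * (?\<kappa> * h n)) * \<bar>noise t (t + h n) k w\<bar> + (?\<kappa> * h n)\<^sup>2" by (simp add: mult_ac)
      qed (use Ei Ji in auto)
      also have "\<dots> = (2 * (?\<kappa> * h n)) * expectation (\<lambda>w. \<bar>noise t (t + h n) k w\<bar>) + (?\<kappa> * h n)\<^sup>2"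
        using Ji by (simp add: prob_space)
      also have "\<dots> \<le> (2 * (?\<kappa> * h n)) * (sqrt \<gamma> * sqrt (h n)) + (?\<kappa> * h n)\<^sup>2"
        using noise_moments(3)[OF t tn(1), of n k] jump_rate_nonneg[where 'd = 'd] h(1)[of n]
        by (intro add_right_mono mult_left_mono) (auto simp: real_sqrt_mult)
      also have "\<dots> = ?b n * h n" by (simp add: algebra_simps power2_eq_square)
      finally show "norm (expectation (E n) / h n) \<le> ?b n"
        using h(1)[of n] by (simp add: abs_divide divide_le_eq)
    qed
    have "?b \<longlonglongrightarrow> 2 * ?\<kappa> * (sqrt \<gamma> * 0) + ?\<kappa>\<^sup>2 * 0" by (intro tendsto_intros sqrt_h h(2))
    then show "?b \<longlonglongrightarrow> 0" by simp
  qed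
  from tendsto_add[OF lim this] show ?thesis
  proof (rule filterlim_cong[THEN iffD1, rotated 3], goal_cases)
    case 3
    show ?case
    proof (rule always_eventually, rule allI)
      fix n
      have "(\<lambda>w. (increment t (t + h n) k w)\<^sup>2) = (\<lambda>w. (noise t (t + h n) k w)\<^sup>2 + E n w)"
        by (simp add: fun_eq_iff increment_decomposition E_def power2_eq_square algebra_simps)
      moreover have "integrable M (\<lambda>w. (noise t (t + h n) k w)\<^sup>2)" "integrable M (E n)"
        unfolding E_def
        by (intro integrable_bounded_rv bounded_rv_add bounded_rv_mult bounded_rv_power bounded_rv_const b)+
      ultimately have "expectation (\<lambda>w. (increment t (t + h n) k w)\<^sup>2) = expectation (bracket t (t + h n) k) + expectation (E n)"
        using noise_moments(1)[OF t tn(1), of n k] by simp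
      then show "expectation (bracket t (t + h n) k) / h n + expectation (E n) / h n
          = expectation (\<lambda>w. (increment t (t + h n) k w)\<^sup>2) / h n"
        by (simp add: add_divide_distrib)
    qed
  qed simp_all
qed

end

text \<open>Expand the product at the later time over the set \<open>D\<close> of sites whose
  increment is taken. One such site gives the drift, two give o(h) by orthogonality, and three or
  more are dominated by third moments.\<close>

lemma product_rate:
  assumes t: "0 \<le> t" and h: "\<And>n. 0 < h n" "h \<longlonglongrightarrow> 0"
    and Z: "Z \<in> borel_measurable (F t)" "AE w in M. \<bar>Z w\<bar> \<le> C" and A: "finite A"
  shows "(\<lambda>n. expectation (\<lambda>w. Z w * ((\<Prod>k\<in>A. X (t + h n) w k) - (\<Prod>k\<in>A. X t w k))) / h n)
    \<longlonglongrightarrow> (\<Sum>k\<in>A. expectation (\<lambda>w. Z w * ((\<Prod>j\<in>A - {k}. X t w j) * laplacian (X t w) k)))"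
proof -
  let ?\<delta> = "\<lambda>n k. increment t (t + h n) k"
  have Zm: "Z \<in> borel_measurable M" by (rule adapted_measurable[OF Z(1)])
  \<comment> \<open>Built from \<open>u\<close>, which is adapted; almost surely it agrees with the
    same expression in \<open>X\<close>.\<close>
  define Y where "Y D w = Z w * (\<Prod>k\<in>A - D. u t w k)" for D w
  have Ym: "Y D \<in> borel_measurable (F t)" for D
    unfolding Y_def using Z(1) adapted(1)[OF t] by measurable
  have Yeq: "AE w in M. \<forall>D. Y D w = Z w * (\<Prod>k\<in>A - D. X t w k)"
    using X_eq by eventually_elim (use t in \<open>auto simp: Y_def\<close>)
  have Yb: "AE w in M. \<bar>Y D w\<bar> \<le> C" for D
    using Yeq Z(2)
  proof eventually_elim
    case (elim w)
    have "(\<Prod>k\<in>A - D. X t w k) \<in> {0..1}" by (intro prod_unit X_range)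
    then have "\<bar>Z w\<bar> * \<bar>\<Prod>k\<in>A - D. X t w k\<bar> \<le> C * 1" using elim(2) by (intro mult_mono) auto
    then show ?case using elim(1) by (simp add: abs_mult)
  qed
  have C0: "0 \<le> C" by (rule AE_bound_nonneg[OF Z(2)])
  have prod_m: "(\<lambda>w. \<Prod>k\<in>D. X r w k) \<in> borel_measurable M" for D r using X_measurable by measurable
  have dprod_m: "(\<lambda>w. \<Prod>k\<in>D. ?\<delta> n k w) \<in> borel_measurable M" for D n using increment_measurable by measurable
  have db: "\<bar>?\<delta> n k w\<bar> \<le> 1" for n k w unfolding increment_def by (rule X_increment_bound)
  have dprod_b: "\<bar>\<Prod>k\<in>D. ?\<delta> n k w\<bar> \<le> 1" for D n w
    unfolding abs_prod using db by (intro prod_le_1) auto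
  have dprod_i: "integrable M (\<lambda>w. \<Prod>k\<in>D. ?\<delta> n k w)" for D n
    by (intro integrable_bounded_rv bounded_rvI[of _ 1] dprod_m dprod_b)
  define T where "T D n = expectation (\<lambda>w. Y D w * (\<Prod>k\<in>D. ?\<delta> n k w))" for D n
  have Ti: "integrable M (\<lambda>w. Y D w * (\<Prod>k\<in>D. ?\<delta> n k w))" for D n
    by (rule integrable_bounded_mult[OF dprod_i adapted_measurable[OF Ym] Yb])
  let ?c = "\<lambda>k. expectation (\<lambda>w. Z w * ((\<Prod>j\<in>A - {k}. X t w j) * laplacian (X t w) k))"
  have single: "(\<lambda>n. T {k} n / h n) \<longlonglongrightarrow> ?c k" for k
  proof -
    have "(\<lambda>n. T {k} n / h n) \<longlonglongrightarrow> expectation (\<lambda>w. Y {k} w * laplacian (X t w) k)"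
      unfolding T_def using linear_rate[OF t h Ym Yb, of "{k}" k] by simp
    moreover have "expectation (\<lambda>w. Y {k} w * laplacian (X t w) k) = ?c k"
    proof (rule integral_cong_AE)
      show "AE w in M. Y {k} w * laplacian (X t w) k = Z w * ((\<Prod>j\<in>A - {k}. X t w j) * laplacian (X t w) k)"
        using Yeq by eventually_elim simp
    qed (use adapted_measurable[OF Ym] Zm prod_m laplacian_X_measurable in measurable)
    ultimately show ?thesis by simp
  qed
  have double: "(\<lambda>n. T {k, l} n / h n) \<longlonglongrightarrow> 0" if "k \<noteq> l" for k l
    unfolding T_def using cross_rate[OF t h Ym Yb that, of "{k, l}"] that by simp
  have large: "(\<lambda>n. T D n / h n) \<longlonglongrightarrow> 0" if D: "finite D" "3 \<le> card D" for D
  proof (rule Lim_null_comparison)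
    have ci: "integrable M (\<lambda>w. \<bar>?\<delta> n k w\<bar> ^ 3)" for n k
    proof (intro integrable_bounded_rv bounded_rvI[of _ 1])
      show "(\<lambda>w. \<bar>?\<delta> n k w\<bar> ^ 3) \<in> borel_measurable M"
        by (intro borel_measurable_power borel_measurable_abs increment_measurable)
      show "\<bar>\<bar>?\<delta> n k w\<bar> ^ 3\<bar> \<le> 1" for w
        using power_le_one[OF abs_ge_zero db[of n k w], of 3] by (simp only: abs_of_nonneg[OF zero_le_power[OF abs_ge_zero]])
    qed
    have Tb: "\<bar>T D n\<bar> \<le> C * (\<Sum>k\<in>D. expectation (\<lambda>w. \<bar>?\<delta> n k w\<bar> ^ 3))" for n
    proof -
      have "\<bar>T D n\<bar> \<le> expectation (\<lambda>w. C * (\<Sum>k\<in>D. \<bar>?\<delta> n k w\<bar> ^ 3))"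
        unfolding T_def
      proof (rule order.trans[OF integral_abs_bound integral_mono_AE])
        show "AE w in M. \<bar>Y D w * (\<Prod>k\<in>D. ?\<delta> n k w)\<bar> \<le> C * (\<Sum>k\<in>D. \<bar>?\<delta> n k w\<bar> ^ 3)"
          using Yb[of D]
        proof eventually_elim
          case (elim w)
          show ?case unfolding abs_mult using elim C0 cube_powers_bound[OF D, of "\<lambda>k. ?\<delta> n k w"] db
            by (intro mult_mono) auto
        qed
      qed (use Ti ci in auto)
      also have "\<dots> = C * (\<Sum>k\<in>D. expectation (\<lambda>w. \<bar>?\<delta> n k w\<bar> ^ 3))"
        using ci by (simp add: Bochner_Integration.integral_sum)
      finally show ?thesis .
    qed
    show "\<forall>\<^sub>F n in sequentially. norm (T D n / h n) \<le> C * (\<Sum>k\<in>D. expectation (\<lambda>w. \<bar>?\<delta> n k w\<bar> ^ 3) / h n)"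
    proof (intro always_eventually allI)
      fix n
      have "\<bar>T D n\<bar> / h n \<le> C * (\<Sum>k\<in>D. expectation (\<lambda>w. \<bar>?\<delta> n k w\<bar> ^ 3)) / h n"
        using Tb[of n] h(1)[of n] by (intro divide_right_mono) auto
      then show "norm (T D n / h n) \<le> C * (\<Sum>k\<in>D. expectation (\<lambda>w. \<bar>?\<delta> n k w\<bar> ^ 3) / h n)"
        using h(1)[of n] by (simp add: abs_divide sum_divide_distrib[symmetric])
    qed
    have "(\<lambda>n. C * (\<Sum>k\<in>D. expectation (\<lambda>w. \<bar>?\<delta> n k w\<bar> ^ 3) / h n)) \<longlonglongrightarrow> C * (\<Sum>k\<in>D. 0)"
      by (intro tendsto_mult tendsto_const tendsto_sum cubic_rate[OF t h Z])
    then show "(\<lambda>n. C * (\<Sum>k\<in>D. expectation (\<lambda>w. \<bar>?\<delta> n k w\<bar> ^ 3) / h n)) \<longlonglongrightarrow> 0" by simp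
  qed
  have expand: "expectation (\<lambda>w. Z w * ((\<Prod>k\<in>A. X (t + h n) w k) - (\<Prod>k\<in>A. X t w k))) = (\<Sum>D\<in>Pow A - {{}}. T D n)" for n
  proof -
    have "AE w in M. Z w * ((\<Prod>k\<in>A. X (t + h n) w k) - (\<Prod>k\<in>A. X t w k)) = (\<Sum>D\<in>Pow A - {{}}. Y D w * (\<Prod>k\<in>D. ?\<delta> n k w))"
      using Yeq
    proof eventually_elim
      case (elim w)
      have "(\<Prod>k\<in>A. X (t + h n) w k) = (\<Prod>k\<in>A. ?\<delta> n k w + X t w k)" by (simp add: increment_def)
      also have "\<dots> = (\<Sum>D\<in>Pow A. (\<Prod>k\<in>D. ?\<delta> n k w) * (\<Prod>k\<in>A - D. X t w k))" by (rule prod_add[OF A])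
      also have "\<dots> = (\<Prod>k\<in>A. X t w k) + (\<Sum>D\<in>Pow A - {{}}. (\<Prod>k\<in>D. ?\<delta> n k w) * (\<Prod>k\<in>A - D. X t w k))"
        using A by (subst sum.remove[of _ "{}"]) auto
      finally have "Z w * ((\<Prod>k\<in>A. X (t + h n) w k) - (\<Prod>k\<in>A. X t w k))
          = (\<Sum>D\<in>Pow A - {{}}. Z w * ((\<Prod>k\<in>D. ?\<delta> n k w) * (\<Prod>k\<in>A - D. X t w k)))"
        by (simp add: sum_distrib_left)
      then show ?case by (simp add: elim mult_ac)
    qed
    then have "expectation (\<lambda>w. Z w * ((\<Prod>k\<in>A. X (t + h n) w k) - (\<Prod>k\<in>A. X t w k)))
        = expectation (\<lambda>w. \<Sum>D\<in>Pow A - {{}}. Y D w * (\<Prod>k\<in>D. ?\<delta> n k w))"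
      using Zm prod_m adapted_measurable[OF Ym] dprod_m by (intro integral_cong_AE) auto
    also have "\<dots> = (\<Sum>D\<in>Pow A - {{}}. T D n)" unfolding T_def using Ti by (intro Bochner_Integration.integral_sum)
    finally show ?thesis .
  qed
  define c where "c D = (if card D = 1 then ?c (the_elem D) else 0)" for D :: "'d site set"
  have rates: "(\<lambda>n. T D n / h n) \<longlonglongrightarrow> c D" if D: "D \<in> Pow A - {{}}" for D
  proof -
    have fin: "finite D" using D A finite_subset by auto
    then have "card D \<noteq> 0" using D by auto
    then consider "card D = 1" | "card D = 2" | "3 \<le> card D" by linarith
    then show ?thesis
    proof cases
      case 1
      then obtain k where k: "D = {k}" by (auto simp: card_1_singleton_iff)
      show ?thesis using single[of k] by (simp add: c_def k)
    next
      case 2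
      then obtain k l where kl: "D = {k, l}" "k \<noteq> l" by (auto simp: card_2_iff)
      show ?thesis using double[OF kl(2)] 2 by (simp add: c_def kl(1))
    next
      case 3
      then show ?thesis using large[OF fin 3] by (simp add: c_def)
    qed
  qed
  have "(\<lambda>n. \<Sum>D\<in>Pow A - {{}}. T D n / h n) \<longlonglongrightarrow> (\<Sum>D\<in>Pow A - {{}}. c D)"
    by (intro tendsto_sum rates)
  also have "(\<lambda>n. \<Sum>D\<in>Pow A - {{}}. T D n / h n) = (\<lambda>n. expectation (\<lambda>w. Z w * ((\<Prod>k\<in>A. X (t + h n) w k) - (\<Prod>k\<in>A. X t w k))) / h n)"
    by (simp add: expand sum_divide_distrib)
  also have "(\<Sum>D\<in>Pow A - {{}}. c D) = (\<Sum>D\<in>(\<lambda>k. {k}) ` A. c D)"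
    using A by (intro sum.mono_neutral_right) (auto simp: c_def card_1_singleton_iff)
  also have "\<dots> = (\<Sum>k\<in>A. ?c k)" by (subst sum.reindex) (auto simp: c_def inj_on_def)
  finally show ?thesis .
qed

lemma expectation_path_continuous:
  fixes W :: "'w \<Rightarrow> real" and g :: "real \<Rightarrow> 'w \<Rightarrow> real"
  assumes W: "W \<in> borel_measurable M" "AE w in M. \<bar>W w\<bar> \<le> C"
    and g: "\<And>r. 0 \<le> r \<Longrightarrow> g r \<in> borel_measurable M" "\<And>r w. \<bar>g r w\<bar> \<le> c" "\<And>w. continuous_on {0..} (\<lambda>r. g r w)"
    and s: "0 \<le> s"
  shows "continuous_on {s..} (\<lambda>r. expectation (\<lambda>w. W w * g r w))"
proof (rule continuous_on_sequentiallyI)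
  fix q :: "nat \<Rightarrow> real" and r assume q: "\<forall>n. q n \<in> {s..}" "r \<in> {s..}" "q \<longlonglongrightarrow> r"
  show "(\<lambda>n. expectation (\<lambda>w. W w * g (q n) w)) \<longlonglongrightarrow> expectation (\<lambda>w. W w * g r w)"
  proof (rule integral_dominated_convergence[where w = "\<lambda>_. \<bar>C\<bar> * \<bar>c\<bar>"])
    have q0: "0 \<le> q n" "0 \<le> r" for n using q(1)[rule_format, of n] q(2) s by auto
    show "(\<lambda>w. W w * g r w) \<in> borel_measurable M" "(\<lambda>w. W w * g (q n) w) \<in> borel_measurable M" for n
      using W(1) g(1) q0 by auto
    show "AE w in M. (\<lambda>n. W w * g (q n) w) \<longlonglongrightarrow> W w * g r w"
    proof (rule AE_I2)
      fix w
      have "((\<lambda>r. g r w) \<circ> q) \<longlonglongrightarrow> g r w"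
        using g(3)[of w] q(3) q0 unfolding continuous_on_sequentially by auto
      then show "(\<lambda>n. W w * g (q n) w) \<longlonglongrightarrow> W w * g r w" by (intro tendsto_mult tendsto_const) (simp add: o_def)
    qed
    show "AE w in M. norm (W w * g (q n) w) \<le> \<bar>C\<bar> * \<bar>c\<bar>" for n
      using W(2)
    proof eventually_elim
      case (elim w)
      have "\<bar>g (q n) w\<bar> \<le> \<bar>c\<bar>" using g(2)[of "q n" w] by linarith
      then show ?case unfolding real_norm_def abs_mult using elim by (intro mult_mono) auto
    qed
  qed simp
qed

text \<open>The derivative is the expectation of (1 - 2X) times the Laplacian, at most the jump
  rate, minus \<gamma> times the quantity itself. It is therefore negative whenever the quantity
  exceeds the bound, and the initial value is 0.\<close>

lemma heterozygosity_bound: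
  assumes t: "0 \<le> t"
  shows "expectation (\<lambda>w. X t w k * (1 - X t w k)) \<le> jump_rate TYPE('d) / \<gamma>"
proof (rule right_deriv_barrier[OF t, where f = "\<lambda>t. expectation (\<lambda>w. X t w k * (1 - X t w k))"])
  let ?\<kappa> = "jump_rate TYPE('d)"
  let ?g = "\<lambda>t. expectation (\<lambda>w. X t w k * (1 - X t w k))"
  have xb: "\<bar>X r w k * (1 - X r w k)\<bar> \<le> 1" for r w
  proof -
    have "X r w k \<in> {0..1}" by (rule X_range)
    then have "X r w k * (1 - X r w k) \<le> 1 * 1" "0 \<le> X r w k * (1 - X r w k)"
      by (intro mult_mono mult_nonneg_nonneg; simp)+
    then show ?thesis by simp
  qed
  have "continuous_on {0..} (\<lambda>r. expectation (\<lambda>w. 1 * (X r w k * (1 - X r w k))))"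
    using X_measurable[of _ k]
    by (intro expectation_path_continuous[where C = 1 and c = 1] continuous_intros X_continuous xb) auto
  then show "continuous_on {0..t} ?g" by (simp add: continuous_on_subset[of "{0..}"] del: right_diff_distrib' right_diff_distrib)
  have "U\<^sub>0 k * (1 - U\<^sub>0 k) = 0" using initial[of k] by auto
  then show "?g 0 \<le> ?\<kappa> / \<gamma>" using \<gamma> jump_rate_nonneg[where 'd = 'd] by (simp only: X_0) simp
  fix r assume r: "0 \<le> r" "r < t" "?\<kappa> / \<gamma> < ?g r"
  \<comment> \<open>Clamping \<open>u\<close> keeps the weight bounded everywhere and measurable at
    time \<open>r\<close>; almost surely it equals 1 - 2X.\<close>
  define Z where "Z w = 1 - 2 * max 0 (min 1 (u r w k))" for w
  have Zm: "Z \<in> borel_measurable (F r)" unfolding Z_def using adapted(1)[OF r(1), of k] by measurable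
  have Zb: "\<bar>Z w\<bar> \<le> 1" for w by (auto simp: Z_def abs_le_iff)
  have Zeq: "AE w in M. Z w = 1 - 2 * X r w k"
    using X_eq
  proof eventually_elim
    case (elim w)
    then have "u r w k = X r w k" using r(1) by simp
    then show ?case using X_range[of r w k] by (simp add: Z_def)
  qed
  let ?D = "expectation (\<lambda>w. Z w * laplacian (X r w) k) - \<gamma> * ?g r"
  have "(?g has_real_derivative ?D) (at_right r)"
  proof (rule right_derivativeI)
    fix h :: "nat \<Rightarrow> real" assume h: "\<And>n. 0 < h n" "h \<longlonglongrightarrow> 0"
    let ?\<delta> = "\<lambda>n. increment r (r + h n) k"
    have "?g (r + h n) - ?g r = expectation (\<lambda>w. Z w * ?\<delta> n w) - expectation (\<lambda>w. (?\<delta> n w)\<^sup>2)" for n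
    proof -
      have \<delta>b: "bounded_rv (?\<delta> n)"
        by (rule bounded_rvI[where c = 1, OF increment_measurable]) (simp add: increment_def X_increment_bound)
      have i: "integrable M (\<lambda>w. Z w * ?\<delta> n w)" "integrable M (\<lambda>w. (?\<delta> n w)\<^sup>2)"
        using integrable_bounded_mult[OF integrable_bounded_rv[OF \<delta>b] adapted_measurable[OF Zm] AE_I2[OF Zb]]
          integrable_bounded_rv[OF bounded_rv_power[OF \<delta>b]] by auto
      have gi: "integrable M (\<lambda>w. X q w k * (1 - X q w k))" for q
        using X_measurable[of q k] by (intro integrable_bounded_rv bounded_rvI[of _ 1] xb) auto
      have "?g (r + h n) - ?g r = expectation (\<lambda>w. X (r + h n) w k * (1 - X (r + h n) w k) - X r w k * (1 - X r w k))"
        using gi by simp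
      also have "\<dots> = expectation (\<lambda>w. Z w * ?\<delta> n w - (?\<delta> n w)\<^sup>2)"
      proof (rule integral_cong_AE)
        show "AE w in M. X (r + h n) w k * (1 - X (r + h n) w k) - X r w k * (1 - X r w k) = Z w * ?\<delta> n w - (?\<delta> n w)\<^sup>2"
          using Zeq by eventually_elim (simp only: increment_def power2_eq_square, simp only: algebra_simps)
      qed (use X_measurable[of _ k] increment_measurable[of r "r + h n" k] adapted_measurable[OF Zm] in auto)
      also have "\<dots> = expectation (\<lambda>w. Z w * ?\<delta> n w) - expectation (\<lambda>w. (?\<delta> n w)\<^sup>2)" using i by simp
      finally show ?thesis .
    qed
    moreover have "(\<lambda>n. expectation (\<lambda>w. Z w * ?\<delta> n w) / h n - expectation (\<lambda>w. (?\<delta> n w)\<^sup>2) / h n) \<longlonglongrightarrow> ?D"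
      by (intro tendsto_diff linear_rate[OF r(1) h Zm AE_I2[OF Zb]] square_rate[OF r(1) h Zm AE_I2[OF Zb]])
    ultimately show "(\<lambda>n. (?g (r + h n) - ?g r) / h n) \<longlonglongrightarrow> ?D" by (simp add: diff_divide_distrib)
  qed
  moreover have "?D \<le> 0"
  proof -
    have "expectation (\<lambda>w. Z w * laplacian (X r w) k) \<le> expectation (\<lambda>_. ?\<kappa>)"
    proof (rule integral_mono)
      show "integrable M (\<lambda>w. Z w * laplacian (X r w) k)"
        by (intro integrable_bounded_mult[OF _ adapted_measurable[OF Zm] AE_I2[OF Zb]] integrable_bounded_rv
            bounded_rvI[OF laplacian_X_measurable laplacian_X_bound])
      fix w
      have "\<bar>Z w * laplacian (X r w) k\<bar> \<le> 1 * ?\<kappa>"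
        unfolding abs_mult by (intro mult_mono Zb laplacian_X_bound) auto
      then show "Z w * laplacian (X r w) k \<le> ?\<kappa>" by (simp add: abs_le_iff)
    qed simp
    moreover have "?\<kappa> < \<gamma> * ?g r" using r(3) \<gamma> by (simp add: divide_less_eq mult.commute)
    ultimately show ?thesis by (simp add: prob_space)
  qed
  ultimately show "\<exists>D\<le>0. (?g has_real_derivative D) (at_right r)" by blast
qed

theorem moment_flow_X: "moment_flow M X U\<^sub>0 (jump_rate TYPE('d) / \<gamma>)"
  unfolding moment_flow_def
proof (intro conjI allI impI)
  show "prob_space M" by (rule prob_space_axioms)
  show "(\<lambda>w. X t w k) \<in> borel_measurable M" for t k by (rule X_measurable)
  show "X t w k \<in> {0..1}" for t w k by (rule X_range)
  show "AE w in M. \<forall>k. X 0 w k = U\<^sub>0 k" by (simp add: X_0)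
  show "expectation (\<lambda>w. X t w k * (1 - X t w k)) \<le> jump_rate TYPE('d) / \<gamma>" if "0 \<le> t" for t k
    by (rule heterozygosity_bound[OF that])
  fix S :: "nat set" and \<tau> :: "nat \<Rightarrow> real" and A :: "nat \<Rightarrow> 'd site set" and B :: "'d site set" and s :: real
  assume "finite S \<and> (\<forall>i\<in>S. 0 \<le> \<tau> i \<and> \<tau> i \<le> s \<and> finite (A i :: 'd site set)) \<and> 0 \<le> s \<and> finite (B :: 'd site set)"
  then have S: "finite S" "\<And>i. i \<in> S \<Longrightarrow> 0 \<le> \<tau> i \<and> \<tau> i \<le> s \<and> finite (A i)" and s: "0 \<le> s" and B: "finite B" by auto
  define W where "W w = path_monomial X S \<tau> A w" for w
  \<comment> \<open>The adapted twin of \<open>W\<close>: the weight in \<open>product_rate\<close>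
    has to be known at time \<open>r\<close>.\<close>
  define W' where "W' w = path_monomial u S \<tau> A w" for w
  have Wm: "W \<in> borel_measurable M" unfolding W_def path_monomial_def using X_measurable by measurable
  have Wb: "\<bar>W w\<bar> \<le> 1" for w
  proof -
    have "W w \<in> {0..1}" unfolding W_def path_monomial_def by (intro prod_unit X_range)
    then show ?thesis by simp
  qed
  have W'm: "W' \<in> borel_measurable (F r)" if "s \<le> r" for r
    unfolding W'_def path_monomial_def
  proof (intro borel_measurable_prod)
    fix i k assume i: "i \<in> S"
    show "(\<lambda>w. u (\<tau> i) w k) \<in> borel_measurable (F r)"
      using S(2)[OF i] that by (intro adapted_mono[OF adapted(1)]) auto
  qed
  have WW': "AE w in M. W' w = W w"
    using X_eq
  proof eventually_elim
    case (elim w)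
    then show ?case unfolding W_def W'_def path_monomial_def using S(2) by (intro prod.cong refl) simp
  qed
  have W'b: "AE w in M. \<bar>W' w\<bar> \<le> 1" using WW' by eventually_elim (simp add: Wb)
  have pm: "(\<lambda>w. \<Prod>k\<in>D. X r w k) \<in> borel_measurable M" for r D using X_measurable by measurable
  have pb: "\<bar>\<Prod>k\<in>D. X r w k\<bar> \<le> 1" for r w D
  proof -
    have "(\<Prod>k\<in>D. X r w k) \<in> {0..1}" by (intro prod_unit X_range)
    then show ?thesis by simp
  qed
  show "continuous_on {s..} (mixed_moment M X S \<tau> A B)"
    unfolding mixed_moment_def[abs_def] W_def[symmetric]
    by (rule expectation_path_continuous[OF Wm AE_I2[OF Wb] pm pb _ s]) (intro continuous_intros X_continuous)
  fix r assume r: "s \<le> r"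
  have r0: "0 \<le> r" using s r by simp
  show "(mixed_moment M X S \<tau> A B has_real_derivative moment_drift M X S \<tau> A B r) (at_right r)"
    unfolding mixed_moment_def[abs_def] moment_drift_def W_def[symmetric]
  proof (rule right_derivativeI)
    fix h :: "nat \<Rightarrow> real" assume h: "\<And>n. 0 < h n" "h \<longlonglongrightarrow> 0"
    have "expectation (\<lambda>w. W' w * ((\<Prod>k\<in>B. X (r + h n) w k) - (\<Prod>k\<in>B. X r w k)))
        = expectation (\<lambda>w. W w * (\<Prod>k\<in>B. X (r + h n) w k)) - expectation (\<lambda>w. W w * (\<Prod>k\<in>B. X r w k))" for n
    proof -
      have i: "integrable M (\<lambda>w. W w * (\<Prod>k\<in>B. X q w k))" for q
        by (intro integrable_bounded_mult[OF _ Wm AE_I2[OF Wb]] integrable_bounded_rv bounded_rvI[OF pm pb])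
      have "expectation (\<lambda>w. W' w * ((\<Prod>k\<in>B. X (r + h n) w k) - (\<Prod>k\<in>B. X r w k)))
          = expectation (\<lambda>w. W w * (\<Prod>k\<in>B. X (r + h n) w k) - W w * (\<Prod>k\<in>B. X r w k))"
      proof (rule integral_cong_AE)
        show "AE w in M. W' w * ((\<Prod>k\<in>B. X (r + h n) w k) - (\<Prod>k\<in>B. X r w k))
            = W w * (\<Prod>k\<in>B. X (r + h n) w k) - W w * (\<Prod>k\<in>B. X r w k)"
          using WW' by eventually_elim (simp add: right_diff_distrib)
      qed (use Wm adapted_measurable[OF W'm[OF order_refl]] pm in auto)
      then show ?thesis using i by simp
    qed
    moreover have "expectation (\<lambda>w. W' w * ((\<Prod>j\<in>B - {k}. X r w j) * laplacian (X r w) k))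
        = expectation (\<lambda>w. W w * ((\<Prod>j\<in>B - {k}. X r w j) * laplacian (X r w) k))" for k
    proof (rule integral_cong_AE)
      show "AE w in M. W' w * ((\<Prod>j\<in>B - {k}. X r w j) * laplacian (X r w) k)
          = W w * ((\<Prod>j\<in>B - {k}. X r w j) * laplacian (X r w) k)"
        using WW' by eventually_elim simp
    qed (use Wm adapted_measurable[OF W'm[OF order_refl]] pm laplacian_X_measurable[of r k] in auto)
    ultimately show "(\<lambda>n. (expectation (\<lambda>w. W w * (\<Prod>k\<in>B. X (r + h n) w k)) - expectation (\<lambda>w. W w * (\<Prod>k\<in>B. X r w k))) / h n)
        \<longlonglongrightarrow> (\<Sum>k\<in>B. expectation (\<lambda>w. W w * ((\<Prod>j\<in>B - {k}. X r w j) * laplacian (X r w) k)))"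
      using product_rate[OF r0 h W'm[OF r] W'b B] by simp
  qed
qed

end

section \<open>Moments of the voter process\<close>

lemma continuous_on_coordinate: "continuous_on A (\<lambda>\<eta> :: 'i \<Rightarrow> bool. of_bool (\<eta> k) :: real)"
proof -
  have "continuous_on UNIV (of_bool :: bool \<Rightarrow> real)"
    by (simp add: continuous_on_open_vimage open_discrete)
  from continuous_on_compose2[OF this continuous_on_product_coordinates]
  have "continuous_on UNIV (\<lambda>\<eta> :: 'i \<Rightarrow> bool. (of_bool :: bool \<Rightarrow> real) (\<eta> k))" by simp
  then show ?thesis by (rule continuous_on_subset) simp
qed

definition monomial :: "'i set \<Rightarrow> ('i \<Rightarrow> bool) \<Rightarrow>\<^sub>C real" where
  "monomial A = Bcontfun (\<lambda>\<eta>. \<Prod>k\<in>A. of_bool (\<eta> k))"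

lemma apply_monomial: "apply_bcontfun (monomial A) \<eta> = (\<Prod>k\<in>A. of_bool (\<eta> k))"
proof -
  have "(\<lambda>\<eta> :: 'a \<Rightarrow> bool. \<Prod>k\<in>A. of_bool (\<eta> k) :: real) \<in> bcontfun"
  proof (rule bcontfun_normI)
    show "continuous_on UNIV (\<lambda>\<eta> :: 'a \<Rightarrow> bool. \<Prod>k\<in>A. of_bool (\<eta> k) :: real)"
      by (intro continuous_on_prod continuous_on_coordinate)
    fix \<eta> :: "'a \<Rightarrow> bool"
    have "(\<Prod>k\<in>A. of_bool (\<eta> k) :: real) \<in> {0..1}" by (intro prod_unit) auto
    then show "norm (\<Prod>k\<in>A. of_bool (\<eta> k) :: real) \<le> 1" by simp
  qed
  then show ?thesis by (simp add: monomial_def Bcontfun_inverse)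
qed

text \<open>For values 0 and 1 the indicator of disagreement times the change of opinion at
  \<open>k\<close> is the difference of the two opinions.\<close>

lemma voter_flip:
  "voter_rate k \<eta> * ((1 - of_bool (\<eta> k)) - of_bool (\<eta> k)) = laplacian (\<lambda>k. of_bool (\<eta> k)) k"
proof -
  have "voter_rate k \<eta> * ((1 - of_bool (\<eta> k)) - of_bool (\<eta> k))
      = (\<Sum>i\<in>neighbours k. 1 / (2 * real CARD('a)) * (of_bool (\<eta> i \<noteq> \<eta> k) * ((1 - of_bool (\<eta> k)) - of_bool (\<eta> k))))"
    by (simp only: voter_rate_def sum_distrib_left sum_distrib_right mult.assoc)
  also have "\<dots> = laplacian (\<lambda>k. of_bool (\<eta> k)) k"
    unfolding laplacian_def by (intro sum.cong refl arg_cong2[of _ _ _ _ "(*)"]) auto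
  finally show ?thesis .
qed

text \<open>Only flips inside \<open>A\<close> change the monomial. The result is the product drift
  of the branching model evaluated at a configuration, which is why the voter process satisfies the
  same moment equations.\<close>

lemma voter_generator_monomial:
  assumes A: "finite A"
  shows "voter_generator (apply_bcontfun (monomial A)) \<eta>
    = (\<Sum>k\<in>A. (\<Prod>j\<in>A - {k}. of_bool (\<eta> j)) * laplacian (\<lambda>k. of_bool (\<eta> k)) k)"
proof -
  let ?f = "apply_bcontfun (monomial A)"
  have out: "?f (\<eta>(k := \<not> \<eta> k)) = ?f \<eta>" if "k \<notin> A" for k
    unfolding apply_monomial using that by (intro prod.cong) auto
  have "voter_generator ?f \<eta> = (\<Sum>\<^sub>\<infinity>k\<in>A. voter_rate k \<eta> * (?f (\<eta>(k := \<not> \<eta> k)) - ?f \<eta>))"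
    unfolding voter_generator_def by (rule infsum_cong_neutral) (auto simp: out)
  also have "\<dots> = (\<Sum>k\<in>A. voter_rate k \<eta> * (?f (\<eta>(k := \<not> \<eta> k)) - ?f \<eta>))" using A by simp
  also have "\<dots> = (\<Sum>k\<in>A. (\<Prod>j\<in>A - {k}. of_bool (\<eta> j)) * laplacian (\<lambda>k. of_bool (\<eta> k)) k)"
  proof (rule sum.cong[OF refl])
    fix k assume k: "k \<in> A"
    have split: "?f \<zeta> = of_bool (\<zeta> k) * (\<Prod>j\<in>A - {k}. of_bool (\<zeta> j))" for \<zeta>
      unfolding apply_monomial by (rule prod.remove[OF A k])
    have "(\<Prod>j\<in>A - {k}. of_bool ((\<eta>(k := \<not> \<eta> k)) j) :: real) = (\<Prod>j\<in>A - {k}. of_bool (\<eta> j))"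
      by (intro prod.cong) auto
    then have "?f (\<eta>(k := \<not> \<eta> k)) - ?f \<eta> = (\<Prod>j\<in>A - {k}. of_bool (\<eta> j)) * ((1 - of_bool (\<eta> k)) - of_bool (\<eta> k))"
      unfolding split by (simp add: algebra_simps)
    then have "voter_rate k \<eta> * (?f (\<eta>(k := \<not> \<eta> k)) - ?f \<eta>)
        = (\<Prod>j\<in>A - {k}. of_bool (\<eta> j)) * (voter_rate k \<eta> * ((1 - of_bool (\<eta> k)) - of_bool (\<eta> k)))"
      by (simp only: mult.left_commute)
    then show "voter_rate k \<eta> * (?f (\<eta>(k := \<not> \<eta> k)) - ?f \<eta>)
        = (\<Prod>j\<in>A - {k}. of_bool (\<eta> j)) * laplacian (\<lambda>k. of_bool (\<eta> k)) k"
      by (simp only: voter_flip)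
  qed
  finally show ?thesis .
qed

section \<open>The natural filtration\<close>

lemma space_natural_filtration: "space (natural_filtration M X t) = space M"
  by (simp add: natural_filtration_def space_measure_of_conv)

lemma sets_natural_filtration:
  "sets (natural_filtration M X t) =
    sigma_sets (space M) {X s -` A \<inter> space M | s A. 0 \<le> s \<and> s \<le> t \<and> A \<in> sets borel}"
  unfolding natural_filtration_def by (rule sets_measure_of) auto

lemma subalgebra_natural_filtration:
  assumes "\<And>t. 0 \<le> t \<Longrightarrow> X t \<in> borel_measurable M"
  shows "subalgebra M (natural_filtration M X t)"
proof -
  have "sigma_sets (space M) {X s -` A \<inter> space M | s A. 0 \<le> s \<and> s \<le> t \<and> A \<in> sets borel} \<subseteq> sets M"
    using assms by (intro sets.sigma_sets_subset) (auto intro: measurable_sets)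
  then show ?thesis by (simp add: subalgebra_def space_natural_filtration sets_natural_filtration)
qed

lemma subalgebra_natural_filtration_mono:
  assumes "s \<le> t"
  shows "subalgebra (natural_filtration M X t) (natural_filtration M X s)"
  unfolding subalgebra_def space_natural_filtration sets_natural_filtration
proof (intro conjI refl sigma_sets_mono')
  show "{X r -` A \<inter> space M | r A. 0 \<le> r \<and> r \<le> s \<and> A \<in> sets borel}
      \<subseteq> {X r -` A \<inter> space M | r A. 0 \<le> r \<and> r \<le> t \<and> A \<in> sets borel}"
  proof
    fix E assume "E \<in> {X r -` A \<inter> space M | r A. 0 \<le> r \<and> r \<le> s \<and> A \<in> sets borel}"
    then show "E \<in> {X r -` A \<inter> space M | r A. 0 \<le> r \<and> r \<le> t \<and> A \<in> sets borel}"
      unfolding mem_Collect_eq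
    proof (elim exE conjE)
      fix r A assume "E = X r -` A \<inter> space M" "0 \<le> r" "r \<le> s" "A \<in> sets borel"
      then show "\<exists>r A. E = X r -` A \<inter> space M \<and> 0 \<le> r \<and> r \<le> t \<and> A \<in> sets borel"
        using assms by (intro exI[of _ r] exI[of _ A]) simp
    qed
  qed
qed

lemma natural_filtration_measurable:
  assumes "0 \<le> s" "s \<le> t"
  shows "X s \<in> borel_measurable (natural_filtration M X t)"
  using assms by (intro measurableI) (auto simp: space_natural_filtration sets_natural_filtration intro!: sigma_sets.Basic)

locale voter_model =
  fixes Q :: "'q measure" and S :: "real \<Rightarrow> ('d::finite config \<Rightarrow>\<^sub>C real) \<Rightarrow> ('d config \<Rightarrow>\<^sub>C real)"
    and \<eta> :: "real \<Rightarrow> 'q \<Rightarrow> 'd config"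
  assumes semigroup: "voter_semigroup S" and process: "markov_process S Q \<eta>"
begin

sublocale prob_space Q
  using process by (simp add: markov_process_def)

lemma \<eta>_measurable: "0 \<le> t \<Longrightarrow> \<eta> t \<in> borel_measurable Q"
  using process by (simp add: markov_process_def)

lemma subalg: "subalgebra Q (natural_filtration Q \<eta> t)"
  by (rule subalgebra_natural_filtration[OF \<eta>_measurable])

lemma markov_property:
  assumes Y: "Y \<in> borel_measurable (natural_filtration Q \<eta> s)" "\<And>w. \<bar>Y w\<bar> \<le> 1" and s: "0 \<le> s" and t: "0 \<le> t"
  shows "expectation (\<lambda>w. Y w * apply_bcontfun f (\<eta> (s + t) w)) = expectation (\<lambda>w. Y w * apply_bcontfun (S t f) (\<eta> s w))"
proof -
  interpret finite_measure_subalgebra Q "natural_filtration Q \<eta> s"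
    by unfold_locales (rule subalg)
  have fm: "(\<lambda>w. apply_bcontfun g (\<eta> r w)) \<in> borel_measurable Q" if "0 \<le> r" for g r
    by (rule measurable_compose[OF \<eta>_measurable[OF that] borel_measurable_continuous_onI]) simp
  have Ym: "Y \<in> borel_measurable Q" by (rule measurable_from_subalg[OF subalg Y(1)])
  have st: "0 \<le> s + t" using s t by simp
  have int: "integrable Q (\<lambda>w. Y w * apply_bcontfun f (\<eta> (s + t) w))"
  proof (rule integrable_bounded_mult[OF integrable_const_bound[where B = "norm f"] Ym AE_I2[OF Y(2)]])
    show "AE w in Q. norm (apply_bcontfun f (\<eta> (s + t) w)) \<le> norm f" by (intro AE_I2 norm_bounded)
  qed (rule fm[OF st])
  have "expectation (\<lambda>w. Y w * apply_bcontfun f (\<eta> (s + t) w))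
      = expectation (\<lambda>w. Y w * real_cond_exp Q (natural_filtration Q \<eta> s) (\<lambda>w. apply_bcontfun f (\<eta> (s + t) w)) w)"
    by (rule real_cond_exp_intg(2)[OF int Y(1) fm[OF st], symmetric])
  also have "\<dots> = expectation (\<lambda>w. Y w * apply_bcontfun (S t f) (\<eta> s w))"
  proof (rule integral_cong_AE)
    have "AE w in Q. real_cond_exp Q (natural_filtration Q \<eta> s) (\<lambda>w. apply_bcontfun f (\<eta> (s + t) w)) w
        = apply_bcontfun (S t f) (\<eta> s w)"
      using process s t unfolding markov_process_def by simp
    then show "AE w in Q. Y w * real_cond_exp Q (natural_filtration Q \<eta> s) (\<lambda>w. apply_bcontfun f (\<eta> (s + t) w)) w
        = Y w * apply_bcontfun (S t f) (\<eta> s w)"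
      by eventually_elim simp
  qed (intro borel_measurable_times Ym fm s borel_measurable_cond_exp2)+
  finally show ?thesis .
qed

lemma expectation_difference:
  assumes Y: "Y \<in> borel_measurable (natural_filtration Q \<eta> s)" "\<And>w. \<bar>Y w\<bar> \<le> 1" and s: "0 \<le> s"
  shows "\<bar>expectation (\<lambda>w. Y w * apply_bcontfun f (\<eta> s w)) - expectation (\<lambda>w. Y w * apply_bcontfun g (\<eta> s w))\<bar> \<le> norm (f - g)"
    "integrable Q (\<lambda>w. Y w * apply_bcontfun f (\<eta> s w))"
proof -
  have fm: "(\<lambda>w. apply_bcontfun g (\<eta> s w)) \<in> borel_measurable Q" for g
    by (rule measurable_compose[OF \<eta>_measurable[OF s] borel_measurable_continuous_onI]) simp
  have Ym: "Y \<in> borel_measurable Q" by (rule measurable_from_subalg[OF subalg Y(1)])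
  have int: "integrable Q (\<lambda>w. Y w * apply_bcontfun f (\<eta> s w))" for f
  proof (rule integrable_bounded_mult[OF integrable_const_bound[where B = "norm f"] Ym AE_I2[OF Y(2)]])
    show "AE w in Q. norm (apply_bcontfun f (\<eta> s w)) \<le> norm f" by (intro AE_I2 norm_bounded)
  qed (rule fm)
  then show "integrable Q (\<lambda>w. Y w * apply_bcontfun f (\<eta> s w))" .
  have "\<bar>expectation (\<lambda>w. Y w * apply_bcontfun (f - g) (\<eta> s w))\<bar> \<le> expectation (\<lambda>_. norm (f - g))"
  proof (rule order.trans[OF integral_abs_bound integral_mono])
    fix w
    show "\<bar>Y w * apply_bcontfun (f - g) (\<eta> s w)\<bar> \<le> norm (f - g)"
      using mult_mono[OF Y(2)[of w] norm_bounded[of "f - g" "\<eta> s w"]] by (simp add: abs_mult)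
  qed (use int[of "f - g"] in auto)
  then show "\<bar>expectation (\<lambda>w. Y w * apply_bcontfun f (\<eta> s w)) - expectation (\<lambda>w. Y w * apply_bcontfun g (\<eta> s w))\<bar> \<le> norm (f - g)"
    using int[of f] int[of g] by (simp add: right_diff_distrib prob_space)
qed

lemma generator_monomial:
  assumes A: "finite A"
  shows "\<exists>g. (\<forall>\<eta>. apply_bcontfun g \<eta> = (\<Sum>k\<in>A. (\<Prod>j\<in>A - {k}. of_bool (\<eta> j)) * laplacian (\<lambda>k. of_bool (\<eta> k)) k))
    \<and> in_generator S (monomial A) g"
proof -
  have "depends_on_finitely_many (apply_bcontfun (monomial A))"
    unfolding depends_on_finitely_many_def apply_monomial
    using A by (intro exI[of _ A]) (auto intro!: prod.cong)
  then have "\<exists>g. apply_bcontfun g = voter_generator (apply_bcontfun (monomial A)) \<and> in_generator S (monomial A) g"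
    using semigroup unfolding voter_semigroup_def by simp
  then show ?thesis by (elim exE conjE) (auto simp: voter_generator_monomial[OF A] fun_eq_iff)
qed

text \<open>Conditioning at the earlier of two times bounds the difference by the distance of
  \<open>S h f\<close> from \<open>f\<close>, with \<open>h\<close> the gap between them. Strong
  continuity at 0 thus gives continuity from both sides.\<close>

lemma monomial_continuous:
  fixes f :: "'d config \<Rightarrow>\<^sub>C real"
  assumes Y: "Y \<in> borel_measurable (natural_filtration Q \<eta> s)" "\<And>w. \<bar>Y w\<bar> \<le> 1" and s: "0 \<le> s"
  shows "continuous_on {s..} (\<lambda>r. expectation (\<lambda>w. Y w * apply_bcontfun f (\<eta> r w)))"
proof -
  let ?\<phi> = "\<lambda>r. expectation (\<lambda>w. Y w * apply_bcontfun f (\<eta> r w))"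
  have Yr: "Y \<in> borel_measurable (natural_filtration Q \<eta> r)" if "s \<le> r" for r
    by (rule measurable_from_subalg[OF subalgebra_natural_filtration_mono[OF that] Y(1)])
  have diff: "\<bar>?\<phi> r' - ?\<phi> r\<bar> \<le> norm (S (r' - r) f - f)" if "s \<le> r" "r \<le> r'" for r r'
  proof -
    have r: "0 \<le> r" "0 \<le> r' - r" using that s by auto
    have "?\<phi> r' = expectation (\<lambda>w. Y w * apply_bcontfun (S (r' - r) f) (\<eta> r w))"
      using markov_property[OF Yr[OF that(1)] Y(2) r, of f] by simp
    then show ?thesis using expectation_difference(1)[OF Yr[OF that(1)] Y(2) r(1)] by simp
  qed
  have "((\<lambda>h. S h f) \<longlongrightarrow> f) (at_right 0)"
  proof -
    have "markov_semigroup S" using semigroup by (simp add: voter_semigroup_def)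
    note S = this[unfolded markov_semigroup_def]
    have "((\<lambda>h. S h f) \<longlongrightarrow> S 0 f) (at_right 0)"
      by (rule S[THEN conjunct2, THEN conjunct2, THEN conjunct1, rule_format]) simp
    then show ?thesis by (simp only: S[THEN conjunct2, THEN conjunct1, rule_format])
  qed
  then have small: "\<forall>\<^sub>F h in at_right 0. dist (S h f) f < e" if "0 < e" for e
    using that by (rule tendstoD)
  show ?thesis
    unfolding continuous_on_iff
  proof (intro ballI allI impI)
    fix r e :: real assume r: "r \<in> {s..}" and e: "0 < e"
    obtain d where d: "0 < d" "\<And>h. 0 < h \<Longrightarrow> h < d \<Longrightarrow> dist (S h f) f < e"
      using small[OF e] unfolding eventually_at_right_field by auto
    show "\<exists>d>0. \<forall>r'\<in>{s..}. dist r' r < d \<longrightarrow> dist (?\<phi> r') (?\<phi> r) < e"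
    proof (intro exI[of _ d] conjI ballI impI d(1))
      fix r' assume r': "r' \<in> {s..}" "dist r' r < d"
      consider "r < r'" | "r' < r" | "r = r'" by linarith
      then show "dist (?\<phi> r') (?\<phi> r) < e"
      proof cases
        case 1
        then have "dist (S (r' - r) f) f < e" using r' by (intro d(2)) (auto simp: dist_real_def)
        then show ?thesis using diff[of r r'] 1 r by (simp add: dist_real_def dist_norm)
      next
        case 2
        then have "dist (S (r - r') f) f < e" using r' by (intro d(2)) (auto simp: dist_real_def)
        then show ?thesis using diff[of r' r] 2 r' by (simp add: dist_real_def dist_norm abs_minus_commute)
      qed (use e in simp)
    qed
  qed
qed

text \<open>By the Markov property the difference quotient is the expectation of the semigroup's
  difference quotient, which converges to the generator in supremum norm.\<close>

lemma monomial_right_derivative: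
  assumes Y: "Y \<in> borel_measurable (natural_filtration Q \<eta> r)" "\<And>w. \<bar>Y w\<bar> \<le> 1" and r: "0 \<le> r"
    and g: "in_generator S f g"
  shows "((\<lambda>r. expectation (\<lambda>w. Y w * apply_bcontfun f (\<eta> r w))) has_real_derivative
    expectation (\<lambda>w. Y w * apply_bcontfun g (\<eta> r w))) (at_right r)"
proof (rule right_derivativeI)
  fix h :: "nat \<Rightarrow> real" assume h: "\<And>n. 0 < h n" "h \<longlonglongrightarrow> 0"
  let ?\<phi> = "\<lambda>r. expectation (\<lambda>w. Y w * apply_bcontfun f (\<eta> r w))"
  let ?q = "\<lambda>n. (S (h n) f - f) /\<^sub>R h n"
  let ?E = "\<lambda>f. expectation (\<lambda>w. Y w * apply_bcontfun f (\<eta> r w))"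
  have int: "integrable Q (\<lambda>w. Y w * apply_bcontfun f (\<eta> r w))" for f
    by (rule expectation_difference(2)[OF Y r])
  have eq: "(?\<phi> (r + h n) - ?\<phi> r) / h n = ?E (?q n)" for n
  proof -
    have "?\<phi> (r + h n) = ?E (S (h n) f)" by (rule markov_property[OF Y r less_imp_le[OF h(1)]])
    then have "?\<phi> (r + h n) - ?\<phi> r = expectation (\<lambda>w. Y w * apply_bcontfun (S (h n) f) (\<eta> r w) - Y w * apply_bcontfun f (\<eta> r w))"
      using int by simp
    then have "(?\<phi> (r + h n) - ?\<phi> r) / h n
        = expectation (\<lambda>w. (Y w * apply_bcontfun (S (h n) f) (\<eta> r w) - Y w * apply_bcontfun f (\<eta> r w)) / h n)"
      by simp
    also have "\<dots> = ?E (?q n)"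
      by (intro Bochner_Integration.integral_cong refl) (simp add: divide_inverse right_diff_distrib left_diff_distrib ac_simps)
    finally show ?thesis .
  qed
  have at: "filterlim h (at_right 0) sequentially"
    using h(2) less_imp_neq[OF h(1)] h(1) by (auto simp: filterlim_at intro!: always_eventually)
  have "(\<lambda>n. norm (?q n - g)) \<longlonglongrightarrow> 0"
  proof -
    have "?q \<longlonglongrightarrow> g" using g unfolding in_generator_def by (rule filterlim_compose[OF _ at])
    then have "(\<lambda>n. ?q n - g) \<longlonglongrightarrow> 0" by (simp add: LIM_zero)
    then show ?thesis by (rule tendsto_norm_zero)
  qed
  then have "(\<lambda>n. ?E (?q n) - ?E g) \<longlonglongrightarrow> 0"
    by (rule Lim_null_comparison[rotated]) (intro always_eventually allI, unfold real_norm_def, rule expectation_difference(1)[OF Y r])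
  then have "(\<lambda>n. ?E (?q n)) \<longlonglongrightarrow> ?E g" by (rule LIM_zero_cancel)
  then show "(\<lambda>n. (?\<phi> (r + h n) - ?\<phi> r) / h n) \<longlonglongrightarrow> ?E g" by (simp only: eq)
qed

lemma right_continuous_path:
  assumes "cadlag euclidean (\<lambda>t. \<eta> t w)" "0 \<le> t"
  shows "((\<lambda>s. of_bool (\<eta> s w k) :: real) \<longlongrightarrow> of_bool (\<eta> t w k)) (at_right t)"
proof -
  have "((\<lambda>s. \<eta> s w) \<longlongrightarrow> \<eta> t w) (at_right t)" using assms by (simp add: cadlag_def)
  from continuous_on_tendsto_compose[OF continuous_on_coordinate[of UNIV k] this] show ?thesis by simp
qed

theorem voter_moment_flow:
  fixes U\<^sub>0 :: "'d site \<Rightarrow> real"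
  assumes init: "AE w in Q. \<forall>k. of_bool (\<eta> 0 w k) = U\<^sub>0 k"
  shows "\<exists>X. moment_flow Q X U\<^sub>0 0 \<and>
    (\<forall>w t k. 0 \<le> t \<longrightarrow> ((\<lambda>s. X s w k) \<longlongrightarrow> X t w k) (at_right t)) \<and>
    (AE w in Q. cadlag euclidean (\<lambda>t. \<eta> t w) \<and> (\<forall>t k. X t w k = of_bool (\<eta> t w k)))"
proof -
  have "AE w in Q. cadlag euclidean (\<lambda>t. \<eta> t w)" using process by (simp add: markov_process_def)
  then obtain N where N: "{w \<in> space Q. \<not> cadlag euclidean (\<lambda>t. \<eta> t w)} \<subseteq> N" "N \<in> null_sets Q" by (auto elim!: AE_E)
  \<comment> \<open>On the exceptional set the path is replaced by the constant 0, so right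
    continuity holds without exception.\<close>
  define X where "X t w k = (if w \<in> space Q - N then of_bool (\<eta> t w k) else 0 :: real)" for t w k
  have rc: "((\<lambda>s. X s w k) \<longlongrightarrow> X t w k) (at_right t)" if "0 \<le> t" for w t k
    using right_continuous_path[OF _ that, of w k] N(1) by (cases "w \<in> space Q - N") (auto simp: X_def)
  have "AE w in Q. w \<notin> N" by (rule AE_not_in[OF N(2)])
  then have good: "AE w in Q. cadlag euclidean (\<lambda>t. \<eta> t w) \<and> (\<forall>t k. X t w k = of_bool (\<eta> t w k))"
    using AE_space by eventually_elim (use N(1) in \<open>auto simp: X_def\<close>)
  have cm: "(\<lambda>w. of_bool (\<eta> t w k) :: real) \<in> borel_measurable Q" if "0 \<le> t" for t k
    by (rule measurable_compose[OF \<eta>_measurable[OF that] borel_measurable_continuous_onI]) (rule continuous_on_coordinate)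
  have Xm: "(\<lambda>w. X t w k) \<in> borel_measurable Q" if "0 \<le> t" for t k
    unfolding X_def using cm[OF that, of k] null_setsD2[OF N(2)] by (intro measurable_If_set) auto
  have Xr: "X t w k \<in> {0..1}" for t w k by (simp add: X_def)
  have "moment_flow Q X U\<^sub>0 0"
    unfolding moment_flow_def
  proof (intro conjI allI impI)
    show "prob_space Q" by (rule prob_space_axioms)
    show "(\<lambda>w. X t w k) \<in> borel_measurable Q" if "0 \<le> t" for t k by (rule Xm[OF that])
    show "X t w k \<in> {0..1}" for t w k by (rule Xr)
    show "AE w in Q. \<forall>k. X 0 w k = U\<^sub>0 k" using good init by eventually_elim simp
    show "expectation (\<lambda>w. X t w k * (1 - X t w k)) \<le> 0" for t k
    proof -
      \<comment> \<open>Values 0 and 1 are idempotent; this is the source of the error 0.\<close>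
      have "X t w k * (1 - X t w k) = 0" for w by (simp add: X_def)
      then show ?thesis by (simp only: integral_zero order_refl)
    qed
    fix S' :: "nat set" and \<tau> :: "nat \<Rightarrow> real" and A :: "nat \<Rightarrow> 'd site set" and B :: "'d site set" and s :: real
    assume "finite S' \<and> (\<forall>i\<in>S'. 0 \<le> \<tau> i \<and> \<tau> i \<le> s \<and> finite (A i)) \<and> 0 \<le> s \<and> finite B"
    then have S': "finite S'" "\<And>i. i \<in> S' \<Longrightarrow> 0 \<le> \<tau> i \<and> \<tau> i \<le> s \<and> finite (A i)" and s: "0 \<le> s" and B: "finite B" by auto
    define Y :: "'q \<Rightarrow> real" where "Y w = (\<Prod>i\<in>S'. \<Prod>k\<in>A i. of_bool (\<eta> (\<tau> i) w k))" for w
    have Yb: "\<bar>Y w\<bar> \<le> 1" for w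
    proof -
      have "Y w \<in> {0..1}" unfolding Y_def by (intro prod_unit) auto
      then show ?thesis by simp
    qed
    have Ym: "Y \<in> borel_measurable (natural_filtration Q \<eta> r)" if "s \<le> r" for r
      unfolding Y_def
    proof (intro borel_measurable_prod)
      fix i k assume i: "i \<in> S'"
      have "\<eta> (\<tau> i) \<in> borel_measurable (natural_filtration Q \<eta> r)"
        using S'(2)[OF i] that by (intro natural_filtration_measurable) auto
      from measurable_compose[OF this borel_measurable_continuous_onI[OF continuous_on_coordinate]]
      show "(\<lambda>w. of_bool (\<eta> (\<tau> i) w k) :: real) \<in> borel_measurable (natural_filtration Q \<eta> r)" .
    qed
    have YQ: "Y \<in> borel_measurable Q" by (rule measurable_from_subalg[OF subalg Ym[OF order_refl]])
    have pX: "(\<lambda>w. path_monomial X S' \<tau> A w) \<in> borel_measurable Q"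
      unfolding path_monomial_def using Xm S'(2) by (intro borel_measurable_prod) auto
    have bm: "(\<lambda>w. \<Prod>k\<in>D. X r w k) \<in> borel_measurable Q" "(\<lambda>w. \<Prod>k\<in>D. of_bool (\<eta> r w k) :: real) \<in> borel_measurable Q"
      if "0 \<le> r" for r D using Xm[OF that] cm[OF that] by measurable
    have lm: "(\<lambda>w. laplacian (X r w) k) \<in> borel_measurable Q" "(\<lambda>w. laplacian (\<lambda>k. of_bool (\<eta> r w k)) k) \<in> borel_measurable Q"
      if "0 \<le> r" for r k unfolding laplacian_def using Xm[OF that] cm[OF that] by measurable
    let ?\<phi> = "mixed_moment Q X S' \<tau> A B"
    have eq: "?\<phi> r = expectation (\<lambda>w. Y w * apply_bcontfun (monomial B) (\<eta> r w))" if "0 \<le> r" for r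
      unfolding mixed_moment_def apply_monomial
    proof (rule integral_cong_AE)
      show "AE w in Q. path_monomial X S' \<tau> A w * (\<Prod>k\<in>B. X r w k) = Y w * (\<Prod>k\<in>B. of_bool (\<eta> r w k))"
        using good by eventually_elim (simp add: Y_def path_monomial_def)
    qed (use bm[OF that] pX YQ in auto)
    show "continuous_on {s..} ?\<phi>"
      using monomial_continuous[OF Ym[OF order_refl] Yb s, of "monomial B"]
      by (rule continuous_on_eq) (use s in \<open>auto simp: eq\<close>)
    fix r assume r: "s \<le> r"
    have r0: "0 \<le> r" using s r by simp
    obtain g where g: "\<And>\<zeta>. apply_bcontfun g \<zeta> = (\<Sum>k\<in>B. (\<Prod>j\<in>B - {k}. of_bool (\<zeta> j)) * laplacian (\<lambda>k. of_bool (\<zeta> k)) k)"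
      "in_generator S (monomial B) g" using generator_monomial[OF B] by auto
    have lap_bound: "\<bar>laplacian (\<lambda>k. of_bool (\<eta> r w k)) k\<bar> \<le> jump_rate TYPE('d)" for w k
      by (rule laplacian_bound) auto
    have deriv: "(?\<phi> has_real_derivative expectation (\<lambda>w. Y w * apply_bcontfun g (\<eta> r w))) (at_right r)"
    proof (subst has_field_derivative_cong_eventually)
      show "\<forall>\<^sub>F q in at_right r. ?\<phi> q = expectation (\<lambda>w. Y w * apply_bcontfun (monomial B) (\<eta> q w))"
        using eventually_at_right_less by eventually_elim (use r0 in \<open>simp add: eq\<close>)
      show "((\<lambda>q. expectation (\<lambda>w. Y w * apply_bcontfun (monomial B) (\<eta> q w))) has_real_derivative
          expectation (\<lambda>w. Y w * apply_bcontfun g (\<eta> r w))) (at_right r)"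
        by (rule monomial_right_derivative[OF Ym[OF r] Yb r0 g(2)])
    qed (simp add: eq r0)

    have int: "integrable Q (\<lambda>w. Y w * ((\<Prod>j\<in>D. of_bool (\<eta> r w j)) * laplacian (\<lambda>k. of_bool (\<eta> r w k)) k))" for D k
    proof (rule integrable_bounded_mult[OF integrable_const_bound[where B = "jump_rate TYPE('d)"] YQ AE_I2[OF Yb]])
      have p: "(\<Prod>j\<in>D. of_bool (\<eta> r w j) :: real) \<in> {0..1}" for w by (intro prod_unit) auto
      have "\<bar>(\<Prod>j\<in>D. of_bool (\<eta> r w j)) * laplacian (\<lambda>k. of_bool (\<eta> r w k)) k\<bar> \<le> 1 * jump_rate TYPE('d)" for w
        unfolding abs_mult using p[of w] by (intro mult_mono lap_bound) auto
      then show "AE w in Q. norm ((\<Prod>j\<in>D. of_bool (\<eta> r w j)) * laplacian (\<lambda>k. of_bool (\<eta> r w k)) k) \<le> jump_rate TYPE('d)" by simp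
    qed (use bm[OF r0] lm[OF r0] in auto)
    have "expectation (\<lambda>w. Y w * apply_bcontfun g (\<eta> r w))
        = (\<Sum>k\<in>B. expectation (\<lambda>w. Y w * ((\<Prod>j\<in>B - {k}. of_bool (\<eta> r w j)) * laplacian (\<lambda>k. of_bool (\<eta> r w k)) k)))"
      unfolding g(1) sum_distrib_left by (intro Bochner_Integration.integral_sum int)
    also have "\<dots> = moment_drift Q X S' \<tau> A B r"
      unfolding moment_drift_def
    proof (intro sum.cong refl integral_cong_AE)
      fix k
      show "AE w in Q. Y w * ((\<Prod>j\<in>B - {k}. of_bool (\<eta> r w j)) * laplacian (\<lambda>k. of_bool (\<eta> r w k)) k)
          = path_monomial X S' \<tau> A w * ((\<Prod>j\<in>B - {k}. X r w j) * laplacian (X r w) k)"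
        using good
      proof eventually_elim
        case (elim w)
        then have "X r w = (\<lambda>k. of_bool (\<eta> r w k))" by auto
        then show ?case using elim by (simp add: Y_def path_monomial_def)
      qed
    qed (use bm[OF r0] lm[OF r0] pX YQ in auto)
    finally show "(?\<phi> has_real_derivative moment_drift Q X S' \<tau> A B r) (at_right r)"
      using deriv by simp
  qed
  then show ?thesis using rc good by (intro exI[of _ X]) simp
qed

end

section \<open>Comparison of moments\<close>

text \<open>The bound is iterated: a bound with constant \<open>c\<close> improves to one with \<open>a + c / 2\<close>,
  whose fixed point is \<open>2 * a\<close>.\<close>

lemma family_gronwall:
  fixes D D' :: "'b \<Rightarrow> real \<Rightarrow> real"
  assumes sT: "s \<le> T" and e: "0 \<le> e" and L: "0 \<le> L"
    and cont: "\<And>B. B \<in> F \<Longrightarrow> continuous_on {s..T} (D B)"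
    and deriv: "\<And>B r. B \<in> F \<Longrightarrow> s \<le> r \<Longrightarrow> r < T \<Longrightarrow> (D B has_real_derivative D' B r) (at_right r)"
    and bound: "\<And>B r c. B \<in> F \<Longrightarrow> s \<le> r \<Longrightarrow> r < T \<Longrightarrow> (\<And>A. A \<in> F \<Longrightarrow> \<bar>D A r\<bar> \<le> c) \<Longrightarrow> \<bar>D' B r\<bar> \<le> L * c + e"
    and start: "\<And>B. B \<in> F \<Longrightarrow> \<bar>D B s\<bar> \<le> \<delta>"
    and crude: "\<And>B r. B \<in> F \<Longrightarrow> s \<le> r \<Longrightarrow> r \<le> T \<Longrightarrow> \<bar>D B r\<bar> \<le> b"
    and B: "B \<in> F" and r: "s \<le> r" "r \<le> T"
  shows "\<bar>D B r\<bar> \<le> 2 * (\<delta> + e * (T - s)) * exp (2 * L * (r - s))"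
proof -
  define a where "a = \<delta> + e * (T - s)"
  define E where "E r = exp (2 * L * (r - s))" for r
  have E1: "1 \<le> E r" if "s \<le> r" for r using that L by (simp add: E_def)
  have a0: "0 \<le> a" unfolding a_def using start[OF B] e sT by (intro add_nonneg_nonneg mult_nonneg_nonneg) auto
  have b0: "0 \<le> b" using crude[OF B order_refl sT] by linarith
  have improve: "\<bar>D B r\<bar> \<le> (a + c / 2) * E r"
    if c: "0 \<le> c" "\<And>A q. A \<in> F \<Longrightarrow> s \<le> q \<Longrightarrow> q \<le> T \<Longrightarrow> \<bar>D A q\<bar> \<le> c * E q" and Br: "B \<in> F" "s \<le> r" "r \<le> T" for c B r
  proof -
    \<comment> \<open>The exponential rate \<open>2 * L\<close> is chosen so that integrating the
      bound \<open>L * (c * E q)\<close> returns \<open>c / 2 * E q\<close>, that is, half of the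
      constant.\<close>
    define g where "g q = e * (q - s) + c / 2 * E q" for q
    have g': "(g has_real_derivative (L * (c * E q) + e)) (at_right q)" for q
      unfolding g_def E_def by (auto intro!: derivative_eq_intros)
    have gc: "continuous_on {s..r} g" unfolding g_def E_def by (intro continuous_intros)
    have dc: "continuous_on {s..r} (D B)" by (rule continuous_on_subset[OF cont[OF Br(1)]]) (use Br in auto)
    have d': "(D B has_real_derivative D' B q) (at_right q)" "\<bar>D' B q\<bar> \<le> L * (c * E q) + e" if "s \<le> q" "q < r" for q
    proof -
      show "(D B has_real_derivative D' B q) (at_right q)" using deriv[OF Br(1), of q] that Br(3) by simp
      show "\<bar>D' B q\<bar> \<le> L * (c * E q) + e"
        by (rule bound[OF Br(1)]) (use that Br c(2) in auto)
    qed
    have "D B r - D B s \<le> g r - g s"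
      by (rule right_deriv_le[OF Br(2) dc gc d'(1) g']) (use d'(2) in \<open>auto simp: abs_le_iff\<close>)
    moreover have "(\<lambda>q. - D B q) r - (\<lambda>q. - D B q) s \<le> g r - g s"
    proof (rule right_deriv_le[OF Br(2) _ gc _ g'])
      show "continuous_on {s..r} (\<lambda>q. - D B q)" using dc by (intro continuous_intros)
      show "((\<lambda>q. - D B q) has_real_derivative - D' B q) (at_right q)" if "s \<le> q" "q < r" for q
        using d'(1)[OF that] by (rule DERIV_minus)
    qed (use d'(2) in \<open>auto simp: abs_le_iff\<close>)
    ultimately have "\<bar>D B r\<bar> \<le> \<delta> + (g r - g s)" using start[OF Br(1)] by linarith
    also have "\<dots> \<le> \<delta> + e * (T - s) + c / 2 * E r"
    proof -
      have "e * (r - s) \<le> e * (T - s)" using Br e by (intro mult_left_mono) auto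
      then show ?thesis using c(1) by (simp add: g_def E_def)
    qed
    also have "\<dots> \<le> a * E r + c / 2 * E r"
      using mult_left_mono[OF E1[OF Br(2)] a0] by (simp add: a_def)
    finally show ?thesis by (simp add: distrib_right)
  qed
  have iterate: "\<bar>D B r\<bar> \<le> (2 * a + b / 2 ^ j) * E r" if "B \<in> F" "s \<le> r" "r \<le> T" for j B r
    using that
  proof (induction j arbitrary: B r)
    case 0
    have "b * 1 \<le> (2 * a + b) * E r" using a0 b0 E1[OF 0(2)] by (intro mult_mono) auto
    then show ?case using crude[OF 0] by simp
  next
    case (Suc j)
    have "\<bar>D B r\<bar> \<le> (a + (2 * a + b / 2 ^ j) / 2) * E r"
      by (rule improve[OF _ Suc.IH Suc.prems]) (use a0 b0 in auto)
    then show ?case by (simp add: add_divide_distrib mult.commute)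
  qed
  have "(\<lambda>j. (2 * a + b / 2 ^ j) * E r) \<longlonglongrightarrow> (2 * a + 0) * E r"
    by (intro tendsto_intros LIMSEQ_divide_realpow_zero) simp
  then have "\<bar>D B r\<bar> \<le> (2 * a + 0) * E r"
    by (rule LIMSEQ_le_const) (use iterate[OF B r] in auto)
  then show ?thesis by (simp add: a_def E_def)
qed

text \<open>If \<open>i\<close> already lies in \<open>D\<close> its factor occurs squared, and
  replacing the square by the factor itself costs at most \<open>x i * (1 - x i)\<close>. Otherwise
  the two products agree.\<close>

lemma prod_insert_near:
  fixes x :: "'i \<Rightarrow> real"
  assumes x: "\<And>i. x i \<in> {0..1}" and D: "finite D"
  shows "\<bar>(\<Prod>j\<in>D. x j) * x i - (\<Prod>j\<in>insert i D. x j)\<bar> \<le> x i * (1 - x i)"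
proof (cases "i \<in> D")
  case True
  define p where "p = (\<Prod>j\<in>D - {i}. x j)"
  have p: "p \<in> {0..1}" unfolding p_def by (intro prod_unit x)
  have "(\<Prod>j\<in>D. x j) = x i * p" unfolding p_def by (rule prod.remove[OF D True])
  then have "\<bar>(\<Prod>j\<in>D. x j) * x i - (\<Prod>j\<in>insert i D. x j)\<bar> = \<bar>p * (- (x i * (1 - x i)))\<bar>"
    using True by (simp add: insert_absorb algebra_simps)
  also have "\<dots> = p * (x i * (1 - x i))" using p x[of i] by (simp add: abs_mult)
  also have "\<dots> \<le> 1 * (x i * (1 - x i))" using p x[of i] by (intro mult_right_mono mult_nonneg_nonneg) auto
  finally show ?thesis by simp
next
  case False
  then show ?thesis using D x[of i] by (simp add: mult.commute)
qed

lemma prod_union_near: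
  fixes x :: "'i \<Rightarrow> real"
  assumes x: "\<And>i. x i \<in> {0..1}" and D: "finite D" and B: "finite B"
  shows "\<bar>(\<Prod>j\<in>D. x j) * (\<Prod>j\<in>B. x j) - (\<Prod>j\<in>D \<union> B. x j)\<bar> \<le> (\<Sum>j\<in>B. x j * (1 - x j))"
  using B
proof (induction B)
  case (insert i B)
  have "\<bar>x i * ((\<Prod>j\<in>D. x j) * (\<Prod>j\<in>B. x j) - (\<Prod>j\<in>D \<union> B. x j))\<bar> \<le> 1 * (\<Sum>j\<in>B. x j * (1 - x j))"
    unfolding abs_mult using insert.IH x[of i] by (intro mult_mono) auto
  moreover have "\<bar>(\<Prod>j\<in>D \<union> B. x j) * x i - (\<Prod>j\<in>insert i (D \<union> B). x j)\<bar> \<le> x i * (1 - x i)"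
    using D insert(1) by (intro prod_insert_near x) auto
  moreover have "(\<Prod>j\<in>D. x j) * (\<Prod>j\<in>insert i B. x j) - (\<Prod>j\<in>insert i (D \<union> B). x j)
      = x i * ((\<Prod>j\<in>D. x j) * (\<Prod>j\<in>B. x j) - (\<Prod>j\<in>D \<union> B. x j))
        + ((\<Prod>j\<in>D \<union> B. x j) * x i - (\<Prod>j\<in>insert i (D \<union> B). x j))"
    using insert(1,2) by (simp add: algebra_simps)
  ultimately show ?case using insert(1,2) by simp
qed simp

lemma sum_neighbours_const:
  "(\<Sum>k\<in>B. \<Sum>i\<in>neighbours (k :: 'd::finite site). 1 / (2 * real CARD('d)) * c) = jump_rate TYPE('d) * card B * c"
proof -
  have "(\<Sum>i\<in>neighbours k. 1 / (2 * real CARD('d)) * c) = jump_rate TYPE('d) * c" for k :: "'d site"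
    using card_neighbours[of k] by (simp add: jump_rate_def)
  then show ?thesis by simp
qed

section \<open>Approximate closure of the moment equations\<close>

locale flow =
  fixes M :: "'w measure" and X :: "real \<Rightarrow> 'w \<Rightarrow> 'd::finite site \<Rightarrow> real" and U\<^sub>0 :: "'d site \<Rightarrow> real" and \<epsilon> :: real
  assumes flow: "moment_flow M X U\<^sub>0 \<epsilon>"
begin

sublocale prob_space M using flow by (simp add: moment_flow_def)

lemma X_measurable: "0 \<le> t \<Longrightarrow> (\<lambda>w. X t w k) \<in> borel_measurable M"
  using flow by (simp add: moment_flow_def)

lemma X_range: "X t w k \<in> {0..1}"
  by (rule flow[unfolded moment_flow_def, THEN conjunct2, THEN conjunct2, THEN conjunct1, rule_format])

lemma X_initial: "AE w in M. \<forall>k. X 0 w k = U\<^sub>0 k"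
  using flow by (simp add: moment_flow_def)

lemma X_heterozygosity: "0 \<le> t \<Longrightarrow> expectation (\<lambda>w. X t w k * (1 - X t w k)) \<le> \<epsilon>"
  using flow by (simp add: moment_flow_def)

lemma X_heterozygosity_nonneg: "0 \<le> X t w k * (1 - X t w k)"
  using X_range[of t w k] by (intro mult_nonneg_nonneg) auto

lemma \<epsilon>_nonneg: "0 \<le> \<epsilon>"
  by (rule order.trans[OF Bochner_Integration.integral_nonneg X_heterozygosity[OF order_refl]]) (rule X_heterozygosity_nonneg)

lemma X_heterozygosity_integrable: "0 \<le> t \<Longrightarrow> integrable M (\<lambda>w. X t w k * (1 - X t w k))"
proof (rule integrable_const_bound[where B = 1])
  have "X t w k * (1 - X t w k) \<le> 1 * 1" for w
    using X_range[of t w k] by (intro mult_mono) auto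
  then show "AE w in M. norm (X t w k * (1 - X t w k)) \<le> 1"
    using X_heterozygosity_nonneg[of t _ k] by simp
qed (use X_measurable in simp)

lemma monomial_range: "path_monomial X S \<tau> A w \<in> {0..1}" "(\<Prod>k\<in>B. X r w k) \<in> {0..1}"
  unfolding path_monomial_def by (intro prod_unit X_range)+

lemma monomial_measurable:
  "(\<And>i. i \<in> S \<Longrightarrow> 0 \<le> \<tau> i) \<Longrightarrow> (\<lambda>w. path_monomial X S \<tau> A w) \<in> borel_measurable M"
  "0 \<le> r \<Longrightarrow> (\<lambda>w. \<Prod>k\<in>B. X r w k) \<in> borel_measurable M"
  unfolding path_monomial_def
  by (rule borel_measurable_prod, rule borel_measurable_prod, rule X_measurable, assumption)
    (rule borel_measurable_prod, rule X_measurable, assumption)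

lemma expectation_near:
  assumes Y: "Y \<in> borel_measurable M" "\<And>w. Y w \<in> {0..1}" and f: "f \<in> borel_measurable M" "\<And>w. f w \<in> {0..1}"
    and g: "g \<in> borel_measurable M" "\<And>w. g w \<in> {0..1}" and r: "0 \<le> r"
    and near: "\<And>w. \<bar>f w - g w\<bar> \<le> (\<Sum>k\<in>B. X r w k * (1 - X r w k))"
  shows "\<bar>expectation (\<lambda>w. Y w * f w) - expectation (\<lambda>w. Y w * g w)\<bar> \<le> card B * \<epsilon>"
proof -
  have int: "integrable M (\<lambda>w. Y w * h w)" if "h \<in> borel_measurable M" "\<And>w. h w \<in> {0..1}" for h
  proof (rule integrable_const_bound[where B = 1])
    show "AE w in M. norm (Y w * h w) \<le> 1"
    proof (rule AE_I2)
      fix w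
      show "norm (Y w * h w) \<le> 1" using Y(2)[of w] that(2)[of w] by (simp add: abs_mult mult_le_one)
    qed
  qed (use Y that in auto)
  have "\<bar>expectation (\<lambda>w. Y w * f w - Y w * g w)\<bar> \<le> expectation (\<lambda>w. \<Sum>k\<in>B. X r w k * (1 - X r w k))"
  proof (rule order.trans[OF integral_abs_bound integral_mono])
    fix w
    have "\<bar>Y w * (f w - g w)\<bar> \<le> 1 * (\<Sum>k\<in>B. X r w k * (1 - X r w k))"
      unfolding abs_mult using Y(2)[of w] near[of w] by (intro mult_mono) auto
    then show "\<bar>Y w * f w - Y w * g w\<bar> \<le> (\<Sum>k\<in>B. X r w k * (1 - X r w k))" by (simp add: right_diff_distrib)
  qed (use int f g X_heterozygosity_integrable[OF r] in auto)
  also have "\<dots> = (\<Sum>k\<in>B. expectation (\<lambda>w. X r w k * (1 - X r w k)))"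
    by (intro Bochner_Integration.integral_sum X_heterozygosity_integrable r)
  also have "\<dots> \<le> (\<Sum>k\<in>B. \<epsilon>)" by (intro sum_mono X_heterozygosity r)
  finally show ?thesis using int[OF f] int[OF g] by simp
qed

text \<open>The drift replaces one site of \<open>B\<close> by a neighbour. If the neighbour already
  lies in \<open>B\<close> a squared factor appears and is reduced to a simple one, at a cost of at
  most \<epsilon>; these are the coalescing walks dual to the voter process.\<close>

lemma moment_derivative_near:
  assumes \<tau>: "\<And>i. i \<in> S \<Longrightarrow> 0 \<le> \<tau> i" and r: "0 \<le> r" and B: "finite B"
  shows "\<bar>moment_drift M X S \<tau> A B r
      - (\<Sum>k\<in>B. \<Sum>i\<in>neighbours k. 1 / (2 * real CARD('d)) *
          (mixed_moment M X S \<tau> A (insert i (B - {k})) r - mixed_moment M X S \<tau> A B r))\<bar>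
    \<le> jump_rate TYPE('d) * card B * \<epsilon>"
proof -
  define Y where "Y w = path_monomial X S \<tau> A w" for w
  have Y: "Y \<in> borel_measurable M" "Y w \<in> {0..1}" for w
    unfolding Y_def by (intro monomial_measurable \<tau> monomial_range; assumption)+
  let ?\<phi> = "\<lambda>B. mixed_moment M X S \<tau> A B r"
  let ?c = "1 / (2 * real CARD('d))"
  have \<phi>: "?\<phi> B = expectation (\<lambda>w. Y w * (\<Prod>k\<in>B. X r w k))" for B by (simp add: mixed_moment_def Y_def)
  have meas: "(\<lambda>w. (\<Prod>j\<in>D. X r w j) * X r w i) \<in> borel_measurable M" for D i
    by (intro borel_measurable_times monomial_measurable(2) X_measurable r)
  have range: "(\<Prod>j\<in>D. X r w j) * X r w i \<in> {0..1}" for D i w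
    using monomial_range(2)[of r w D] X_range[of r w i] by (auto intro: mult_le_one)
  have int: "integrable M (\<lambda>w. Y w * ((\<Prod>j\<in>D. X r w j) * X r w i))" for D i
  proof (rule integrable_const_bound[where B = 1])
    show "AE w in M. norm (Y w * ((\<Prod>j\<in>D. X r w j) * X r w i)) \<le> 1"
    proof (rule AE_I2)
      fix w
      have "(\<Prod>j\<in>D. X r w j) * X r w i \<in> {0..1}" by (rule range)
      then show "norm (Y w * ((\<Prod>j\<in>D. X r w j) * X r w i)) \<le> 1"
        unfolding real_norm_def abs_mult[of "Y w"] using Y(2)[of w] by (intro mult_le_one) auto
    qed
  qed (intro borel_measurable_times[OF Y(1) meas])
  let ?m = "\<lambda>k i. expectation (\<lambda>w. Y w * ((\<Prod>j\<in>B - {k}. X r w j) * X r w i))"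
  have same: "?m k k = ?\<phi> B" if "k \<in> B" for k
    unfolding \<phi> prod.remove[OF B that] by (simp add: mult.commute)
  have near: "\<bar>?m k i - ?\<phi> (insert i (B - {k}))\<bar> \<le> \<epsilon>" for k i
  proof -
    have "\<bar>?m k i - ?\<phi> (insert i (B - {k}))\<bar> \<le> card {i} * \<epsilon>"
      unfolding \<phi>
      by (rule expectation_near[OF Y meas range monomial_measurable(2)[OF r] monomial_range(2) r])
        (use prod_insert_near[OF X_range, of "B - {k}"] B in simp)
    then show ?thesis by simp
  qed
  have exact: "expectation (\<lambda>w. Y w * ((\<Prod>j\<in>B - {k}. X r w j) * laplacian (X r w) k))
      = (\<Sum>i\<in>neighbours k. ?c * (?m k i - ?\<phi> B))" if k: "k \<in> B" for k
  proof -
    have "expectation (\<lambda>w. Y w * ((\<Prod>j\<in>B - {k}. X r w j) * laplacian (X r w) k))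
      = expectation (\<lambda>w. \<Sum>i\<in>neighbours k. ?c * (Y w * ((\<Prod>j\<in>B - {k}. X r w j) * X r w i) - Y w * ((\<Prod>j\<in>B - {k}. X r w j) * X r w k)))"
      by (intro Bochner_Integration.integral_cong refl)
        (simp add: laplacian_def sum_distrib_left right_diff_distrib left_diff_distrib diff_divide_distrib mult_ac)
    also have "\<dots> = (\<Sum>i\<in>neighbours k. expectation (\<lambda>w. ?c * (Y w * ((\<Prod>j\<in>B - {k}. X r w j) * X r w i) - Y w * ((\<Prod>j\<in>B - {k}. X r w j) * X r w k))))"
      by (intro Bochner_Integration.integral_sum integrable_mult_right Bochner_Integration.integrable_diff int)
    also have "\<dots> = (\<Sum>i\<in>neighbours k. ?c * (?m k i - ?m k k))"
      by (simp only: integral_mult_right_zero Bochner_Integration.integral_diff[OF int int])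
    finally show ?thesis by (simp only: same[OF k])
  qed
  have "(\<Sum>k\<in>B. expectation (\<lambda>w. Y w * ((\<Prod>j\<in>B - {k}. X r w j) * laplacian (X r w) k)))
      - (\<Sum>k\<in>B. \<Sum>i\<in>neighbours k. ?c * (?\<phi> (insert i (B - {k})) - ?\<phi> B))
      = (\<Sum>k\<in>B. \<Sum>i\<in>neighbours k. ?c * (?m k i - ?\<phi> (insert i (B - {k}))))"
    unfolding sum_subtractf[symmetric] by (intro sum.cong refl) (simp add: exact sum_subtractf[symmetric] right_diff_distrib)
  also have "\<bar>\<dots>\<bar> \<le> (\<Sum>k\<in>B. \<Sum>i\<in>neighbours k. ?c * \<epsilon>)"
  proof (rule order.trans[OF sum_abs sum_mono])
    fix k
    show "\<bar>\<Sum>i\<in>neighbours k. ?c * (?m k i - ?\<phi> (insert i (B - {k})))\<bar> \<le> (\<Sum>i\<in>neighbours k. ?c * \<epsilon>)"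
    proof (rule order.trans[OF sum_abs sum_mono])
      fix i
      show "\<bar>?c * (?m k i - ?\<phi> (insert i (B - {k})))\<bar> \<le> ?c * \<epsilon>"
        unfolding abs_mult using near[of k i] by (intro mult_mono) auto
    qed
  qed
  also have "\<dots> = jump_rate TYPE('d) * card B * \<epsilon>"
    by (rule sum_neighbours_const)
  finally show ?thesis unfolding moment_drift_def Y_def .
qed

lemma mixed_moment_flow:
  assumes "finite S" "\<And>i. i \<in> S \<Longrightarrow> 0 \<le> \<tau> i \<and> \<tau> i \<le> s \<and> finite (A i)" "0 \<le> s" "finite B"
  shows "continuous_on {s..} (mixed_moment M X S \<tau> A B)"
    and "s \<le> r \<Longrightarrow> (mixed_moment M X S \<tau> A B has_real_derivative moment_drift M X S \<tau> A B r) (at_right r)"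
proof -
  note dyn = flow[unfolded moment_flow_def, THEN conjunct2, THEN conjunct2, THEN conjunct2, THEN conjunct2, THEN conjunct2,
      rule_format, of S \<tau> s A B]
  show "continuous_on {s..} (mixed_moment M X S \<tau> A B)" using dyn assms by simp
  show "(mixed_moment M X S \<tau> A B has_real_derivative moment_drift M X S \<tau> A B r) (at_right r)"
    if "s \<le> r" using dyn assms that by simp
qed

lemma mixed_moment_bound:
  assumes "\<And>i. i \<in> S \<Longrightarrow> 0 \<le> \<tau> i" "0 \<le> r"
  shows "0 \<le> mixed_moment M X S \<tau> A B r" "mixed_moment M X S \<tau> A B r \<le> 1"
proof -
  have range: "path_monomial X S \<tau> A w * (\<Prod>k\<in>B. X r w k) \<in> {0..1}" for w
    using monomial_range(1)[where S = S and A = A and \<tau> = \<tau> and w = w] monomial_range(2)[of r w B] by (auto intro: mult_le_one)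
  have meas: "(\<lambda>w. path_monomial X S \<tau> A w * (\<Prod>k\<in>B. X r w k)) \<in> borel_measurable M"
    by (intro borel_measurable_times monomial_measurable assms)
  have int: "integrable M (\<lambda>w. path_monomial X S \<tau> A w * (\<Prod>k\<in>B. X r w k))"
    by (rule integrable_const_bound[where B = 1, OF AE_I2 meas]) (use range in simp)
  show "0 \<le> mixed_moment M X S \<tau> A B r"
    unfolding mixed_moment_def by (rule Bochner_Integration.integral_nonneg) (use range in simp)
  show "mixed_moment M X S \<tau> A B r \<le> 1"
    unfolding mixed_moment_def by (rule integral_le_const[OF int AE_I2]) (use range in simp)
qed

end

text \<open>Moving a site to a neighbour never enlarges the set, so the sets of at most
  \<open>n\<close> sites form a family closed under the equations. Each of the at most
  \<open>n\<close> sites moves at rate \<open>jump_rate\<close>, and a move compares two moments;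
  this gives the Lipschitz constant \<open>2 * jump_rate * n\<close>.\<close>

lemma mixed_moments_close:
  fixes X :: "real \<Rightarrow> 'w \<Rightarrow> 'd::finite site \<Rightarrow> real" and X' :: "real \<Rightarrow> 'q \<Rightarrow> 'd site \<Rightarrow> real"
  assumes F1: "moment_flow M X U\<^sub>0 \<epsilon>" and F2: "moment_flow Q X' U\<^sub>0 \<epsilon>'"
    and S: "finite S" "\<And>i. i \<in> S \<Longrightarrow> 0 \<le> \<tau> i \<and> \<tau> i \<le> s \<and> finite (A i)" and s: "0 \<le> s" "s \<le> r"
    and start: "\<And>B. finite B \<Longrightarrow> card B \<le> n \<Longrightarrow> \<bar>mixed_moment M X S \<tau> A B s - mixed_moment Q X' S \<tau> A B s\<bar> \<le> \<delta>"
    and B: "finite B" "card B \<le> n"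
  shows "\<bar>mixed_moment M X S \<tau> A B r - mixed_moment Q X' S \<tau> A B r\<bar>
    \<le> 2 * (\<delta> + jump_rate TYPE('d) * n * (\<epsilon> + \<epsilon>') * (r - s)) * exp (2 * (2 * jump_rate TYPE('d) * n) * (r - s))"
proof -
  interpret M: flow M X U\<^sub>0 \<epsilon> by unfold_locales (rule F1)
  interpret Q: flow Q X' U\<^sub>0 \<epsilon>' by unfold_locales (rule F2)
  let ?\<kappa> = "jump_rate TYPE('d)"
  let ?c = "1 / (2 * real CARD('d))"
  define F where "F = {B :: 'd site set. finite B \<and> card B \<le> n}"
  let ?\<phi> = "mixed_moment M X S \<tau> A" and ?\<psi> = "mixed_moment Q X' S \<tau> A"
  let ?\<phi>' = "moment_drift M X S \<tau> A" and ?\<psi>' = "moment_drift Q X' S \<tau> A"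
  have \<tau>: "\<And>i. i \<in> S \<Longrightarrow> 0 \<le> \<tau> i" using S(2) by simp
  have "\<bar>(\<lambda>B r. ?\<phi> B r - ?\<psi> B r) B r\<bar>
      \<le> 2 * (\<delta> + ?\<kappa> * n * (\<epsilon> + \<epsilon>') * (r - s)) * exp (2 * (2 * ?\<kappa> * n) * (r - s))"
  proof (rule family_gronwall[where F = F and b = 1 and D' = "\<lambda>B r. ?\<phi>' B r - ?\<psi>' B r"])
    show "0 \<le> ?\<kappa> * n * (\<epsilon> + \<epsilon>')" "0 \<le> 2 * ?\<kappa> * n"
      using jump_rate_nonneg[where 'd = 'd] M.\<epsilon>_nonneg Q.\<epsilon>_nonneg by simp_all
    show "B \<in> F" using B by (simp add: F_def)
    fix B assume "B \<in> F"
    then have B: "finite B" "card B \<le> n" by (auto simp: F_def)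
    have fm: "continuous_on {s..} (?\<phi> B)" "s \<le> q \<Longrightarrow> (?\<phi> B has_real_derivative ?\<phi>' B q) (at_right q)" for q
      by (rule M.mixed_moment_flow[OF S s(1) B(1)]; assumption)+
    have fq: "continuous_on {s..} (?\<psi> B)" "s \<le> q \<Longrightarrow> (?\<psi> B has_real_derivative ?\<psi>' B q) (at_right q)" for q
      by (rule Q.mixed_moment_flow[OF S s(1) B(1)]; assumption)+
    have "continuous_on {s..} (\<lambda>q. ?\<phi> B q - ?\<psi> B q)" by (intro continuous_intros fm(1) fq(1))
    then show "continuous_on {s..r} (\<lambda>q. ?\<phi> B q - ?\<psi> B q)" by (rule continuous_on_subset) auto
    show "\<bar>?\<phi> B s - ?\<psi> B s\<bar> \<le> \<delta>" by (rule start[OF B])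
    show "((\<lambda>q. ?\<phi> B q - ?\<psi> B q) has_real_derivative (?\<phi>' B q - ?\<psi>' B q)) (at_right q)" if "s \<le> q" for q
      by (rule DERIV_diff[OF fm(2)[OF that] fq(2)[OF that]])
    show "\<bar>?\<phi> B q - ?\<psi> B q\<bar> \<le> 1" if "s \<le> q" for q
    proof -
      have "0 \<le> q" using s(1) that by simp
      then have "0 \<le> ?\<phi> B q" "?\<phi> B q \<le> 1" "0 \<le> ?\<psi> B q" "?\<psi> B q \<le> 1"
        using M.mixed_moment_bound[OF \<tau>] Q.mixed_moment_bound[OF \<tau>] by simp_all
      then show ?thesis by (simp add: abs_le_iff)
    qed
    fix q c assume q: "s \<le> q" and c: "\<And>B. B \<in> F \<Longrightarrow> \<bar>?\<phi> B q - ?\<psi> B q\<bar> \<le> c"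
    have q0: "0 \<le> q" using q s(1) by simp
    let ?\<Phi> = "\<Sum>k\<in>B. \<Sum>i\<in>neighbours k. ?c * (?\<phi> (insert i (B - {k})) q - ?\<phi> B q)"
    let ?\<Psi> = "\<Sum>k\<in>B. \<Sum>i\<in>neighbours k. ?c * (?\<psi> (insert i (B - {k})) q - ?\<psi> B q)"
    have c0: "0 \<le> c" using c[OF \<open>B \<in> F\<close>] by linarith
    have "\<bar>?\<Phi> - ?\<Psi>\<bar> \<le> (\<Sum>k\<in>B. \<Sum>i\<in>neighbours k. ?c * (2 * c))"
      unfolding sum_subtractf[symmetric]
    proof (rule order.trans[OF sum_abs sum_mono], rule order.trans[OF sum_abs sum_mono])
      fix k i assume k: "k \<in> B"
      have "card (insert i (B - {k})) \<le> card B"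
        using B(1) k by (metis card_Diff_singleton card_Suc_Diff1 card_insert_le_m1 card_gt_0_iff empty_iff order_refl finite_Diff diff_Suc_1)
      then have "insert i (B - {k}) \<in> F" using B by (simp add: F_def)
      note d = c[OF this] c[OF \<open>B \<in> F\<close>]
      have "\<bar>(?\<phi> (insert i (B - {k})) q - ?\<psi> (insert i (B - {k})) q) - (?\<phi> B q - ?\<psi> B q)\<bar> \<le> 2 * c"
        using d by linarith
      then have "?c * \<bar>(?\<phi> (insert i (B - {k})) q - ?\<psi> (insert i (B - {k})) q) - (?\<phi> B q - ?\<psi> B q)\<bar> \<le> ?c * (2 * c)"
        by (intro mult_left_mono) auto
      moreover have "?c * (?\<phi> (insert i (B - {k})) q - ?\<phi> B q) - ?c * (?\<psi> (insert i (B - {k})) q - ?\<psi> B q)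
          = ?c * ((?\<phi> (insert i (B - {k})) q - ?\<psi> (insert i (B - {k})) q) - (?\<phi> B q - ?\<psi> B q))"
        by (simp only: right_diff_distrib)
      ultimately show "\<bar>?c * (?\<phi> (insert i (B - {k})) q - ?\<phi> B q) - ?c * (?\<psi> (insert i (B - {k})) q - ?\<psi> B q)\<bar> \<le> ?c * (2 * c)"
        by (simp add: abs_mult)
    qed
    also have "\<dots> = ?\<kappa> * card B * (2 * c)" by (rule sum_neighbours_const)
    also have "\<dots> \<le> 2 * ?\<kappa> * n * c"
      using mult_mono[of "real (card B)" n "?\<kappa> * (2 * c)" "?\<kappa> * (2 * c)"] B(2) c0 jump_rate_nonneg[where 'd = 'd] by (simp add: mult_ac)
    finally have 1: "\<bar>?\<Phi> - ?\<Psi>\<bar> \<le> 2 * ?\<kappa> * n * c" .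
    have near: "?\<kappa> * card B * e \<le> ?\<kappa> * n * e" if "0 \<le> e" for e
      using B(2) that jump_rate_nonneg[where 'd = 'd] by (intro mult_mono) auto
    have 2: "\<bar>?\<phi>' B q - ?\<Phi>\<bar> \<le> ?\<kappa> * n * \<epsilon>"
      using order.trans[OF M.moment_derivative_near[OF \<tau> q0 B(1)] near[OF M.\<epsilon>_nonneg]] by simp
    have 3: "\<bar>?\<psi>' B q - ?\<Psi>\<bar> \<le> ?\<kappa> * n * \<epsilon>'"
      using order.trans[OF Q.moment_derivative_near[OF \<tau> q0 B(1)] near[OF Q.\<epsilon>_nonneg]] by simp
    show "\<bar>?\<phi>' B q - ?\<psi>' B q\<bar> \<le> 2 * ?\<kappa> * n * c + ?\<kappa> * n * (\<epsilon> + \<epsilon>')"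
      using 1 2 3 unfolding distrib_left by linarith
  qed (use s in auto)
  then show ?thesis by simp
qed

text \<open>Induction over the times in increasing order. Over the last interval the moments are
  compared by Gronwall; at its left end the two factors taken at the same time are merged into one
  set. This may double its size, so the induction hypothesis is used with \<open>2 * n\<close>. The
  constant is chosen before the process and \<epsilon>, hence uniformly in \<gamma>.\<close>

theorem moments_close:
  fixes \<tau> :: "nat \<Rightarrow> real" and U\<^sub>0 :: "'d::finite site \<Rightarrow> real"
    and Q :: "'q measure" and X' :: "real \<Rightarrow> 'q \<Rightarrow> 'd site \<Rightarrow> real"
  assumes "finite S" "\<And>i. i \<in> S \<Longrightarrow> 0 \<le> \<tau> i" and F2: "moment_flow Q X' U\<^sub>0 \<epsilon>'"
  shows "\<exists>C\<ge>0. \<forall>(M :: 'w measure) X \<epsilon> A. moment_flow M X U\<^sub>0 \<epsilon> \<longrightarrow> (\<forall>i\<in>S. finite (A i) \<and> card (A i) \<le> n) \<longrightarrow>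
    \<bar>(\<integral>w. path_monomial X S \<tau> A w \<partial>M) - (\<integral>w. path_monomial X' S \<tau> A w \<partial>Q)\<bar> \<le> C * (\<epsilon> + \<epsilon>')"
  using assms(1,2)
proof (induction S arbitrary: n rule: finite_ranking_induct[where f = \<tau>])
  case empty
  have "(\<integral>w. 1 \<partial>M) = (1 :: real)" if "moment_flow M X U\<^sub>0 \<epsilon>" for M :: "'w measure" and X \<epsilon>
  proof -
    interpret prob_space M using that by (simp add: moment_flow_def)
    show ?thesis by (simp add: prob_space)
  qed
  moreover have "(\<integral>w. 1 \<partial>Q) = (1 :: real)"
  proof -
    interpret prob_space Q using F2 by (simp add: moment_flow_def)
    show ?thesis by (simp add: prob_space)
  qed
  ultimately show ?case by (intro exI[of _ 0]) (simp add: path_monomial_def)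
next
  case (insert x S)
  interpret Q: flow Q X' U\<^sub>0 \<epsilon>' by unfold_locales (rule F2)
  show ?case
  proof (cases "x \<in> S")
    case True
    then show ?thesis using insert.IH[of n] insert.prems by (simp add: insert_absorb)
  next
    case x: False
    let ?\<kappa> = "jump_rate TYPE('d)"
    have \<kappa>: "0 \<le> ?\<kappa>" by (rule jump_rate_nonneg)
    have \<tau>x: "0 \<le> \<tau> x" using insert.prems by simp
    have \<tau>: "0 \<le> \<tau> i" if "i \<in> S" for i using insert.prems that by simp
    have "\<exists>s C. 0 \<le> s \<and> s \<le> \<tau> x \<and> 0 \<le> C \<and> (\<forall>i\<in>S. \<tau> i \<le> s) \<and>
      (\<forall>(M :: 'w measure) X \<epsilon> A B. moment_flow M X U\<^sub>0 \<epsilon> \<longrightarrow> (\<forall>i\<in>S. finite (A i) \<and> card (A i) \<le> n) \<longrightarrow> finite B \<longrightarrow> card B \<le> n \<longrightarrow>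
        \<bar>mixed_moment M X S \<tau> A B s - mixed_moment Q X' S \<tau> A B s\<bar> \<le> C * (\<epsilon> + \<epsilon>'))"
    proof (cases "S = {}")
      case True
      \<comment> \<open>With no earlier time the comparison starts at 0, where both processes are in
        the same deterministic state.\<close>
      have init: "mixed_moment M X {} \<tau> A B 0 = (\<Prod>k\<in>B. U\<^sub>0 k)" if "moment_flow M X U\<^sub>0 \<epsilon>" "finite B"
        for M :: "'z measure" and X A B and \<epsilon> :: real
      proof -
        interpret flow M X U\<^sub>0 \<epsilon> by unfold_locales (rule that(1))
        have "mixed_moment M X {} \<tau> A B 0 = expectation (\<lambda>_. \<Prod>k\<in>B. U\<^sub>0 k)"
          unfolding mixed_moment_def path_monomial_def
        proof (rule integral_cong_AE)
          show "AE w in M. (\<Prod>i\<in>{}. \<Prod>k\<in>A i. X (\<tau> i) w k) * (\<Prod>k\<in>B. X 0 w k) = (\<Prod>k\<in>B. U\<^sub>0 k)"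
            using X_initial by eventually_elim simp
        qed (use monomial_measurable(2)[OF order_refl] in auto)
        then show ?thesis by (simp add: prob_space)
      qed
      have "\<bar>mixed_moment M X {} \<tau> A B 0 - mixed_moment Q X' {} \<tau> A B 0\<bar> \<le> 0 * (\<epsilon> + \<epsilon>')"
        if "moment_flow M X U\<^sub>0 \<epsilon>" "finite B" for M :: "'w measure" and X A B and \<epsilon> :: real
        using init[OF that] init[OF F2 that(2)] by simp
      then show ?thesis using True \<tau>x by (intro exI[of _ 0] exI[of _ "0 :: real"]) simp
    next
      case False
      \<comment> \<open>At the largest earlier time, the left end of the last interval, a past
        factor and the present set belong to the same time.\<close>
      define s where "s = Max (\<tau> ` S)"
      have "s \<in> \<tau> ` S" unfolding s_def using insert.hyps(1) False by (intro Max_in) auto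
      then obtain j where j: "j \<in> S" "s = \<tau> j" by auto
      have max: "\<tau> i \<le> s" if "i \<in> S" for i unfolding s_def using insert.hyps(1) that by (intro Max_ge) auto
      obtain C where C: "0 \<le> C" "\<And>(M :: 'w measure) X \<epsilon> A. moment_flow M X U\<^sub>0 \<epsilon> \<Longrightarrow> (\<And>i. i \<in> S \<Longrightarrow> finite (A i) \<and> card (A i) \<le> 2 * n) \<Longrightarrow>
        \<bar>(\<integral>w. path_monomial X S \<tau> A w \<partial>M) - (\<integral>w. path_monomial X' S \<tau> A w \<partial>Q)\<bar> \<le> C * (\<epsilon> + \<epsilon>')"
        using insert.IH[of "2 * n"] \<tau> by auto
      have merge: "\<bar>mixed_moment M X S \<tau> A B s - (\<integral>w. path_monomial X S \<tau> (A(j := A j \<union> B)) w \<partial>M)\<bar> \<le> n * \<epsilon>"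
        if "moment_flow M X U\<^sub>0 \<epsilon>" and A: "\<forall>i\<in>S. finite (A i) \<and> card (A i) \<le> n" and B: "finite B" "card B \<le> n" for M :: "'z measure" and X A B and \<epsilon> :: real
      proof -
        interpret flow M X U\<^sub>0 \<epsilon> by unfold_locales (rule that(1))
        have Aj: "finite (A j)" using A j(1) by simp
        define Y where "Y w = path_monomial X (S - {j}) \<tau> A w" for w
        have Y: "Y \<in> borel_measurable M" "Y w \<in> {0..1}" for w
          unfolding Y_def using \<tau> by (intro monomial_measurable monomial_range; simp)+
        have 1: "mixed_moment M X S \<tau> A B s = expectation (\<lambda>w. Y w * ((\<Prod>k\<in>A j. X s w k) * (\<Prod>k\<in>B. X s w k)))"
          unfolding mixed_moment_def Y_def path_monomial_def prod.remove[OF insert.hyps(1) j(1)] j(2) by (simp only: mult_ac)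
        have "(path_monomial X (S - {j}) \<tau> (A(j := A j \<union> B)) w) = Y w" for w
          unfolding Y_def path_monomial_def by (intro prod.cong) auto
        then have 2: "(\<integral>w. path_monomial X S \<tau> (A(j := A j \<union> B)) w \<partial>M) = expectation (\<lambda>w. Y w * (\<Prod>k\<in>A j \<union> B. X s w k))"
          unfolding path_monomial_def prod.remove[OF insert.hyps(1) j(1)] by (simp add: j(2) mult.commute)
        have s: "0 \<le> s" using \<tau>[OF j(1)] j(2) by simp
        have pair: "(\<Prod>k\<in>A j. X s w k) * (\<Prod>k\<in>B. X s w k) \<in> {0..1}" for w
          using monomial_range(2)[of s w "A j"] monomial_range(2)[of s w B] by (auto intro: mult_le_one)
        have "\<bar>mixed_moment M X S \<tau> A B s - (\<integral>w. path_monomial X S \<tau> (A(j := A j \<union> B)) w \<partial>M)\<bar> \<le> card B * \<epsilon>"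
          unfolding 1 2
          by (rule expectation_near[OF Y _ pair monomial_measurable(2)[OF s] monomial_range(2) s prod_union_near[OF X_range Aj B(1)]])
            (intro borel_measurable_times monomial_measurable(2) s)
        also have "\<dots> \<le> n * \<epsilon>" using B(2) \<epsilon>_nonneg by (intro mult_right_mono) auto
        finally show ?thesis .
      qed
      have "\<bar>mixed_moment M X S \<tau> A B s - mixed_moment Q X' S \<tau> A B s\<bar> \<le> (C + n) * (\<epsilon> + \<epsilon>')"
        if F1: "moment_flow M X U\<^sub>0 \<epsilon>" and A: "\<forall>i\<in>S. finite (A i) \<and> card (A i) \<le> n" and B: "finite B" "card B \<le> n"
        for M :: "'w measure" and X A B and \<epsilon> :: real
      proof -
        have "finite ((A(j := A j \<union> B)) i) \<and> card ((A(j := A j \<union> B)) i) \<le> 2 * n" if i: "i \<in> S" for i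
          using A i B card_Un_le[of "A j" B] by (cases "i = j") fastforce+
        then have "\<bar>(\<integral>w. path_monomial X S \<tau> (A(j := A j \<union> B)) w \<partial>M)
          - (\<integral>w. path_monomial X' S \<tau> (A(j := A j \<union> B)) w \<partial>Q)\<bar> \<le> C * (\<epsilon> + \<epsilon>')"
          by (rule C(2)[OF F1])
        then show ?thesis
          using merge[OF F1 A B] merge[OF F2 A B] unfolding distrib_right distrib_left by linarith
      qed
      then show ?thesis using C(1) max \<tau>[OF j(1)] insert.hyps(2)[OF j(1)] j(2)
        by (intro exI[of _ s] exI[of _ "C + n"]) simp
    qed
    then obtain s C where s: "0 \<le> s" "s \<le> \<tau> x" "\<And>i. i \<in> S \<Longrightarrow> \<tau> i \<le> s" and C: "0 \<le> C"
      "\<And>(M :: 'w measure) X \<epsilon> A B. moment_flow M X U\<^sub>0 \<epsilon> \<Longrightarrow> (\<And>i. i \<in> S \<Longrightarrow> finite (A i) \<and> card (A i) \<le> n) \<Longrightarrow> finite B \<Longrightarrow> card B \<le> n \<Longrightarrow>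
        \<bar>mixed_moment M X S \<tau> A B s - mixed_moment Q X' S \<tau> A B s\<bar> \<le> C * (\<epsilon> + \<epsilon>')"
      by (elim exE conjE) auto
    \<comment> \<open>The bound of \<open>mixed_moments_close\<close> with the common factor
      \<open>\<epsilon> + \<epsilon>'\<close> taken out: \<open>C\<close> is the error at time
      \<open>s\<close> and the other summand accumulates afterwards.\<close>
    define K where "K = 2 * (C + ?\<kappa> * n * (\<tau> x - s)) * exp (2 * (2 * ?\<kappa> * n) * (\<tau> x - s))"
    have "0 \<le> K" unfolding K_def using C(1) \<kappa> s by simp
    moreover have "\<bar>(\<integral>w. path_monomial X (insert x S) \<tau> A w \<partial>M) - (\<integral>w. path_monomial X' (insert x S) \<tau> A w \<partial>Q)\<bar> \<le> K * (\<epsilon> + \<epsilon>')"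
      if F1: "moment_flow M X U\<^sub>0 \<epsilon>" and A: "\<forall>i\<in>insert x S. finite (A i) \<and> card (A i) \<le> n" for M :: "'w measure" and X \<epsilon> A
    proof -
      have Ax: "finite (A x)" "card (A x) \<le> n" and AS: "\<And>i. i \<in> S \<Longrightarrow> finite (A i) \<and> card (A i) \<le> n"
        and AS': "\<And>i. i \<in> S \<Longrightarrow> 0 \<le> \<tau> i \<and> \<tau> i \<le> s \<and> finite (A i)"
        using A s(3) \<tau> by auto
      have int: "(\<integral>w. path_monomial Z (insert x S) \<tau> A w \<partial>N) = mixed_moment N Z S \<tau> A (A x) (\<tau> x)" for N :: "'z measure" and Z
        unfolding mixed_moment_def path_monomial_def prod.insert[OF insert.hyps(1) x] by (simp only: mult.commute)
      have "\<bar>mixed_moment M X S \<tau> A (A x) (\<tau> x) - mixed_moment Q X' S \<tau> A (A x) (\<tau> x)\<bar>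
          \<le> 2 * (C * (\<epsilon> + \<epsilon>') + ?\<kappa> * n * (\<epsilon> + \<epsilon>') * (\<tau> x - s)) * exp (2 * (2 * ?\<kappa> * n) * (\<tau> x - s))"
        by (rule mixed_moments_close[OF F1 F2 insert.hyps(1) AS' s(1,2) C(2)[OF F1 AS] Ax])
      also have "\<dots> = K * (\<epsilon> + \<epsilon>')" by (simp add: K_def algebra_simps)
      finally show ?thesis unfolding int .
    qed
    ultimately show ?thesis by (intro exI[of _ K]) simp
  qed
qed

section \<open>Convergence of the occupation functionals\<close>

text \<open>A list, so that the same time and site may occur repeatedly.\<close>

definition history :: "(real \<Rightarrow> 'w \<Rightarrow> 'd site \<Rightarrow> real) \<Rightarrow> (real \<times> 'd site) list \<Rightarrow> 'w \<Rightarrow> real" where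
  "history X hs w = (\<Prod>(t, k)\<leftarrow>hs. X t w k)"

definition occupation :: "(real \<Rightarrow> 'w \<Rightarrow> 'd::finite site \<Rightarrow> real) \<Rightarrow> 'w \<Rightarrow> 'd site option list \<Rightarrow> real" where
  "occupation X w l = (\<integral>t. (\<Prod>i\<leftarrow>l. coord i (exp (- t), X t w)) \<partial>exp_law)"

lemma coord_monomial:
  "\<exists>a ks. \<forall>p. (\<Prod>i\<leftarrow>l. coord i p) = fst p ^ a * (\<Prod>k\<leftarrow>ks. snd p k)"
proof (induction l)
  case Nil
  show ?case by (rule exI[of _ 0], rule exI[of _ "[]"]) simp
next
  case (Cons i l)
  then obtain a ks where IH: "\<And>p. (\<Prod>i\<leftarrow>l. coord i p) = fst p ^ a * (\<Prod>k\<leftarrow>ks. snd p k)" by (elim exE) blast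
  show ?case
  proof (cases i)
    case None
    then show ?thesis by (intro exI[of _ "Suc a"] exI[of _ ks]) (simp add: IH)
  next
    case (Some k)
    then show ?thesis by (intro exI[of _ a] exI[of _ "k # ks"]) (simp add: IH)
  qed
qed

text \<open>Right continuity of every path is what makes the process jointly measurable in time and
  chance, as Fubini requires.\<close>

locale path_flow = flow M X U\<^sub>0 \<epsilon>
  for M :: "'w measure" and X :: "real \<Rightarrow> 'w \<Rightarrow> 'd::finite site \<Rightarrow> real" and U\<^sub>0 \<epsilon> +
  assumes right_continuous: "\<And>w t k. 0 \<le> t \<Longrightarrow> ((\<lambda>s. X s w k) \<longlongrightarrow> X t w k) (at_right t)"
begin

lemma X_jointly_measurable: "(\<lambda>(w, t). X t w k) \<in> borel_measurable (M \<Otimes>\<^sub>M exp_law)"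
proof -
  have "(\<lambda>(t, w). X (max 0 t) w k) \<in> borel_measurable (borel \<Otimes>\<^sub>M M)"
    using jointly_measurable_right_continuous[of "\<lambda>t w. X t w k" M] X_measurable right_continuous by simp
  moreover have "(\<lambda>x. (snd x, fst x)) \<in> measurable (M \<Otimes>\<^sub>M exp_law) (borel \<Otimes>\<^sub>M M)"
  proof (intro measurable_Pair measurable_fst)
    have "(\<lambda>t. t) \<in> measurable exp_law borel"
      unfolding measurable_exp_law by (rule measurable_restrict_space1) simp
    then show "snd \<in> measurable (M \<Otimes>\<^sub>M exp_law) borel"
      using measurable_compose[OF measurable_snd] by fastforce
  qed
  ultimately have "(\<lambda>x. (\<lambda>(t, w). X (max 0 t) w k) (snd x, fst x)) \<in> borel_measurable (M \<Otimes>\<^sub>M exp_law)"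
    by (rule measurable_compose[rotated])
  then show ?thesis
    by (rule measurable_cong[THEN iffD1, rotated]) (auto simp: space_pair_measure)
qed

lemma coord_jointly_measurable: "(\<lambda>(w, t). \<Prod>i\<leftarrow>l. coord i (exp (- t), X t w)) \<in> borel_measurable (M \<Otimes>\<^sub>M exp_law)"
proof (induction l)
  case (Cons i l)
  have "(\<lambda>(w, t). coord i (exp (- t), X t w)) \<in> borel_measurable (M \<Otimes>\<^sub>M exp_law)"
  proof (cases i)
    case None
    have "(\<lambda>t. exp (- t)) \<in> borel_measurable exp_law"
      unfolding measurable_exp_law by (rule measurable_restrict_space1) simp
    from measurable_compose[OF measurable_snd this] None show ?thesis unfolding case_prod_beta by simp
  qed (use X_jointly_measurable in simp)
  with Cons show ?case by (simp add: case_prod_beta borel_measurable_times)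
qed simp

lemma coord_range: "t \<in> space exp_law \<Longrightarrow> coord i (exp (- t), X t w) \<in> {0..1}"
  using X_range by (cases i) auto

lemma coord_prod_range: "t \<in> space exp_law \<Longrightarrow> (\<Prod>i\<leftarrow>l. coord i (exp (- t), X t w)) \<in> {0..1}"
  by (rule prod_list_unit) (rule coord_range)

lemma occupation_measurable: "(\<lambda>w. occupation X w l) \<in> borel_measurable M"
  unfolding occupation_def by (rule exp_law.borel_measurable_lebesgue_integral[OF coord_jointly_measurable])

lemma coord_integrable:
  assumes "w \<in> space M"
  shows "integrable exp_law (\<lambda>t. \<Prod>i\<leftarrow>l. coord i (exp (- t), X t w))"
proof (rule exp_law.integrable_const_bound[where B = 1])
  show "AE t in exp_law. norm (\<Prod>i\<leftarrow>l. coord i (exp (- t), X t w)) \<le> 1"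
    by (rule AE_I2) (use coord_prod_range[of _ w l] in simp)
  show "(\<lambda>t. \<Prod>i\<leftarrow>l. coord i (exp (- t), X t w)) \<in> borel_measurable exp_law"
    using measurable_compose[OF measurable_Pair1'[OF assms] coord_jointly_measurable] by simp
qed

lemma occupation_range:
  assumes "w \<in> space M"
  shows "occupation X w l \<in> {0..1}"
proof -
  have "0 \<le> occupation X w l"
    unfolding occupation_def by (rule Bochner_Integration.integral_nonneg_AE, rule AE_I2) (use coord_prod_range[of _ w l] in simp)
  moreover have "occupation X w l \<le> 1"
    unfolding occupation_def
    by (rule exp_law.integral_le_const[OF coord_integrable[OF assms]], rule AE_I2) (use coord_prod_range[of _ w l] in simp)
  ultimately show ?thesis by simp
qed

lemma occupation_prod_range: "w \<in> space M \<Longrightarrow> (\<Prod>l\<leftarrow>ls. occupation X w l) \<in> {0..1}"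
  by (rule prod_list_unit) (rule occupation_range)

lemma occupation_prod_measurable: "(\<lambda>w. \<Prod>l\<leftarrow>ls. occupation X w l) \<in> borel_measurable M"
  by (induction ls) (auto intro: borel_measurable_times occupation_measurable)

lemma history_range: "history X hs w \<in> {0..1}"
  unfolding history_def using X_range by (intro prod_list_unit) (auto split: prod.splits)

lemma history_measurable: "fst ` set hs \<subseteq> {0..} \<Longrightarrow> history X hs \<in> borel_measurable M"
proof (induction hs)
  case (Cons h hs)
  then have "history X hs \<in> borel_measurable M" by (intro Cons.IH) auto
  moreover have "(\<lambda>w. X (fst h) w (snd h)) \<in> borel_measurable M"
    using Cons.prems by (intro X_measurable) auto
  ultimately show ?case by (simp add: history_def[abs_def] case_prod_beta)
qed (simp add: history_def[abs_def])

lemma functional_bound: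
  "w \<in> space M \<Longrightarrow> history X hs w * (\<Prod>l\<leftarrow>ls. occupation X w l) \<in> {0..1}"
  using history_range[of hs w] occupation_prod_range[of w ls] by (auto intro: mult_le_one)

lemma functional_expectation_bound:
  assumes "fst ` set hs \<subseteq> {0..}"
  shows "\<bar>expectation (\<lambda>w. history X hs w * (\<Prod>l\<leftarrow>ls. occupation X w l))\<bar> \<le> 1"
proof -
  have b: "norm (history X hs w * (\<Prod>l\<leftarrow>ls. occupation X w l)) \<le> 1" if "w \<in> space M" for w
    using functional_bound[OF that, of hs ls] by simp
  have "integrable M (\<lambda>w. history X hs w * (\<Prod>l\<leftarrow>ls. occupation X w l))"
    by (rule integrable_const_bound[where B = 1])
      (use b history_measurable[OF assms] occupation_prod_measurable in \<open>auto intro!: borel_measurable_times\<close>)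
  then have "\<bar>expectation (\<lambda>w. history X hs w * (\<Prod>l\<leftarrow>ls. occupation X w l))\<bar> \<le> expectation (\<lambda>_. 1)"
    by (intro order.trans[OF integral_abs_bound integral_mono]) (use b in auto)
  then show ?thesis by (simp add: prob_space)
qed

text \<open>Taking the time integral of one occupation functional outside the expectation turns it
  into further points of the history, all at the integration time; the exponent \<open>a\<close>
  counts the time coordinates.\<close>

lemma functional_Fubini:
  fixes hs and ls :: "'d site option list list"
  assumes hs: "fst ` set hs \<subseteq> {0..}"
    and l: "\<And>p. (\<Prod>i\<leftarrow>l. coord i p) = fst p ^ a * (\<Prod>k\<leftarrow>ks. snd p k)"
  defines "G \<equiv> \<lambda>t. exp (- t) ^ a * expectation (\<lambda>w. history X (map (\<lambda>k. (t, k)) ks @ hs) w * (\<Prod>l\<leftarrow>ls. occupation X w l))"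
  shows "expectation (\<lambda>w. history X hs w * (\<Prod>l\<leftarrow>l # ls. occupation X w l)) = (\<integral>t. G t \<partial>exp_law)"
    and "G \<in> borel_measurable exp_law"
proof -
  interpret P: pair_prob_space M exp_law ..
  let ?R = "\<lambda>w. history X hs w * (\<Prod>l\<leftarrow>ls. occupation X w l)"
  let ?f = "\<lambda>w t. ?R w * (\<Prod>i\<leftarrow>l. coord i (exp (- t), X t w))"
  have Rm: "?R \<in> borel_measurable M"
    by (intro borel_measurable_times history_measurable hs occupation_prod_measurable)
  have fm: "(\<lambda>(w, t). ?f w t) \<in> borel_measurable (M \<Otimes>\<^sub>M exp_law)"
    using borel_measurable_times[OF measurable_compose[OF measurable_fst Rm] coord_jointly_measurable[of l]]
    by (simp add: case_prod_beta)
  have fi: "integrable (M \<Otimes>\<^sub>M exp_law) (\<lambda>(w, t). ?f w t)"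
  proof (rule P.integrable_const_bound[where B = 1, OF AE_I2 fm])
    fix x assume "x \<in> space (M \<Otimes>\<^sub>M exp_law)"
    then have x: "fst x \<in> space M" "snd x \<in> space exp_law" by (auto simp: space_pair_measure)
    show "norm (case x of (w, t) \<Rightarrow> ?f w t) \<le> 1"
      using functional_bound[OF x(1), of hs ls] coord_prod_range[OF x(2), of "fst x" l]
      by (simp only: case_prod_beta real_norm_def abs_mult[of "?R _"]) (auto intro: mult_le_one)
  qed
  have G: "(\<integral>w. ?f w t \<partial>M) = G t" for t
  proof -
    have "?f w t = exp (- t) ^ a * (history X (map (\<lambda>k. (t, k)) ks @ hs) w * (\<Prod>l\<leftarrow>ls. occupation X w l))" for w
      unfolding l by (simp add: history_def o_def mult_ac)
    then have "(\<integral>w. ?f w t \<partial>M) = expectation (\<lambda>w. exp (- t) ^ a * (history X (map (\<lambda>k. (t, k)) ks @ hs) w * (\<Prod>l\<leftarrow>ls. occupation X w l)))"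
      by (simp only:)
    then show ?thesis by (simp only: G_def integral_mult_right_zero)
  qed
  have "expectation (\<lambda>w. history X hs w * (\<Prod>l\<leftarrow>l # ls. occupation X w l)) = (\<integral>w. (\<integral>t. ?f w t \<partial>exp_law) \<partial>M)"
  proof (intro Bochner_Integration.integral_cong refl)
    fix w assume w: "w \<in> space M"
    have "(\<integral>t. ?f w t \<partial>exp_law) = ?R w * occupation X w l"
      unfolding occupation_def[of X w l] by (rule integral_mult_right_zero)
    then show "history X hs w * (\<Prod>l\<leftarrow>l # ls. occupation X w l) = (\<integral>t. ?f w t \<partial>exp_law)"
      by (simp only: list.map prod_list.Cons mult_ac)
  qed
  also have "\<dots> = (\<integral>t. (\<integral>w. ?f w t \<partial>M) \<partial>exp_law)" by (rule P.Fubini_integral[OF fi, symmetric])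
  finally show "expectation (\<lambda>w. history X hs w * (\<Prod>l\<leftarrow>l # ls. occupation X w l)) = (\<integral>t. G t \<partial>exp_law)" by (simp only: G)
  have "(\<lambda>(t, w). ?f w t) \<in> borel_measurable (exp_law \<Otimes>\<^sub>M M)"
    using measurable_pair_swap[OF fm] by simp
  from borel_measurable_lebesgue_integral[OF this] show "G \<in> borel_measurable exp_law" by (simp only: G)
qed

end

lemma history_convergence:
  fixes M :: "nat \<Rightarrow> 'w measure" and X :: "nat \<Rightarrow> real \<Rightarrow> 'w \<Rightarrow> 'd::finite site \<Rightarrow> real"
    and Q :: "'q measure" and X' :: "real \<Rightarrow> 'q \<Rightarrow> 'd site \<Rightarrow> real"
  assumes M: "\<And>n. moment_flow (M n) (X n) U\<^sub>0 (\<epsilon> n)" and \<epsilon>: "\<epsilon> \<longlonglongrightarrow> 0" and Q: "moment_flow Q X' U\<^sub>0 0"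
    and hs: "fst ` set hs \<subseteq> {0..}"
  shows "(\<lambda>n. \<integral>w. history (X n) hs w \<partial>M n) \<longlonglongrightarrow> (\<integral>w. history X' hs w \<partial>Q)"
proof -
  \<comment> \<open>Factors are labelled by their position in the list, so coinciding times and
    repeated points remain separate factors with singleton sets.\<close>
  define \<tau> where "\<tau> i = fst (hs ! i)" for i
  define A where "A i = {snd (hs ! i)}" for i
  let ?S = "{..<length hs}"
  have h: "history Z hs w = path_monomial Z ?S \<tau> A w" for Z :: "real \<Rightarrow> 'z \<Rightarrow> 'd site \<Rightarrow> real" and w
    unfolding history_def path_monomial_def prod.list_conv_set_nth by (simp add: \<tau>_def A_def atLeast0LessThan case_prod_beta)
  have \<tau>: "0 \<le> \<tau> i" if "i \<in> ?S" for i
    using subsetD[OF hs imageI[OF nth_mem[of i hs]]] that by (simp add: \<tau>_def)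
  have "\<exists>C\<ge>0. \<forall>(M :: 'w measure) X \<epsilon> A. moment_flow M X U\<^sub>0 \<epsilon> \<longrightarrow> (\<forall>i\<in>?S. finite (A i) \<and> card (A i) \<le> 1) \<longrightarrow>
    \<bar>(\<integral>w. path_monomial X ?S \<tau> A w \<partial>M) - (\<integral>w. path_monomial X' ?S \<tau> A w \<partial>Q)\<bar> \<le> C * (\<epsilon> + 0)"
    by (rule moments_close[OF finite_lessThan \<tau> Q])
  then obtain C where C: "\<forall>(M :: 'w measure) X \<epsilon> A. moment_flow M X U\<^sub>0 \<epsilon> \<longrightarrow> (\<forall>i\<in>?S. finite (A i) \<and> card (A i) \<le> 1) \<longrightarrow>
    \<bar>(\<integral>w. path_monomial X ?S \<tau> A w \<partial>M) - (\<integral>w. path_monomial X' ?S \<tau> A w \<partial>Q)\<bar> \<le> C * (\<epsilon> + 0)"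
    by (elim exE conjE)
  have "\<bar>(\<integral>w. history (X n) hs w \<partial>M n) - (\<integral>w. history X' hs w \<partial>Q)\<bar> \<le> C * \<epsilon> n" for n
    unfolding h using C[rule_format, OF M[of n], of A] by (simp add: A_def)
  then have near: "\<forall>\<^sub>F n in sequentially. norm ((\<integral>w. history (X n) hs w \<partial>M n) - (\<integral>w. history X' hs w \<partial>Q)) \<le> C * \<epsilon> n"
    by (intro always_eventually allI) (simp only: real_norm_def)
  have "(\<lambda>n. (\<integral>w. history (X n) hs w \<partial>M n) - (\<integral>w. history X' hs w \<partial>Q)) \<longlonglongrightarrow> 0"
    by (rule Lim_null_comparison[OF near tendsto_mult_right_zero[OF \<epsilon>]])
  then show ?thesis by (rule LIM_zero_cancel)
qed

text \<open>By Fubini each occupation functional is traded for an integral over additional points of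
  the history, so the induction is on \<open>ls\<close> with \<open>hs\<close> arbitrary; dominated
  convergence passes to the limit under the time integral.\<close>

theorem occupation_convergence:
  fixes M :: "nat \<Rightarrow> 'w measure" and X :: "nat \<Rightarrow> real \<Rightarrow> 'w \<Rightarrow> 'd::finite site \<Rightarrow> real"
    and Q :: "'q measure" and X' :: "real \<Rightarrow> 'q \<Rightarrow> 'd site \<Rightarrow> real"
  assumes M: "\<And>n. path_flow (M n) (X n) U\<^sub>0 (\<epsilon> n)" and \<epsilon>: "\<epsilon> \<longlonglongrightarrow> 0" and Q: "path_flow Q X' U\<^sub>0 0"
    and hs: "fst ` set hs \<subseteq> {0..}"
  shows "(\<lambda>n. \<integral>w. history (X n) hs w * (\<Prod>l\<leftarrow>ls. occupation (X n) w l) \<partial>M n)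
    \<longlonglongrightarrow> (\<integral>w. history X' hs w * (\<Prod>l\<leftarrow>ls. occupation X' w l) \<partial>Q)"
  using hs
proof (induction ls arbitrary: hs)
  case Nil
  have "moment_flow (M n) (X n) U\<^sub>0 (\<epsilon> n)" for n using M[of n] by (simp add: path_flow_def flow_def)
  moreover have "moment_flow Q X' U\<^sub>0 0" using Q by (simp add: path_flow_def flow_def)
  ultimately show ?case using history_convergence[where X = X and M = M and X' = X' and Q = Q and hs = hs and U\<^sub>0 = U\<^sub>0, OF _ \<epsilon>] Nil by simp
next
  case (Cons l ls)
  obtain a ks where l: "\<And>p. (\<Prod>i\<leftarrow>l. coord i p) = fst p ^ a * (\<Prod>k\<leftarrow>ks. snd p k)"
    using coord_monomial[of l] by (elim exE) blast
  have hs': "fst ` set (map (\<lambda>k. (t, k)) ks @ hs) \<subseteq> {0..}" if "t \<in> space exp_law" for t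
    using that Cons.prems by auto
  let ?E = "\<lambda>N Z t. (\<integral>w. history Z (map (\<lambda>k. (t, k)) ks @ hs) w * (\<Prod>l\<leftarrow>ls. occupation Z w l) \<partial>N)"
  show ?case
    unfolding path_flow.functional_Fubini(1)[OF M Cons.prems l] path_flow.functional_Fubini(1)[OF Q Cons.prems l]
  proof (rule integral_dominated_convergence[where w = "\<lambda>_. 1"])
    show "(\<lambda>t. exp (- t) ^ a * ?E (M n) (X n) t) \<in> borel_measurable exp_law" for n
      by (rule path_flow.functional_Fubini(2)[OF M Cons.prems l])
    show "(\<lambda>t. exp (- t) ^ a * ?E Q X' t) \<in> borel_measurable exp_law"
      by (rule path_flow.functional_Fubini(2)[OF Q Cons.prems l])
    show "AE t in exp_law. (\<lambda>n. exp (- t) ^ a * ?E (M n) (X n) t) \<longlonglongrightarrow> exp (- t) ^ a * ?E Q X' t"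
      by (rule AE_I2) (intro tendsto_mult tendsto_const Cons.IH hs')
    show "AE t in exp_law. norm (exp (- t) ^ a * ?E (M n) (X n) t) \<le> 1" for n
    proof (rule AE_I2)
      fix t assume t: "t \<in> space exp_law"
      have "\<bar>?E (M n) (X n) t\<bar> \<le> 1" by (rule path_flow.functional_expectation_bound[OF M hs'[OF t]])
      moreover have "exp (- t) ^ a \<le> 1" using t by (intro power_le_one) auto
      ultimately show "norm (exp (- t) ^ a * ?E (M n) (X n) t) \<le> 1" by (simp add: abs_mult mult_le_one)
    qed
  qed simp
qed

section \<open>Right-continuous paths with left limits\<close>

lemma cadlag_cong:
  assumes "cadlag X w" "\<And>t. 0 \<le> t \<Longrightarrow> w' t = w t"
  shows "cadlag X w'"
  unfolding cadlag_def
proof (intro conjI allI impI)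
  fix t :: real assume t: "0 \<le> t"
  have "\<forall>\<^sub>F s in at_right t. w s = w' s"
    using eventually_at_right_less by eventually_elim (use t assms(2) in simp)
  moreover have "limitin X w (w t) (at_right t)" using assms(1) t by (simp add: cadlag_def)
  ultimately show "limitin X w' (w' t) (at_right t)"
    using assms(2)[OF t] by (simp add: limitin_transform_eventually)
next
  fix t :: real assume t: "0 < t"
  have "\<forall>\<^sub>F s in at_left t. 0 < s" using t by (rule eventually_at_leftI[rotated]) simp
  then have "\<forall>\<^sub>F s in at_left t. w s = w' s" by eventually_elim (use assms(2) in simp)
  moreover obtain l where "limitin X w l (at_left t)" using assms(1) t by (auto simp: cadlag_def)
  ultimately show "\<exists>l. limitin X w' l (at_left t)" by (blast intro: limitin_transform_eventually)
qed

lemma cadlag_continuous: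
  assumes "continuous_map (top_of_set {0..}) X w"
  shows "cadlag X w"
  unfolding cadlag_def
proof (intro conjI allI impI)
  fix t :: real assume t: "0 \<le> t"
  have "\<forall>\<^sub>F s in at_right t. 0 \<le> s"
    using eventually_at_right_less by eventually_elim (use t in simp)
  then have "limitin (top_of_set {0..}) (\<lambda>s. s) t (at_right t)"
    using t by (simp add: limitin_subtopology tendsto_ident_at)
  from continuous_map_limit[OF assms this] show "limitin X w (w t) (at_right t)" by (simp add: o_def)
next
  fix t :: real assume t: "0 < t"
  have "\<forall>\<^sub>F s in at_left t. 0 < s" using t by (rule eventually_at_leftI[rotated]) simp
  then have "\<forall>\<^sub>F s in at_left t. 0 \<le> s" by eventually_elim simp
  then have "limitin (top_of_set {0..}) (\<lambda>s. s) t (at_left t)"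
    using t by (simp add: limitin_subtopology tendsto_ident_at)
  from continuous_map_limit[OF assms this] show "\<exists>l. limitin X w l (at_left t)" by (auto simp: o_def)
qed

lemma cadlag_compose:
  assumes "continuous_map X Y g" "cadlag X w"
  shows "cadlag Y (g \<circ> w)"
  unfolding cadlag_def
proof (intro conjI allI impI)
  fix t :: real assume t: "0 \<le> t"
  show "limitin Y (g \<circ> w) ((g \<circ> w) t) (at_right t)"
    using continuous_map_limit[OF assms(1), of w "w t" "at_right t"] assms(2) t by (simp add: cadlag_def)
next
  fix t :: real assume "0 < t"
  then obtain l where "limitin X w l (at_left t)" using assms(2) by (auto simp: cadlag_def)
  from continuous_map_limit[OF assms(1) this] show "\<exists>l. limitin Y (g \<circ> w) l (at_left t)" by blast
qed

context weighted
begin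

lemma almost_surely_cube_path_flow:
  assumes flow: "path_flow M X U\<^sub>0 \<epsilon>"
    and Z: "AE w in M. Z w \<in> extensional {0..} \<and> cadlag (L2_top \<beta>) (Z w) \<and> (\<forall>t\<ge>0. Z w t = state_of (X t w))"
  shows "almost_surely_cube M Z (occupation X)"
  unfolding almost_surely_cube_def
proof (intro conjI)
  interpret path_flow M X U\<^sub>0 \<epsilon> by (rule flow)
  show "prob_space M" by (rule prob_space_axioms)
  show "occupation X \<in> borel_measurable M"
    by (rule measurable_coordinatewise_then_product) (rule occupation_measurable)
  show "AE w in M. Z w \<in> cube_paths \<beta> \<and> occupation X w = (\<lambda>l. occ l (Z w))"
    using Z
  proof eventually_elim
    case (elim w)
    have "X t w \<in> cube" for t using X_range by auto
    then have "Z w \<in> cube_paths \<beta>" using elim by (auto simp: cube_paths_def)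
    moreover have "occupation X w l = occ l (Z w)" for l
      unfolding occupation_def occ_def
      by (rule Bochner_Integration.integral_cong[OF refl]) (use elim in \<open>simp add: state_of_def\<close>)
    ultimately show ?case by auto
  qed
qed

text \<open>Carries right continuity and left limits of the voter paths from the product topology to
  the weighted space.\<close>

lemma config_state_continuous: "continuous_map euclidean (L2_top \<beta>) (\<lambda>\<eta> :: 'd config. state_of (\<lambda>k. of_bool (\<eta> k)))"
proof -
  have "continuous_on UNIV (\<lambda>(\<eta> :: 'd config) k. of_bool (\<eta> k) :: real)"
    by (intro continuous_on_coordinatewise_then_product continuous_on_coordinate)
  then have "continuous_map euclidean (top_of_set cube) (\<lambda>(\<eta> :: 'd config) k. of_bool (\<eta> k) :: real)"
    by (auto simp: continuous_map_in_subtopology)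
  from continuous_map_compose[OF this state_of_continuous] show ?thesis by (simp add: o_def)
qed

end

section \<open>The two processes as flows of moments, and the limit theorem\<close>

lemma sbm_path_flow:
  fixes \<beta> U\<^sub>0 V\<^sub>0 :: "'d::finite site \<Rightarrow> real"
  assumes weight: "admissible_weight \<beta>" and initial: "\<And>k. (U\<^sub>0 k, V\<^sub>0 k) \<in> {(1, 0), (0, 1)}"
    and \<gamma>: "0 < \<gamma>" and sbm: "sbm_solution \<beta> \<gamma> (- 1) M u v" and start: "AE w in M. u 0 w = U\<^sub>0 \<and> v 0 w = V\<^sub>0"
  shows "\<exists>X. path_flow M X U\<^sub>0 (jump_rate TYPE('d) / \<gamma>) \<and>
    weighted.almost_surely_cube \<beta> M (\<lambda>w. \<lambda>t\<in>{0..}. (u t w, v t w)) (occupation X)"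
proof -
  from sbm[unfolded sbm_solution_def] obtain F B1 B2 I1 I2 where H:
    "filtered_prob_space M F" "\<forall>k. brownian_motion M F (B1 k)" "\<forall>k. brownian_motion M F (B2 k)"
    "jointly_gaussian M (case_sum (\<lambda>(t, k). B1 k t) (\<lambda>(t, k). B2 k t)) (({0..} \<times> UNIV) <+> ({0..} \<times> UNIV))"
    "\<forall>t\<ge>0. \<forall>k j.
           (\<integral>w. B1 k t w * B1 j t w \<partial>M) = of_bool (k = j) * t \<and>
           (\<integral>w. B2 k t w * B2 j t w \<partial>M) = of_bool (k = j) * t \<and>
           (\<integral>w. B1 k t w * B2 j t w \<partial>M) = - 1 * of_bool (k = j) * t"
    "\<forall>t\<ge>0. \<forall>k. (\<lambda>w. u t w k) \<in> borel_measurable (F t) \<and> (\<lambda>w. v t w k) \<in> borel_measurable (F t)"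
    "AE w in M. continuous_map (top_of_set {0..}) (L2_top \<beta>) (\<lambda>t. (u t w, v t w))"
    "\<forall>k. ito_integral M F (B1 k) (\<lambda>s w. sqrt (\<gamma> * u s w k * v s w k)) (I1 k)"
    "\<forall>k. ito_integral M F (B2 k) (\<lambda>s w. sqrt (\<gamma> * u s w k * v s w k)) (I2 k)"
    "AE w in M. \<forall>t\<ge>0. \<forall>k.
           u t w k = u 0 w k + (LINT s:{0..t}|lborel. laplacian (u s w) k) + I1 k t w \<and>
           v t w k = v 0 w k + (LINT s:{0..t}|lborel. laplacian (v s w) k) + I2 k t w"
    by (elim exE conjE)
  obtain m where m: "\<And>k. (\<Sum>\<^sub>\<infinity>i. \<beta> i * \<bar>rw_rate i k\<bar>) < m * \<beta> k"
    using weight unfolding admissible_weight_def by auto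
  interpret weighted \<beta> using weight by unfold_locales (auto simp: admissible_weight_def)
  interpret sbm: annihilating_sbm M F \<beta> \<gamma> m B1 B2 I1 I2 u v U\<^sub>0 V\<^sub>0
    by unfold_locales (use H m \<gamma> start initial in simp_all)
  have "path_flow M sbm.X U\<^sub>0 (jump_rate TYPE('d) / \<gamma>)"
  proof unfold_locales
    show "moment_flow M sbm.X U\<^sub>0 (jump_rate TYPE('d) / \<gamma>)" by (rule sbm.moment_flow_X)
    fix w k and t :: real assume t: "0 \<le> t"
    have "((\<lambda>s. sbm.X s w k) \<longlongrightarrow> sbm.X t w k) (at t within {0..})"
      using sbm.X_continuous[of w k] t by (simp add: continuous_on_def)
    then show "((\<lambda>s. sbm.X s w k) \<longlongrightarrow> sbm.X t w k) (at_right t)"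
      by (rule tendsto_within_subset) (use t in auto)
  qed
  moreover have "almost_surely_cube M (\<lambda>w. \<lambda>t\<in>{0..}. (u t w, v t w)) (occupation sbm.X)"
  proof (rule almost_surely_cube_path_flow[OF calculation])
    show "AE w in M. (\<lambda>t\<in>{0..}. (u t w, v t w)) \<in> extensional {0..} \<and> cadlag (L2_top \<beta>) (\<lambda>t\<in>{0..}. (u t w, v t w)) \<and>
        (\<forall>t\<ge>0. (\<lambda>t\<in>{0..}. (u t w, v t w)) t = state_of (sbm.X t w))"
      using sbm.X_eq H(7)
    proof eventually_elim
      case (elim w)
      have "cadlag (L2_top \<beta>) (\<lambda>t\<in>{0..}. (u t w, v t w))"
        by (rule cadlag_cong[OF cadlag_continuous[OF elim(2)]]) simp
      moreover have "(u t w, v t w) = state_of (sbm.X t w)" if "0 \<le> t" for t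
        using elim(1) that by (auto simp: state_of_def)
      ultimately show ?case by simp
    qed
  qed
  ultimately show ?thesis by (intro exI[of _ sbm.X]) simp
qed

lemma voter_path_flow:
  fixes \<beta> U\<^sub>0 :: "'d::finite site \<Rightarrow> real" and \<eta> :: "real \<Rightarrow> 'q \<Rightarrow> 'd config"
  assumes weight: "admissible_weight \<beta>" and voter: "voter_process Q \<eta>"
    and start: "AE w in Q. \<forall>k. of_bool (\<eta> 0 w k) = U\<^sub>0 k"
  shows "\<exists>X. path_flow Q X U\<^sub>0 0 \<and>
    weighted.almost_surely_cube \<beta> Q (\<lambda>w. \<lambda>t\<in>{0..}. state_of (\<lambda>k. of_bool (\<eta> t w k))) (occupation X)"
proof -
  obtain S where "voter_semigroup S" "markov_process S Q \<eta>" using voter by (auto simp: voter_process_def)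
  then interpret voter_model Q S \<eta> by unfold_locales
  interpret weighted \<beta> using weight by unfold_locales (auto simp: admissible_weight_def)
  from voter_moment_flow[OF start] obtain X where X: "moment_flow Q X U\<^sub>0 0"
    "\<forall>w t k. 0 \<le> t \<longrightarrow> ((\<lambda>s. X s w k) \<longlongrightarrow> X t w k) (at_right t)"
    "AE w in Q. cadlag euclidean (\<lambda>t. \<eta> t w) \<and> (\<forall>t k. X t w k = of_bool (\<eta> t w k))" by (elim exE conjE)
  have flow: "path_flow Q X U\<^sub>0 0" by unfold_locales (use X(1,2) in auto)
  have "almost_surely_cube Q (\<lambda>w. \<lambda>t\<in>{0..}. state_of (\<lambda>k. of_bool (\<eta> t w k))) (occupation X)"
  proof (rule almost_surely_cube_path_flow[OF flow])
    show "AE w in Q. (\<lambda>t\<in>{0..}. state_of (\<lambda>k. of_bool (\<eta> t w k))) \<in> extensional {0..} \<and>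
        cadlag (L2_top \<beta>) (\<lambda>t\<in>{0..}. state_of (\<lambda>k. of_bool (\<eta> t w k))) \<and>
        (\<forall>t\<ge>0. (\<lambda>t\<in>{0..}. state_of (\<lambda>k. of_bool (\<eta> t w k))) t = state_of (X t w))"
      using X(3)
    proof eventually_elim
      case (elim w)
      have "cadlag (L2_top \<beta>) ((\<lambda>\<zeta>. state_of (\<lambda>k. of_bool (\<zeta> k))) \<circ> (\<lambda>t. \<eta> t w))"
        using elim by (intro cadlag_compose[OF config_state_continuous]) simp
      then have "cadlag (L2_top \<beta>) (\<lambda>t\<in>{0..}. state_of (\<lambda>k. of_bool (\<eta> t w k)))"
        by (rule cadlag_cong) (simp add: o_def)
      moreover have "X t w = (\<lambda>k. of_bool (\<eta> t w k))" for t using elim by auto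
      ultimately show ?case by simp
    qed
  qed
  then show ?thesis using flow by (intro exI[of _ X]) simp
qed

theorem theorem3p16:
  fixes \<beta> U\<^sub>0 V\<^sub>0 :: "'d::finite site \<Rightarrow> real"
    and P :: "real \<Rightarrow> 'w measure"
    and u v :: "real \<Rightarrow> real \<Rightarrow> 'w \<Rightarrow> 'd site \<Rightarrow> real"
    and \<gamma>s :: "nat \<Rightarrow> real"
    and Q :: "'q measure"
    and \<eta> :: "real \<Rightarrow> 'q \<Rightarrow> 'd config"
    and U V :: "real \<Rightarrow> 'q \<Rightarrow> 'd site \<Rightarrow> real"
  assumes weight: "admissible_weight \<beta>"
    and initial: "\<And>k. (U\<^sub>0 k, V\<^sub>0 k) \<in> {(1, 0), (0, 1)}"
    and sbm: "\<And>\<gamma>. \<gamma> > 0 \<Longrightarrow> sbm_solution \<beta> \<gamma> (- 1) (P \<gamma>) (u \<gamma>) (v \<gamma>)"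
    and sbm_initial: "\<And>\<gamma>. \<gamma> > 0 \<Longrightarrow> AE \<omega> in P \<gamma>. u \<gamma> 0 \<omega> = U\<^sub>0 \<and> v \<gamma> 0 \<omega> = V\<^sub>0"
    and \<gamma>s_pos: "\<And>n. \<gamma>s n > 0"
    and \<gamma>s_lim: "filterlim \<gamma>s at_top sequentially"
    and voter: "voter_process Q \<eta>"
    and U_def: "\<And>t \<omega> k. U t \<omega> k = of_bool (\<eta> t \<omega> k)"
    and V_def: "\<And>t \<omega> k. V t \<omega> k = 1 - U t \<omega> k"
    and voter_initial: "AE \<omega> in Q. U 0 \<omega> = U\<^sub>0"
  shows "limitin (weak_topology (meyer_zheng (L2_top \<beta>)))
      (\<lambda>n. law (meyer_zheng (L2_top \<beta>)) (P (\<gamma>s n))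
             (\<lambda>\<omega>. \<lambda>t\<in>{0..}. (u (\<gamma>s n) t \<omega>, v (\<gamma>s n) t \<omega>)))
      (law (meyer_zheng (L2_top \<beta>)) Q (\<lambda>\<omega>. \<lambda>t\<in>{0..}. (U t \<omega>, V t \<omega>)))
      sequentially"
proof -
  interpret weighted \<beta> using weight by unfold_locales (auto simp: admissible_weight_def)
  have "AE w in Q. \<forall>k. of_bool (\<eta> 0 w k) = U\<^sub>0 k"
    using voter_initial by eventually_elim (simp flip: U_def)
  from voter_path_flow[OF weight voter this] obtain X\<^sub>0 where X\<^sub>0: "path_flow Q X\<^sub>0 U\<^sub>0 0"
    "almost_surely_cube Q (\<lambda>w. \<lambda>t\<in>{0..}. state_of (\<lambda>k. of_bool (\<eta> t w k))) (occupation X\<^sub>0)" by (elim exE conjE)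
  have UV: "(\<lambda>w. \<lambda>t\<in>{0..}. (U t w, V t w)) = (\<lambda>w. \<lambda>t\<in>{0..}. state_of (\<lambda>k. of_bool (\<eta> t w k)))"
    by (auto simp: fun_eq_iff state_of_def restrict_def U_def V_def)
  have "\<forall>n. \<exists>X. path_flow (P (\<gamma>s n)) X U\<^sub>0 (jump_rate TYPE('d) / \<gamma>s n) \<and>
    almost_surely_cube (P (\<gamma>s n)) (\<lambda>w. \<lambda>t\<in>{0..}. (u (\<gamma>s n) t w, v (\<gamma>s n) t w)) (occupation X)"
    by (intro allI sbm_path_flow[OF weight initial] \<gamma>s_pos sbm sbm_initial)
  then obtain X where X: "\<forall>n. path_flow (P (\<gamma>s n)) (X n) U\<^sub>0 (jump_rate TYPE('d) / \<gamma>s n) \<and>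
    almost_surely_cube (P (\<gamma>s n)) (\<lambda>w. \<lambda>t\<in>{0..}. (u (\<gamma>s n) t w, v (\<gamma>s n) t w)) (occupation (X n))"
    by (rule choice[THEN exE])
  have \<epsilon>: "(\<lambda>n. jump_rate TYPE('d) / \<gamma>s n) \<longlonglongrightarrow> 0"
    by (rule tendsto_divide_0[OF tendsto_const filterlim_at_top_imp_at_infinity[OF \<gamma>s_lim]])
  show ?thesis
    unfolding UV
  proof (rule law_convergence)
    show "almost_surely_cube (P (\<gamma>s n)) (\<lambda>w. \<lambda>t\<in>{0..}. (u (\<gamma>s n) t w, v (\<gamma>s n) t w)) (occupation (X n))" for n
      using X by simp
    show "almost_surely_cube Q (\<lambda>w. \<lambda>t\<in>{0..}. state_of (\<lambda>k. of_bool (\<eta> t w k))) (occupation X\<^sub>0)" by (rule X\<^sub>0(2))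
    show "(\<lambda>n. \<integral>w. (\<Prod>l\<leftarrow>ls. occupation (X n) w l) \<partial>P (\<gamma>s n)) \<longlonglongrightarrow> (\<integral>w. (\<Prod>l\<leftarrow>ls. occupation X\<^sub>0 w l) \<partial>Q)" for ls
      using occupation_convergence[where hs = "[]", OF conjunct1[OF X[rule_format]] \<epsilon> X\<^sub>0(1)] by (simp add: history_def)
  qed
qed

end
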